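(* Let Assumption 1 (stated in the context) hold with $p^*\ge 4$ and some $\alpha\in(0,2)$. Let $\hat\alpha$ be the wavelet local Whittle estimator defined in the context, computed either from continuous-time observations ($\mathbf{d}_{j,k}=d_{j,k}$) or from discrete-time observations ($\mathbf{d}_{j,k}=d^D_{j,k}$). Assume that $J_0$ and $J_1$ depend on $T$ in such a way that $0<J_0<J_1\le J$, $$\lim_{T\to\infty}J_0=\lim_{T\to\infty}(J_1-J_0)=\infty,\qquad(\mathrm{a})$$ $$\limsup_{T\to\infty}J_0/J<1/\alpha,\qquad(\mathrm{b})$$ $$\limsup_{T\to\infty}J_1/J<1/(2-\alpha).\qquad(\mathrm{c})$$ Assume moreover that $$\int_{-\infty}^{\infty}s\,\psi(s)\,\mathrm{d}s=0,\qquad(\mathrm{d})$$ and that there exist constants $a,b$ such that $$\sum_{k\in\mathbb{Z}}k\,\phi(t-k)=a+bt\quad\text{for all }t\in\mathbb{R}.\qquad(\mathrm{e})$$ Then $\hat\alpha$ is a consistent estimator of $\alpha$, that is, $\hat\alpha\to\alpha$ in probability as $T\to\infty$. Moreover, if $\alpha\in(1,2)$, then conditions (c), (d) and (e) are not necessary for the same result to hold: the conclusion holds assuming, of (a)–(e), only (a) and (b).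
   Context: **Assumption 1.** (i) The random vectors $(\eta,U)$, $(\eta_\ell,U_\ell)$, $\ell\in\mathbb{Z}$, are independent with common distribution $\nu$ on $(0,\infty)\times\mathbb{R}$, and are independent of the (unit-rate) homogeneous Poisson point process on the real line with points $\{t_\ell\}_{\ell\in\mathbb{Z}}$, indexed so that $t_\ell<t_{\ell+1}$ for all $\ell$ and $t_{-1}<0\le t_0$. (ii) $p^*$ is a positive integer with $\mathbb{E}[|U|^{p^*}]<\infty$. (iii) There exist a real number $\alpha\in(0,2)$ and positive functions $L_0,\dots,L_{p^*}$, slowly varying at infinity, such that for all $t>0$ and $p=0,\dots,p^*$, $H_p(t):=\mathbb{E}[|U|^p\mathbf{1}_{\{\eta>t\}}]=L_p(t)t^{-\alpha}$. **Process.** The infinite-source Poisson process is $X(t)=\sum_{\ell\in\mathbb{N}}U_\ell\mathbf{1}_{\{t_\ell\le t<t_\ell+\eta_\ell\}}$, $t\ge0$, with $\mathbb{N}=\{0,1,2,\dots\}$. **Wavelets.** Fix $M\ge1$. $\psi:\mathbb{R}\to\mathbb{R}$ is a bounded function, not almost everywhere zero, with compact support in $[0,M]$ and $\int_0^M\psi(s)\,\mathrm{d}s=0$. For integers $j\ge0$, $k\in\mathbb{Z}$, $\psi_{j,k}(s)=2^{-j/2}\psi(2^{-j}s-k)$. $\phi:\mathbb{R}\to\mathbb{R}$ is a bounded function with compact support included in $[-M+1,1]$ and $\sum_{k\in\mathbb{Z}}\phi(t-k)=1$ for all $t\in\mathbb{R}$. **Wavelet coefficients.** Continuous-time: $X$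 is observed on $[0,T]$ and $d_{j,k}=\int_0^\infty\psi_{j,k}(s)X(s)\,\mathrm{d}s$. Discrete-time: $X(0),X(1),\dots,X(T-1)$ are observed, and $d^D_{j,k}=\int\psi_{j,k}(s)\,\mathrm{I}_\phi[X](s)\,\mathrm{d}s$, where $\mathrm{I}_\phi[x](t)=\sum_{k\in\mathbb{Z}}x(k)\phi(t-k)$. (For the indices used below, only $X(0),\dots,X(T-1)$ matter.) Here $T$ is a positive integer in the discrete case. **Estimator.** Let $J=\max\{j: 2^j\le(T-M+1)/(M+1)\}$, $n_j=2^{J-j}$, and let $J_0,J_1$ be integers (depending on $T$) with $0<J_0<J_1\le J$. Put $\Delta=\{(j,k): J_0<j\le J_1,\ 0\le k\le n_j-1\}$ and $\delta=\frac1{\#\Delta}\sum_{(j,k)\in\Delta}j$. The contrast is $$\hat W(\alpha')=\log\Big(\sum_{(j,k)\in\Delta}\frac{\mathbf{d}_{j,k}^2}{2^{(2-\alpha')j}}\Big)+\delta\log(2)(2-\alpha'),$$ and $\hat\alpha:=\arg\min_{\alpha'\in(0,2)}\hat W(\alpha')$. *)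

theory Defs
  imports "HOL-Probability.Probability"
begin

section \<open>The infinite-source Poisson process\<close>

text \<open>Measurability is not required here: it is automatic wherever the definition is applied to
  \<open>t \<mapsto> t\<^sup>\<alpha> H(t)\<close> with \<open>H\<close> monotone.\<close>

definition slowly_varying :: "(real \<Rightarrow> real) \<Rightarrow> bool" where
  "slowly_varying L \<longleftrightarrow>
     (\<forall>\<^sub>F t in at_top. 0 < L t) \<and> (\<forall>c>0. ((\<lambda>t. L (c * t) / L t) \<longlongrightarrow> 1) at_top)"

text \<open>The count is extended-valued because \<^const>\<open>card\<close> would report infinitely many points as 0.\<close>

definition point_count :: "(int \<Rightarrow> 'a \<Rightarrow> real) \<Rightarrow> real set \<Rightarrow> 'a \<Rightarrow> ennreal" where
  "point_count t A \<omega> = emeasure (count_space UNIV) {l. t l \<omega> \<in> A}"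

text \<open>The Poisson probabilities are written out, rather than taken from \<^const>\<open>poisson_pmf\<close>, so as to
  cover null sets \<open>A\<close> (rate 0) as well; there \<open>0 ^ 0 = 1\<close> gives the point mass at 0.\<close>

definition unit_poisson_points :: "'a measure \<Rightarrow> (int \<Rightarrow> 'a \<Rightarrow> real) \<Rightarrow> bool" where
  "unit_poisson_points P t \<longleftrightarrow>
     (\<forall>l. t l \<in> borel_measurable P) \<and>
     (AE \<omega> in P. (\<forall>l. t l \<omega> < t (l + 1) \<omega>) \<and> t (- 1) \<omega> < 0 \<and> 0 \<le> t 0 \<omega>) \<and>
     (\<forall>A\<in>sets borel. bounded A \<longrightarrow>
        (\<forall>n::nat. measure P {\<omega>\<in>space P. point_count t A \<omega> = of_nat n} =
           exp (- measure lborel A) * measure lborel A ^ n / fact n)) \<and>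
     (\<forall>(I::nat set) A. finite I \<and> (\<forall>i\<in>I. A i \<in> sets borel \<and> bounded (A i)) \<and> disjoint_family_on A I
        \<longrightarrow> prob_space.indep_vars P (\<lambda>_. borel) (\<lambda>i. point_count t (A i)) I)"

definition iid_marked_poisson ::
  "'a measure \<Rightarrow> (real \<times> real) measure \<Rightarrow> (int \<Rightarrow> 'a \<Rightarrow> real) \<Rightarrow> (int \<Rightarrow> 'a \<Rightarrow> real) \<Rightarrow> (int \<Rightarrow> 'a \<Rightarrow> real) \<Rightarrow> bool"
where
  "iid_marked_poisson P \<nu> t \<eta> U \<longleftrightarrow>
     unit_poisson_points P t \<and>
     prob_space.indep_vars P (\<lambda>_. borel) (\<lambda>l \<omega>. (\<eta> l \<omega>, U l \<omega>)) UNIV \<and>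
     (\<forall>l. distr P borel (\<lambda>\<omega>. (\<eta> l \<omega>, U l \<omega>)) = \<nu>) \<and>
     (AE z in \<nu>. 0 < fst z) \<and>
     prob_space.indep_set P
       (sets (vimage_algebra (space P) (\<lambda>\<omega> l. (\<eta> l \<omega>, U l \<omega>)) (\<Pi>\<^sub>M l\<in>UNIV. borel)))
       (sets (vimage_algebra (space P) (\<lambda>\<omega> l. t l \<omega>) (\<Pi>\<^sub>M l\<in>UNIV. borel)))"

text \<open>\<open>H\<^sub>p(t) = E[|U|\<^sup>p 1{\<eta> > t}]\<close>, as an integral over the common law \<open>\<nu>\<close> of \<open>(\<eta>, U)\<close>.\<close>

definition mark_tail :: "(real \<times> real) measure \<Rightarrow> nat \<Rightarrow> real \<Rightarrow> real" where
  "mark_tail \<nu> p t = (LINT z|\<nu>. \<bar>snd z\<bar> ^ p * indicator {t<..} (fst z))"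

text \<open>Almost surely only finitely many terms are nonzero. The sources are those with index
  \<open>l \<ge> 0\<close>, so that the process vanishes at negative times.\<close>

definition infinite_source ::
  "(int \<Rightarrow> 'a \<Rightarrow> real) \<Rightarrow> (int \<Rightarrow> 'a \<Rightarrow> real) \<Rightarrow> (int \<Rightarrow> 'a \<Rightarrow> real) \<Rightarrow> 'a \<Rightarrow> real \<Rightarrow> real" where
  "infinite_source t \<eta> U \<omega> s =
     (\<Sum>l::nat. U (int l) \<omega> * indicator {t (int l) \<omega> ..< t (int l) \<omega> + \<eta> (int l) \<omega>} s)"


section \<open>Wavelet coefficients\<close>

definition admissible_wavelet :: "real \<Rightarrow> (real \<Rightarrow> real) \<Rightarrow> bool" where
  "admissible_wavelet M \<psi> \<longleftrightarrow>
     \<psi> \<in> borel_measurable lebesgue \<and> bounded (range \<psi>) \<and>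
     \<not> (AE s in lebesgue. \<psi> s = 0) \<and>
     (\<forall>s. s \<notin> {0..M} \<longrightarrow> \<psi> s = 0) \<and>
     (LINT s:{0..M}|lebesgue. \<psi> s) = 0"

definition admissible_interpolator :: "real \<Rightarrow> (real \<Rightarrow> real) \<Rightarrow> bool" where
  "admissible_interpolator M \<phi> \<longleftrightarrow>
     \<phi> \<in> borel_measurable lebesgue \<and> bounded (range \<phi>) \<and>
     (\<forall>s. s \<notin> {- M + 1..1} \<longrightarrow> \<phi> s = 0) \<and>
     (\<forall>t. ((\<lambda>k::int. \<phi> (t - of_int k)) has_sum 1) UNIV)"

definition wavelet :: "(real \<Rightarrow> real) \<Rightarrow> nat \<Rightarrow> int \<Rightarrow> real \<Rightarrow> real" where
  "wavelet \<psi> j k s = 2 powr (- real j / 2) * \<psi> (2 powr (- real j) * s - of_int k)"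

definition interpolate :: "(real \<Rightarrow> real) \<Rightarrow> (real \<Rightarrow> real) \<Rightarrow> real \<Rightarrow> real" where
  "interpolate \<phi> x t = (\<Sum>\<^sub>\<infinity>k::int. x (of_int k) * \<phi> (t - of_int k))"

datatype observation = Continuous_Time | Discrete_Time

fun wavelet_coeff ::
  "observation \<Rightarrow> (real \<Rightarrow> real) \<Rightarrow> (real \<Rightarrow> real) \<Rightarrow> (real \<Rightarrow> real) \<Rightarrow> nat \<Rightarrow> int \<Rightarrow> real" where
  "wavelet_coeff Continuous_Time \<psi> \<phi> x j k = (LINT s:{0..}|lebesgue. wavelet \<psi> j k s * x s)"
| "wavelet_coeff Discrete_Time \<psi> \<phi> x j k = (LINT s|lebesgue. wavelet \<psi> j k s * interpolate \<phi> x s)"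

text \<open>How \<open>T\<close> tends to infinity: through the reals, or through the positive integers.\<close>

fun horizon :: "observation \<Rightarrow> real filter" where
  "horizon Continuous_Time = at_top"
| "horizon Discrete_Time = filtermap real sequentially"


section \<open>The local Whittle estimator\<close>

text \<open>The set is finite, and it is nonempty as soon as \<open>T \<ge> 2 M\<close>.\<close>

definition max_scale :: "real \<Rightarrow> real \<Rightarrow> nat" where
  "max_scale M T = Max {j. 2 ^ j \<le> (T - M + 1) / (M + 1)}"

definition whittle_indices :: "nat \<Rightarrow> nat \<Rightarrow> nat \<Rightarrow> (nat \<times> int) set" where
  "whittle_indices J J0 J1 = {(j, k). J0 < j \<and> j \<le> J1 \<and> 0 \<le> k \<and> k \<le> 2 ^ (J - j) - 1}"

definition mean_scale :: "(nat \<times> int) set \<Rightarrow> real" where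
  "mean_scale \<Delta> = (\<Sum>(j, k)\<in>\<Delta>. real j) / real (card \<Delta>)"

definition whittle_contrast :: "(nat \<times> int) set \<Rightarrow> (nat \<Rightarrow> int \<Rightarrow> real) \<Rightarrow> real \<Rightarrow> real" where
  "whittle_contrast \<Delta> d a =
     ln (\<Sum>(j, k)\<in>\<Delta>. (d j k)\<^sup>2 / 2 powr ((2 - a) * real j)) + mean_scale \<Delta> * ln 2 * (2 - a)"

text \<open>The contrast need not attain its infimum on the open interval \<open>(0, 2)\<close>, nor at one point only.
  An estimator is therefore any measurable choice of a minimizer, with no constraint on the
  outcomes for which there is none.\<close>

definition local_whittle_estimator ::
  "'a measure \<Rightarrow> real filter \<Rightarrow> (real \<Rightarrow> 'a \<Rightarrow> real \<Rightarrow> real) \<Rightarrow> (real \<Rightarrow> 'a \<Rightarrow> real) \<Rightarrow> bool" where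
  "local_whittle_estimator P F W \<alpha>hat \<longleftrightarrow>
     (\<forall>\<^sub>F T in F. \<alpha>hat T \<in> borel_measurable P \<and>
        (\<forall>\<omega>\<in>space P. (\<exists>a. is_arg_min (W T \<omega>) (\<lambda>a. a \<in> {0<..<2}) a)
           \<longrightarrow> is_arg_min (W T \<omega>) (\<lambda>a. a \<in> {0<..<2}) (\<alpha>hat T \<omega>)))"

definition converges_in_probability ::
  "'a measure \<Rightarrow> real filter \<Rightarrow> (real \<Rightarrow> 'a \<Rightarrow> real) \<Rightarrow> real \<Rightarrow> bool" where
  "converges_in_probability P F Y c \<longleftrightarrow>
     (\<forall>\<^sub>F T in F. Y T \<in> borel_measurable P) \<and>
     (\<forall>\<epsilon>>0. ((\<lambda>T. measure P {\<omega>\<in>space P. \<epsilon> < \<bar>Y T \<omega> - c\<bar>}) \<longlongrightarrow> 0) F)"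

end

theory Submission
 imports Defs
begin

text \<open>
  Every wavelet coefficient on the observation window is a sum of \<open>U\<^sub>l (\<Psi>\<^sub>j\<^sub>k (t\<^sub>l + \<eta>\<^sub>l) - \<Psi>\<^sub>j\<^sub>k (t\<^sub>l))\<close> over the
  sources \<open>l\<close>, where \<open>\<Psi>\<^sub>j\<^sub>k\<close> is a primitive of \<open>\<psi>\<^sub>j\<^sub>k\<close> for continuous observations and a step function
  close to that primitive for discrete ones. Given their number, the points in a bounded window
  are, up to their order, independent and uniform, so the empirical energy of a scale is a quadratic
  form in an i.i.d. sample of deterministic size.

  The mean energy of scale \<open>j\<close> is asymptotically a constant multiple of \<open>n\<^sub>j q(j)\<close> with
  \<open>q(j) = 4\<^sup>j H\<^sub>2(2\<^sup>j)\<close>, and \<open>q\<close> varies regularly with index \<open>2 - \<alpha>\<close>. Its variance is negligible as soon as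
  \<open>\<alpha> J\<^sub>0 < J\<close>. The squared means of the coefficients are controlled by \<open>H\<^sub>1\<close>: for \<open>\<alpha> > 1\<close> directly, and
  otherwise because \<open>\<Psi>\<^sub>j\<^sub>k\<close> integrates to 0, which is what (d) and (e) provide; they are then negligible as
  soon as \<open>(2 - \<alpha>) J\<^sub>1 < J\<close>. Hence after normalization the energy of scale \<open>J\<^sub>0 + i\<close> behaves like \<open>2\<^sup>-\<^sup>i 2\<^bsup>(2 - \<alpha>) i\<^esup>\<close>.

  The exponential of the contrast is a sum of exponentials of affine functions, hence quasiconvex, and its limit
  is proportional to \<open>1 / (1 - (1 - 2\<^sup>x)\<^sup>2)\<close> in terms of \<open>x = \<alpha>' - \<alpha>\<close>. By quasiconvexity it suffices to compare
  the contrast at \<open>\<alpha>\<close> with its values at two neighbouring points.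
\<close>

text \<open>Write x = 2^j and X = 2^J, and allow a small power of x as the price of every slowly
  varying factor. The energy of level j then has three relative errors: fourth moments of single
  sources contribute x^\<alpha> / X to the relative variance, covariances of the coefficients
  contribute x / X, and the squared means are of relative size x^(2 - \<alpha>) / X. In the limit
  level J0 + i has weight 2^(-i), so there the last error enters the contrast with the exponent (1 -
  \<alpha>) i + (2 - \<alpha>) J0 - J. For \<alpha> > 1 this decreases in i and is already negative
  enough at i = 0; otherwise it is bounded by (2 - \<alpha>) J1 - J, whence the condition on J1.
  Strictness of the limsup conditions leaves a margin linear in J, which pays for all the small
  powers. Only finitely many levels get individual limits; the others enter through the sum of their
  expectations, which has to be small uniformly in J1. Fixing the number of sources avoids random
  sample sizes, but then only events invariant under permutations of the sources can be transferred
  back.\<close>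

lemmas integrable_boundedI = Bochner_Integration.integrable_bound
 and integrable_sumI = Bochner_Integration.integrable_sum
 and integrable_addI = Bochner_Integration.integrable_add
 and integrable_diffI = Bochner_Integration.integrable_diff
 and lint_cong = Bochner_Integration.integral_cong
 and lint_sum = Bochner_Integration.integral_sum
 and lint_add = Bochner_Integration.integral_add
 and lint_diff = Bochner_Integration.integral_diff

section \<open>Regularly varying tails and moments of the marks\<close>

text \<open>Regular variation of index -\<alpha>, bundled with the monotonicity and positivity that
  the tails \<open>H\<^sub>p\<close> have. Monotonicity replaces the uniform convergence theorem in
  the Potter bounds; positivity down to 0 lets estimates beyond a threshold be continued below
  it.\<close>

definition regular_tail :: "real => (real => real) => bool" where
 "regular_tail \<alpha> H \<longleftrightarrow>
   (\<forall>x y. 0 <= x --> x <= y --> H y <= H x) \<and> (\<forall>x\<ge>0. 0 < H x) \<and>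
   (\<forall>c>0. ((\<lambda>x. H (c * x) / H x) \<longlongrightarrow> c powr - \<alpha>) at_top)"

section \<open>Potter bounds for monotone regularly varying tails\<close>

lemma powr_floor_bounds:
 fixes r :: real
 assumes "1 <= r"
 obtains i :: nat where "2 ^ i <= r" "r <= 2 ^ (i + 1)"
proof -
 define i where "i = nat \<lfloor>log 2 r\<rfloor>"
 have l0: "0 <= log 2 r" using assms by simp
 have "real i <= log 2 r" "log 2 r <= real i + 1"
  using l0 unfolding i_def by linarith+
 moreover have "2 powr log 2 r = r" using assms by simp
 ultimately have "2 powr real i <= r" "r <= 2 powr (real i + 1)"
  by (metis powr_mono one_le_numeral)+
 hence "2 ^ i <= r" "r <= 2 ^ (i+1)"
  by (simp_all add: powr_realpow powr_add)
 thus ?thesis using that by blast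
qed

lemma regular_tail_doubling:
 assumes H: "regular_tail \<alpha> H" and "0 < e"
 obtains x0 where "1 <= x0"
  "\<And>x. x0 <= x ==> 2 powr (- \<alpha> - e) * H x <= H (2 * x)"
  "\<And>x. x0 <= x ==> H (2 * x) <= 2 powr (- \<alpha> + e) * H x"
proof -
 have lim: "((\<lambda>x. H (2 * x) / H x) \<longlongrightarrow> 2 powr - \<alpha>) at_top"
  using H unfolding regular_tail_def by simp
 have "\<forall>\<^sub>F x in at_top. 2 powr (- \<alpha> - e) < H (2 * x) / H x"
  by (rule order_tendstoD[OF lim]) (use assms in auto)
 moreover have "\<forall>\<^sub>F x in at_top. H (2 * x) / H x < 2 powr (- \<alpha> + e)"
  by (rule order_tendstoD[OF lim]) (use assms in auto)
 ultimately have "\<forall>\<^sub>F x in at_top. 2 powr (- \<alpha> - e) < H (2 * x) / H x \<and> H (2 * x) / H x < 2 powr (- \<alpha> + e)"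
  by eventually_elim simp
 then obtain x1 where x1: "\<And>x. x1 <= x ==> 2 powr (- \<alpha> - e) < H (2 * x) / H x \<and> H (2 * x) / H x < 2 powr (- \<alpha> + e)"
  unfolding eventually_at_top_linorder by blast
 have pos: "0 < H x" if "0 <= x" for x using H that unfolding regular_tail_def by auto
 show ?thesis
 proof (rule that[of "max 1 x1"])
  fix x assume x: "max 1 x1 <= x"
  show "2 powr (- \<alpha> - e) * H x <= H (2 * x)" "H (2 * x) <= 2 powr (- \<alpha> + e) * H x"
   using x1[of x] x pos[of x] by (simp_all add: field_simps)
 qed auto
qed

text \<open>Iterating the estimates for H (2 y) / H y along y, 2 y, 4 y, ... settles the dyadic
  ratios; monotonicity interpolates between two of them at the cost of one more factor 2, whose
  power \<open>2 powr (\<alpha> + e)\<close> is the constant.\<close>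

lemma regular_tail_Potter:
 assumes H: "regular_tail \<alpha> H" and "0 < e" and "0 < \<alpha>"
 obtains C x0 where "1 <= x0" "1 <= C"
  "\<And>x y. x0 <= y ==> y <= x ==> H y <= C * (x / y) powr (\<alpha> + e) * H x"
  "\<And>x y. x0 <= y ==> y <= x ==> H x <= C * (x / y) powr (- \<alpha> + e) * H y"
proof -
 obtain x0 where x0: "1 <= x0"
  and lo: "\<And>x. x0 <= x ==> 2 powr (- \<alpha> - e) * H x <= H (2 * x)"
  and up: "\<And>x. x0 <= x ==> H (2 * x) <= 2 powr (- \<alpha> + e) * H x"
  using regular_tail_doubling[OF H \<open>0 < e\<close>] by metis
 have pos: "0 < H x" if "0 <= x" for x using H that unfolding regular_tail_def by auto
 have mono: "H y <= H x" if "0 <= x" "x <= y" for x y using H that unfolding regular_tail_def by auto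
 have ge: "x0 <= 2 ^ i * y" if "x0 <= y" for i :: nat and y
  using that x0 mult_mono[of 1 "2 ^ i" x0 y] by simp
 have lo': "(2 powr (- \<alpha> - e)) ^ i * H y <= H (2 ^ i * y)" if y: "x0 <= y" for i y
 proof (induction i)
  case (Suc i)
  have "(2 powr (- \<alpha> - e)) ^ Suc i * H y <= 2 powr (- \<alpha> - e) * H (2 ^ i * y)"
   using mult_left_mono[OF Suc, of "2 powr (- \<alpha> - e)"] by (simp add: mult_ac)
  also have "... <= H (2 * (2 ^ i * y))" by (rule lo[OF ge[OF y]])
  finally show ?case by (simp add: mult_ac)
 qed simp
 have up': "H (2 ^ i * y) <= (2 powr (- \<alpha> + e)) ^ i * H y" if y: "x0 <= y" for i y
 proof (induction i)
  case (Suc i)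
  have "H (2 * (2 ^ i * y)) <= 2 powr (- \<alpha> + e) * H (2 ^ i * y)" by (rule up[OF ge[OF y]])
  also have "... <= (2 powr (- \<alpha> + e)) ^ Suc i * H y"
   using mult_left_mono[OF Suc, of "2 powr (- \<alpha> + e)"] by (simp add: mult_ac)
  finally show ?case by (simp add: mult_ac)
 qed simp
 define C where "C = 2 powr (\<alpha> + e)"
 have C1: "1 <= C" unfolding C_def using assms by (intro ge_one_powr_ge_zero) auto
 show ?thesis
 proof (rule that[OF x0 C1])
  fix x y assume y: "x0 <= y" and yx: "y <= x"
  have y0: "0 < y" using y x0 by simp
  have "1 <= x / y" using y0 yx by simp
  then obtain i :: nat where i: "2 ^ i <= x / y" "x / y <= 2 ^ (i + 1)" by (rule powr_floor_bounds)
  have ix: "2 ^ i * y <= x" "x <= 2 ^ (i + 1) * y" using i y0 by (simp_all add: field_simps)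
  have p: "(2 powr s) ^ m = (2 ^ m) powr s" for s :: real and m :: nat
   by (simp add: powr_powr flip: powr_realpow) (simp add: mult.commute)
  have "H y <= (2 ^ (i+1)) powr (\<alpha> + e) * H (2 ^ (i+1) * y)"
  proof -
   have "(2 ^ (i+1)) powr (\<alpha> + e) * ((2 powr (- \<alpha> - e)) ^ (i+1) * H y) <= (2 ^ (i+1)) powr (\<alpha> + e) * H (2 ^ (i+1) * y)"
    by (intro mult_left_mono lo'[OF y]) simp
   also have "(2 ^ (i+1)) powr (\<alpha> + e) * ((2 powr (- \<alpha> - e)) ^ (i+1) * H y) = (2 ^ (i+1)) powr ((\<alpha> + e) + (- \<alpha> - e)) * H y"
    unfolding p by (subst powr_add) simp
   finally show ?thesis by simp
  qed
  also have "... <= (2 ^ (i+1)) powr (\<alpha> + e) * H x"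
   by (intro mult_left_mono mono) (use ix y0 yx in auto)
  also have "(2 ^ (i+1)) powr (\<alpha> + e) <= (2 * (x / y)) powr (\<alpha> + e)"
   by (intro powr_mono2) (use i assms in auto)
  also have "... = C * (x / y) powr (\<alpha> + e)"
   unfolding C_def using y0 yx by (subst powr_mult) auto
  finally show "H y <= C * (x / y) powr (\<alpha> + e) * H x"
   using pos[of x] y0 yx by simp
  have "H x <= H (2 ^ i * y)" by (intro mono) (use ix y0 in auto)
  also have "... <= (2 ^ i) powr (- \<alpha> + e) * H y" using up'[OF y, of i] unfolding p .
  also have "(2 ^ i) powr (- \<alpha> + e) <= C * (x / y) powr (- \<alpha> + e)"
  \<comment> \<open>The power is increasing or decreasing according to the sign of the exponent, so
    either 2^i <= x / y or x / (2 y) <= 2^i is the useful side of the dyadic bracketing.\<close>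
  proof (cases "- \<alpha> + e \<ge> 0")
   case True
   have "(2 ^ i) powr (- \<alpha> + e) <= 1 * (x / y) powr (- \<alpha> + e)"
    unfolding mult_1 by (intro powr_mono2) (use i True in auto)
   also have "... <= C * (x / y) powr (- \<alpha> + e)" using C1 by (intro mult_right_mono) auto
   finally show ?thesis .
  next
   case False
   have "(2 ^ i) powr (- \<alpha> + e) <= (x / y / 2) powr (- \<alpha> + e)"
    by (intro powr_mono2') (use i False y0 yx in auto)
   also have "... = 2 powr (\<alpha> - e) * (x / y) powr (- \<alpha> + e)"
    using y0 yx by (subst powr_divide) (auto simp: powr_minus_divide[symmetric] divide_inverse powr_minus[symmetric])
   also have "... <= C * (x / y) powr (- \<alpha> + e)"
    unfolding C_def using assms by (intro mult_right_mono powr_mono) auto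
   finally show ?thesis .
  qed
  finally show "H x <= C * (x / y) powr (- \<alpha> + e) * H y"
   using pos[of y] y0 by simp
 qed
qed

lemma regular_tail_lower:
 assumes "regular_tail \<alpha> H" "0 < e" "0 < \<alpha>"
 obtains c where "0 < c" "\<And>x. 1 <= x ==> c * x powr (- \<alpha> - e) <= H x"
proof -
 obtain C x0 where x0: "1 <= x0" "1 <= C"
  and P1: "\<And>x y. x0 <= y ==> y <= x ==> H y <= C * (x / y) powr (\<alpha> + e) * H x"
  using regular_tail_Potter[OF assms] by metis
 have pos: "0 < H x" if "0 <= x" for x using assms that unfolding regular_tail_def by auto
 have mono: "H y <= H x" if "0 <= x" "x <= y" for x y using assms that unfolding regular_tail_def by auto
 show ?thesis
 proof (rule that[of "H x0 / C"])
  show "0 < H x0 / C" using pos[of x0] x0 by simp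
  fix x :: real assume x: "1 <= x"
  show "H x0 / C * x powr (- \<alpha> - e) <= H x"
  proof (cases "x0 <= x")
   case True
   have "H x0 <= C * (x / x0) powr (\<alpha> + e) * H x" using P1[OF _ True] by simp
   also have "... <= C * x powr (\<alpha> + e) * H x"
    by (intro mult_right_mono mult_left_mono powr_mono2)
      (use x x0 assms pos[of x] in \<open>auto simp: field_simps intro: mult_left_mono\<close>)
   finally have *: "H x0 / C <= x powr (\<alpha> + e) * H x" using x0 by (simp add: field_simps)
   have "H x0 / C * x powr (- \<alpha> - e) <= x powr (\<alpha> + e) * H x * x powr (- \<alpha> - e)"
    by (intro mult_right_mono *) simp
   also have "... = x powr ((\<alpha> + e) + (- \<alpha> - e)) * H x" by (subst powr_add) simp
   finally show ?thesis using x by simp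
  next
   case False
   have "x powr (- \<alpha> - e) <= x powr 0" using x assms by (intro powr_mono) auto
   hence "H x0 / C * x powr (- \<alpha> - e) <= H x0 / 1 * 1"
    using pos[of x0] x0 x by (intro mult_mono divide_left_mono) auto
   also have "... <= H x" using mono[of x x0] False x by simp
   finally show ?thesis .
  qed
 qed
qed

text \<open>The bound must reach down to 0. Since d <= \<alpha>, the power on the right is
  nonincreasing, so below the threshold \<open>x0\<close> it stays above its value at
  \<open>x0\<close>, where the constant makes the right-hand side at least H 0.\<close>

lemma regular_tail_upper:
 assumes "regular_tail \<alpha> H" "0 < d" "d <= \<alpha>" "0 < \<alpha>"
 obtains C where "0 < C" "\<And>x. 0 < x ==> H x <= C * x powr (- \<alpha> + d)"
proof -
 obtain C x0 where x0: "1 <= x0" "1 <= C"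
  and P2: "\<And>x y. x0 <= y ==> y <= x ==> H x <= C * (x / y) powr (- \<alpha> + d) * H y"
  using regular_tail_Potter[OF assms(1,2,4)] by metis
 have pos: "0 < H x" if "0 <= x" for x using assms that unfolding regular_tail_def by auto
 have mono: "H y <= H x" if "0 <= x" "x <= y" for x y using assms that unfolding regular_tail_def by auto
 define D where "D = C * x0 powr (\<alpha> - d) * H 0"
 have "0 < D" unfolding D_def using x0 pos[of 0] by simp
 show ?thesis
 proof (rule that[OF \<open>0 < D\<close>])
  fix x :: real assume x: "0 < x"
  have H0: "H x0 <= H 0" using x0 by (intro mono) auto
  have e: "D * x powr (- \<alpha> + d) = C * (x / x0) powr (- \<alpha> + d) * H 0"
  proof -
   have "(x / x0) powr (- \<alpha> + d) = x powr (- \<alpha> + d) * x0 powr (\<alpha> - d)"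
    using x x0 by (subst powr_divide) (auto simp: divide_inverse powr_minus[symmetric])
   thus ?thesis unfolding D_def by (simp add: mult_ac)
  qed
  show "H x <= D * x powr (- \<alpha> + d)"
  proof (cases "x0 <= x")
   case True
   show ?thesis unfolding e
    by (rule order_trans[OF P2[OF order_refl True]]) (use x0 H0 in \<open>auto intro!: mult_left_mono\<close>)
  next
   case False
   have "1 = 1 powr (- \<alpha> + d)" by simp
   also have "... <= (x / x0) powr (- \<alpha> + d)"
    by (intro powr_mono2') (use False x x0 assms in auto)
   finally have "1 * 1 <= C * (x / x0) powr (- \<alpha> + d)" using x0 by (intro mult_mono) auto
   hence "1 * H 0 <= C * (x / x0) powr (- \<alpha> + d) * H 0" using pos[of 0] by (intro mult_right_mono) auto
   thus ?thesis unfolding e using mono[of 0 x] x by simp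
  qed
 qed
qed

text \<open>Supplies the integrable majorant of H (x w) / H x near w = 0. The Potter bounds stop
  where x w < \<open>x0\<close>; there H (x w) <= H 0, and H 0 is compared with H x through H
  x0.\<close>

lemma regular_tail_scaled_bound:
 assumes "regular_tail \<alpha> H" "0 < e" "0 < \<alpha>"
 obtains C x0 where "1 <= x0" "1 <= C"
  "\<And>x w. x0 <= x ==> 0 < w ==> w <= 1 ==> H (x * w) <= C * w powr (- \<alpha> - e) * H x"
proof -
 obtain C x0 where x0: "1 <= x0" "1 <= C"
  and P1: "\<And>x y. x0 <= y ==> y <= x ==> H y <= C * (x / y) powr (\<alpha> + e) * H x"
  using regular_tail_Potter[OF assms] by metis
 have pos: "0 < H x" if "0 <= x" for x using assms that unfolding regular_tail_def by auto
 have mono: "H y <= H x" if "0 <= x" "x <= y" for x y using assms that unfolding regular_tail_def by auto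
 have H0: "H x0 <= H 0" using x0 by (intro mono) auto
 define D where "D = C * (H 0 / H x0)"
 have h1: "1 <= H 0 / H x0" using H0 pos[of x0] x0 by simp
 have D1: "C <= D" unfolding D_def using x0 h1 mult_left_mono[of 1 "H 0 / H x0" C] by simp
 show ?thesis
 proof (rule that[OF x0(1)])
  show "1 <= D" using D1 x0 by simp
  fix x w :: real assume x: "x0 <= x" and w: "0 < w" "w <= 1"
  have inv: "(1 / w) powr (\<alpha> + e) = w powr (- \<alpha> - e)"
  proof -
   have "(1 / w) powr (\<alpha> + e) = 1 / w powr (\<alpha> + e)" using w by (subst powr_divide) auto
   also have "... = w powr - (\<alpha> + e)" by (rule powr_minus_divide[symmetric])
   also have "- (\<alpha> + e) = - \<alpha> - e" by simp
   finally show ?thesis .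
  qed
  show "H (x * w) <= D * w powr (- \<alpha> - e) * H x"
  proof (cases "x0 <= x * w")
   case True
   have "H (x * w) <= C * (x / (x * w)) powr (\<alpha> + e) * H x"
    by (rule P1[OF True]) (use x x0 w in auto)
   also have "x / (x * w) = 1 / w" using x x0 by simp
   also have "C * (1 / w) powr (\<alpha> + e) * H x <= D * (1 / w) powr (\<alpha> + e) * H x"
    using pos[of x] x x0 D1 by (intro mult_right_mono) auto
   finally show ?thesis unfolding inv .
  next
   case False
   have "H (x * w) <= H 0" using x x0 w by (intro mono) auto
   also have "... = H 0 / H x0 * H x0" using pos[of x0] x0 by simp
   also have "... <= H 0 / H x0 * (C * (x / x0) powr (\<alpha> + e) * H x)"
    using P1[OF order_refl x] h1 by (intro mult_left_mono) auto
   also have "... = D * (x / x0) powr (\<alpha> + e) * H x" unfolding D_def by simp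
   also have "... <= D * (1 / w) powr (\<alpha> + e) * H x"
   proof (intro mult_right_mono mult_left_mono powr_mono2)
    show "x / x0 <= 1 / w" using False x x0 w by (simp add: field_simps)
   qed (use assms x x0 D1 pos[of x] in auto)
   finally show ?thesis unfolding inv .
  qed
 qed
qed

section \<open>Moments of functions of the duration\<close>

lemma powr_integrable_from_0:
 fixes a c :: real
 assumes "-1 < a" "0 <= c"
 shows "integrable lborel (\<lambda>w. w powr a * indicator {0..c} w)"
  and "(LINT w|lborel. w powr a * indicator {0..c} w) = c powr (a + 1) / (a + 1)"
proof -
 have hi: "((\<lambda>w. w powr a) has_integral c powr (a + 1) / (a + 1)) {0..c}"
  by (rule has_integral_powr_from_0[OF assms])
 have "(\<lambda>w. w powr a * indicator {0..c} w) = (\<lambda>w. if w \<in> {0..c} then w powr a else 0)"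
  by (auto simp: fun_eq_iff indicator_def)
 hence "((\<lambda>w. w powr a * indicator {0..c} w) has_integral c powr (a + 1) / (a + 1)) UNIV"
  using hi by (simp only: has_integral_restrict_UNIV)
 hence "has_bochner_integral lborel (\<lambda>w. w powr a * indicator {0..c} w) (c powr (a + 1) / (a + 1))"
  by (intro has_bochner_integral_nn_integral nn_integral_has_integral_lborel) (use assms in auto)
 thus "integrable lborel (\<lambda>w. w powr a * indicator {0..c} w)"
  "(LINT w|lborel. w powr a * indicator {0..c} w) = c powr (a + 1) / (a + 1)"
  by (auto simp: has_bochner_integral_iff)
qed

text \<open>The tails of order 1, 2 and 4 govern, in turn, the means of the coefficients, their
  energies, and the variances of these energies.\<close>

locale mark_law = prob_space \<nu> for \<nu> :: "(real \<times> real) measure" +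
 fixes \<alpha> :: real
 assumes sets_nu: "sets \<nu> = sets borel"
  and duration_pos: "AE z in \<nu>. 0 < fst z"
  and moment4: "integrable \<nu> (\<lambda>z. \<bar>snd z\<bar> ^ 4)"
  and alpha: "0 < \<alpha>" "\<alpha> < 2"
  and tails: "regular_tail \<alpha> (mark_tail \<nu> 1)" "regular_tail \<alpha> (mark_tail \<nu> 2)" "regular_tail \<alpha> (mark_tail \<nu> 4)"
begin

lemma space_nu [simp]: "space \<nu> = UNIV"
 using sets_eq_imp_space_eq[OF sets_nu] by simp

lemma sets_nu_pair [measurable_cong]: "sets \<nu> = sets (borel \<Otimes>\<^sub>M borel)"
 using sets_nu by (simp only: borel_prod)

lemma moment_integrable:
 assumes "p <= 4"
 shows "integrable \<nu> (\<lambda>z. \<bar>snd z\<bar> ^ p)"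
proof (rule integrable_boundedI[where f="\<lambda>z. 1 + \<bar>snd z\<bar> ^ 4"])
 show "AE z in \<nu>. norm (\<bar>snd z\<bar> ^ p) <= norm (1 + \<bar>snd z\<bar> ^ 4)"
 proof (rule AE_I2)
  fix z :: "real \<times> real"
  have "\<bar>snd z\<bar> ^ p <= 1 + \<bar>snd z\<bar> ^ 4"
  proof (cases "\<bar>snd z\<bar> <= 1")
   case True
   hence "\<bar>snd z\<bar> ^ p <= 1" by (simp add: power_le_one)
   thus ?thesis by (simp add: add_increasing2)
  next
   case False
   hence "\<bar>snd z\<bar> ^ p <= \<bar>snd z\<bar> ^ 4" using assms by (intro power_increasing) auto
   thus ?thesis by simp
  qed
  thus "norm (\<bar>snd z\<bar> ^ p) <= norm (1 + \<bar>snd z\<bar> ^ 4)" by simp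
 qed
qed (use moment4 in \<open>measurable, auto\<close>)

lemma mark_tail_integrable:
 assumes "p <= 4"
 shows "integrable \<nu> (\<lambda>z. \<bar>snd z\<bar> ^ p * indicator {x<..} (fst z))"
 by (rule integrable_boundedI[OF moment_integrable[OF assms]]) (measurable, auto simp: indicator_def)

lemma mark_tail_antimono:
 assumes "p <= 4" "x <= y"
 shows "mark_tail \<nu> p y <= mark_tail \<nu> p x"
 unfolding mark_tail_def
 by (intro integral_mono mark_tail_integrable assms) (use assms in \<open>auto simp: indicator_def\<close>)

lemma mark_tail_nonneg: "0 <= mark_tail \<nu> p x"
 unfolding mark_tail_def by (intro Bochner_Integration.integral_nonneg) auto

lemma mark_tail_le_moment:
 assumes "p <= 4"
 shows "mark_tail \<nu> p x <= (LINT z|\<nu>. \<bar>snd z\<bar> ^ p)"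
 unfolding mark_tail_def
 by (intro integral_mono mark_tail_integrable moment_integrable assms) (auto simp: indicator_def)

lemma mark_tail_measurable [measurable]:
 assumes "p <= 4"
 shows "mark_tail \<nu> p \<in> borel_measurable borel"
proof -
 have "mono (\<lambda>x. - mark_tail \<nu> p x)" using mark_tail_antimono[OF assms] by (intro monoI) auto
 hence "(\<lambda>x. - mark_tail \<nu> p x) \<in> borel_measurable borel" by (rule borel_measurable_mono)
 hence "(\<lambda>x. - (- mark_tail \<nu> p x)) \<in> borel_measurable borel" by (rule borel_measurable_uminus)
 thus ?thesis by simp
qed

text \<open>Fubini over marks and w. For \<gamma> vanishing on the negative half-line the inner
  integral is the primitive of \<gamma> at duration / x, so moments of functions of the duration
  reduce to integrals of \<open>mark_tail\<close>.\<close>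

lemma layer_cake:
 assumes p: "p <= 4" and x: "0 < x" and [measurable]: "\<gamma> \<in> borel_measurable borel" and int: "integrable lborel \<gamma>"
 shows "integrable \<nu> (\<lambda>z. \<bar>snd z\<bar> ^ p * (LINT w|lborel. \<gamma> w * indicator {..<fst z / x} w))"
  and "(LINT z|\<nu>. \<bar>snd z\<bar> ^ p * (LINT w|lborel. \<gamma> w * indicator {..<fst z / x} w)) =
     (LINT w|lborel. \<gamma> w * mark_tail \<nu> p (x * w))"
proof -
 interpret L: pair_sigma_finite \<nu> lborel ..
 let ?f = "\<lambda>(z, w). \<bar>snd z\<bar> ^ p * (\<gamma> w * indicator {..<fst z / x} w)"
 have ind: "indicator {..<fst z / x} w = (indicator {p. w < fst p / x} z :: real)" for z :: "real \<times> real" and w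
  by (auto simp: indicator_def)
 have meas: "?f \<in> borel_measurable (\<nu> \<Otimes>\<^sub>M lborel)"
 proof -
  have [measurable]: "(\<lambda>q. indicator {q :: (real \<times> real) \<times> real. snd q < fst (fst q) / x} q :: real) \<in> borel_measurable (\<nu> \<Otimes>\<^sub>M lborel)"
   by measurable
  have "(\<lambda>q. \<bar>snd (fst q)\<bar> ^ p * (\<gamma> (snd q) * indicator {q :: (real \<times> real) \<times> real. snd q < fst (fst q) / x} q)) \<in> borel_measurable (\<nu> \<Otimes>\<^sub>M lborel)"
   by measurable
  also have "(\<lambda>q. \<bar>snd (fst q)\<bar> ^ p * (\<gamma> (snd q) * indicator {q :: (real \<times> real) \<times> real. snd q < fst (fst q) / x} q)) = ?f"
   by (auto simp: fun_eq_iff indicator_def)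
  finally show ?thesis .
 qed
 have inner: "integrable lborel (\<lambda>w. \<gamma> w * indicator {..<a} w)" for a :: real
  by (rule integrable_boundedI[OF int]) (auto simp: indicator_def)
 have If: "integrable (\<nu> \<Otimes>\<^sub>M lborel) ?f"
 proof (rule L.Fubini_integrable[OF meas])
  show "AE z in \<nu>. integrable lborel (\<lambda>w. ?f (z, w))" using inner by auto
  show "integrable \<nu> (\<lambda>z. (LINT w|lborel. norm (?f (z, w))))"
  proof (rule integrable_boundedI[where f="\<lambda>z. \<bar>snd z\<bar> ^ p * (LINT w|lborel. \<bar>\<gamma> w\<bar>)"])
   show "integrable \<nu> (\<lambda>z. \<bar>snd z\<bar> ^ p * (LINT w|lborel. \<bar>\<gamma> w\<bar>))" using moment_integrable[OF p] by simp
   show "(\<lambda>z. (LINT w|lborel. norm (?f (z, w)))) \<in> borel_measurable \<nu>"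
    using meas by (intro lborel.borel_measurable_lebesgue_integral) (auto simp: split_beta')
   show "AE z in \<nu>. norm (LINT w|lborel. norm (?f (z, w))) <= norm (\<bar>snd z\<bar> ^ p * (LINT w|lborel. \<bar>\<gamma> w\<bar>))"
   proof (rule AE_I2)
    fix z :: "real \<times> real"
    have "(LINT w|lborel. \<bar>\<gamma> w * indicator {..<fst z / x} w\<bar>) <= (LINT w|lborel. \<bar>\<gamma> w\<bar>)"
     using inner int by (intro integral_mono integrable_abs) (auto simp: indicator_def)
    hence "\<bar>snd z\<bar> ^ p * (LINT w|lborel. \<bar>\<gamma> w * indicator {..<fst z / x} w\<bar>) <= \<bar>snd z\<bar> ^ p * (LINT w|lborel. \<bar>\<gamma> w\<bar>)"
     by (rule mult_left_mono) simp
    thus "norm (LINT w|lborel. norm (?f (z, w))) <= norm (\<bar>snd z\<bar> ^ p * (LINT w|lborel. \<bar>\<gamma> w\<bar>))"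
     by (simp add: abs_mult)
   qed
  qed
 qed
 have i1: "(LINT w|lborel. ?f (z, w)) = \<bar>snd z\<bar> ^ p * (LINT w|lborel. \<gamma> w * indicator {..<fst z / x} w)" for z :: "real \<times> real"
  by simp
 have i2: "(LINT z|\<nu>. ?f (z, w)) = \<gamma> w * mark_tail \<nu> p (x * w)" for w
 proof -
  have "(indicator {..<fst z / x} w :: real) = indicator {x * w<..} (fst z)" for z :: "real \<times> real"
   using x by (auto simp: indicator_def field_simps)
  hence e: "(\<lambda>z. ?f (z, w)) = (\<lambda>z. \<gamma> w * (\<bar>snd z\<bar> ^ p * indicator {x * w<..} (fst z)))"
   by (simp add: fun_eq_iff mult_ac)
  show ?thesis unfolding mark_tail_def by (simp only: e integral_mult_right_zero)
 qed
 show "integrable \<nu> (\<lambda>z. \<bar>snd z\<bar> ^ p * (LINT w|lborel. \<gamma> w * indicator {..<fst z / x} w))"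
  using L.integrable_fst'[OF If] unfolding i1 .
 show "(LINT z|\<nu>. \<bar>snd z\<bar> ^ p * (LINT w|lborel. \<gamma> w * indicator {..<fst z / x} w)) = (LINT w|lborel. \<gamma> w * mark_tail \<nu> p (x * w))"
  using L.Fubini_integral[of "\<lambda>z w. ?f (z, w)"] If unfolding i1 i2 by simp
qed

text \<open>The squared effect of a pulse at scale x: proportional to the duration while this is
  below x, saturated afterwards. The absolute value keeps the factor in [0, 1] also on the null set
  where the duration is not positive.\<close>

definition truncated_moment :: "nat => real => real" where
 "truncated_moment p x = (LINT z|\<nu>. \<bar>snd z\<bar> ^ p * (min 1 (\<bar>fst z\<bar> / x))^2)"

lemma truncated_moment_integrable:
 assumes "p <= 4" "0 < x"
 shows "integrable \<nu> (\<lambda>z. \<bar>snd z\<bar> ^ p * (min 1 (\<bar>fst z\<bar> / x))^2)"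
proof (rule integrable_boundedI[OF moment_integrable[OF assms(1)]])
 show "AE z in \<nu>. norm (\<bar>snd z\<bar> ^ p * (min 1 (\<bar>fst z\<bar> / x))^2) <= norm (\<bar>snd z\<bar> ^ p)"
 proof (rule AE_I2)
  fix z :: "real \<times> real"
  have "(min 1 (\<bar>fst z\<bar> / x))^2 <= 1" using assms by (intro power_le_one) auto
  hence "\<bar>snd z\<bar> ^ p * (min 1 (\<bar>fst z\<bar> / x))^2 <= \<bar>snd z\<bar> ^ p * 1" by (intro mult_left_mono) auto
  thus "norm (\<bar>snd z\<bar> ^ p * (min 1 (\<bar>fst z\<bar> / x))^2) <= norm (\<bar>snd z\<bar> ^ p)" by simp
 qed
qed measurable

text \<open>Layer cake with the density 2 w on [0, 1], whose primitive is min(1, v)^2. Under the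
  tail bound the integrand is at most a multiple of w^(1 - a), integrable because a < 2.\<close>

lemma truncated_moment_le:
 assumes p: "p <= 4" and x: "0 < x" and a: "a < 2" and C: "0 <= C"
  and H: "\<And>w. 0 < w ==> w <= 1 ==> mark_tail \<nu> p (x * w) <= C * w powr (- a)"
 shows "truncated_moment p x <= 2 * C / (2 - a)"
proof -
 define \<gamma> :: "real => real" where "\<gamma> w = 2 * (w powr 1 * indicator {0..1} w)" for w
 have pi: "integrable lborel \<gamma>" "\<gamma> \<in> borel_measurable borel"
  unfolding \<gamma>_def using powr_integrable_from_0(1)[of 1 1] by auto
 have eq: "(LINT w|lborel. \<gamma> w * indicator {..<v / x} w) = (min 1 (\<bar>v\<bar> / x))^2" if v: "0 < v" for v
 proof -
  define c where "c = min 1 (v / x)"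
  have c: "0 <= c" unfolding c_def using v x by simp
  have "(LINT w|lborel. \<gamma> w * indicator {..<v / x} w) = (LINT w|lborel. 2 * (w powr 1 * indicator {0..c} w))"
  proof (rule integral_cong_AE)
   have "AE w in lborel. w \<noteq> v / x" by (rule AE_lborel_singleton)
   thus "AE w in lborel. \<gamma> w * indicator {..<v / x} w = 2 * (w powr 1 * indicator {0..c} w)"
    by eventually_elim (auto simp: \<gamma>_def indicator_def c_def)
  qed (auto simp: \<gamma>_def)
  also have "... = c^2" using powr_integrable_from_0(2)[of 1 c] c by (simp add: powr_numeral)
  finally show ?thesis unfolding c_def using v by simp
 qed
 have "truncated_moment p x = (LINT z|\<nu>. \<bar>snd z\<bar> ^ p * (LINT w|lborel. \<gamma> w * indicator {..<fst z / x} w))"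
  unfolding truncated_moment_def
 proof (rule integral_cong_AE)
  show "AE z in \<nu>. \<bar>snd z\<bar> ^ p * (min 1 (\<bar>fst z\<bar> / x))^2 = \<bar>snd z\<bar> ^ p * (LINT w|lborel. \<gamma> w * indicator {..<fst z / x} w)"
   using duration_pos by eventually_elim (simp add: eq)
  show "(\<lambda>z. \<bar>snd z\<bar> ^ p * (LINT w|lborel. \<gamma> w * indicator {..<fst z / x} w)) \<in> borel_measurable \<nu>"
   using layer_cake(1)[OF p x pi(2,1)] by auto
 qed measurable
 also have "... = (LINT w|lborel. \<gamma> w * mark_tail \<nu> p (x * w))" by (rule layer_cake(2)[OF p x pi(2,1)])
 also have "... <= (LINT w|lborel. 2 * C * (w powr (1 - a) * indicator {0..1} w))"
 proof (rule integral_mono')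
  show "integrable lborel (\<lambda>w. 2 * C * (w powr (1 - a) * indicator {0..1} w))"
   using powr_integrable_from_0(1)[of "1 - a" 1] a by simp
  fix w :: real
  show "\<gamma> w * mark_tail \<nu> p (x * w) <= 2 * C * (w powr (1 - a) * indicator {0..1} w)"
  proof (cases "0 < w \<and> w <= 1")
   case True
   have "w powr (1 - a) = w * w powr (- a)" using True by (simp add: powr_diff powr_minus divide_inverse)
   thus ?thesis using H[of w] True mult_left_mono[OF H[of w], of "2 * w"] by (simp add: \<gamma>_def mult_ac)
  next
   case False
   hence "\<gamma> w = 0" unfolding \<gamma>_def by (auto simp: indicator_def)
   thus ?thesis using C by simp
  qed
  show "0 <= 2 * C * (w powr (1 - a) * indicator {0..1} w)" using C by simp
 qed
 also have "... = 2 * C / (2 - a)" using powr_integrable_from_0(2)[of "1 - a" 1] a by simp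
 finally show ?thesis .
qed

lemma truncated_moment2_bound:
 obtains C x0 where "0 < C" "1 <= x0" "\<And>x. x0 <= x ==> truncated_moment 2 x <= C * mark_tail \<nu> 2 x"
proof -
 \<comment> \<open>Makes \<alpha> + e the midpoint of \<alpha> and 2, hence an admissible exponent
   in \<open>truncated_moment_le\<close>.\<close>
 define e where "e = (2 - \<alpha>) / 2"
 have e: "0 < e" "\<alpha> + e < 2" using alpha unfolding e_def by (simp_all add: field_simps)
 obtain C x0 where C: "1 <= x0" "1 <= C"
  and H: "\<And>x w. x0 <= x ==> 0 < w ==> w <= 1 ==> mark_tail \<nu> 2 (x * w) <= C * w powr (- \<alpha> - e) * mark_tail \<nu> 2 x"
  using regular_tail_scaled_bound[OF tails(2) e(1) alpha(1)] by metis
 show ?thesis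
 proof (rule that[of "2 * C / (2 - (\<alpha> + e))" x0])
  fix x assume x: "x0 <= x"
  have "truncated_moment 2 x <= 2 * (C * mark_tail \<nu> 2 x) / (2 - (\<alpha> + e))"
  proof (rule truncated_moment_le)
   fix w :: real assume "0 < w" "w <= 1"
   thus "mark_tail \<nu> 2 (x * w) <= C * mark_tail \<nu> 2 x * w powr - (\<alpha> + e)"
    using H[OF x, of w] by (simp add: mult_ac)
  qed (use C x e mark_tail_nonneg in auto)
  thus "truncated_moment 2 x <= 2 * C / (2 - (\<alpha> + e)) * mark_tail \<nu> 2 x" by simp
 qed (use C e in auto)
qed

text \<open>\<open>H\<^sub>4\<close> and \<open>H\<^sub>2\<close> may have different slowly varying
  factors, so no bound relative to \<open>H\<^sub>2\<close> is available as for the second moment; a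
  power x^e is given away instead.\<close>

lemma truncated_moment4_bound:
 assumes "0 < e" "e <= \<alpha>"
 obtains C where "0 < C" "\<And>x. 0 < x ==> truncated_moment 4 x <= C * x powr (- \<alpha> + e)"
proof -
 obtain C where C: "0 < C" and H: "\<And>x. 0 < x ==> mark_tail \<nu> 4 x <= C * x powr (- \<alpha> + e)"
  using regular_tail_upper[OF tails(3) assms alpha(1)] by metis
 have a: "\<alpha> - e < 2" using assms alpha by simp
 show ?thesis
 proof (rule that[of "2 * C / (2 - (\<alpha> - e))"])
  fix x :: real assume x: "0 < x"
  have "truncated_moment 4 x <= 2 * (C * x powr (- \<alpha> + e)) / (2 - (\<alpha> - e))"
  proof (rule truncated_moment_le)
   fix w :: real assume "0 < w" "w <= 1"
   thus "mark_tail \<nu> 4 (x * w) <= C * x powr (- \<alpha> + e) * w powr - (\<alpha> - e)"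
    using H[of "x * w"] x by (simp add: powr_mult mult_ac)
  qed (use C x a in auto)
  thus "truncated_moment 4 x <= 2 * C / (2 - (\<alpha> - e)) * x powr (- \<alpha> + e)" by simp
 qed (use C a in auto)
qed

end

section \<open>The primitive of the wavelet and the energy of a pulse\<close>

text \<open>Formulated for a Borel function that satisfies the bound and the support condition
  everywhere; a Lebesgue measurable wavelet is replaced by such a version when the locale is
  interpreted.\<close>

locale wavelet_primitive =
 fixes M K :: real and \<psi> :: "real => real"
 assumes M: "1 <= M" and psi_measurable [measurable]: "\<psi> \<in> borel_measurable borel"
  and psi_bound: "\<And>s. \<bar>\<psi> s\<bar> <= K" and psi_support: "\<And>s. s \<notin> {0..M} ==> \<psi> s = 0"
  and psi_zero: "(LINT s|lborel. \<psi> s) = 0"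
  and psi_nonzero: "\<not> (AE s in lborel. \<psi> s = 0)"
begin

lemma K_nonneg: "0 <= K" using psi_bound[of 0] by linarith

definition prim :: "real => real" where
 "prim x = (LINT s|lborel. \<psi> s * indicator {..<x} s)"

lemma bounded_interval_integrable:
 fixes f :: "real => real"
 assumes [measurable]: "f \<in> borel_measurable borel" and "\<And>s. \<bar>f s\<bar> <= c" and "\<And>s. s \<notin> {a..b} ==> f s = 0"
 shows "integrable lborel f"
proof (rule integrable_boundedI[where f="\<lambda>s. c * indicator {a..b} s"])
 have "emeasure lborel {a..b} < \<infinity>" by (cases "a <= b") auto
 thus "integrable lborel (\<lambda>s. c * indicator {a..b} s)" by (intro integrable_mult_right integrable_real_indicator) auto
 show "AE s in lborel. norm (f s) <= norm (c * indicator {a..b} s)"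
  using assms(2,3) by (intro AE_I2) (auto simp: indicator_def intro: order_trans[OF _ abs_ge_self])
qed auto

lemma psi_integrable: "integrable lborel \<psi>"
 by (rule bounded_interval_integrable[OF psi_measurable psi_bound psi_support])

lemma psi_indicator_integrable:
 assumes "A \<in> sets borel"
 shows "integrable lborel (\<lambda>s. \<psi> s * indicator A s)"
 using assms by (intro bounded_interval_integrable[of _ K 0 M]) (auto simp: indicator_def psi_bound psi_support K_nonneg)

lemma prim_diff: "x <= y ==> prim y - prim x = (LINT s|lborel. \<psi> s * indicator {x..<y} s)"
 unfolding prim_def
proof -
 assume xy: "x <= y"
 have "(LINT s|lborel. \<psi> s * indicator {..<y} s) - (LINT s|lborel. \<psi> s * indicator {..<x} s) =
  (LINT s|lborel. \<psi> s * indicator {..<y} s - \<psi> s * indicator {..<x} s)"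
  by (rule lint_diff[symmetric]; rule psi_indicator_integrable) simp_all
 also have "... = (LINT s|lborel. \<psi> s * indicator {x..<y} s)"
  using xy by (intro lint_cong refl) (auto simp: indicator_def)
 finally show "(LINT s|lborel. \<psi> s * indicator {..<y} s) - (LINT s|lborel. \<psi> s * indicator {..<x} s) =
  (LINT s|lborel. \<psi> s * indicator {x..<y} s)" .
qed

lemma prim_Lipschitz: "\<bar>prim x - prim y\<bar> <= K * \<bar>x - y\<bar>"
proof -
 have *: "\<bar>prim y - prim x\<bar> <= K * (y - x)" if "x <= y" for x y
 proof -
  have "\<bar>prim y - prim x\<bar> <= (LINT s|lborel. \<bar>\<psi> s * indicator {x..<y} s\<bar>)"
   unfolding prim_diff[OF that] by (rule integral_abs_bound)
  also have "... <= (LINT s|lborel. K * indicator {x..<y} s)"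
   using that psi_bound K_nonneg
   by (intro integral_mono integrable_abs psi_indicator_integrable integrable_mult_right integrable_real_indicator) (auto simp: indicator_def)
  also have "... = K * (y - x)" using that by simp
  finally show ?thesis .
 qed
 show ?thesis using *[of x y] *[of y x] by (cases "x <= y") (auto simp: abs_minus_commute)
qed

lemma prim_eq_0: "x <= 0 \<or> M <= x ==> prim x = 0"
proof -
 have "AE s in lborel. s \<noteq> M" "AE s in lborel. s \<noteq> 0" by (rule AE_lborel_singleton)+
 assume "x <= 0 \<or> M <= x"
 thus ?thesis
 proof
  assume x: "x <= 0"
  have z: "\<psi> s * indicator {..<x} s = 0" for s using x psi_support[of s] by (auto simp: indicator_def)
  show ?thesis unfolding prim_def z by simp
 next
  assume x: "M <= x"
  have "prim x = (LINT s|lborel. \<psi> s)"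
   unfolding prim_def
  proof (rule integral_cong_AE)
   show "AE s in lborel. \<psi> s * indicator {..<x} s = \<psi> s"
    using \<open>AE s in lborel. s \<noteq> M\<close> by eventually_elim (use x psi_support in \<open>auto simp: indicator_def\<close>)
  qed auto
  thus ?thesis using psi_zero by simp
 qed
qed

lemma prim_measurable [measurable]: "prim \<in> borel_measurable borel"
proof (rule borel_measurable_continuous_onI)
 have "K-lipschitz_on UNIV prim"
  using prim_Lipschitz K_nonneg by (intro lipschitz_onI) (auto simp: dist_real_def)
 thus "continuous_on UNIV prim" by (rule lipschitz_on_continuous_on)
qed

lemma prim_bound: "\<bar>prim x\<bar> <= K * M"
proof (cases "x <= 0 \<or> M <= x")
 case False
 have "\<bar>prim x\<bar> <= K * \<bar>x\<bar>" using prim_Lipschitz[of x 0] prim_eq_0[of 0] by simp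
 also have "... <= K * M" using False K_nonneg by (intro mult_left_mono) auto
 finally show ?thesis .
next
 case True
 thus ?thesis using prim_eq_0[OF True] K_nonneg M by simp
qed

lemma prim_square_integrable: "integrable lborel (\<lambda>t. (prim t)^2)"
proof (rule bounded_interval_integrable[of _ "(K * M)^2" 0 M])
 show "\<bar>(prim s)^2\<bar> <= (K * M)^2" for s using power_mono[OF prim_bound[of s], of 2] by simp
qed (use prim_eq_0 in \<open>auto simp: not_le\<close>)

text \<open>A vanishing square integral forces the continuous function \<open>prim\<close> to vanish
  identically. Then the measures whose densities are the positive and the negative part of \<psi>
  agree on all rays, hence coincide, and \<psi> is 0 almost everywhere.\<close>

lemma prim_square_pos: "0 < (LINT t|lborel. (prim t)^2)"
proof (rule ccontr)
 assume "\<not> ?thesis"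
 hence z: "(LINT t|lborel. (prim t)^2) = 0" by (simp add: antisym not_less)
 have "AE t in lborel. (prim t)^2 = 0"
  using z integral_nonneg_eq_0_iff_AE[OF prim_square_integrable] by simp
 hence ae: "AE t in lborel. prim t = 0" by simp
 have pz: "prim x = 0" for x
 proof (rule ccontr)
  assume x: "prim x \<noteq> 0"
  \<comment> \<open>By the Lipschitz bound \<open>prim\<close> cannot reach 0 within this distance
    of x; K + 1 replaces K because K may be 0.\<close>
  define d where "d = \<bar>prim x\<bar> / (K + 1)"
  have d: "0 < d" unfolding d_def using x K_nonneg by simp
  have nz: "prim y \<noteq> 0" if "\<bar>y - x\<bar> < d" for y
  proof
   assume y: "prim y = 0"
   have "\<bar>prim x\<bar> <= K * \<bar>y - x\<bar>" using prim_Lipschitz[of x y] y by (simp add: abs_minus_commute)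
   also have "... <= (K + 1) * \<bar>y - x\<bar>" by (intro mult_right_mono) auto
   also have "... < (K + 1) * d" using that K_nonneg by (intro mult_strict_left_mono) auto
   also have "... = \<bar>prim x\<bar>" unfolding d_def using K_nonneg by simp
   finally show False by simp
  qed
  have "AE t in lborel. \<not> (t \<in> {x..<x + d})"
   using ae by eventually_elim (use nz in force)
  hence "emeasure lborel {t\<in>space lborel. t \<in> {x..<x + d}} = 0" by (rule emeasure_eq_0_AE)
  moreover have "{t\<in>space lborel. t \<in> {x..<x + d}} = {x..<x + d}" by auto
  ultimately have "emeasure lborel {x..<x + d} = 0" by (simp only:)
  thus False using d by simp
 qed
 define p where "p s = max 0 (\<psi> s)" for s
 define m where "m s = max 0 (- \<psi> s)" for s
 have [measurable]: "p \<in> borel_measurable borel" "m \<in> borel_measurable borel" unfolding p_def m_def by measurable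
 have pm: "\<psi> s = p s - m s" "0 <= p s" "0 <= m s" for s unfolding p_def m_def by auto
 have ip: "integrable lborel (\<lambda>s. p s * indicator A s)" "integrable lborel (\<lambda>s. m s * indicator A s)"
  if [measurable]: "A \<in> sets borel" for A
 proof -
  show "integrable lborel (\<lambda>s. p s * indicator A s)"
   by (rule integrable_boundedI[OF psi_integrable]) (measurable, auto simp: indicator_def p_def)
  show "integrable lborel (\<lambda>s. m s * indicator A s)"
   by (rule integrable_boundedI[OF psi_integrable]) (measurable, auto simp: indicator_def m_def)
 qed
 have eqm: "(LINT s|lborel. p s * indicator {x<..} s) = (LINT s|lborel. m s * indicator {x<..} s)" for x
 proof -
  have "(LINT s|lborel. p s * indicator {x<..} s) - (LINT s|lborel. m s * indicator {x<..} s) = (LINT s|lborel. \<psi> s * indicator {x<..} s)"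
   by (subst lint_diff[symmetric]) (auto intro!: ip simp: pm(1) left_diff_distrib)
  also have "... = (LINT s|lborel. \<psi> s - \<psi> s * indicator {..<x} s)"
  proof (rule integral_cong_AE)
   have "AE s in lborel. s \<noteq> x" by (rule AE_lborel_singleton)
   thus "AE s in lborel. \<psi> s * indicator {x<..} s = \<psi> s - \<psi> s * indicator {..<x} s"
    by eventually_elim (auto simp: indicator_def)
  qed auto
  also have "... = 0"
   using psi_integrable psi_indicator_integrable[of "{..<x}"] psi_zero pz[of x, unfolded prim_def] by simp
  finally show ?thesis by simp
 qed
 have "density lborel p = density lborel m"
 proof (rule measure_eqI_lessThan)
  fix x
  have e: "emeasure (density lborel p) {x<..} = ennreal (LINT s|lborel. p s * indicator {x<..} s)"
      "emeasure (density lborel m) {x<..} = ennreal (LINT s|lborel. m s * indicator {x<..} s)"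
   using ip[of "{x<..}"] pm
   by (auto simp: emeasure_density nn_integral_eq_integral[symmetric] ennreal_mult' ennreal_indicator intro!: nn_integral_cong)
  show "emeasure (density lborel p) {x<..} < \<infinity>" unfolding e by simp
  show "emeasure (density lborel p) {x<..} = emeasure (density lborel m) {x<..}" unfolding e eqm ..
 qed auto
 moreover have "(\<integral>\<^sup>+s. ennreal (p s) \<partial>lborel) \<noteq> \<infinity>"
  using ip(1)[of UNIV] pm by (subst nn_integral_eq_integral) auto
 ultimately have "AE s in lborel. ennreal (p s) = ennreal (m s)"
  by (subst (asm) finite_density_unique) (use pm in auto)
 hence "AE s in lborel. \<psi> s = 0" by eventually_elim (use pm in \<open>simp add: pm(1)\<close>)
 thus False using psi_nonzero by simp
qed

text \<open>Integration by parts in the form of Fubini's theorem, with the tail integral of g in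
  place of an antiderivative.\<close>

lemma integral_mult_prim:
 assumes [measurable]: "g \<in> borel_measurable borel" and g: "integrable lborel g"
 shows "(LINT s|lborel. g s * prim s) = (LINT r|lborel. \<psi> r * (LINT s|lborel. g s * indicator {r<..} s))"
proof -
 let ?f = "\<lambda>s r. g s * (\<psi> r * indicator {..<s} r) :: real"
 have mind: "(\<lambda>q :: real \<times> real. indicator {..<fst q} (snd q) :: real) \<in> borel_measurable (lborel \<Otimes>\<^sub>M lborel)"
 proof -
  have "(\<lambda>q :: real \<times> real. indicator {q. snd q < fst q} q :: real) \<in> borel_measurable (lborel \<Otimes>\<^sub>M lborel)" by measurable
  thus ?thesis by (simp add: indicator_def)
 qed
 have If: "integrable (lborel \<Otimes>\<^sub>M lborel) (\<lambda>(s, r). ?f s r)"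
 proof (rule lborel_pair.Fubini_integrable)
  show "(\<lambda>(s, r). ?f s r) \<in> borel_measurable (lborel \<Otimes>\<^sub>M lborel)"
   using mind unfolding split_beta' by measurable
  show "AE s in lborel. integrable lborel (\<lambda>r. case (s, r) of (s, r) => ?f s r)"
   by (auto intro!: AE_I2 psi_indicator_integrable)
  show "integrable lborel (\<lambda>s. (LINT r|lborel. norm (case (s, r) of (s, r) => ?f s r)))"
  proof (rule integrable_boundedI[where f="\<lambda>s. \<bar>g s\<bar> * (LINT r|lborel. \<bar>\<psi> r\<bar>)"])
   show "integrable lborel (\<lambda>s. \<bar>g s\<bar> * (LINT r|lborel. \<bar>\<psi> r\<bar>))"
    by (intro integrable_mult_left integrable_abs g)
   show "(\<lambda>s. (LINT r|lborel. norm (case (s, r) of (s, r) => ?f s r))) \<in> borel_measurable lborel"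
    using mind by (intro lborel.borel_measurable_lebesgue_integral) (auto simp: split_beta')
   show "AE s in lborel. norm (LINT r|lborel. norm (case (s, r) of (s, r) => ?f s r)) <= norm (\<bar>g s\<bar> * (LINT r|lborel. \<bar>\<psi> r\<bar>))"
   proof (rule AE_I2)
    fix s
    have "(LINT r|lborel. \<bar>\<psi> r * indicator {..<s} r\<bar>) <= (LINT r|lborel. \<bar>\<psi> r\<bar>)"
     by (intro integral_mono integrable_abs psi_indicator_integrable psi_integrable) (auto simp: indicator_def)
    thus "norm (LINT r|lborel. norm (case (s, r) of (s, r) => ?f s r)) <= norm (\<bar>g s\<bar> * (LINT r|lborel. \<bar>\<psi> r\<bar>))"
     by (simp add: abs_mult mult_left_mono)
   qed
  qed
 qed
 have "(LINT s|lborel. g s * prim s) = (LINT s|lborel. (LINT r|lborel. ?f s r))"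
  unfolding prim_def by simp
 also have "... = (LINT r|lborel. (LINT s|lborel. ?f s r))" by (rule lborel_pair.Fubini_integral[OF If, symmetric])
 also have "... = (LINT r|lborel. \<psi> r * (LINT s|lborel. g s * indicator {r<..} s))"
 proof (rule lint_cong[OF refl])
  fix r
  have e: "?f s r = \<psi> r * (g s * indicator {r<..} s)" for s by (simp add: indicator_def)
  show "(LINT s|lborel. ?f s r) = \<psi> r * (LINT s|lborel. g s * indicator {r<..} s)" unfolding e by simp
 qed
 finally show ?thesis .
qed

text \<open>The integrand is formally half the derivative of \<open>prim\<close> squared. With g =
  \<psi> the tail integral of g is the negative of \<open>prim\<close>, so
  \<open>integral_mult_prim\<close> equates the integral with its own negative.\<close>

lemma psi_prim_orthogonal: "(LINT s|lborel. \<psi> s * prim s) = 0"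
proof -
 have "(LINT s|lborel. \<psi> s * indicator {r<..} s) = - prim r" for r
 proof -
  have "(LINT s|lborel. \<psi> s * indicator {r<..} s) = (LINT s|lborel. \<psi> s - \<psi> s * indicator {..<r} s)"
  proof (rule integral_cong_AE)
   have "AE s in lborel. s \<noteq> r" by (rule AE_lborel_singleton)
   thus "AE s in lborel. \<psi> s * indicator {r<..} s = \<psi> s - \<psi> s * indicator {..<r} s"
    by eventually_elim (auto simp: indicator_def)
  qed measurable
  also have "... = - prim r"
   using psi_integrable psi_indicator_integrable[of "{..<r}"] psi_zero by (simp add: prim_def)
  finally show ?thesis .
 qed
 thus ?thesis using integral_mult_prim[OF psi_measurable psi_integrable] by simp
qed

section \<open>The energy of a pulse as a function of its duration\<close>

definition energy :: "real => real" where
 "energy v = (LINT t|lborel. (prim (t + v) - prim t)^2)"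

text \<open>The density that \<open>energy\<close> has as a function of the duration. The summand
  with \<open>prim s\<close> integrates to 0 by \<open>psi_prim_orthogonal\<close>; it is kept
  because the resulting difference is of order w near 0. Durations beyond M add nothing, as the
  supports are then disjoint.\<close>

definition energy_density :: "real => real" where
 "energy_density w = (if 0 < w \<and> w < M then 2 * (LINT s|lborel. \<psi> s * (prim s - prim (s - w))) else 0)"

lemma psi_prim_integrable: "integrable lborel (\<lambda>s. \<psi> s * prim (s - w))"
 by (rule bounded_interval_integrable[of _ "K * (K * M)" 0 M])
   (use psi_bound prim_bound K_nonneg psi_support in \<open>auto simp: abs_mult intro!: mult_mono\<close>)

lemma energy_density_eq:
 assumes "0 < w"
 shows "energy_density w = - 2 * (LINT t|lborel. \<psi> (t + w) * prim t)"
proof -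
 have tr: "(LINT s|lborel. \<psi> s * prim (s - w)) = (LINT t|lborel. \<psi> (t + w) * prim t)"
  using lborel_integral_real_affine[of 1 "\<lambda>s. \<psi> s * prim (s - w)" w] by (simp add: add.commute)
 have d: "(LINT s|lborel. \<psi> s * (prim s - prim (s - w))) = - (LINT s|lborel. \<psi> s * prim (s - w))"
  using psi_prim_integrable[of 0] psi_prim_integrable[of w] psi_prim_orthogonal by (simp add: right_diff_distrib)
 show ?thesis
 proof (cases "w < M")
  case True
  thus ?thesis using assms d tr unfolding energy_density_def by simp
 next
  case False
  have z: "\<psi> s * prim (s - w) = 0" for s
   using psi_support[of s] prim_eq_0[of "s - w"] False by (cases "s <= M") auto
  have "(LINT s|lborel. \<psi> s * prim (s - w)) = 0" unfolding z by simp
  thus ?thesis using False tr unfolding energy_density_def by simp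
 qed
qed

text \<open>The factor w is what counts: against the tail bound w^(-\<alpha> - e) it leaves w^(1 -
  \<alpha> - e), which is integrable at 0 even for \<alpha> >= 1 as long as \<alpha> + e <
  2.\<close>

lemma energy_density_bound: "\<bar>energy_density w\<bar> <= 2 * K * K * M * \<bar>w\<bar> * indicator {0..M} w"
proof (cases "0 < w \<and> w < M")
 case True
 have "\<bar>(LINT s|lborel. \<psi> s * (prim s - prim (s - w)))\<bar> <= (LINT s|lborel. \<bar>\<psi> s * (prim s - prim (s - w))\<bar>)" by (rule integral_abs_bound)
 also have "... <= (LINT s|lborel. K * (K * w) * indicator {0..M} s)"
 proof (rule integral_mono)
  show "integrable lborel (\<lambda>s. \<bar>\<psi> s * (prim s - prim (s - w))\<bar>)"
   using psi_prim_integrable[of 0] psi_prim_integrable[of w] by (simp add: right_diff_distrib)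
  show "integrable lborel (\<lambda>s. K * (K * w) * indicator {0..M} s)"
   using M by (intro integrable_mult_right integrable_real_indicator) auto
  fix s
  have "\<bar>prim s - prim (s - w)\<bar> <= K * w" using prim_Lipschitz[of s "s - w"] True by simp
  hence "\<bar>\<psi> s\<bar> * \<bar>prim s - prim (s - w)\<bar> <= K * (K * w)" using psi_bound K_nonneg by (intro mult_mono) auto
  thus "\<bar>\<psi> s * (prim s - prim (s - w))\<bar> <= K * (K * w) * indicator {0..M} s"
   using psi_support[of s] by (auto simp: indicator_def abs_mult)
 qed
 also have "... = K * (K * w) * M" using M by simp
 finally show ?thesis using True unfolding energy_density_def by (simp add: abs_mult mult_ac)
next
 case False
 thus ?thesis unfolding energy_density_def using K_nonneg M by (auto simp: indicator_def)
qed

lemma energy_density_measurable [measurable]: "energy_density \<in> borel_measurable borel"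
proof -
 have "(\<lambda>w. (LINT s|lborel. \<psi> s * (prim s - prim (s - w)))) \<in> borel_measurable borel"
  by (rule lborel.borel_measurable_lebesgue_integral) (simp add: split_beta')
 thus ?thesis unfolding energy_density_def by measurable
qed

lemma energy_density_integrable: "integrable lborel energy_density"
proof (rule bounded_interval_integrable[of _ "2 * K * K * M * M" 0 M])
 fix s
 have "2 * K * K * M * \<bar>s\<bar> * indicator {0..M} s <= 2 * K * K * M * M"
  using M K_nonneg by (auto simp: indicator_def intro!: mult_left_mono)
 thus "\<bar>energy_density s\<bar> <= 2 * K * K * M * M" using energy_density_bound[of s] by linarith
qed (auto simp: energy_density_def)

lemma shift_integrable:
 fixes f :: "real => real"
 assumes "integrable lborel f"
 shows "integrable lborel (\<lambda>t. f (t + v))" "(LINT t|lborel. f (t + v)) = (LINT t|lborel. f t)"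
 using lborel_integrable_real_affine[OF assms, of 1 v] lborel_integral_real_affine[of 1 f v] by (auto simp: add.commute)

lemma prim_shift_integrable: "integrable lborel (\<lambda>t. prim t * prim (t + v))"
 by (rule bounded_interval_integrable[of _ "(K * M) * (K * M)" 0 M])
   (use prim_bound K_nonneg M prim_eq_0 in \<open>auto simp: abs_mult not_le intro!: mult_mono\<close>)

lemma energy_integrable: "integrable lborel (\<lambda>t. (prim (t + v) - prim t)^2)"
proof -
 have e: "(\<lambda>t. (prim (t + v) - prim t)^2) = (\<lambda>t. (prim (t + v))^2 + (prim t)^2 - 2 * (prim t * prim (t + v)))"
  by (simp add: power2_diff mult_ac)
 show ?thesis unfolding e
  using shift_integrable(1)[OF prim_square_integrable, of v] prim_square_integrable prim_shift_integrable[of v] by simp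
qed

lemma energy_eq: "energy v = 2 * (LINT t|lborel. (prim t)^2) - 2 * (LINT t|lborel. prim t * prim (t + v))"
proof -
 have "(\<lambda>t. (prim (t + v) - prim t)^2) = (\<lambda>t. (prim (t + v))^2 + (prim t)^2 - 2 * (prim t * prim (t + v)))"
  by (simp add: power2_diff mult_ac)
 thus ?thesis unfolding energy_def
  using shift_integrable[OF prim_square_integrable, of v] prim_square_integrable prim_shift_integrable[of v] by simp
qed

text \<open>A fundamental theorem of calculus obtained from Fubini, since \<psi> is only measurable:
  integrating \<psi> (t + w) over w in [0, v) gives the increment of \<open>prim\<close>, and by
  \<open>energy_eq\<close> the energy is affine in the resulting correlation.\<close>

lemma energy_eq_integral_density:
 assumes "0 <= v"
 shows "energy v = (LINT w|lborel. energy_density w * indicator {..<v} w)"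
proof -
 let ?f = "\<lambda>w t. indicator {0<..<v} w * (\<psi> (t + w) * prim t) :: real"
 have If: "integrable (lborel \<Otimes>\<^sub>M lborel) (\<lambda>(w, t). ?f w t)"
 proof (rule integrable_boundedI[where f="\<lambda>(w, t). K * (K * M) * indicator ({0<..<v} \<times> {0..M}) (w, t)"])
  have "emeasure (lborel \<Otimes>\<^sub>M lborel) ({0<..<v} \<times> {0..M}) < \<infinity>"
   using assms M by (subst lborel.emeasure_pair_measure_Times) (auto simp: ennreal_mult_less_top)
  thus "integrable (lborel \<Otimes>\<^sub>M lborel) (\<lambda>(w, t). K * (K * M) * indicator ({0<..<v} \<times> {0..M}) (w, t))"
   unfolding split_beta' prod.collapse by (intro integrable_mult_right integrable_real_indicator) auto
  show "(\<lambda>(w, t). ?f w t) \<in> borel_measurable (lborel \<Otimes>\<^sub>M lborel)" unfolding split_beta' by measurable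
  show "AE q in lborel \<Otimes>\<^sub>M lborel. norm (case q of (w, t) => ?f w t) <= norm (case q of (w, t) => K * (K * M) * indicator ({0<..<v} \<times> {0..M}) (w, t))"
  proof (rule AE_I2, clarify)
   fix w t
   have "\<bar>\<psi> (t + w)\<bar> * \<bar>prim t\<bar> <= K * (K * M)" using psi_bound prim_bound K_nonneg by (intro mult_mono) auto
   thus "norm (?f w t) <= norm (K * (K * M) * indicator ({0<..<v} \<times> {0..M}) (w, t))"
    using prim_eq_0[of t] K_nonneg M by (cases "t \<in> {0..M}") (auto simp: indicator_def abs_mult)
  qed
 qed
 have A: "(LINT t|lborel. ?f w t) = - (energy_density w * indicator {..<v} w) / 2" for w
  using energy_density_eq[of w] by (auto simp: indicator_def energy_density_def)
 have B: "(LINT w|lborel. ?f w t) = (prim (t + v) - prim t) * prim t" for t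
 proof -
  have "(LINT w|lborel. ?f w t) = (LINT w|lborel. indicator {0..<v} w * \<psi> (t + w)) * prim t"
  proof (subst integral_mult_left_zero[symmetric], rule integral_cong_AE)
   have "AE w in lborel. w \<noteq> (0::real)" by (rule AE_lborel_singleton)
   thus "AE w in lborel. ?f w t = indicator {0..<v} w * \<psi> (t + w) * prim t"
    by eventually_elim (auto simp: indicator_def)
  qed measurable
  also have "(LINT w|lborel. indicator {0..<v} w * \<psi> (t + w)) = (LINT s|lborel. \<psi> s * indicator {t..<t + v} s)"
   by (subst lborel_integral_real_affine[of 1 "\<lambda>s. \<psi> s * indicator {t..<t + v} s" t])
     (auto intro!: lint_cong simp: indicator_def)
  also have "... = prim (t + v) - prim t" using prim_diff[of t "t + v"] assms by simp
  finally show ?thesis .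
 qed
 have "- (LINT w|lborel. energy_density w * indicator {..<v} w) / 2 = (LINT w|lborel. (LINT t|lborel. ?f w t))"
  unfolding A by simp
 also have "... = (LINT t|lborel. (LINT w|lborel. ?f w t))" by (rule lborel_pair.Fubini_integral[OF If, symmetric])
 also have "... = (LINT t|lborel. prim t * prim (t + v) - (prim t)^2)"
  unfolding B by (simp add: algebra_simps power2_eq_square)
 also have "... = - energy v / 2"
  using prim_shift_integrable[of v] prim_square_integrable by (simp add: energy_eq)
 finally show ?thesis by simp
qed

text \<open>A shift by at least M separates the supports, so the correlation term vanishes.\<close>

lemma energy_large:
 assumes "M <= v"
 shows "energy v = 2 * (LINT t|lborel. (prim t)^2)"
proof -
 have z: "prim t * prim (t + v) = 0" for t
  using prim_eq_0[of t] prim_eq_0[of "t + v"] assms by (cases "t <= 0") auto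
 show ?thesis unfolding energy_eq z by simp
qed

lemma energy_nonneg: "0 <= energy v"
 unfolding energy_def by simp

end

section \<open>Mean energy of a pulse at large scales\<close>

locale wavelet_energy = mark_law \<nu> \<alpha> + wavelet_primitive M K \<psi>
 for \<nu> \<alpha> M K \<psi>
begin

lemma energy_moment:
 assumes "0 < x"
 shows "integrable \<nu> (\<lambda>z. \<bar>snd z\<bar>^2 * energy (fst z / x))"
  and "(LINT z|\<nu>. \<bar>snd z\<bar>^2 * energy (fst z / x)) = (LINT w|lborel. energy_density w * mark_tail \<nu> 2 (x * w))"
proof -
 have [measurable]: "energy \<in> borel_measurable borel"
  unfolding energy_def by (rule lborel.borel_measurable_lebesgue_integral) (simp add: split_beta')
 note lc = layer_cake[of 2 x energy_density, OF _ assms energy_density_measurable energy_density_integrable, simplified]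
 have ae: "AE z in \<nu>. \<bar>snd z\<bar>^2 * energy (fst z / x) = \<bar>snd z\<bar>^2 * (LINT w|lborel. energy_density w * indicator {..<fst z / x} w)"
  using duration_pos by eventually_elim (use assms in \<open>simp add: energy_eq_integral_density\<close>)
 have m: "(\<lambda>z. \<bar>snd z\<bar>^2 * energy (fst z / x)) \<in> borel_measurable \<nu>" by measurable
 show "integrable \<nu> (\<lambda>z. \<bar>snd z\<bar>^2 * energy (fst z / x))"
  using integrable_cong_AE[OF m _ ae] lc(1) borel_measurable_integrable[OF lc(1)] by simp
 show "(LINT z|\<nu>. \<bar>snd z\<bar>^2 * energy (fst z / x)) = (LINT w|lborel. energy_density w * mark_tail \<nu> 2 (x * w))"
  using integral_cong_AE[OF m _ ae] lc(2) borel_measurable_integrable[OF lc(1)] by simp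
qed

text \<open>By \<open>energy_moment\<close> the quotient is the integral of
  \<open>energy_density w\<close> times H (x w) / H x, and dominated convergence gives the integral
  against w^(-\<alpha>). The density may change sign, so positivity of the limit needs an argument
  of its own.\<close>

lemma energy_moment_asymptotics:
 obtains C0 where "0 < C0"
  "((\<lambda>x. (LINT z|\<nu>. \<bar>snd z\<bar>^2 * energy (fst z / x)) / mark_tail \<nu> 2 x) \<longlongrightarrow> C0) at_top"
proof -
 define H where "H = mark_tail \<nu> 2"
 have Hr: "regular_tail \<alpha> H" unfolding H_def by (rule tails(2))
 have Hpos: "0 < H x" if "0 <= x" for x using Hr that unfolding regular_tail_def by auto
 have Hmono: "H y <= H x" if "x <= y" for x y using mark_tail_antimono[of 2 x y] that unfolding H_def by simp
 have [measurable]: "H \<in> borel_measurable borel" unfolding H_def by measurable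
 define e where "e = (2 - \<alpha>) / 2"
 have e: "0 < e" "\<alpha> + e < 2" using alpha unfolding e_def by (simp_all add: field_simps)
 obtain C x0 where C: "1 <= x0" "1 <= C"
  and Hb: "\<And>x w. x0 <= x ==> 0 < w ==> w <= 1 ==> H (x * w) <= C * w powr (- \<alpha> - e) * H x"
  using regular_tail_scaled_bound[OF Hr e(1) alpha(1)] by metis
 define D where "D = 2 * K * K * M"
 have D0: "0 <= D" unfolding D_def using K_nonneg M by simp
 define C0 where "C0 = (LINT w|lborel. energy_density w * w powr - \<alpha>)"
 let ?s = "\<lambda>x w. energy_density w * (H (x * w) / H x)"
 have lim: "((\<lambda>x. (LINT w|lborel. ?s x w)) \<longlongrightarrow> C0) at_top"
  unfolding C0_def
 \<comment> \<open>On [0, 1] the majorant comes from \<open>regular_tail_scaled_bound\<close>, on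
   [1, M] from monotonicity of H.\<close>
 proof (rule integral_dominated_convergence_at_top[where w="\<lambda>w. D * C * (w powr (1 - (\<alpha> + e)) * indicator {0..1} w) + D * (w powr 1 * indicator {0..M} w)"])
  show "integrable lborel (\<lambda>w. D * C * (w powr (1 - (\<alpha> + e)) * indicator {0..1} w) + D * (w powr 1 * indicator {0..M} w))"
   using powr_integrable_from_0(1)[of "1 - (\<alpha> + e)" 1] powr_integrable_from_0(1)[of 1 M] e M by simp
  show "AE w in lborel. ((\<lambda>x. ?s x w) \<longlongrightarrow> energy_density w * w powr - \<alpha>) at_top"
  proof (rule AE_I2)
   fix w :: real
   show "((\<lambda>x. ?s x w) \<longlongrightarrow> energy_density w * w powr - \<alpha>) at_top"
   proof (cases "0 < w")
    case True
    hence "((\<lambda>x. H (w * x) / H x) \<longlongrightarrow> w powr - \<alpha>) at_top" using Hr unfolding regular_tail_def by simp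
    thus ?thesis by (intro tendsto_mult tendsto_const) (simp add: mult.commute)
   qed (simp add: energy_density_def)
  qed
  show "\<forall>\<^sub>F x in at_top. AE w in lborel. norm (?s x w) <= D * C * (w powr (1 - (\<alpha> + e)) * indicator {0..1} w) + D * (w powr 1 * indicator {0..M} w)"
   using eventually_ge_at_top[of x0]
  proof eventually_elim
   case (elim x)
   have Hx: "0 < H x" using elim C by (intro Hpos) auto
   show ?case
   proof (rule AE_I2)
    fix w :: real
    show "norm (?s x w) <= D * C * (w powr (1 - (\<alpha> + e)) * indicator {0..1} w) + D * (w powr 1 * indicator {0..M} w)"
    proof (cases "0 < w \<and> w < M")
     case True
     have gd: "\<bar>energy_density w\<bar> <= D * w" using energy_density_bound[of w] True unfolding D_def by simp
     have r0: "0 <= H (x * w) / H x" using Hpos[of "x * w"] Hx True elim C by (simp add: less_imp_le)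
     have n: "norm (?s x w) <= D * w * (H (x * w) / H x)"
      using gd r0 by (simp only: real_norm_def abs_mult abs_of_nonneg[OF r0]) (intro mult_right_mono)
     show ?thesis
     proof (cases "w <= 1")
      case w1: True
      have "H (x * w) / H x <= C * w powr (- \<alpha> - e)" using Hb[OF elim, of w] True w1 Hx by (simp add: field_simps)
      hence "D * w * (H (x * w) / H x) <= D * w * (C * w powr (- \<alpha> - e))" using D0 True by (intro mult_left_mono) auto
      also have "... = D * C * (w powr (1 + (- \<alpha> - e)))" using True by (subst powr_add) simp
      also have "1 + (- \<alpha> - e) = 1 - (\<alpha> + e)" by simp
      finally have f: "norm (?s x w) <= D * C * w powr (1 - (\<alpha> + e)) + D * w"
       using n mult_nonneg_nonneg[OF D0, of w] True by linarith
      have "D * C * (w powr (1 - (\<alpha> + e)) * indicator {0..1} w) + D * (w powr 1 * indicator {0..M} w) =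
        D * C * w powr (1 - (\<alpha> + e)) + D * w"
       using True w1 by (simp add: indicator_def)
      thus ?thesis using f by (simp only:)
     next
      case w1: False
      have "H (x * w) <= H x" using w1 elim C by (intro Hmono) (auto simp: mult_le_cancel_left1)
      hence "H (x * w) / H x <= 1" using Hx by simp
      hence "D * w * (H (x * w) / H x) <= D * w * 1" using D0 True by (intro mult_left_mono) auto
      thus ?thesis using n True w1 by (simp add: indicator_def)
     qed
    next
     case False
     thus ?thesis using D0 C by (auto simp: energy_density_def indicator_def)
    qed
   qed
  qed
 qed measurable
 have eq: "(LINT z|\<nu>. \<bar>snd z\<bar>^2 * energy (fst z / x)) / H x = (LINT w|lborel. ?s x w)" if "0 < x" for x
  using energy_moment(2)[OF that] unfolding H_def by simp
 have lim': "((\<lambda>x. (LINT z|\<nu>. \<bar>snd z\<bar>^2 * energy (fst z / x)) / H x) \<longlongrightarrow> C0) at_top"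
  by (rule Lim_transform_eventually[OF lim], rule eventually_mono[OF eventually_gt_at_top[of 0]], erule eq[symmetric])
 define E where "E = 2 * (LINT t|lborel. (prim t)^2)"
 have E0: "0 < E" unfolding E_def using prim_square_pos by simp
 \<comment> \<open>Pulses longer than M x all have the same positive energy E; keeping only these
   bounds the quotient from below by E H (M x) / H x.\<close>
 have "E * M powr - \<alpha> <= C0"
 proof (rule tendsto_le[OF _ lim'])
  show "((\<lambda>x. E * (H (M * x) / H x)) \<longlongrightarrow> E * M powr - \<alpha>) at_top"
   using Hr M unfolding regular_tail_def by (intro tendsto_mult tendsto_const) auto
  show "\<forall>\<^sub>F x in at_top. E * (H (M * x) / H x) <= (LINT z|\<nu>. \<bar>snd z\<bar>^2 * energy (fst z / x)) / H x"
   using eventually_gt_at_top[of 0]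
  proof eventually_elim
   case (elim x)
   have Hx: "0 < H x" using elim by (intro Hpos) auto
   have "E * H (M * x) = (LINT z|\<nu>. E * (\<bar>snd z\<bar>^2 * indicator {M * x<..} (fst z)))" unfolding H_def mark_tail_def by simp
   also have "... <= (LINT z|\<nu>. \<bar>snd z\<bar>^2 * energy (fst z / x))"
   proof (rule integral_mono)
    show "integrable \<nu> (\<lambda>z. E * (\<bar>snd z\<bar>^2 * indicator {M * x<..} (fst z)))"
     using mark_tail_integrable[of 2] by (intro integrable_mult_right) simp
    fix z :: "real \<times> real"
    show "E * (\<bar>snd z\<bar>^2 * indicator {M * x<..} (fst z)) <= \<bar>snd z\<bar>^2 * energy (fst z / x)"
    proof (cases "M * x < fst z")
     case True
     hence "energy (fst z / x) = E" unfolding E_def using elim by (intro energy_large) (simp add: field_simps)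
     thus ?thesis using True by simp
    qed (simp add: energy_nonneg)
   qed (rule energy_moment(1)[OF elim])
   finally show ?case using Hx by (simp add: field_simps)
  qed
 qed simp
 moreover have "0 < E * M powr - \<alpha>" using E0 M by simp
 ultimately show ?thesis using that[of C0] lim' unfolding H_def by simp
qed

end

section \<open>Quadratic forms in independent variables\<close>

lemma sum_fourth_power_le:
 fixes a b :: real
 shows "(a + b) ^ 4 <= 8 * (a ^ 4 + b ^ 4)"
proof -
 have "(a + b)^2 <= 2 * (a^2 + b^2)" using sum_squares_bound[of a b] by (simp add: power2_sum)
 hence "((a + b)^2)^2 <= (2 * (a^2 + b^2))^2" by (intro power_mono) auto
 also have "... = 4 * (a^2 + b^2)^2" by (subst power_mult_distrib) simp
 also have "(a^2 + b^2)^2 <= 2 * ((a^2)^2 + (b^2)^2)" using sum_squares_bound[of "a^2" "b^2"] by (simp add: power2_sum)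
 finally show ?thesis by simp
qed

lemma abs_product4_le:
 fixes a b c d :: real
 shows "\<bar>a * b * c * d\<bar> <= a ^ 4 + b ^ 4 + c ^ 4 + d ^ 4"
proof -
 have 1: "\<bar>x * y\<bar> <= x^2 + y^2" for x y :: real
 proof -
  have "2 * \<bar>x * y\<bar> <= x^2 + y^2"
   using sum_squares_bound[of "\<bar>x\<bar>" "\<bar>y\<bar>"] by (simp add: abs_mult)
  thus ?thesis using zero_le_power2[of x] zero_le_power2[of y] by linarith
 qed
 have "\<bar>(a * b) * (c * d)\<bar> <= (a * b)^2 + (c * d)^2" by (rule 1)
 also have "... = \<bar>a^2 * b^2\<bar> + \<bar>c^2 * d^2\<bar>" by (simp add: power_mult_distrib)
 also have "... <= ((a^2)^2 + (b^2)^2) + ((c^2)^2 + (d^2)^2)" by (intro add_mono 1)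
 finally show ?thesis by (simp add: mult.assoc)
qed

text \<open>Membership in L^4. On a probability space, products of up to four such functions are
  integrable by \<open>abs_product4_le\<close>, which covers every term in the expansion of a
  squared quadratic form.\<close>

definition fourth_integrable :: "'a measure => ('a => real) => bool" where
 "fourth_integrable M f \<longleftrightarrow> f \<in> borel_measurable M \<and> integrable M (\<lambda>x. f x ^ 4)"

lemma fourth_integrable_add:
 assumes "fourth_integrable M f" "fourth_integrable M g"
 shows "fourth_integrable M (\<lambda>x. f x + g x)"
proof -
 have [measurable]: "f \<in> borel_measurable M" "g \<in> borel_measurable M"
  using assms unfolding fourth_integrable_def by auto
 have "integrable M (\<lambda>x. (f x + g x) ^ 4)"
  by (rule integrable_boundedI[where f="\<lambda>x. 8 * (f x ^ 4 + g x ^ 4)"])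
    (use assms in \<open>auto simp: fourth_integrable_def intro!: sum_fourth_power_le order_trans[OF sum_fourth_power_le] abs_ge_self\<close>)
 thus ?thesis unfolding fourth_integrable_def by simp
qed

context prob_space begin

lemma fourth_integrable_const: "fourth_integrable M (\<lambda>x. c)"
 unfolding fourth_integrable_def by simp

lemma fourth_integrable_product4:
 assumes "fourth_integrable M f" "fourth_integrable M g" "fourth_integrable M h" "fourth_integrable M k"
 shows "integrable M (\<lambda>x. f x * g x * h x * k x)"
proof (rule integrable_boundedI[where f="\<lambda>x. f x ^ 4 + g x ^ 4 + h x ^ 4 + k x ^ 4"])
 show "AE x in M. norm (f x * g x * h x * k x) <= norm (f x ^ 4 + g x ^ 4 + h x ^ 4 + k x ^ 4)"
  using abs_product4_le by (auto intro!: order_trans[OF _ abs_ge_self])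
qed (use assms in \<open>auto simp: fourth_integrable_def\<close>)

lemma fourth_integrable_product3:
 assumes "fourth_integrable M f" "fourth_integrable M g" "fourth_integrable M h"
 shows "integrable M (\<lambda>x. f x * g x * h x)"
 using fourth_integrable_product4[OF assms fourth_integrable_const[of 1]] by simp

lemma fourth_integrable_product2:
 assumes "fourth_integrable M f" "fourth_integrable M g"
 shows "integrable M (\<lambda>x. f x * g x)"
 using fourth_integrable_product3[OF assms fourth_integrable_const[of 1]] by simp

lemma fourth_integrable_integrable:
 assumes "fourth_integrable M f"
 shows "integrable M f"
 using fourth_integrable_product2[OF assms fourth_integrable_const[of 1]] by simp

lemma fourth_integrable_energy:
 assumes F: "\<And>k. k \<in> K ==> fourth_integrable M (F k)"
 shows "integrable M (\<lambda>x. ((\<Sum>k\<in>K. (F k x)^2) - c)^2)"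
  and "k \<in> K ==> integrable M (\<lambda>x. ((\<Sum>k\<in>K. (F k x)^2) - c) * F k x)"
proof -
 have "integrable M (\<lambda>x. (\<Sum>k\<in>K. \<Sum>l\<in>K. F k x * F k x * F l x * F l x) - 2 * c * (\<Sum>k\<in>K. F k x * F k x) + c * c)"
  by (intro integrable_addI integrable_diffI integrable_sumI fourth_integrable_product4
    fourth_integrable_product2 F integrable_mult_right) auto
 thus "integrable M (\<lambda>x. ((\<Sum>k\<in>K. (F k x)^2) - c)^2)"
  by (simp add: power2_eq_square algebra_simps sum_product sum_distrib_left)
 show "integrable M (\<lambda>x. ((\<Sum>k\<in>K. (F k x)^2) - c) * F k x)" if "k \<in> K"
 proof -
  have "integrable M (\<lambda>x. (\<Sum>l\<in>K. F l x * F l x * F k x) - c * F k x)"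
   by (intro integrable_diffI integrable_sumI fourth_integrable_product3 F that
     integrable_mult_right fourth_integrable_integrable)
  thus ?thesis by (simp add: power2_eq_square algebra_simps sum_distrib_left)
 qed
qed

lemma indep_product:
 fixes f :: "'b => real" and h :: "'b => real"
 assumes ind: "indep_var N1 X N2 Y" and [measurable]: "f \<in> borel_measurable N1" "h \<in> borel_measurable N2"
  and int: "integrable M (\<lambda>w. f (X w))" "integrable M (\<lambda>w. h (Y w))"
 shows "integrable M (\<lambda>w. f (X w) * h (Y w))"
  and "expectation (\<lambda>w. f (X w) * h (Y w)) = expectation (\<lambda>w. f (X w)) * expectation (\<lambda>w. h (Y w))"
proof -
 have "indep_var borel (f \<circ> X) borel (h \<circ> Y)"
  by (rule indep_var_compose[OF ind]) auto
 from indep_var_integrable[OF this] indep_var_lebesgue_integral[OF this] int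
 show "integrable M (\<lambda>w. f (X w) * h (Y w))"
  "expectation (\<lambda>w. f (X w) * h (Y w)) = expectation (\<lambda>w. f (X w)) * expectation (\<lambda>w. h (Y w))"
  by (simp_all add: comp_def)
qed

text \<open>The deviation is A + C + 2 B with A depending on X, C on Y, and B bilinear. A and C are
  centred and independent; A B and B C have mean 0 because each summand of B carries a centred
  factor from the other side. Besides the two variances only the second moment of B survives, as a
  sum of products of covariances.\<close>

lemma quadratic_variance_step:
 fixes f :: "'k => 'b => real" and h :: "'k => 'b => real"
 assumes ind: "indep_var N1 X N2 Y" and K: "finite K"
  and f: "\<And>k. k \<in> K ==> f k \<in> borel_measurable N1" "\<And>k. k \<in> K ==> fourth_integrable M (\<lambda>w. f k (X w))"
  and h: "\<And>k. k \<in> K ==> h k \<in> borel_measurable N2" "\<And>k. k \<in> K ==> fourth_integrable M (\<lambda>w. h k (Y w))"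
  and f0: "\<And>k. k \<in> K ==> expectation (\<lambda>w. f k (X w)) = 0"
  and h0: "\<And>k. k \<in> K ==> expectation (\<lambda>w. h k (Y w)) = 0"
  and a: "a = expectation (\<lambda>w. \<Sum>k\<in>K. (f k (X w))^2)" and c: "c = expectation (\<lambda>w. \<Sum>k\<in>K. (h k (Y w))^2)"
 shows "expectation (\<lambda>w. ((\<Sum>k\<in>K. (f k (X w) + h k (Y w))^2) - (a + c))^2) =
  expectation (\<lambda>w. ((\<Sum>k\<in>K. (f k (X w))^2) - a)^2) + expectation (\<lambda>w. ((\<Sum>k\<in>K. (h k (Y w))^2) - c)^2)
  + 4 * (\<Sum>k\<in>K. \<Sum>l\<in>K. expectation (\<lambda>w. f k (X w) * f l (X w)) * expectation (\<lambda>w. h k (Y w) * h l (Y w)))"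
proof -
 define A where "A x = (\<Sum>k\<in>K. (f k x)^2) - a" for x
 define C where "C y = (\<Sum>k\<in>K. (h k y)^2) - c" for y
 define B where "B w = (\<Sum>k\<in>K. f k (X w) * h k (Y w))" for w
 have [measurable]: "A \<in> borel_measurable N1" "C \<in> borel_measurable N2"
  unfolding A_def C_def
  by (auto intro!: borel_measurable_diff borel_measurable_sum borel_measurable_power f(1) h(1))
 have f2: "integrable M (\<lambda>w. (f k (X w))^2)" if "k \<in> K" for k
  unfolding power2_eq_square by (intro fourth_integrable_product2 f that)
 have h2: "integrable M (\<lambda>w. (h k (Y w))^2)" if "k \<in> K" for k
  unfolding power2_eq_square by (intro fourth_integrable_product2 h that)
 have intA: "integrable M (\<lambda>w. A (X w))" unfolding A_def using f2 by auto
 have intC: "integrable M (\<lambda>w. C (Y w))" unfolding C_def using h2 by auto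
 have EA: "expectation (\<lambda>w. A (X w)) = 0"
  unfolding A_def using f2 by (subst lint_diff) (auto simp: a prob_space)
 have EC: "expectation (\<lambda>w. C (Y w)) = 0"
  unfolding C_def using h2 by (subst lint_diff) (auto simp: c prob_space)
 have AA: "integrable M (\<lambda>w. (A (X w))^2)" and CC: "integrable M (\<lambda>w. (C (Y w))^2)"
  unfolding A_def C_def by (intro fourth_integrable_energy(1) f h; assumption)+
 note AC = indep_product[OF ind _ _ intA intC]
 have Af: "integrable M (\<lambda>w. A (X w) * f k (X w))" and Ch: "integrable M (\<lambda>w. C (Y w) * h k (Y w))" if "k \<in> K" for k
  using fourth_integrable_energy(2)[of K "\<lambda>k w. f k (X w)" k a] fourth_integrable_energy(2)[of K "\<lambda>k w. h k (Y w)" k c]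
   that f h unfolding A_def C_def by auto
 have AB1: "integrable M (\<lambda>w. (A (X w) * f k (X w)) * h k (Y w))"
   "expectation (\<lambda>w. (A (X w) * f k (X w)) * h k (Y w)) = 0" if "k \<in> K" for k
  using indep_product[OF ind, of "\<lambda>x. A x * f k x" "h k"] that f h Af h0 fourth_integrable_integrable by auto
 have BC1: "integrable M (\<lambda>w. f k (X w) * (C (Y w) * h k (Y w)))"
   "expectation (\<lambda>w. f k (X w) * (C (Y w) * h k (Y w))) = 0" if "k \<in> K" for k
  using indep_product[OF ind, of "f k" "\<lambda>x. C x * h k x"] that f h Ch f0 fourth_integrable_integrable by auto
 have BB1: "integrable M (\<lambda>w. (f k (X w) * f l (X w)) * (h k (Y w) * h l (Y w)))"
   "expectation (\<lambda>w. (f k (X w) * f l (X w)) * (h k (Y w) * h l (Y w))) =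
    expectation (\<lambda>w. f k (X w) * f l (X w)) * expectation (\<lambda>w. h k (Y w) * h l (Y w))"
  if "k \<in> K" "l \<in> K" for k l
  using indep_product[OF ind, of "\<lambda>x. f k x * f l x" "\<lambda>x. h k x * h l x"] that f h fourth_integrable_product2 by auto
 have AB_eq: "(\<lambda>w. A (X w) * B w) = (\<lambda>w. \<Sum>k\<in>K. (A (X w) * f k (X w)) * h k (Y w))"
  unfolding B_def by (simp add: sum_distrib_left mult_ac)
 have BC_eq: "(\<lambda>w. B w * C (Y w)) = (\<lambda>w. \<Sum>k\<in>K. f k (X w) * (C (Y w) * h k (Y w)))"
  unfolding B_def by (simp add: sum_distrib_right sum_distrib_left mult_ac)
 have BB_eq: "(\<lambda>w. (B w)^2) = (\<lambda>w. \<Sum>k\<in>K. \<Sum>l\<in>K. (f k (X w) * f l (X w)) * (h k (Y w) * h l (Y w)))"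
  unfolding B_def power2_eq_square by (simp add: sum_product mult_ac)
 have AB: "integrable M (\<lambda>w. A (X w) * B w)" "expectation (\<lambda>w. A (X w) * B w) = 0"
  unfolding AB_eq using AB1 by auto
 have BC: "integrable M (\<lambda>w. B w * C (Y w))" "expectation (\<lambda>w. B w * C (Y w)) = 0"
  unfolding BC_eq using BC1 by auto
 have BB: "integrable M (\<lambda>w. (B w)^2)" "expectation (\<lambda>w. (B w)^2) =
   (\<Sum>k\<in>K. \<Sum>l\<in>K. expectation (\<lambda>w. f k (X w) * f l (X w)) * expectation (\<lambda>w. h k (Y w) * h l (Y w)))"
  unfolding BB_eq using BB1 by auto
 have eq: "(\<lambda>w. ((\<Sum>k\<in>K. (f k (X w) + h k (Y w))^2) - (a + c))^2) =
  (\<lambda>w. (A (X w))^2 + (C (Y w))^2 + 4 * (B w)^2 + 2 * (A (X w) * C (Y w)) + 4 * (A (X w) * B w) + 4 * (B w * C (Y w)))"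
 proof
  fix w
  have e: "(\<Sum>k\<in>K. (f k (X w) + h k (Y w))^2) - (a + c) = A (X w) + C (Y w) + 2 * B w"
   unfolding A_def B_def C_def by (simp add: power2_sum sum.distrib sum_distrib_left mult_ac)
  show "((\<Sum>k\<in>K. (f k (X w) + h k (Y w))^2) - (a + c))^2 =
   (A (X w))^2 + (C (Y w))^2 + 4 * (B w)^2 + 2 * (A (X w) * C (Y w)) + 4 * (A (X w) * B w) + 4 * (B w * C (Y w))"
   unfolding e by algebra
 qed
 have "expectation (\<lambda>w. ((\<Sum>k\<in>K. (f k (X w) + h k (Y w))^2) - (a + c))^2) = expectation (\<lambda>w. (A (X w))^2) + expectation (\<lambda>w. (C (Y w))^2) + 4 * expectation (\<lambda>w. (B w)^2)"
  unfolding eq using AA CC BB(1) AC AB BC EA by simp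
 thus ?thesis by (simp only: BB(2) A_def C_def)
qed

text \<open>Induction on m, adding one variable at a time by \<open>quadratic_variance_step\<close>.
  The covariances of the partial sums are m times those of one variable, so a step adds at most v +
  4 m w, and the total is at most m v + 2 m^2 w. The remaining conclusions are carried along because
  the induction step needs them.\<close>

lemma quadratic_variance_bound:
 fixes Z :: "nat => 'a => 'b" and g :: "'k => 'b => real"
 assumes ind: "indep_vars (\<lambda>_. N) Z {..<n}" and law: "\<And>i. i < n ==> distr M N (Z i) = Q" and K: "finite K"
  and g: "\<And>k. k \<in> K ==> g k \<in> borel_measurable N" "\<And>k. k \<in> K ==> integrable Q (\<lambda>z. g k z ^ 4)"
  and g0: "\<And>k. k \<in> K ==> (LINT z|Q. g k z) = 0"
  and G2: "integrable Q (\<lambda>z. (\<Sum>k\<in>K. (g k z)^2)^2)"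
  and mn: "m <= n"
 shows "expectation (\<lambda>y. ((\<Sum>k\<in>K. (\<Sum>i<m. g k (Z i y))^2) - m * (\<Sum>k\<in>K. (LINT z|Q. (g k z)^2)))^2)
  <= m * (LINT z|Q. (\<Sum>k\<in>K. (g k z)^2)^2) + 2 * (real m)^2 * (\<Sum>k\<in>K. \<Sum>l\<in>K. (LINT z|Q. g k z * g l z)^2)"
  and "\<And>k. k \<in> K ==> fourth_integrable M (\<lambda>y. \<Sum>i<m. g k (Z i y))"
  and "\<And>k. k \<in> K ==> expectation (\<lambda>y. \<Sum>i<m. g k (Z i y)) = 0"
  and "\<And>k l. k \<in> K ==> l \<in> K ==> expectation (\<lambda>y. (\<Sum>i<m. g k (Z i y)) * (\<Sum>i<m. g l (Z i y))) = m * (LINT z|Q. g k z * g l z)"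
proof -
 have rv: "Z i \<in> measurable M N" if "i < n" for i using ind that unfolding indep_vars_def by auto
 have tr: "expectation (\<lambda>y. f (Z i y)) = (LINT z|Q. f z)" if "i < n" "f \<in> borel_measurable N" for i and f :: "'b => real"
  using integral_distr[OF rv[OF that(1)] that(2)] law[OF that(1)] by simp
 have tri: "integrable M (\<lambda>y. f (Z i y)) \<longleftrightarrow> integrable Q f" if "i < n" "f \<in> borel_measurable N" for i and f :: "'b => real"
  using integrable_distr_eq[OF rv[OF that(1)] that(2)] law[OF that(1)] by simp
 define c where "c k l = (LINT z|Q. g k z * g l z)" for k l
 have gg: "(LINT z|Q. (g k z)^2) = c k k" for k by (simp add: c_def power2_eq_square)
 define S where "S = (\<Sum>k\<in>K. c k k)"
 define v where "v = (LINT z|Q. (\<Sum>k\<in>K. (g k z)^2)^2)"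
 define w where "w = (\<Sum>k\<in>K. \<Sum>l\<in>K. (c k l)^2)"
 have w0: "0 <= w" unfolding w_def by (intro sum_nonneg) auto
 have L4: "fourth_integrable M (\<lambda>y. g k (Z i y))" if "i < n" "k \<in> K" for i k
 proof -
  have "integrable M (\<lambda>y. (g k (Z i y)) ^ 4)"
   by (subst tri[OF that(1), of "\<lambda>z. g k z ^ 4"]) (use g that in auto)
  thus ?thesis unfolding fourth_integrable_def using g(1)[OF that(2)] rv[OF that(1)] by (auto intro: measurable_compose)
 qed
 have main: "expectation (\<lambda>y. ((\<Sum>k\<in>K. (\<Sum>i<m. g k (Z i y))^2) - m * S)^2) <= m * v + 2 * (real m)^2 * w \<and>
  (\<forall>k\<in>K. fourth_integrable M (\<lambda>y. \<Sum>i<m. g k (Z i y))) \<and> (\<forall>k\<in>K. expectation (\<lambda>y. \<Sum>i<m. g k (Z i y)) = 0) \<and>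
  (\<forall>k\<in>K. \<forall>l\<in>K. expectation (\<lambda>y. (\<Sum>i<m. g k (Z i y)) * (\<Sum>i<m. g l (Z i y))) = m * c k l)"
  using mn
 proof (induction m)
  case 0
  show ?case using fourth_integrable_const[of 0] by simp
 next
  case (Suc m)
  hence m: "m < n" and IH: "expectation (\<lambda>y. ((\<Sum>k\<in>K. (\<Sum>i<m. g k (Z i y))^2) - m * S)^2) <= m * v + 2 * (real m)^2 * w"
   "\<And>k. k\<in>K ==> fourth_integrable M (\<lambda>y. \<Sum>i<m. g k (Z i y))" "\<And>k. k\<in>K ==> expectation (\<lambda>y. \<Sum>i<m. g k (Z i y)) = 0"
   "\<And>k l. k\<in>K ==> l \<in> K ==> expectation (\<lambda>y. (\<Sum>i<m. g k (Z i y)) * (\<Sum>i<m. g l (Z i y))) = m * c k l"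
   by auto
  define X where "X y = restrict (\<lambda>i. Z i y) {..<m}" for y
  define Y where "Y y = restrict (\<lambda>i. Z i y) {m}" for y
  define f where "f k x = (\<Sum>i<m. g k (x i))" for k and x :: "nat => 'b"
  define h where "h k x = g k (x m)" for k and x :: "nat => 'b"
  have XY: "indep_var (PiM {..<m} (\<lambda>_. N)) X (PiM {m} (\<lambda>_. N)) Y"
   unfolding X_def Y_def by (rule indep_var_restrict[OF ind]) (use m in auto)
  have fX: "f k (X y) = (\<Sum>i<m. g k (Z i y))" for k y unfolding f_def X_def by simp
  have hY: "h k (Y y) = g k (Z m y)" for k y unfolding h_def Y_def by simp
  have fm: "f k \<in> borel_measurable (PiM {..<m} (\<lambda>_. N))" if "k \<in> K" for k
   unfolding f_def using g(1)[OF that] by (intro borel_measurable_sum) (auto intro: measurable_compose[OF measurable_component_singleton])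
  have hm: "h k \<in> borel_measurable (PiM {m} (\<lambda>_. N))" if "k \<in> K" for k
   unfolding h_def using g(1)[OF that] by (auto intro: measurable_compose[OF measurable_component_singleton])
  have f4: "fourth_integrable M (\<lambda>y. f k (X y))" if "k \<in> K" for k unfolding fX by (rule IH(2)[OF that])
  have h4: "fourth_integrable M (\<lambda>y. h k (Y y))" if "k \<in> K" for k unfolding hY by (rule L4[OF m that])
  have Eh: "expectation (\<lambda>y. h k (Y y)) = 0" if "k \<in> K" for k
   unfolding hY using tr[OF m g(1)[OF that]] g0[OF that] by simp
  have Ehh: "expectation (\<lambda>y. h k (Y y) * h l (Y y)) = c k l" if "k \<in> K" "l \<in> K" for k l
   unfolding hY c_def using tr[OF m, of "\<lambda>z. g k z * g l z"] g(1) that by simp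
  have Eff: "expectation (\<lambda>y. f k (X y) * f l (X y)) = m * c k l" if "k \<in> K" "l \<in> K" for k l
   unfolding fX using IH(4) that by simp
  have Ef: "expectation (\<lambda>y. f k (X y)) = 0" if "k \<in> K" for k unfolding fX by (rule IH(3)[OF that])
  have suc: "(\<Sum>i<Suc m. g k (Z i y)) = f k (X y) + h k (Y y)" for k y unfolding fX hY by simp
  have a: "real m * S = expectation (\<lambda>y. \<Sum>k\<in>K. (f k (X y))^2)"
   unfolding S_def power2_eq_square using f4
   by (subst lint_sum) (auto simp: Eff sum_distrib_left intro: fourth_integrable_product2)
  have cc: "S = expectation (\<lambda>y. \<Sum>k\<in>K. (h k (Y y))^2)"
   unfolding S_def power2_eq_square using h4
   by (subst lint_sum) (auto simp: Ehh intro: fourth_integrable_product2)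
  have step: "expectation (\<lambda>y. ((\<Sum>k\<in>K. (f k (X y) + h k (Y y))^2) - (real m * S + S))^2) =
   expectation (\<lambda>y. ((\<Sum>k\<in>K. (f k (X y))^2) - real m * S)^2) + expectation (\<lambda>y. ((\<Sum>k\<in>K. (h k (Y y))^2) - S)^2)
   + 4 * (\<Sum>k\<in>K. \<Sum>l\<in>K. expectation (\<lambda>y. f k (X y) * f l (X y)) * expectation (\<lambda>y. h k (Y y) * h l (Y y)))"
   by (rule quadratic_variance_step[OF XY K]) (fact fm f4 hm h4 Ef Eh a cc)+
  have t3: "(\<Sum>k\<in>K. \<Sum>l\<in>K. expectation (\<lambda>y. f k (X y) * f l (X y)) * expectation (\<lambda>y. h k (Y y) * h l (Y y))) = m * w"
   unfolding w_def by (simp add: Eff Ehh sum_distrib_left power2_eq_square mult_ac)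
  have t2: "expectation (\<lambda>y. ((\<Sum>k\<in>K. (h k (Y y))^2) - S)^2) <= v"
  proof -
   let ?C = "\<lambda>y. \<Sum>k\<in>K. (h k (Y y))^2"
   have mC: "(\<lambda>z. (\<Sum>k\<in>K. (g k z)^2)^2) \<in> borel_measurable N" using g(1) by auto
   have i1: "integrable M (\<lambda>y. (?C y)^2)" unfolding hY by (subst tri[OF m mC]) (rule G2)
   have i2: "integrable M ?C"
    unfolding power2_eq_square by (intro integrable_sumI fourth_integrable_product2 h4)
   have "(\<lambda>y. (?C y - S)^2) = (\<lambda>y. (?C y)^2 - 2 * S * ?C y + S^2)" by (rule ext) (simp add: power2_diff)
   hence "expectation (\<lambda>y. (?C y - S)^2) = expectation (\<lambda>y. (?C y)^2) - 2 * S * expectation ?C + S^2"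
    using i1 i2 by (simp add: prob_space)
   also have "... <= expectation (\<lambda>y. (?C y)^2)" unfolding cc[symmetric] by (simp add: power2_eq_square)
   also have "... = v" unfolding hY v_def by (rule tr[OF m mC])
   finally show ?thesis .
  qed
  have "expectation (\<lambda>y. ((\<Sum>k\<in>K. (\<Sum>i<Suc m. g k (Z i y))^2) - real (Suc m) * S)^2)
   <= real (Suc m) * v + 2 * (real (Suc m))^2 * w"
  proof -
   have "expectation (\<lambda>y. ((\<Sum>k\<in>K. (\<Sum>i<Suc m. g k (Z i y))^2) - real (Suc m) * S)^2)
    <= (m * v + 2 * (real m)^2 * w) + v + 4 * (m * w)"
    unfolding suc using step t2 t3 IH(1) unfolding fX by (simp add: algebra_simps)
   \<comment> \<open>Uses 2 m^2 + 4 m <= 2 (m + 1)^2.\<close>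
   also have "... <= real (Suc m) * v + 2 * (real (Suc m))^2 * w"
    using w0 by (simp add: algebra_simps power2_eq_square)
   finally show ?thesis .
  qed
  moreover have "fourth_integrable M (\<lambda>y. \<Sum>i<Suc m. g k (Z i y))" if "k \<in> K" for k
   unfolding suc by (intro fourth_integrable_add f4 h4 that)
  moreover have "expectation (\<lambda>y. \<Sum>i<Suc m. g k (Z i y)) = 0" if "k \<in> K" for k
   unfolding suc using Ef[OF that] Eh[OF that] fourth_integrable_integrable f4[OF that] h4[OF that] by simp
  moreover have "expectation (\<lambda>y. (\<Sum>i<Suc m. g k (Z i y)) * (\<Sum>i<Suc m. g l (Z i y))) = real (Suc m) * c k l"
   if kl: "k \<in> K" "l \<in> K" for k l
  proof -
   have x1: "integrable M (\<lambda>y. f k (X y) * h l (Y y))" "expectation (\<lambda>y. f k (X y) * h l (Y y)) = 0" if "k \<in> K" "l \<in> K" for k l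
    using indep_product[OF XY fm[OF that(1)] hm[OF that(2)]] f4 h4 that Ef fourth_integrable_integrable by auto
   have x2: "integrable M (\<lambda>y. f k (X y) * f l (X y))" "integrable M (\<lambda>y. h k (Y y) * h l (Y y))"
    using f4 h4 kl by (auto intro: fourth_integrable_product2)
   have "(\<lambda>y. (\<Sum>i<Suc m. g k (Z i y)) * (\<Sum>i<Suc m. g l (Z i y))) =
     (\<lambda>y. f k (X y) * f l (X y) + h k (Y y) * h l (Y y) + f k (X y) * h l (Y y) + f l (X y) * h k (Y y))"
    unfolding suc by (simp add: algebra_simps)
   thus ?thesis using x1[OF kl] x1[OF kl(2,1)] x2 Eff[OF kl] Ehh[OF kl] by (simp add: algebra_simps)
  qed
  ultimately show ?case by blast
 qed
 show "expectation (\<lambda>y. ((\<Sum>k\<in>K. (\<Sum>i<m. g k (Z i y))^2) - m * (\<Sum>k\<in>K. (LINT z|Q. (g k z)^2)))^2)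
  <= m * (LINT z|Q. (\<Sum>k\<in>K. (g k z)^2)^2) + 2 * (real m)^2 * (\<Sum>k\<in>K. \<Sum>l\<in>K. (LINT z|Q. g k z * g l z)^2)"
  using main unfolding S_def v_def w_def gg unfolding c_def by simp
 show "\<And>k. k \<in> K ==> fourth_integrable M (\<lambda>y. \<Sum>i<m. g k (Z i y))" using main by blast
 show "\<And>k. k \<in> K ==> expectation (\<lambda>y. \<Sum>i<m. g k (Z i y)) = 0" using main by blast
 show "\<And>k l. k \<in> K ==> l \<in> K ==> expectation (\<lambda>y. (\<Sum>i<m. g k (Z i y)) * (\<Sum>i<m. g l (Z i y))) = m * (LINT z|Q. g k z * g l z)"
  using main unfolding c_def by blast
qed

text \<open>Nonnegativity of the variance of |X|; integrability comes from 2 |X| <= 1 + X^2.\<close>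

lemma expectation_abs_le_sqrt:
 fixes X :: "'a => real"
 assumes [measurable]: "X \<in> borel_measurable M" and i2: "integrable M (\<lambda>w. (X w)^2)"
 shows "integrable M X" "expectation (\<lambda>w. \<bar>X w\<bar>) <= sqrt (expectation (\<lambda>w. (X w)^2))"
proof -
 show i1: "integrable M X"
 proof (rule integrable_boundedI[where f="\<lambda>w. 1 + (X w)^2"])
  show "AE w in M. norm (X w) <= norm (1 + (X w)^2)"
  proof (rule AE_I2)
   fix w
   have "0 <= (\<bar>X w\<bar> - 1)^2" by simp
   hence "2 * \<bar>X w\<bar> <= 1 + (X w)^2" by (simp add: power2_diff)
   thus "norm (X w) <= norm (1 + (X w)^2)" by simp
  qed
 qed (use i2 in auto)
 have "0 <= variance (\<lambda>w. \<bar>X w\<bar>)" by (rule variance_positive)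
 also have "... = expectation (\<lambda>w. \<bar>X w\<bar>^2) - (expectation (\<lambda>w. \<bar>X w\<bar>))^2"
  using i1 i2 by (intro variance_eq) auto
 finally have "(expectation (\<lambda>w. \<bar>X w\<bar>))^2 <= expectation (\<lambda>w. (X w)^2)" by simp
 thus "expectation (\<lambda>w. \<bar>X w\<bar>) <= sqrt (expectation (\<lambda>w. (X w)^2))" by (rule real_le_rsqrt)
qed

lemma square_expectation_le:
 fixes X :: "'a => real"
 assumes "X \<in> borel_measurable M" "integrable M (\<lambda>w. (X w)^2)"
 shows "(expectation X)^2 <= expectation (\<lambda>w. (X w)^2)"
proof -
 have "0 <= variance X" by (rule variance_positive)
 also have "... = expectation (\<lambda>w. (X w)^2) - (expectation X)^2"
  using expectation_abs_le_sqrt(1)[OF assms] assms by (intro variance_eq) auto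
 finally show ?thesis by simp
qed

end

section \<open>Quadratic forms with a summable envelope\<close>

lemma sum_squares_le_square_sum:
 fixes a :: "'k => real"
 assumes "\<And>k. k \<in> K ==> 0 <= a k"
 shows "(\<Sum>k\<in>K. (a k)^2) <= (\<Sum>k\<in>K. a k)^2"
proof (cases "finite K")
 case True
 have "(\<Sum>k\<in>K. (a k)^2) <= (\<Sum>k\<in>K. a k * (\<Sum>l\<in>K. a l))"
 proof (rule sum_mono)
  fix k assume k: "k \<in> K"
  have "a k <= (\<Sum>l\<in>K. a l)" using True k assms by (intro member_le_sum) auto
  thus "(a k)^2 <= a k * (\<Sum>l\<in>K. a l)" unfolding power2_eq_square using assms k by (intro mult_left_mono) auto
 qed
 thus ?thesis by (simp add: power2_eq_square sum_distrib_right)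
qed simp

text \<open>One source is seen by few coefficients of a scale, which is expressed by an envelope B
  of the l^1 norm over k. All ingredients of \<open>quadratic_variance_bound\<close> then follow
  from moments of B and from a bound \<kappa> on the single second moments.\<close>

lemma (in prob_space) dominated_covariance_bound:
 fixes f :: "'k => 'a => real"
 assumes K: "finite K" and "\<forall>k\<in>K. f k \<in> borel_measurable M"
  and B[measurable]: "B \<in> borel_measurable M" and "\<forall>z\<in>space M. (\<Sum>k\<in>K. \<bar>f k z\<bar>) <= B z"
  and B4: "integrable M (\<lambda>z. B z ^ 4)"
  and "\<forall>k\<in>K. expectation (\<lambda>z. (f k z)^2) <= \<kappa>" and \<kappa>0: "0 <= \<kappa>"
 defines "g \<equiv> (\<lambda>k z. f k z - expectation (f k))"
 shows "\<And>k. k \<in> K ==> fourth_integrable M (f k)"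
  and "\<And>k. k \<in> K ==> fourth_integrable M (g k)"
  and "integrable M (\<lambda>z. (\<Sum>k\<in>K. (g k z)^2)^2)"
  and "expectation (\<lambda>z. (\<Sum>k\<in>K. (g k z)^2)^2) <= 16 * expectation (\<lambda>z. B z ^ 4)"
  and "(\<Sum>k\<in>K. \<Sum>l\<in>K. (expectation (\<lambda>z. g k z * g l z))^2) <= 2 * \<kappa> * expectation (\<lambda>z. (B z)^2)"
  and "\<And>k. k \<in> K ==> expectation (\<lambda>z. (g k z)^2) = expectation (\<lambda>z. (f k z)^2) - (expectation (f k))^2"
  and "\<And>k. k \<in> K ==> expectation (g k) = 0"
proof -
 note f[measurable] = assms(2)[rule_format] and dom = assms(4)[rule_format] and \<kappa> = assms(6)[rule_format]
 have fB: "\<bar>f k z\<bar> <= B z" if "k \<in> K" "z \<in> space M" for k z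
 proof -
  have "\<bar>f k z\<bar> <= (\<Sum>k\<in>K. \<bar>f k z\<bar>)" using K that by (intro member_le_sum) auto
  thus ?thesis using dom[OF that(2)] by linarith
 qed
 have B0: "0 <= B z" if "z \<in> space M" for z
  using dom[OF that] by (rule order_trans[rotated]) (simp add: sum_nonneg)
 have LB: "fourth_integrable M B" using B B4 unfolding fourth_integrable_def by auto
 show Lf: "fourth_integrable M (f k)" if "k \<in> K" for k
 proof -
  have "integrable M (\<lambda>z. f k z ^ 4)"
  proof (rule integrable_boundedI[OF B4])
   show "AE z in M. norm (f k z ^ 4) <= norm (B z ^ 4)"
   proof (rule AE_I2)
    fix z assume z: "z \<in> space M"
    have "\<bar>f k z\<bar> ^ 4 <= B z ^ 4" by (intro power_mono fB that z) auto
    thus "norm (f k z ^ 4) <= norm (B z ^ 4)" by (simp add: power_abs)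
   qed
  qed (use that in auto)
  thus ?thesis unfolding fourth_integrable_def using f that by auto
 qed
 define \<mu> where "\<mu> k = expectation (f k)" for k
 have g: "g = (\<lambda>k z. f k z + (- \<mu> k))" unfolding g_def \<mu>_def by simp
 show Lg: "fourth_integrable M (g k)" if "k \<in> K" for k
  unfolding g by (intro fourth_integrable_add Lf that fourth_integrable_const)
 have If: "integrable M (f k)" if "k \<in> K" for k by (rule fourth_integrable_integrable[OF Lf[OF that]])
 have Iff: "integrable M (\<lambda>z. f k z * f l z)" if "k \<in> K" "l \<in> K" for k l
  by (rule fourth_integrable_product2[OF Lf[OF that(1)] Lf[OF that(2)]])
 have Igg: "integrable M (\<lambda>z. g k z * g l z)" if "k \<in> K" "l \<in> K" for k l
  by (rule fourth_integrable_product2[OF Lg[OF that(1)] Lg[OF that(2)]])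
 have IB: "integrable M B" by (rule fourth_integrable_integrable[OF LB])
 have IBB: "integrable M (\<lambda>z. (B z)^2)" using fourth_integrable_product2[OF LB LB] by (simp add: power2_eq_square)
 define b2 where "b2 = expectation (\<lambda>z. (B z)^2)"
 define b4 where "b4 = expectation (\<lambda>z. B z ^ 4)"
 have b22: "b2^2 <= b4"
  using square_expectation_le[of "\<lambda>z. (B z)^2"] B4 unfolding b2_def b4_def by (simp flip: power_mult)
 have EB: "(expectation B)^2 <= b2" unfolding b2_def by (rule square_expectation_le[OF B IBB])
 have b20: "0 <= b2" unfolding b2_def by simp
 show Eg: "expectation (g k) = 0" if "k \<in> K" for k
  unfolding g using If[OF that] by (simp add: prob_space \<mu>_def)
 have Egg: "expectation (\<lambda>z. g k z * g l z) = expectation (\<lambda>z. f k z * f l z) - \<mu> k * \<mu> l" if "k \<in> K" "l \<in> K" for k l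
 proof -
  have "(\<lambda>z. g k z * g l z) = (\<lambda>z. f k z * f l z - \<mu> l * f k z - \<mu> k * f l z + \<mu> k * \<mu> l)"
   unfolding g by (simp add: algebra_simps)
  thus ?thesis using Iff[OF that] If that by (simp add: prob_space \<mu>_def[symmetric] algebra_simps)
 qed
 show "expectation (\<lambda>z. (g k z)^2) = expectation (\<lambda>z. (f k z)^2) - (expectation (f k))^2" if "k \<in> K" for k
  using Egg[OF that that] by (simp add: power2_eq_square \<mu>_def)
 have sum_mu: "(\<Sum>k\<in>K. \<bar>\<mu> k\<bar>) <= expectation B"
 proof -
  have "(\<Sum>k\<in>K. \<bar>\<mu> k\<bar>) <= (\<Sum>k\<in>K. expectation (\<lambda>z. \<bar>f k z\<bar>))"
   unfolding \<mu>_def by (intro sum_mono integral_abs_bound)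
  also have "... = expectation (\<lambda>z. \<Sum>k\<in>K. \<bar>f k z\<bar>)"
   using If by (subst lint_sum) auto
  also have "... <= expectation B"
   using If IB dom by (intro integral_mono) auto
  finally show ?thesis .
 qed
 have m2: "(\<Sum>k\<in>K. (\<mu> k)^2) <= b2"
 proof -
  have "(\<Sum>k\<in>K. (\<mu> k)^2) = (\<Sum>k\<in>K. \<bar>\<mu> k\<bar>^2)" by simp
  also have "... <= (\<Sum>k\<in>K. \<bar>\<mu> k\<bar>)^2" by (rule sum_squares_le_square_sum) simp
  also have "... <= (expectation B)^2" by (intro power_mono sum_mu sum_nonneg) auto
  finally show ?thesis using EB by linarith
 qed
 \<comment> \<open>From (a - m)^2 <= 2 a^2 + 2 m^2 and the l^1 bound; the squared means sum to at
   most the second moment of B, whose square is at most the fourth moment. This later merges the two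
   terms into the constant 16.\<close>
 have pw: "(\<Sum>k\<in>K. (g k z)^2)^2 <= 8 * B z ^ 4 + 8 * b2^2" if z: "z \<in> space M" for z
 proof -
  have "(\<Sum>k\<in>K. (g k z)^2) <= (\<Sum>k\<in>K. 2 * (f k z)^2 + 2 * (\<mu> k)^2)"
  proof (rule sum_mono)
   fix k
   have "0 <= (f k z + \<mu> k)^2" by simp
   thus "(g k z)^2 <= 2 * (f k z)^2 + 2 * (\<mu> k)^2" unfolding g by (simp add: power2_eq_square algebra_simps)
  qed
  also have "... = 2 * (\<Sum>k\<in>K. \<bar>f k z\<bar>^2) + 2 * (\<Sum>k\<in>K. (\<mu> k)^2)" by (simp add: sum.distrib sum_distrib_left)
  also have "(\<Sum>k\<in>K. \<bar>f k z\<bar>^2) <= (\<Sum>k\<in>K. \<bar>f k z\<bar>)^2" by (rule sum_squares_le_square_sum) simp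
  also have "... <= (B z)^2" by (intro power_mono dom z sum_nonneg) auto
  finally have "(\<Sum>k\<in>K. (g k z)^2) <= 2 * (B z)^2 + 2 * b2" using m2 by linarith
  hence "(\<Sum>k\<in>K. (g k z)^2)^2 <= (2 * (B z)^2 + 2 * b2)^2" by (intro power_mono sum_nonneg) auto
  also have "... <= 8 * B z ^ 4 + 8 * b2^2"
  proof -
   have "0 <= (2 * (B z)^2 - 2 * b2)^2" by simp
   moreover have "B z ^ 4 = (B z)^2 * (B z)^2" by (simp add: power4_eq_xxxx power2_eq_square)
   ultimately show ?thesis by (simp add: power2_eq_square algebra_simps)
  qed
  finally show ?thesis .
 qed
 have mg: "(\<lambda>z. (\<Sum>k\<in>K. (g k z)^2)^2) \<in> borel_measurable M"
  using Lg unfolding fourth_integrable_def by (intro borel_measurable_power borel_measurable_sum) auto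
 show I4: "integrable M (\<lambda>z. (\<Sum>k\<in>K. (g k z)^2)^2)"
 proof (rule integrable_boundedI[where f="\<lambda>z. 8 * B z ^ 4 + 8 * b2^2"])
  show "AE z in M. norm ((\<Sum>k\<in>K. (g k z)^2)^2) <= norm (8 * B z ^ 4 + 8 * b2^2)"
   using pw by (intro AE_I2) (auto intro!: order_trans[OF _ abs_ge_self])
 qed (use B4 mg in auto)
 have "expectation (\<lambda>z. (\<Sum>k\<in>K. (g k z)^2)^2) <= expectation (\<lambda>z. 8 * B z ^ 4 + 8 * b2^2)"
  using I4 B4 pw by (intro integral_mono) auto
 also have "... = 8 * b4 + 8 * b2^2" using B4 by (simp add: prob_space b4_def)
 finally show "expectation (\<lambda>z. (\<Sum>k\<in>K. (g k z)^2)^2) <= 16 * expectation (\<lambda>z. B z ^ 4)"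
  using b22 unfolding b4_def by linarith
 define c where "c k l = expectation (\<lambda>z. g k z * g l z)" for k l
 have ck: "c k k <= \<kappa>" if "k \<in> K" for k
 proof -
  have "c k k = expectation (\<lambda>z. (f k z)^2) - \<mu> k * \<mu> k" unfolding c_def Egg[OF that that] by (simp add: power2_eq_square)
  thus ?thesis using \<kappa>[OF that] zero_le_square[of "\<mu> k"] by linarith
 qed
 have cabs: "\<bar>c k l\<bar> <= \<kappa>" if "k \<in> K" "l \<in> K" for k l
 proof -
  have "\<bar>c k l\<bar> <= expectation (\<lambda>z. \<bar>g k z * g l z\<bar>)" unfolding c_def by (rule integral_abs_bound)
  also have "... <= expectation (\<lambda>z. (g k z * g k z + g l z * g l z) / 2)"
  proof (rule integral_mono)
   fix z
   have "0 <= (\<bar>g k z\<bar> - \<bar>g l z\<bar>)^2" by simp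
   thus "\<bar>g k z * g l z\<bar> <= (g k z * g k z + g l z * g l z) / 2"
    by (simp add: power2_eq_square algebra_simps abs_mult)
  qed (use Igg that in auto)
  also have "... = (c k k + c l l) / 2" using Igg[OF that(1,1)] Igg[OF that(2,2)] unfolding c_def by simp
  also have "... <= \<kappa>" using ck[OF that(1)] ck[OF that(2)] by simp
  finally show ?thesis .
 qed
 have sumc: "(\<Sum>k\<in>K. \<Sum>l\<in>K. \<bar>c k l\<bar>) <= 2 * b2"
 proof -
  have "(\<Sum>k\<in>K. \<Sum>l\<in>K. \<bar>c k l\<bar>) <= (\<Sum>k\<in>K. \<Sum>l\<in>K. expectation (\<lambda>z. \<bar>f k z\<bar> * \<bar>f l z\<bar>) + \<bar>\<mu> k\<bar> * \<bar>\<mu> l\<bar>)"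
  proof (intro sum_mono)
   fix k l assume kl: "k \<in> K" "l \<in> K"
   have "\<bar>c k l\<bar> <= \<bar>expectation (\<lambda>z. f k z * f l z)\<bar> + \<bar>\<mu> k * \<mu> l\<bar>" unfolding c_def Egg[OF kl] by linarith
   also have "\<bar>expectation (\<lambda>z. f k z * f l z)\<bar> <= expectation (\<lambda>z. \<bar>f k z * f l z\<bar>)" by (rule integral_abs_bound)
   finally show "\<bar>c k l\<bar> <= expectation (\<lambda>z. \<bar>f k z\<bar> * \<bar>f l z\<bar>) + \<bar>\<mu> k\<bar> * \<bar>\<mu> l\<bar>" by (simp add: abs_mult)
  qed
  also have "... = (\<Sum>k\<in>K. \<Sum>l\<in>K. expectation (\<lambda>z. \<bar>f k z\<bar> * \<bar>f l z\<bar>)) + (\<Sum>k\<in>K. \<bar>\<mu> k\<bar>)^2"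
   by (simp add: sum.distrib power2_eq_square sum_product)
  also have "(\<Sum>k\<in>K. \<Sum>l\<in>K. expectation (\<lambda>z. \<bar>f k z\<bar> * \<bar>f l z\<bar>)) = expectation (\<lambda>z. \<Sum>k\<in>K. \<Sum>l\<in>K. \<bar>f k z\<bar> * \<bar>f l z\<bar>)"
  proof -
   have ia: "integrable M (\<lambda>z. \<bar>f k z\<bar> * \<bar>f l z\<bar>)" if "k \<in> K" "l \<in> K" for k l
    using integrable_abs[OF Iff[OF that]] by (simp add: abs_mult)
   show ?thesis
    by (subst lint_sum, intro integrable_sumI ia, assumption+,
      intro sum.cong refl, subst lint_sum) (auto intro: ia)
  qed
  also have "... <= b2"
   unfolding b2_def
  proof (rule integral_mono)
   show "integrable M (\<lambda>z. \<Sum>k\<in>K. \<Sum>l\<in>K. \<bar>f k z\<bar> * \<bar>f l z\<bar>)"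
    using integrable_abs[OF Iff] by (intro integrable_sumI) (auto simp: abs_mult)
   fix z assume z: "z \<in> space M"
   have "(\<Sum>k\<in>K. \<Sum>l\<in>K. \<bar>f k z\<bar> * \<bar>f l z\<bar>) = (\<Sum>k\<in>K. \<bar>f k z\<bar>)^2" by (simp add: power2_eq_square sum_product)
   also have "... <= (B z)^2" by (intro power_mono dom z sum_nonneg) auto
   finally show "(\<Sum>k\<in>K. \<Sum>l\<in>K. \<bar>f k z\<bar> * \<bar>f l z\<bar>) <= (B z)^2" .
  qed (rule IBB)
  also have "(\<Sum>k\<in>K. \<bar>\<mu> k\<bar>)^2 <= (expectation B)^2" by (intro power_mono sum_mu sum_nonneg) auto
  finally show ?thesis using EB by linarith
 qed
 \<comment> \<open>One factor of each squared covariance is bounded by \<kappa>, through the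
   arithmetic-geometric inequality; the absolute values of the other factors sum to at most twice
   the second moment of B.\<close>
 show "(\<Sum>k\<in>K. \<Sum>l\<in>K. (expectation (\<lambda>z. g k z * g l z))^2) <= 2 * \<kappa> * expectation (\<lambda>z. (B z)^2)"
 proof -
  have "(\<Sum>k\<in>K. \<Sum>l\<in>K. (c k l)^2) <= (\<Sum>k\<in>K. \<Sum>l\<in>K. \<kappa> * \<bar>c k l\<bar>)"
  proof (intro sum_mono)
   fix k l assume "k \<in> K" "l \<in> K"
   thus "(c k l)^2 <= \<kappa> * \<bar>c k l\<bar>"
    using mult_right_mono[OF cabs[of k l], of "\<bar>c k l\<bar>"] by (simp add: power2_eq_square abs_mult_self_eq)
  qed
  also have "... = \<kappa> * (\<Sum>k\<in>K. \<Sum>l\<in>K. \<bar>c k l\<bar>)" by (simp add: sum_distrib_left)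
  also have "... <= \<kappa> * (2 * b2)" by (intro mult_left_mono sumc \<kappa>0)
  finally show ?thesis unfolding c_def b2_def by simp
 qed
qed

text \<open>Centring the summands gives S = E + 2 C + D, with E a centred quadratic form, C linear
  and D the squared means. The variance bound treats E, and Cauchy-Schwarz bounds C by sqrt (D E).
  The reference value s is built from uncentred second moments; it exceeds the mean of E by at most
  D, which together with D itself makes 2 D.\<close>

lemma (in prob_space) energy_concentration:
 fixes Z :: "nat => 'a => 'b" and f :: "'k => 'b => real"
 assumes ind: "indep_vars (\<lambda>_. N) Z {..<n}" and law: "\<And>i. i < n ==> distr M N (Z i) = Q"
  and Q: "prob_space Q" and sQ: "sets Q = sets N" and K: "finite K"
  and f: "\<And>k. k \<in> K ==> f k \<in> borel_measurable N" and B: "B \<in> borel_measurable N"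
  and dom: "\<And>z. z \<in> space N ==> (\<Sum>k\<in>K. \<bar>f k z\<bar>) <= B z" and B4: "integrable Q (\<lambda>z. B z ^ 4)"
  and \<kappa>: "\<And>k. k \<in> K ==> (LINT z|Q. (f k z)^2) <= \<kappa>" and \<kappa>0: "0 <= \<kappa>"
 defines "S \<equiv> (\<lambda>w. \<Sum>k\<in>K. (\<Sum>i<n. f k (Z i w))^2)"
  and "s \<equiv> real n * (\<Sum>k\<in>K. (LINT z|Q. (f k z)^2))" and "D \<equiv> (\<Sum>k\<in>K. (real n * (LINT z|Q. f k z))^2)"
 shows "integrable M S"
  and "expectation (\<lambda>w. \<bar>S w - s\<bar>) <= sqrt (16 * real n * (LINT z|Q. B z ^ 4) + 4 * (real n)^2 * \<kappa> * (LINT z|Q. (B z)^2))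
      + 2 * D + 2 * sqrt (D * s)"
  and "expectation S <= s + D"
proof -
 interpret Q: prob_space Q by (rule Q)
 have mQ: "borel_measurable Q = borel_measurable N" using sQ by (rule measurable_cong_sets) simp
 have spQ: "space Q = space N" using sQ by (rule sets_eq_imp_space_eq)
 define \<mu> where "\<mu> k = (LINT z|Q. f k z)" for k
 define g where "g k z = f k z - \<mu> k" for k z
 have bf: "\<forall>k\<in>K. f k \<in> borel_measurable N" "\<forall>z\<in>space N. (\<Sum>k\<in>K. \<bar>f k z\<bar>) <= B z"
  "\<forall>k\<in>K. (LINT z|Q. (f k z)^2) <= \<kappa>" using f dom \<kappa> by auto
 note dc = Q.dominated_covariance_bound[of K f B \<kappa>, unfolded mQ spQ, OF K bf(1) B bf(2) B4 bf(3) \<kappa>0, folded \<mu>_def g_def]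
 have gN: "g k \<in> borel_measurable N" if "k \<in> K" for k using f[OF that] unfolding g_def by simp
 have g4: "integrable Q (\<lambda>z. g k z ^ 4)" if "k \<in> K" for k
  using dc(2)[OF that] unfolding fourth_integrable_def g_def by simp
 have g0: "(LINT z|Q. g k z) = 0" if "k \<in> K" for k using dc(7)[OF that] unfolding g_def by simp
 have gI: "integrable Q (\<lambda>z. (\<Sum>k\<in>K. (g k z)^2)^2)" using dc(3) unfolding g_def by simp
 define e where "e k w = (\<Sum>i<n. g k (Z i w))" for k w
 have qv1: "expectation (\<lambda>w. ((\<Sum>k\<in>K. (\<Sum>i<n. g k (Z i w))^2) - real n * (\<Sum>k\<in>K. (LINT z|Q. (g k z)^2)))^2)
  <= real n * (LINT z|Q. (\<Sum>k\<in>K. (g k z)^2)^2) + 2 * (real n)^2 * (\<Sum>k\<in>K. \<Sum>l\<in>K. (LINT z|Q. g k z * g l z)^2)"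
  by (rule quadratic_variance_bound(1)[OF ind _ K]) (use law gN g4 g0 gI in auto)
 have qv2: "fourth_integrable M (\<lambda>w. \<Sum>i<n. g k (Z i w))" if "k \<in> K" for k
  by (rule quadratic_variance_bound(2)[OF ind _ K]) (use law gN g4 g0 gI that in auto)
 have qv3: "expectation (\<lambda>w. \<Sum>i<n. g k (Z i w)) = 0" if "k \<in> K" for k
  by (rule quadratic_variance_bound(3)[OF ind _ K]) (use law gN g4 g0 gI that in auto)
 have qv4: "expectation (\<lambda>w. (\<Sum>i<n. g k (Z i w)) * (\<Sum>i<n. g l (Z i w))) = real n * (LINT z|Q. g k z * g l z)"
  if "k \<in> K" "l \<in> K" for k l
  by (rule quadratic_variance_bound(4)[OF ind _ K]) (use law gN g4 g0 gI that in auto)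
 define V where "V = 16 * real n * (LINT z|Q. B z ^ 4) + 4 * (real n)^2 * \<kappa> * (LINT z|Q. (B z)^2)"
 define s' where "s' = n * (\<Sum>k\<in>K. (LINT z|Q. (g k z)^2))"
 define E where "E w = (\<Sum>k\<in>K. (e k w)^2)" for w
 have Vb: "expectation (\<lambda>w. (E w - s')^2) <= V"
 proof -
  have "expectation (\<lambda>w. (E w - s')^2) <= n * (LINT z|Q. (\<Sum>k\<in>K. (g k z)^2)^2) + 2 * (real n)^2 * (\<Sum>k\<in>K. \<Sum>l\<in>K. (LINT z|Q. g k z * g l z)^2)"
   unfolding E_def s'_def e_def by (rule qv1)
  also have "... <= n * (16 * (LINT z|Q. B z ^ 4)) + 2 * (real n)^2 * (2 * \<kappa> * (LINT z|Q. (B z)^2))"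
   using dc(4,5) unfolding g_def by (intro add_mono mult_left_mono) auto
  also have "... = V" unfolding V_def by simp
  finally show ?thesis .
 qed
 have ms: "s' = s - (\<Sum>k\<in>K. n * (\<mu> k)^2)"
  unfolding s'_def s_def using dc(6) unfolding g_def \<mu>_def
  by (simp add: sum_subtractf right_diff_distrib sum_distrib_left)
 have D0: "0 <= D" unfolding D_def by (intro sum_nonneg) auto
 \<comment> \<open>Because n <= n^2 for every natural number n.\<close>
 have mD: "(\<Sum>k\<in>K. n * (\<mu> k)^2) <= D"
  unfolding D_def \<mu>_def[symmetric] power_mult_distrib
  by (intro sum_mono mult_right_mono) (cases n; simp add: power2_eq_square)+
 have m0: "0 <= (\<Sum>k\<in>K. n * (\<mu> k)^2)" by (intro sum_nonneg) auto
 have s'0: "0 <= s'" unfolding s'_def by (intro mult_nonneg_nonneg sum_nonneg) auto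
 have s's: "s' <= s" using ms m0 by linarith
 have s0: "0 <= s" using s'0 s's by linarith
 have Le: "fourth_integrable M (e k)" if "k \<in> K" for k using qv2[OF that] unfolding e_def .
 have me: "e k \<in> borel_measurable M" if "k \<in> K" for k using Le[OF that] unfolding fourth_integrable_def by auto
 have Ie: "integrable M (e k)" if "k \<in> K" for k using fourth_integrable_integrable[OF Le[OF that]] .
 have Ie2: "integrable M (\<lambda>w. (e k w)^2)" if "k \<in> K" for k
  using fourth_integrable_product2[OF Le[OF that] Le[OF that]] by (simp add: power2_eq_square)
 have Ee: "expectation (e k) = 0" if "k \<in> K" for k using qv3[OF that] unfolding e_def .
 have mE: "E \<in> borel_measurable M" unfolding E_def using me by (intro borel_measurable_sum borel_measurable_power) auto
 have IE: "integrable M E" unfolding E_def using Ie2 by (intro integrable_sumI) auto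
 have E0: "0 <= E w" for w unfolding E_def by (intro sum_nonneg) auto
 have EE: "expectation E = s'"
 proof -
  have "expectation E = (\<Sum>k\<in>K. expectation (\<lambda>w. (e k w)^2))"
   unfolding E_def using Ie2 by (subst lint_sum) auto
  also have "... = (\<Sum>k\<in>K. n * (LINT z|Q. (g k z)^2))"
   using qv4 by (intro sum.cong refl) (simp add: power2_eq_square e_def)
  finally show ?thesis unfolding s'_def by (simp add: sum_distrib_left)
 qed
 have IE2: "integrable M (\<lambda>w. (E w - s')^2)" unfolding E_def by (rule fourth_integrable_energy(1)[OF Le])
 have EV: "expectation (\<lambda>w. \<bar>E w - s'\<bar>) <= sqrt V"
 proof -
  have "expectation (\<lambda>w. \<bar>E w - s'\<bar>) <= sqrt (expectation (\<lambda>w. (E w - s')^2))"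
   using mE IE2 by (intro expectation_abs_le_sqrt(2)) auto
  also have "... <= sqrt V" using Vb by simp
  finally show ?thesis .
 qed
 define C where "C w = (\<Sum>k\<in>K. n * \<mu> k * e k w)" for w
 have IC: "integrable M C" unfolding C_def using Ie by (intro integrable_sumI integrable_mult_right) auto
 have EC: "expectation C = 0" unfolding C_def using Ie Ee by (subst lint_sum) auto
 have Seq: "S w = E w + 2 * C w + D" for w
 proof -
  have "(\<Sum>i<n. f k (Z i w)) = e k w + n * \<mu> k" for k
   unfolding e_def g_def by (simp add: sum_subtractf)
  hence "S w = (\<Sum>k\<in>K. (e k w)^2 + 2 * (n * \<mu> k * e k w) + (n * \<mu> k)^2)"
   unfolding S_def by (intro sum.cong refl) (simp add: power2_eq_square algebra_simps)
  thus ?thesis unfolding E_def C_def D_def \<mu>_def[symmetric] by (simp add: sum.distrib sum_distrib_left)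
 qed
 show IS: "integrable M S" unfolding Seq[abs_def] using IE IC by simp
 have "expectation S = s' + D" unfolding Seq[abs_def] using IE IC EE EC by (simp add: prob_space)
 thus "expectation S <= s + D" using s's by simp
 have Cabs: "\<bar>C w\<bar> <= sqrt D * sqrt (E w)" for w
 proof -
  have "\<bar>C w\<bar> <= (\<Sum>k\<in>K. \<bar>n * \<mu> k\<bar> * \<bar>e k w\<bar>)"
   unfolding C_def by (rule order_trans[OF sum_abs]) (simp add: abs_mult)
  also have "... <= L2_set (\<lambda>k. n * \<mu> k) K * L2_set (\<lambda>k. e k w) K" by (rule L2_set_mult_ineq)
  also have "... = sqrt D * sqrt (E w)" unfolding L2_set_def D_def E_def \<mu>_def ..
  finally show ?thesis .
 qed
 have IsE: "integrable M (\<lambda>w. sqrt (E w))" "expectation (\<lambda>w. sqrt (E w)) <= sqrt s"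
 proof -
  have m: "(\<lambda>w. sqrt (E w)) \<in> borel_measurable M" using mE by measurable
  have i: "integrable M (\<lambda>w. (sqrt (E w))^2)" using IE E0 by simp
  show "integrable M (\<lambda>w. sqrt (E w))" by (rule expectation_abs_le_sqrt(1)[OF m i])
  have "expectation (\<lambda>w. sqrt (E w)) = expectation (\<lambda>w. \<bar>sqrt (E w)\<bar>)" using E0 by simp
  also have "... <= sqrt (expectation (\<lambda>w. (sqrt (E w))^2))" by (rule expectation_abs_le_sqrt(2)[OF m i])
  also have "... = sqrt s'" using E0 EE by simp
  also have "... <= sqrt s" using s's by simp
  finally show "expectation (\<lambda>w. sqrt (E w)) <= sqrt s" .
 qed
 have "expectation (\<lambda>w. \<bar>S w - s\<bar>) <= expectation (\<lambda>w. \<bar>E w - s'\<bar> + 2 * sqrt D * sqrt (E w) + 2 * D)"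
 proof (rule integral_mono)
  fix w
  have "\<bar>S w - s\<bar> <= \<bar>E w - s'\<bar> + 2 * \<bar>C w\<bar> + \<bar>D\<bar> + \<bar>s' - s\<bar>" unfolding Seq by linarith
  thus "\<bar>S w - s\<bar> <= \<bar>E w - s'\<bar> + 2 * sqrt D * sqrt (E w) + 2 * D" using Cabs[of w] mD ms m0 D0 by linarith
 qed (use IS IE IsE(1) in auto)
 also have "... = expectation (\<lambda>w. \<bar>E w - s'\<bar>) + 2 * sqrt D * expectation (\<lambda>w. sqrt (E w)) + 2 * D"
  using IE IsE(1) by (simp add: prob_space)
 also have "... <= sqrt V + 2 * sqrt D * sqrt s + 2 * D"
  by (intro add_mono mult_left_mono EV IsE(2)) (use D0 in auto)
 finally show "expectation (\<lambda>w. \<bar>S w - s\<bar>) <= sqrt (16 * real n * (LINT z|Q. B z ^ 4) + 4 * (real n)^2 * \<kappa> * (LINT z|Q. (B z)^2))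
      + 2 * D + 2 * sqrt (D * s)"
  unfolding V_def by (simp add: real_sqrt_mult algebra_simps)
qed

section \<open>The marked Poisson process given the number of points\<close>

lemma int_less_step:
 fixes f :: "int => real"
 assumes "\<And>l. f l < f (l + 1)" and "a < b"
 shows "f a < f b"
 using assms(2)
proof (induction b rule: int_gr_induct)
 case base
 show ?case using assms(1) by simp
next
 case (step i)
 show ?case using step assms(1)[of i] by simp
qed

locale marked_points = prob_space P for P :: "'a measure" +
 fixes \<nu> :: "(real \<times> real) measure" and t \<eta> U :: "int => 'a => real"
 assumes iid: "iid_marked_poisson P \<nu> t \<eta> U"
begin

text \<open>The event of exactly n points in [0, R), expressed through the indexing: measurability
  is then immediate, and agreement with \<open>point_count\<close> holds almost surely.\<close>

definition occupied :: "real => nat => 'a set" where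
 "occupied R n = {\<omega>\<in>space P. (\<forall>i<n. t (int i) \<omega> \<in> {0..<R}) \<and> R <= t (int n) \<omega>}"

lemma points_measurable [measurable]: "t l \<in> borel_measurable P"
 using iid unfolding iid_marked_poisson_def unit_poisson_points_def by auto

lemma marks_measurable: "(\<lambda>w. (\<eta> l w, U l w)) \<in> borel_measurable P"
proof -
 have "indep_vars (\<lambda>_. borel) (\<lambda>l w. (\<eta> l w, U l w)) UNIV"
  using iid unfolding iid_marked_poisson_def by auto
 thus ?thesis unfolding indep_vars_def by auto
qed

lemma mark_law: "distr P borel (\<lambda>w. (\<eta> l w, U l w)) = \<nu>"
 using iid unfolding iid_marked_poisson_def by auto

lemma prob_space_marks: "prob_space \<nu>"
 using prob_space_distr[OF marks_measurable, of 0] mark_law by simp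

lemma sets_marks [measurable_cong, simp]: "sets \<nu> = sets borel"
 by (subst mark_law[of 0, symmetric]) simp

lemma AE_points_ordered:
 "AE w in P. (\<forall>a b. a < b --> t a w < t b w) \<and> (\<forall>l. 0 <= t l w \<longleftrightarrow> 0 <= l)"
proof -
 have "AE w in P. (\<forall>l. t l w < t (l + 1) w) \<and> t (- 1) w < 0 \<and> 0 <= t 0 w"
  using iid unfolding iid_marked_poisson_def unit_poisson_points_def by auto
 thus ?thesis
 proof eventually_elim
  case (elim w)
  have s: "t a w < t b w" if "a < b" for a b
   using int_less_step[of "\<lambda>l. t l w"] elim that by auto
  have "0 <= t l w \<longleftrightarrow> 0 <= l" for l
  proof (cases "0 <= l")
   case True
   hence "t 0 w <= t l w" using s[of 0 l] by (cases "l = 0") auto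
   thus ?thesis using elim True by auto
  next
   case False
   hence "t l w <= t (-1) w" using s[of l "-1"] by (cases "l = -1") auto
   thus ?thesis using elim False by auto
  qed
  thus ?case using s by blast
 qed
qed

lemma AE_occupied_index:
 "AE w in P. \<forall>R n. w \<in> occupied R n --> {l. t l w \<in> {0..<R}} = {0..<int n}"
 using AE_points_ordered
proof eventually_elim
 case (elim w)
 show ?case
 proof (intro allI impI equalityI subsetI)
  fix R n l assume o: "w \<in> occupied R n" and l: "l \<in> {l. t l w \<in> {0..<R}}"
  hence "0 <= l" using elim by auto
  moreover have "l < int n"
  proof (rule ccontr)
   assume "\<not> l < int n"
   hence "t (int n) w <= t l w" using elim by (metis linorder_not_less order_le_less)
   thus False using o l by (auto simp: occupied_def)
  qed
  ultimately show "l \<in> {0..<int n}" by simp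
 next
  fix R n l assume o: "w \<in> occupied R n" and "l \<in> {0..<int n}"
  then obtain i where "l = int i" "i < n" by (metis atLeastLessThan_iff nonneg_int_cases of_nat_less_iff)
  thus "l \<in> {l. t l w \<in> {0..<R}}" using o by (auto simp: occupied_def)
 qed
qed

text \<open>By the ordering, the indices of the points in [0, R) contain with l all of {0..l}; such
  a set is an initial segment and is determined by its cardinality.\<close>

lemma AE_occupied_iff:
 "AE w in P. \<forall>R n. w \<in> occupied R n \<longleftrightarrow> point_count t {0..<R} w = of_nat n"
 using AE_points_ordered AE_occupied_index AE_space
proof eventually_elim
 case (elim w)
 note ord = elim(1) and idx = elim(2)
 show ?case
 proof (intro allI iffI)
  fix R n assume "w \<in> occupied R n"
  hence "{l. t l w \<in> {0..<R}} = {0..<int n}" using idx by auto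
  thus "point_count t {0..<R} w = of_nat n" unfolding point_count_def by simp
 next
  fix R n assume c: "point_count t {0..<R} w = of_nat n"
  let ?S = "{l. t l w \<in> {0..<R}}"
  have fin: "finite ?S"
   using c unfolding point_count_def by (metis emeasure_count_space_infinite infinity_ennreal_def ennreal_of_nat_neq_top subset_UNIV)
  have card: "card ?S = n"
   using c fin unfolding point_count_def by simp
  have down: "{0..l} \<subseteq> ?S" if "l \<in> ?S" for l
  proof
   fix k assume "k \<in> {0..l}"
   moreover from this have "t k w <= t l w" using ord by (metis atLeastAtMost_iff order_le_less)
   ultimately show "k \<in> ?S" using ord that by force
  qed
  have "?S \<subseteq> {0..<int n}"
  proof
   fix l assume l: "l \<in> ?S"
   have "card {0..l} <= n" using card_mono[OF fin down[OF l]] card by simp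
   thus "l \<in> {0..<int n}" using l ord by auto
  qed
  hence S: "?S = {0..<int n}" using card by (intro card_subset_eq) auto
  show "w \<in> occupied R n"
   unfolding occupied_def
  proof (intro CollectI conjI allI impI)
   fix i assume "i < n"
   hence "int i \<in> ?S" unfolding S by simp
   thus "t (int i) w \<in> {0..<R}" by simp
  next
   have "int n \<notin> ?S" unfolding S by simp
   thus "R <= t (int n) w" using ord by simp
  qed (use elim in auto)
 qed
qed

lemma occupied_measurable [measurable]: "occupied R n \<in> sets P"
 unfolding occupied_def by measurable

lemma point_count_measurable:
 assumes "A \<in> sets borel" "bounded A"
 shows "point_count t A \<in> borel_measurable P"
proof -
 have "indep_vars (\<lambda>_. borel) (\<lambda>i. point_count t A) {0::nat}"
  using iid assms unfolding iid_marked_poisson_def unit_poisson_points_def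
  by (auto dest!: spec[of _ "{0::nat}"] spec[of _ "\<lambda>_. A"] simp: disjoint_family_on_def)
 thus ?thesis unfolding indep_vars_def by simp
qed

lemma prob_point_count:
 assumes "A \<in> sets borel" "bounded A"
 shows "prob {w\<in>space P. point_count t A w = of_nat n} = exp (- measure lborel A) * measure lborel A ^ n / fact n"
 using iid assms unfolding iid_marked_poisson_def unit_poisson_points_def by auto

lemma prob_occupied:
 assumes "0 <= R"
 shows "prob (occupied R n) = exp (- R) * R ^ n / fact n"
proof -
 have [measurable]: "point_count t {0..<R} \<in> borel_measurable P"
  by (rule point_count_measurable) auto
 have "prob (occupied R n) = prob {w\<in>space P. point_count t {0..<R} w = of_nat n}"
 proof (rule finite_measure_eq_AE)
  show "AE x in P. (x \<in> occupied R n) = (x \<in> {w \<in> space P. point_count t {0..<R} w = of_nat n})"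
   using AE_occupied_iff AE_space by eventually_elim (auto simp: occupied_def)
 qed measurable
 also have "... = exp (- R) * R ^ n / fact n"
  using prob_point_count[of "{0..<R}" n] assms by simp
 finally show ?thesis .
qed

abbreviation perms :: "nat => (nat => nat) set" where
 "perms n \<equiv> {\<sigma>. \<sigma> permutes {..<n}}"

section \<open>The joint law of the points, up to their order\<close>

lemma box_event_measurable:
 assumes "\<And>i. i < n ==> A i \<in> sets borel"
 shows "{w\<in>occupied R n. \<forall>i<n. t (int (s i)) w \<in> A i} \<in> sets P"
proof -
 have "{w\<in>space P. \<forall>i\<in>{..<n}. t (int (s i)) w \<in> A i} \<in> sets P"
 proof (rule sets.sets_Collect_finite_All)
  fix i assume "i \<in> {..<n}"
  hence "t (int (s i)) -` A i \<inter> space P \<in> sets P"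
   using assms by (intro measurable_sets[OF points_measurable]) auto
  also have "t (int (s i)) -` A i \<inter> space P = {w \<in> space P. t (int (s i)) w \<in> A i}" by blast
  finally show "{w \<in> space P. t (int (s i)) w \<in> A i} \<in> sets P" .
 qed simp
 hence "occupied R n \<inter> {w\<in>space P. \<forall>i\<in>{..<n}. t (int (s i)) w \<in> A i} \<in> sets P" by auto
 also have "occupied R n \<inter> {w\<in>space P. \<forall>i\<in>{..<n}. t (int (s i)) w \<in> A i} =
   {w\<in>occupied R n. \<forall>i<n. t (int (s i)) w \<in> A i}"
  using sets.sets_into_space[OF occupied_measurable] by blast
 finally show ?thesis .
qed

text \<open>For disjoint boxes at most one permutation assigns the points to them, and one does
  exactly when each box holds one point and the rest of [0, R) none. The indicators summed over all
  permutations are therefore the indicator of an event about independent Poisson counts.\<close>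

lemma prob_boxes_disjoint:
 assumes A: "\<And>i. i < n ==> A i \<in> sets borel" "\<And>i. i < n ==> A i \<subseteq> {0..<R}"
  and disj: "disjoint_family_on A {..<n}" and R: "0 <= R"
 shows "(\<Sum>p\<in>perms n. prob {w\<in>occupied R n. \<forall>i<n. t (int (p i)) w \<in> A i}) =
      exp (- R) * (\<Prod>i<n. measure lborel (A i))"
proof -
 \<comment> \<open>Cell number n is what the boxes leave of [0, R); its prescribed count is 0, that
   of every box is 1.\<close>
 define B where "B i = (if i < n then A i else {0..<R} - (\<Union>i<n. A i))" for i
 define m where "m i = (if i < n then 1 else 0 :: nat)" for i
 have B: "B i \<in> sets borel" "B i \<subseteq> {0..<R}" for i
  using A by (auto simp: B_def)
 have Bb: "bounded (B i)" for i using bounded_subset[OF _ B(2)[of i]] by auto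
 have dB: "disjoint_family_on B {..n}"
  using disj unfolding disjoint_family_on_def B_def by auto
 have ind: "indep_vars (\<lambda>_. borel) (\<lambda>i. point_count t (B i)) {..n}"
 proof -
  have "\<forall>(I::nat set) A. finite I \<and> (\<forall>i\<in>I. A i \<in> sets borel \<and> bounded (A i)) \<and> disjoint_family_on A I
    --> indep_vars (\<lambda>_. borel) (\<lambda>i. point_count t (A i)) I"
   using iid unfolding iid_marked_poisson_def unit_poisson_points_def by blast
  from this[rule_format, of "{..n}" B] show ?thesis using B Bb dB by simp
 qed
 have [measurable]: "point_count t (B i) \<in> borel_measurable P" for i
  by (rule point_count_measurable) (use B Bb in auto)
 have [measurable]: "{x::ennreal} \<in> sets borel" for x by simp
 let ?E = "{w\<in>space P. \<forall>i\<le>n. point_count t (B i) w = of_nat (m i)}"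
 let ?X = "\<lambda>p. {w\<in>occupied R n. \<forall>i<n. t (int (p i)) w \<in> A i}"
 have mX: "?X p \<in> sets P" for p
  using A by (intro box_event_measurable) auto
 have mE: "?E \<in> sets P" by measurable
 have ae: "AE w in P. (\<Sum>p\<in>perms n. indicator (?X p) w) = (indicator ?E w :: real)"
  using AE_occupied_index AE_occupied_iff AE_space
 proof eventually_elim
  case (elim w)
  note idx = elim(1) and occ = elim(2) and sp = elim(3)
  have cnt: "point_count t {0..<R} w = (\<Sum>i\<le>n. point_count t (B i) w)"
  proof -
   have "{l. t l w \<in> {0..<R}} = (\<Union>i\<in>{..n}. {l. t l w \<in> B i})"
   proof -
    have "{0..<R} = (\<Union>i\<in>{..n}. B i)"
     using A unfolding B_def by (auto simp: le_less split: if_splits)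
    thus ?thesis by auto
   qed
   thus ?thesis unfolding point_count_def
    using dB by (subst sum_emeasure) (auto simp: disjoint_family_on_def)
  qed
  show ?case
  proof (cases "w \<in> occupied R n")
   case False
   have "w \<notin> ?E"
   proof
    assume "w \<in> ?E"
    hence "point_count t {0..<R} w = (\<Sum>i\<le>n. of_nat (m i))" unfolding cnt by simp
    also have "... = of_nat (\<Sum>i\<le>n. m i)" by simp
    also have "(\<Sum>i\<le>n. m i) = (\<Sum>i<n. 1)"
     unfolding m_def by (subst lessThan_Suc_atMost[symmetric]) simp
    finally have "w \<in> occupied R n" using occ by simp
    thus False using False by simp
   qed
   thus ?thesis using False by simp
  next
   case True
   have S: "{l. t l w \<in> {0..<R}} = {0..<int n}" using idx True by auto
   have inB: "\<exists>k<n. l = int k" if "t l w \<in> B i" for l i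
   proof -
    have "l \<in> {l. t l w \<in> {0..<R}}" using that B(2)[of i] by blast
    hence "l \<in> {0..<int n}" unfolding S .
    thus ?thesis by (intro exI[of _ "nat l"]) auto
   qed
   let ?Sg = "{p\<in>perms n. \<forall>i<n. t (int (p i)) w \<in> A i}"
   have sumcard: "(\<Sum>p\<in>perms n. indicator (?X p) w) = real (card ?Sg)"
   proof -
    have "(\<Sum>p\<in>perms n. indicator (?X p) w) = (\<Sum>p\<in>perms n. if \<forall>i<n. t (int (p i)) w \<in> A i then 1 else 0 :: real)"
     using True by (intro sum.cong) (auto simp: indicator_def)
    also have "... = real (card ?Sg)"
     by (subst sum.If_cases) (auto simp: finite_permutations Int_def)
    finally show ?thesis .
   qed
   have one: "{l. t l w \<in> B i} = {int (p i)}" if s: "p \<in> ?Sg" and i: "i < n" for p i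
   proof (intro equalityI subsetI)
    fix l assume l: "l \<in> {l. t l w \<in> B i}"
    then obtain k where k: "k < n" "l = int k" using inB by blast
    obtain i' where i': "i' < n" "p i' = k"
     using s k permutes_image[of p "{..<n}"] by (metis (no_types, lifting) image_iff lessThan_iff mem_Collect_eq)
    have "t l w \<in> A i'" using s i' k by auto
    hence "i' = i" using l i i' disj unfolding B_def disjoint_family_on_def by force
    thus "l \<in> {int (p i)}" using i' k by simp
   next
    fix l assume "l \<in> {int (p i)}"
    thus "l \<in> {l. t l w \<in> B i}" using s i unfolding B_def by auto
   qed
   show ?thesis
   proof (cases "?Sg = {}")
    case nonempty: False
    then obtain p where s: "p \<in> ?Sg" by blast
    have "?Sg = {p}"
    proof (intro equalityI subsetI)
     fix \<tau> assume \<tau>: "\<tau> \<in> ?Sg"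
     have "\<tau> i = p i" for i
     proof (cases "i < n")
      case True
      have "{int (\<tau> i)} = {int (p i)}" using one[OF \<tau> True] one[OF s True] by simp
      thus ?thesis by simp
     next
      case False
      thus ?thesis using \<tau> s by (auto simp: permutes_def)
     qed
     thus "\<tau> \<in> {p}" by auto
    qed (use s in auto)
    hence "real (card ?Sg) = 1" by simp
    moreover have "w \<in> ?E"
    proof -
     have "point_count t (B i) w = of_nat (m i)" if "i <= n" for i
     proof (cases "i < n")
      case True
      thus ?thesis unfolding point_count_def one[OF s True] m_def by simp
     next
      case False
      have "{l. t l w \<in> B i} = {}"
      proof (rule ccontr)
       assume "{l. t l w \<in> B i} \<noteq> {}"
       then obtain l where l: "t l w \<in> B i" by blast
       then obtain k where k: "k < n" "l = int k" using inB by blast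
       obtain i' where i': "i' < n" "p i' = k"
        using s k permutes_image[of p "{..<n}"] by (metis (no_types, lifting) image_iff lessThan_iff mem_Collect_eq)
       have "t l w \<in> A i'" using s i' k by auto
       thus False using l i' False unfolding B_def by auto
      qed
      thus ?thesis unfolding point_count_def m_def using False by simp
     qed
     thus ?thesis using sp by auto
    qed
    ultimately show ?thesis unfolding sumcard by simp
   next
    case empty: True
    have "w \<notin> ?E"
    proof
     assume "w \<in> ?E"
     hence c1: "emeasure (count_space UNIV) {l. t l w \<in> B i} = 1" if "i < n" for i
      using that unfolding point_count_def m_def by auto
     have ex: "\<exists>k<n. t (int k) w \<in> A i" if "i < n" for i
     proof -
      have "{l. t l w \<in> B i} \<noteq> {}" using c1[OF that] by (metis emeasure_empty zero_neq_one)
      then obtain l where l: "t l w \<in> B i" by blast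
      then obtain k where "k < n" "l = int k" using inB by blast
      thus ?thesis using l that unfolding B_def by auto
     qed
     then obtain f where f: "\<And>i. i < n ==> f i < n \<and> t (int (f i)) w \<in> A i" by metis
     define p where "p i = (if i < n then f i else i)" for i
     have "inj_on p {..<n}"
     proof (rule inj_onI)
      fix x y assume xy: "x \<in> {..<n}" "y \<in> {..<n}" "p x = p y"
      hence "t (int (f x)) w \<in> A x \<inter> A y" using f[of x] f[of y] unfolding p_def by auto
      thus "x = y" using xy disj unfolding disjoint_family_on_def by blast
     qed
     moreover have "p ` {..<n} \<subseteq> {..<n}" using f unfolding p_def by auto
     ultimately have "bij_betw p {..<n} {..<n}"
      unfolding bij_betw_def by (simp add: endo_inj_surj)
     hence "p permutes {..<n}" by (rule bij_imp_permutes) (simp add: p_def)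
     hence "p \<in> ?Sg" using f unfolding p_def by auto
     hence "p \<in> {}" unfolding empty .
     thus False by simp
    qed
    thus ?thesis unfolding sumcard empty by simp
   qed
  qed
 qed
 have iX: "integrable P (indicator (?X p) :: 'a => real)" for p
  by (intro integrable_real_indicator mX) (simp add: emeasure_eq_measure)
 have sX: "expectation (indicator (?X p)) = prob (?X p)" for p
  by (subst Bochner_Integration.integral_indicator) (simp_all add: Int_absorb2 sets.sets_into_space[OF mX])
 have "(\<Sum>p\<in>perms n. prob (?X p)) = (\<Sum>p\<in>perms n. expectation (indicator (?X p)))"
  unfolding sX ..
 also have "... = expectation (\<lambda>w. \<Sum>p\<in>perms n. indicator (?X p) w)"
  by (rule lint_sum[symmetric]) (rule iX)
 also have "... = expectation (indicator ?E)"
 proof (rule integral_cong_AE)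
  show "(\<lambda>w. \<Sum>p\<in>perms n. indicator (?X p) w :: real) \<in> borel_measurable P"
   by (intro borel_measurable_sum borel_measurable_indicator mX)
  show "(indicator ?E :: 'a => real) \<in> borel_measurable P"
   by (intro borel_measurable_indicator mE)
  show "AE w in P. (\<Sum>p\<in>perms n. indicator (?X p) w) = (indicator ?E w :: real)" by (rule ae)
 qed
 also have "... = prob ?E"
  by (subst Bochner_Integration.integral_indicator) (simp_all add: Int_absorb2 sets.sets_into_space[OF mE])
 also have "?E = (\<Inter>i\<in>{..n}. point_count t (B i) -` {of_nat (m i)} \<inter> space P)" by auto
 also have "prob ... = (\<Prod>i\<in>{..n}. prob (point_count t (B i) -` {of_nat (m i)} \<inter> space P))"
  by (rule indep_varsD_finite[OF ind]) auto
 also have "... = (\<Prod>i\<in>{..n}. exp (- measure lborel (B i)) * measure lborel (B i) ^ m i / fact (m i))"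
 proof (intro prod.cong refl)
  fix i
  have "point_count t (B i) -` {of_nat (m i)} \<inter> space P = {w\<in>space P. point_count t (B i) w = of_nat (m i)}" by auto
  thus "prob (point_count t (B i) -` {of_nat (m i)} \<inter> space P) = exp (- measure lborel (B i)) * measure lborel (B i) ^ m i / fact (m i)"
   using prob_point_count[OF B(1) Bb] by simp
 qed
 \<comment> \<open>The cells partition [0, R), so the exponential factors multiply to exp (- R); of
   the other factors each box keeps its length and the remaining cell keeps 1.\<close>
 also have "... = (\<Prod>i\<le>n. exp (- measure lborel (B i))) * (\<Prod>i\<le>n. measure lborel (B i) ^ m i / fact (m i))"
  by (subst prod.distrib[symmetric]) simp
 also have "(\<Prod>i\<le>n. exp (- measure lborel (B i))) = exp (- (\<Sum>i\<le>n. measure lborel (B i)))"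
  by (simp add: exp_sum sum_negf[symmetric] del: sum_negf)
 also have "(\<Sum>i\<le>n. measure lborel (B i)) = measure lborel (\<Union>i\<in>{..n}. B i)"
 proof (rule measure_finite_Union[symmetric])
  show "emeasure lborel (B i) \<noteq> \<infinity>" for i
   using emeasure_mono[OF B(2)[of i], of lborel] R by (auto simp: top_unique)
 qed (use B dB in auto)
 also have "(\<Union>i\<in>{..n}. B i) = {0..<R}"
  using A unfolding B_def by (auto simp: le_less split: if_splits)
 also have "(\<Prod>i\<le>n. measure lborel (B i) ^ m i / fact (m i)) = (\<Prod>i<n. measure lborel (A i))"
  by (subst lessThan_Suc_atMost[symmetric]) (simp add: m_def B_def)
 finally show ?thesis using R by simp
qed

end

text \<open>Union bound over the pairs on which c collides: prescribing c i = c j leaves m^(n - 1)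
  maps. The factor m on the left avoids a subtraction in the exponent.\<close>

lemma card_not_inj_le:
 "card {c \<in> {..<n} \<rightarrow>\<^sub>E {..<m::nat}. \<not> inj_on c {..<n}} * m <= n^2 * m ^ n"
proof -
 let ?P = "{..<n} \<rightarrow>\<^sub>E {..<m}"
 let ?E = "\<lambda>(i,j). {c \<in> ?P. c i = c j}"
 have one: "card (?E (i, j)) * m <= m ^ n" if "i < n" "j < n" "i \<noteq> j" for i j
 proof -
  have "inj_on (\<lambda>c. restrict c ({..<n} - {j})) (?E (i, j))"
  proof (rule inj_onI, clarsimp)
   fix x y assume x: "x \<in> ?P" "x i = x j" and y: "y \<in> ?P" "y i = y j"
    and eq: "restrict x ({..<n} - {j}) = restrict y ({..<n} - {j})"
   show "x = y"
   proof (rule PiE_ext[OF x(1) y(1)])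
    fix k assume k: "k \<in> {..<n}"
    have e: "x k = y k" if "k \<noteq> j" "k < n" for k using fun_cong[OF eq, of k] that by simp
    show "x k = y k"
    proof (cases "k = j")
     case True
     thus ?thesis using e[of i] that x y by simp
    qed (use e k in auto)
   qed
  qed
  hence "card (?E (i, j)) = card ((\<lambda>c. restrict c ({..<n} - {j})) ` ?E (i, j))"
   by (simp add: card_image)
  also have "... <= card (({..<n} - {j}) \<rightarrow>\<^sub>E {..<m})"
   by (intro card_mono finite_PiE) (auto simp: PiE_iff split: if_splits)
  also have "... = m ^ (n - 1)" using that by (simp add: card_PiE)
  finally have "card (?E (i, j)) * m <= m ^ (n - 1) * m" by simp
  also have "... = m ^ n" using that by (cases n) auto
  finally show ?thesis .
 qed
 have "{c \<in> ?P. \<not> inj_on c {..<n}} \<subseteq> (\<Union>p\<in>{p\<in>{..<n}\<times>{..<n}. fst p \<noteq> snd p}. ?E p)"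
  by (force simp: inj_on_def)
 hence "card {c \<in> ?P. \<not> inj_on c {..<n}} <= card (\<Union>p\<in>{p\<in>{..<n}\<times>{..<n}. fst p \<noteq> snd p}. ?E p)"
  by (intro card_mono finite_UN_I) (auto intro: finite_PiE finite_subset[of _ ?P])
 also have "... <= (\<Sum>p\<in>{p\<in>{..<n}\<times>{..<n}. fst p \<noteq> snd p}. card (?E p))"
  by (rule card_UN_le) simp
 finally have "card {c \<in> ?P. \<not> inj_on c {..<n}} * m <= (\<Sum>p\<in>{p\<in>{..<n}\<times>{..<n}. fst p \<noteq> snd p}. card (?E p) * m)"
  by (simp add: sum_distrib_right[symmetric])
 also have "... <= (\<Sum>p\<in>{p\<in>{..<n}\<times>{..<n}. fst p \<noteq> snd p}. m ^ n)"
  by (rule sum_mono) (use one in auto)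
 also have "... = card {p\<in>{..<n}\<times>{..<n}. fst p \<noteq> snd p} * m ^ n" by simp
 also have "... <= card ({..<n}\<times>{..<n}) * m ^ n"
  by (intro mult_right_mono card_mono) auto
 finally show ?thesis by (simp add: power2_eq_square)
qed

context marked_points begin

text \<open>Overlapping boxes are cut along a grid of m equal cells. Assignments of distinct cells
  produce disjoint boxes, for which equality is known; the contribution of all other assignments is
  O(1 / m) on both sides, and m is arbitrary.\<close>

lemma prob_boxes:
 assumes A: "\<And>i. i < n ==> A i \<in> sets borel" "\<And>i. i < n ==> A i \<subseteq> {0..<R}" and R: "0 < R"
 shows "(\<Sum>s\<in>perms n. prob {y\<in>occupied R n. \<forall>i<n. t (int (s i)) y \<in> A i}) =
      exp (- R) * (\<Prod>i<n. measure lborel (A i))"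
proof -
 define X where "X A s = {y\<in>occupied R n. \<forall>i<n. t (int (s i)) y \<in> A i}" for A :: "nat => real set" and s
 define G where "G A = (\<Sum>s\<in>perms n. prob (X A s))" for A
 define V where "V A = exp (- R) * (\<Prod>i<n. measure lborel (A i))" for A :: "nat => real set"
 define ok where "ok A \<longleftrightarrow> (\<forall>i<n. A i \<in> sets borel \<and> A i \<subseteq> {0..<R})" for A
 have mX: "X A s \<in> sets P" if "ok A" for A s
  using that unfolding X_def ok_def by (intro box_event_measurable) auto
 have G0: "0 <= G A" for A unfolding G_def by (simp add: sum_nonneg)
 have V0: "0 <= V A" for A unfolding V_def by (simp add: prod_nonneg)
 have fin: "emeasure lborel S \<noteq> \<infinity>" if "S \<subseteq> {0..<R}" for S
  using emeasure_mono[OF that, of lborel] R by (auto simp: top_unique)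
 have Gmono: "G A <= G B" if "ok A" "ok B" "\<And>i. i < n ==> A i \<subseteq> B i" for A B
  unfolding G_def
  by (intro sum_mono finite_measure_mono mX that) (use that(3) in \<open>force simp: X_def\<close>)
 have Vmono: "V A <= V B" if "ok A" "ok B" "\<And>i. i < n ==> A i \<subseteq> B i" for A B
  unfolding V_def
  by (intro mult_left_mono prod_mono conjI measure_mono_fmeasurable that)
    (use that fin in \<open>auto simp: ok_def fmeasurable_def less_top[symmetric]\<close>)
 define C where "C m c = {real c * R / real m ..< (real c + 1) * R / real m}" for m c :: nat
 have C: "C m c \<in> sets borel" "C m c \<subseteq> {0..<R}" if "c < m" for m c
 proof -
  have "(real c + 1) * R <= real m * R" using that R by (intro mult_right_mono) auto
  thus "C m c \<subseteq> {0..<R}" using that R unfolding C_def by (auto simp: field_simps)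
 qed (simp add: C_def)
 have Cm: "measure lborel (C m c) = R / m" if "0 < m" for m c
  unfolding C_def using R that by (simp add: field_simps divide_right_mono)
 have Cdisj: "C m c \<inter> C m c' = {}" if "0 < m" "c \<noteq> c'" for m c c'
 proof -
  have *: "C m c \<inter> C m c' = {}" if lt: "c < c'" for c c'
  proof -
   have "(real c + 1) * R <= real c' * R" using lt R by (intro mult_right_mono) auto
   hence "(real c + 1) * R / m <= real c' * R / m" using \<open>0 < m\<close> by (intro divide_right_mono) auto
   thus ?thesis unfolding C_def by auto
  qed
  show ?thesis using *[of c c'] *[of c' c] that by (cases "c < c'") auto
 qed
 have Ccover: "\<exists>c<m. x \<in> C m c" if "0 < m" "x \<in> {0..<R}" for m x
 proof -
  define c where "c = nat \<lfloor>x * m / R\<rfloor>"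
  have "real c <= x * m / R" "x * m / R < real c + 1"
   unfolding c_def using that R by (auto simp: le_nat_floor) 
  hence *: "real c * R / m <= x" "x < (real c + 1) * R / m" using R that by (auto simp: field_simps)
  have "x * m / R < m" using that R by (simp add: field_simps)
  hence "c < m" using \<open>real c <= x * m / R\<close> by linarith
  thus ?thesis using * unfolding C_def by auto
 qed
 let ?P = "\<lambda>m. {..<n} \<rightarrow>\<^sub>E {..<m::nat}"
 have finP: "finite (?P m)" for m by (intro finite_PiE) auto
 have okc: "ok (\<lambda>i. A i \<inter> C m (c i))" if "ok A" "c \<in> ?P m" for A m c
  using that C unfolding ok_def by (auto simp: PiE_iff)
 \<comment> \<open>Each point lies in exactly one cell, so both sides of the claim are additive over
   the assignments c of cells to coordinates.\<close>
 have Gsplit: "G A = (\<Sum>c\<in>?P m. G (\<lambda>i. A i \<inter> C m (c i)))" if m: "0 < m" and A: "ok A" for A m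
 proof -
  have "prob (X A s) = (\<Sum>c\<in>?P m. prob (X (\<lambda>i. A i \<inter> C m (c i)) s))" for s
  proof -
   have "X A s = (\<Union>c\<in>?P m. X (\<lambda>i. A i \<inter> C m (c i)) s)"
   proof (intro equalityI subsetI)
    fix y assume w: "y \<in> X A s"
    have "\<exists>c<m. t (int (s i)) y \<in> C m c" if "i < n" for i
    proof (rule Ccover[OF m])
     have "A i \<subseteq> {0..<R}" "t (int (s i)) y \<in> A i" using w A that unfolding X_def ok_def by auto
     thus "t (int (s i)) y \<in> {0..<R}" by blast
    qed
    then obtain c where c: "\<And>i. i < n ==> c i < m \<and> t (int (s i)) y \<in> C m (c i)" by metis
    show "y \<in> (\<Union>c\<in>?P m. X (\<lambda>i. A i \<inter> C m (c i)) s)"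
     using c w by (intro UN_I[of "restrict c {..<n}"]) (auto simp: X_def)
   qed (auto simp: X_def)
   also have "prob ... = (\<Sum>c\<in>?P m. prob (X (\<lambda>i. A i \<inter> C m (c i)) s))"
   proof (rule finite_measure_finite_Union[OF finP])
    show "(\<lambda>c. X (\<lambda>i. A i \<inter> C m (c i)) s) ` ?P m \<subseteq> events" using mX okc[OF A] by blast
    show "disjoint_family_on (\<lambda>c. X (\<lambda>i. A i \<inter> C m (c i)) s) (?P m)"
    proof (unfold disjoint_family_on_def, intro ballI impI)
     fix c c' assume c: "c \<in> ?P m" "c' \<in> ?P m" "c \<noteq> c'"
     then obtain i where "i < n" "c i \<noteq> c' i" by (metis PiE_ext lessThan_iff)
     thus "X (\<lambda>i. A i \<inter> C m (c i)) s \<inter> X (\<lambda>i. A i \<inter> C m (c' i)) s = {}"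
      using Cdisj[OF m, of "c i" "c' i"] unfolding X_def by fastforce
    qed
   qed
   finally show ?thesis .
  qed
  thus ?thesis unfolding G_def by (subst sum.swap) simp
 qed
 have Vsplit: "V A = (\<Sum>c\<in>?P m. V (\<lambda>i. A i \<inter> C m (c i)))" if m: "0 < m" and A: "ok A" for A m
 proof -
  have "measure lborel (A i) = (\<Sum>c\<in>{..<m}. measure lborel (A i \<inter> C m c))" if i: "i < n" for i
  proof -
   have "A i = (\<Union>c\<in>{..<m}. A i \<inter> C m c)" using A i Ccover[OF m] unfolding ok_def by fast
   also have "measure lborel ... = (\<Sum>c\<in>{..<m}. measure lborel (A i \<inter> C m c))"
   proof (rule measure_finite_Union)
    show "(\<lambda>c. A i \<inter> C m c) ` {..<m} \<subseteq> sets lborel" using A C i unfolding ok_def by auto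
    show "disjoint_family_on (\<lambda>c. A i \<inter> C m c) {..<m}"
     using Cdisj[OF m] unfolding disjoint_family_on_def by blast
    show "emeasure lborel (A i \<inter> C m c) \<noteq> \<infinity>" for c
     using A i unfolding ok_def by (intro fin) auto
   qed simp
   finally show ?thesis .
  qed
  hence "(\<Prod>i<n. measure lborel (A i)) = (\<Prod>i<n. \<Sum>c\<in>{..<m}. measure lborel (A i \<inter> C m c))"
   by (intro prod.cong) auto
  also have "... = (\<Sum>c\<in>?P m. \<Prod>i<n. measure lborel (A i \<inter> C m (c i)))"
   by (rule prod_sum_PiE) auto
  finally show ?thesis unfolding V_def by (simp add: sum_distrib_left)
 qed
 have eq_inj: "G (\<lambda>i. A i \<inter> C m (c i)) = V (\<lambda>i. A i \<inter> C m (c i))"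
  if "0 < m" "ok A" "c \<in> ?P m" "inj_on c {..<n}" for A m c
  unfolding G_def V_def X_def
 proof (rule prob_boxes_disjoint)
  show "disjoint_family_on (\<lambda>i. A i \<inter> C m (c i)) {..<n}"
   unfolding disjoint_family_on_def
  proof (intro ballI impI)
   fix i j assume "i \<in> {..<n}" "j \<in> {..<n}" "i \<noteq> j"
   hence "c i \<noteq> c j" using that by (auto simp: inj_on_def)
   thus "(A i \<inter> C m (c i)) \<inter> (A j \<inter> C m (c j)) = {}" using Cdisj[OF that(1)] by blast
  qed
 qed (use okc[OF that(2,3)] R in \<open>auto simp: ok_def\<close>)
 \<comment> \<open>For full boxes the totals on both sides agree by \<open>prob_occupied\<close>.
   Subtracting the injective assignments gives equality of the non-injective parts, and by
   monotonicity these dominate the corresponding parts for A.\<close>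
 define Full where "Full = (\<lambda>_::nat. {0..<R})"
 have okF: "ok Full" unfolding ok_def Full_def by auto
 have GF: "G Full = V Full"
 proof -
  have "X Full s = occupied R n" if "s \<in> perms n" for s
   using that permutes_in_image[of s "{..<n}"] unfolding X_def Full_def occupied_def by auto
  hence "G Full = fact n * prob (occupied R n)"
   unfolding G_def by (simp add: card_permutations)
  also have "... = exp (- R) * R ^ n" using prob_occupied[of R n] R by simp
  finally show ?thesis unfolding V_def Full_def using R by simp
 qed
 have bound: "\<bar>G A - V A\<bar> <= exp (- R) * R ^ n * real (n^2) / real m" if m: "0 < m" and okA: "ok A" for A m
 proof -
  let ?N = "{c \<in> ?P m. \<not> inj_on c {..<n}}"
  have split: "(\<Sum>c\<in>?P m. f c) = (\<Sum>c\<in>?P m - ?N. f c) + (\<Sum>c\<in>?N. f c)" for f :: "_ => real"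
   by (rule sum.subset_diff) (use finP in auto)
  have inj_eq: "(\<Sum>c\<in>?P m - ?N. G (\<lambda>i. B i \<inter> C m (c i))) = (\<Sum>c\<in>?P m - ?N. V (\<lambda>i. B i \<inter> C m (c i)))"
   if "ok B" for B
   by (rule sum.cong) (use eq_inj[OF m that] in auto)
  have rest: "(\<Sum>c\<in>?N. G (\<lambda>i. Full i \<inter> C m (c i))) = (\<Sum>c\<in>?N. V (\<lambda>i. Full i \<inter> C m (c i)))"
   using Gsplit[OF m okF] Vsplit[OF m okF] GF inj_eq[OF okF] unfolding split by simp
  have "V (\<lambda>i. Full i \<inter> C m (c i)) = exp (- R) * (R / m) ^ n" if "c \<in> ?N" for c
  proof -
   have "Full i \<inter> C m (c i) = C m (c i)" if "i < n" for i
   proof -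
    have "c i < m" using \<open>c \<in> ?N\<close> that by (auto simp: PiE_iff)
    thus ?thesis using C(2)[of "c i" m] unfolding Full_def by blast
   qed
   thus ?thesis unfolding V_def by (simp add: Cm[OF m])
  qed
  hence "(\<Sum>c\<in>?N. V (\<lambda>i. Full i \<inter> C m (c i))) = real (card ?N) * (exp (- R) * (R / m) ^ n)" by simp
  also have "... = exp (- R) * R ^ n * (real (card ?N * m) / (real (m ^ n))) / real m"
   using m by (simp add: power_divide field_simps)
  also have "... <= exp (- R) * R ^ n * real (n^2) / real m"
  proof (intro divide_right_mono mult_left_mono)
   have "real (card ?N * m) <= real (n^2 * m ^ n)" using card_not_inj_le[of n m] by (simp only: of_nat_le_iff)
   thus "real (card ?N * m) / (real (m ^ n)) <= real (n^2)" using m by (simp add: field_simps)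
  qed (use R in auto)
  finally have small: "(\<Sum>c\<in>?N. V (\<lambda>i. Full i \<inter> C m (c i))) <= exp (- R) * R ^ n * real (n^2) / real m" .
  have A_sub: "A i \<inter> C m (c i) \<subseteq> Full i \<inter> C m (c i)" if "i < n" for i c
   using okA that unfolding ok_def Full_def by auto
  have GA: "(\<Sum>c\<in>?N. G (\<lambda>i. A i \<inter> C m (c i))) <= (\<Sum>c\<in>?N. G (\<lambda>i. Full i \<inter> C m (c i)))"
   by (intro sum_mono Gmono okc okA okF A_sub) auto
  have VA: "(\<Sum>c\<in>?N. V (\<lambda>i. A i \<inter> C m (c i))) <= (\<Sum>c\<in>?N. V (\<lambda>i. Full i \<inter> C m (c i)))"
   by (intro sum_mono Vmono okc okA okF A_sub) auto
  have "G A - V A = (\<Sum>c\<in>?N. G (\<lambda>i. A i \<inter> C m (c i))) - (\<Sum>c\<in>?N. V (\<lambda>i. A i \<inter> C m (c i)))"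
   using Gsplit[OF m okA] Vsplit[OF m okA] inj_eq[OF okA] unfolding split by simp
  moreover have "0 <= (\<Sum>c\<in>?N. G (\<lambda>i. A i \<inter> C m (c i)))" "0 <= (\<Sum>c\<in>?N. V (\<lambda>i. A i \<inter> C m (c i)))"
   using G0 V0 by (auto intro: sum_nonneg)
  ultimately show ?thesis using GA VA rest small by linarith
 qed
 have okA: "ok A" using A unfolding ok_def by auto
 have "\<bar>G A - V A\<bar> <= 0"
 proof (rule tendsto_lowerbound)
  show "(\<lambda>m. exp (- R) * R ^ n * real (n^2) / real m) \<longlonglongrightarrow> 0"
   by (rule lim_const_over_n)
  show "\<forall>\<^sub>F m in sequentially. \<bar>G A - V A\<bar> <= exp (- R) * R ^ n * real (n^2) / real m"
   using eventually_gt_at_top[of 0] by eventually_elim (use bound okA in auto)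
 qed simp
 thus ?thesis unfolding G_def V_def X_def by simp
qed

end

text \<open>The law of one source, given the number of points in [0, R) and disregarding their
  order: a uniform starting time and an independent mark.\<close>

definition sample_space :: "real => (real \<times> real) measure => (real \<times> real \<times> real) measure" where
 "sample_space R \<nu> = uniform_measure lborel {0..<R} \<Otimes>\<^sub>M \<nu>"

lemma measurable_pair_count_space:
 assumes "countable A" "\<And>x. x \<in> A ==> f x \<in> measurable N K"
 shows "(\<lambda>(x, y). f x y) \<in> measurable (count_space A \<Otimes>\<^sub>M N) K"
 by (rule measurable_pair_measure_countable1) (simp_all add: assms)

text \<open>Turns a sum of image measures over permutations into a single image measure, to which
  the uniqueness theorems for product measures apply.\<close>

lemma emeasure_distr_count_space_pair:
 assumes "finite A" "\<And>x. x \<in> A ==> f x \<in> measurable N K" "finite_measure N" "B \<in> sets K"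
 shows "emeasure (distr (count_space A \<Otimes>\<^sub>M N) K (\<lambda>(x, y). f x y)) B = (\<Sum>x\<in>A. emeasure N (f x -` B \<inter> space N))"
proof -
 interpret N: finite_measure N by fact
 interpret A: sigma_finite_measure "count_space A"
  using assms(1) by (rule sigma_finite_measure_count_space_finite)
 interpret pair_sigma_finite "count_space A" N ..
 have m: "(\<lambda>(x, y). f x y) \<in> measurable (count_space A \<Otimes>\<^sub>M N) K"
  using assms by (intro measurable_pair_count_space countable_finite) auto
 have "emeasure (distr (count_space A \<Otimes>\<^sub>M N) K (\<lambda>(x, y). f x y)) B =
   emeasure (count_space A \<Otimes>\<^sub>M N) ((\<lambda>(x, y). f x y) -` B \<inter> space (count_space A \<Otimes>\<^sub>M N))"
  by (rule emeasure_distr[OF m assms(4)])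
 also have "... = (\<integral>\<^sup>+x. emeasure N (Pair x -` ((\<lambda>(x, y). f x y) -` B \<inter> space (count_space A \<Otimes>\<^sub>M N))) \<partial>count_space A)"
  by (rule N.emeasure_pair_measure_alt) (rule measurable_sets[OF m assms(4)])
 also have "... = (\<Sum>x\<in>A. emeasure N (Pair x -` ((\<lambda>(x, y). f x y) -` B \<inter> space (count_space A \<Otimes>\<^sub>M N))))"
  using assms(1) by (rule nn_integral_count_space_finite)
 also have "... = (\<Sum>x\<in>A. emeasure N (f x -` B \<inter> space N))"
  by (intro sum.cong refl arg_cong[where f="emeasure N"]) (auto simp: space_pair_measure)
 finally show ?thesis .
qed

text \<open>The sides \<open>D i\<close> are arbitrary sets of the product sigma-algebra, not
  rectangles; the product formula is therefore obtained by integrating out the two families of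
  coordinates one after the other.\<close>

lemma PiM_pair_eq_distr_zip:
 assumes "finite I" "prob_space A" "prob_space B"
 shows "distr (PiM I (\<lambda>_. A) \<Otimes>\<^sub>M PiM I (\<lambda>_. B)) (PiM I (\<lambda>_. A \<Otimes>\<^sub>M B)) (\<lambda>(x, y). \<lambda>i\<in>I. (x i, y i))
  = PiM I (\<lambda>_. A \<Otimes>\<^sub>M B)"
proof -
 interpret A: prob_space A by fact
 interpret B: prob_space B by fact
 interpret AB: pair_prob_space A B ..
 interpret PA: product_prob_space "\<lambda>_. A" I ..
 interpret PB: product_prob_space "\<lambda>_. B" I ..
 interpret PAB: product_sigma_finite "\<lambda>_. A \<Otimes>\<^sub>M B" ..
 interpret PA': prob_space "PiM I (\<lambda>_. A)" by (rule prob_space_PiM) (simp add: assms)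
 interpret PB': prob_space "PiM I (\<lambda>_. B)" by (rule prob_space_PiM) (simp add: assms)
 interpret PP: pair_prob_space "PiM I (\<lambda>_. A)" "PiM I (\<lambda>_. B)" ..
 let ?z = "\<lambda>(x, y). \<lambda>i\<in>I. (x i, y i)"
 have mz: "?z \<in> measurable (PiM I (\<lambda>_. A) \<Otimes>\<^sub>M PiM I (\<lambda>_. B)) (PiM I (\<lambda>_. A \<Otimes>\<^sub>M B))"
  by (simp add: split_beta') 
 show ?thesis
 proof (rule PAB.PiM_eqI[OF assms(1)])
  fix D assume D: "\<And>i. i \<in> I ==> D i \<in> sets (A \<Otimes>\<^sub>M B)"
  have DP: "Pi\<^sub>E I D \<in> sets (PiM I (\<lambda>_. A \<Otimes>\<^sub>M B))" using D assms(1) by (intro sets_PiM_I_finite) auto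
  have "emeasure (distr (PiM I (\<lambda>_. A) \<Otimes>\<^sub>M PiM I (\<lambda>_. B)) (PiM I (\<lambda>_. A \<Otimes>\<^sub>M B)) ?z) (Pi\<^sub>E I D)
    = (\<integral>\<^sup>+p. indicator (Pi\<^sub>E I D) (?z p) \<partial>(PiM I (\<lambda>_. A) \<Otimes>\<^sub>M PiM I (\<lambda>_. B)))"
   using nn_integral_distr[OF mz, of "indicator (Pi\<^sub>E I D)"] DP by simp
  also have "... = (\<integral>\<^sup>+x. \<integral>\<^sup>+y. indicator (Pi\<^sub>E I D) (?z (x, y)) \<partial>PiM I (\<lambda>_. B) \<partial>PiM I (\<lambda>_. A))"
   by (rule PB.P.nn_integral_fst[symmetric]) (use DP mz in measurable)
  also have "... = (\<integral>\<^sup>+x. \<integral>\<^sup>+y. (\<Prod>i\<in>I. indicator (D i) (x i, y i)) \<partial>PiM I (\<lambda>_. B) \<partial>PiM I (\<lambda>_. A))"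
   by (intro nn_integral_cong) (auto simp: indicator_def PiE_iff prod_zero_iff assms(1))
  also have "... = (\<integral>\<^sup>+x. (\<Prod>i\<in>I. \<integral>\<^sup>+b. indicator (D i) (x i, b) \<partial>B) \<partial>PiM I (\<lambda>_. A))"
  proof (rule nn_integral_cong)
   fix x assume x: "x \<in> space (PiM I (\<lambda>_. A))"
   show "(\<integral>\<^sup>+y. (\<Prod>i\<in>I. indicator (D i) (x i, y i)) \<partial>PiM I (\<lambda>_. B)) = (\<Prod>i\<in>I. \<integral>\<^sup>+b. indicator (D i) (x i, b) \<partial>B)"
   proof (rule PB.product_nn_integral_prod[OF assms(1)])
    fix i assume i: "i \<in> I"
    have "x i \<in> space A" using x i by (auto simp: space_PiM)
    thus "(\<lambda>b. indicator (D i) (x i, b)) \<in> borel_measurable B"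
     using D[OF i] by (intro measurable_compose[OF measurable_Pair1'[of "x i" A B]]) auto
   qed
  qed
  also have "... = (\<Prod>i\<in>I. \<integral>\<^sup>+a. \<integral>\<^sup>+b. indicator (D i) (a, b) \<partial>B \<partial>A)"
   by (rule PA.product_nn_integral_prod[OF assms(1)])
     (use D in \<open>auto intro!: B.borel_measurable_nn_integral simp: split_beta'\<close>)
  also have "... = (\<Prod>i\<in>I. emeasure (A \<Otimes>\<^sub>M B) (D i))"
   using D by (intro prod.cong refl) (simp add: B.nn_integral_fst)
  finally show "emeasure (distr (PiM I (\<lambda>_. A) \<Otimes>\<^sub>M PiM I (\<lambda>_. B)) (PiM I (\<lambda>_. A \<Otimes>\<^sub>M B)) ?z) (Pi\<^sub>E I D) =
   (\<Prod>i\<in>I. emeasure (A \<Otimes>\<^sub>M B) (D i))" .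
 qed simp
qed

context marked_points begin

lemma marks_PiM_law:
 fixes f :: "nat => int"
 assumes "inj_on f I"
 shows "distr P (PiM I (\<lambda>_. borel)) (\<lambda>w. \<lambda>i\<in>I. (\<eta> (f i) w, U (f i) w)) = PiM I (\<lambda>_. \<nu>)"
proof -
 let ?m = "\<lambda>l w. (\<eta> l w, U l w)"
 have "indep_vars (\<lambda>_. borel) ?m UNIV"
  using iid unfolding iid_marked_poisson_def by auto
 hence law: "distr P (PiM UNIV (\<lambda>_. borel)) (\<lambda>w. \<lambda>l\<in>UNIV. ?m l w) = PiM UNIV (\<lambda>_. \<nu>)"
  using indep_vars_iff_distr_eq_PiM[where I=UNIV and M'="\<lambda>_. borel" and X="?m"] marks_measurable mark_law by simp
 have mm: "(\<lambda>w. \<lambda>l\<in>UNIV. ?m l w) \<in> measurable P (PiM UNIV (\<lambda>_. borel))"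
  using marks_measurable by (intro measurable_restrict) auto
 have mf: "(\<lambda>w. \<lambda>n\<in>I. w (f n)) \<in> measurable (PiM UNIV (\<lambda>_. borel)) (PiM I (\<lambda>_. borel))"
  by (intro measurable_restrict measurable_component_singleton) auto
 have "PiM I (\<lambda>_. \<nu>) = distr (PiM UNIV (\<lambda>_. \<nu>)) (PiM I (\<lambda>_. \<nu>)) (\<lambda>w. \<lambda>n\<in>I. w (f n))"
  using distr_PiM_reindex[of UNIV "\<lambda>_. \<nu>" f I] prob_space_marks assms by simp
 also have "... = distr (PiM UNIV (\<lambda>_. \<nu>)) (PiM I (\<lambda>_. borel)) (\<lambda>w. \<lambda>n\<in>I. w (f n))"
  by (intro distr_cong refl sets_PiM_cong) auto
 also have "... = distr P (PiM I (\<lambda>_. borel)) ((\<lambda>w. \<lambda>n\<in>I. w (f n)) \<circ> (\<lambda>w. \<lambda>l\<in>UNIV. ?m l w))"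
  unfolding law[symmetric] by (rule distr_distr[OF mf mm])
 finally show ?thesis by (simp add: comp_def cong: restrict_cong)
qed

text \<open>The event \<open>occupied R n\<close> depends on the points only, so it can be absorbed
  into their side of the independence.\<close>

lemma points_marks_indep:
 fixes f :: "nat => int" and n :: nat
 assumes A: "A \<in> sets (PiM I (\<lambda>_. borel))" and C: "C \<in> sets (PiM I (\<lambda>_. borel))"
 shows "prob {w\<in>occupied R n. (\<lambda>i\<in>I. t (f i) w) \<in> A \<and> (\<lambda>i\<in>I. (\<eta> (f i) w, U (f i) w)) \<in> C} =
  prob {w\<in>occupied R n. (\<lambda>i\<in>I. t (f i) w) \<in> A} *
  prob {w\<in>space P. (\<lambda>i\<in>I. (\<eta> (f i) w, U (f i) w)) \<in> C}"
proof -
 let ?T = "\<lambda>w l. t l w" and ?M = "\<lambda>w l. (\<eta> l w, U l w)"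
 let ?B1 = "(\<Pi>\<^sub>M l\<in>(UNIV::int set). (borel :: real measure))" and ?B2 = "(\<Pi>\<^sub>M l\<in>(UNIV::int set). (borel :: (real \<times> real) measure))"
 have ind: "indep_set (sets (vimage_algebra (space P) ?M ?B2)) (sets (vimage_algebra (space P) ?T ?B1))"
  using iid unfolding iid_marked_poisson_def by auto
 have mf: "(\<lambda>x. \<lambda>i\<in>I. x (f i)) \<in> measurable ?B1 (PiM I (\<lambda>_. borel))"
   "(\<lambda>x. \<lambda>i\<in>I. x (f i)) \<in> measurable ?B2 (PiM I (\<lambda>_. borel))"
  by (intro measurable_restrict measurable_component_singleton; simp)+
 define A' where "A' = {x\<in>space ?B1. (\<forall>i<n. x (int i) \<in> {0..<R}) \<and> R <= x (int n) \<and> (\<lambda>i\<in>I. x (f i)) \<in> A}"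
 define C' where "C' = {x\<in>space ?B2. (\<lambda>i\<in>I. x (f i)) \<in> C}"
 have C': "C' \<in> sets ?B2" unfolding C'_def using measurable_sets[OF mf(2) C] by (simp add: vimage_def Int_def conj_commute)
 have A': "A' \<in> sets ?B1"
 proof -
  have 1: "{x\<in>space ?B1. (\<lambda>i\<in>I. x (f i)) \<in> A} \<in> sets ?B1"
   using measurable_sets[OF mf(1) A] by (simp add: vimage_def Int_def conj_commute)
  have 2: "{x\<in>space ?B1. (\<forall>i<n. x (int i) \<in> {0..<R}) \<and> R <= x (int n)} \<in> sets ?B1" by measurable
  have "A' = {x\<in>space ?B1. (\<lambda>i\<in>I. x (f i)) \<in> A} \<inter> {x\<in>space ?B1. (\<forall>i<n. x (int i) \<in> {0..<R}) \<and> R <= x (int n)}"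
   unfolding A'_def by blast
  thus ?thesis using 1 2 by simp
 qed
 have Ain: "?T -` A' \<inter> space P \<in> sets (vimage_algebra (space P) ?T ?B1)"
  using A' by (subst sets_vimage_algebra2) (auto simp: space_PiM)
 have Cin: "?M -` C' \<inter> space P \<in> sets (vimage_algebra (space P) ?M ?B2)"
  using C' by (subst sets_vimage_algebra2) (auto simp: space_PiM)
 have "prob ((?M -` C' \<inter> space P) \<inter> (?T -` A' \<inter> space P)) = prob (?M -` C' \<inter> space P) * prob (?T -` A' \<inter> space P)"
  by (rule indep_setD[OF ind Cin Ain])
 moreover have "(?M -` C' \<inter> space P) \<inter> (?T -` A' \<inter> space P) = {w\<in>occupied R n. (\<lambda>i\<in>I. t (f i) w) \<in> A \<and> (\<lambda>i\<in>I. (\<eta> (f i) w, U (f i) w)) \<in> C}"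
  unfolding A'_def C'_def occupied_def by (auto simp: space_PiM)
 moreover have "?M -` C' \<inter> space P = {w\<in>space P. (\<lambda>i\<in>I. (\<eta> (f i) w, U (f i) w)) \<in> C}"
  unfolding C'_def by (auto simp: space_PiM)
 moreover have "?T -` A' \<inter> space P = {w\<in>occupied R n. (\<lambda>i\<in>I. t (f i) w) \<in> A}"
  unfolding A'_def occupied_def by (auto simp: space_PiM)
 ultimately show ?thesis by simp
qed

text \<open>\<open>prob_boxes\<close> identifies a finite measure with a product measure on boxes,
  and uniqueness extends this to all measurable sets. In one fixed order the points are not
  independent uniform variables; only the sum over all orders has product form.\<close>

lemma points_PiM_law:
 assumes R: "0 < R" and B: "B \<in> sets (PiM {..<n} (\<lambda>_. borel))"
 shows "(\<Sum>s\<in>perms n. prob {w\<in>occupied R n. (\<lambda>i\<in>{..<n}. t (int (s i)) w) \<in> B}) =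
  exp (- R) * R ^ n * measure (PiM {..<n} (\<lambda>_. uniform_measure lborel {0..<R})) B"
proof -
 let ?U = "uniform_measure lborel {0..<R}"
 have Up: "prob_space ?U" using R by (intro prob_space_uniform_measure) auto
 interpret U: prob_space ?U by fact
 interpret PU: product_sigma_finite "\<lambda>_::nat. ?U" ..
 interpret PU': prob_space "PiM {..<n} (\<lambda>_. ?U)" by (rule prob_space_PiM) (rule Up)
 \<comment> \<open>P restricted to the conditioning event. The factor exp R / R^n below normalizes
   its total mass after summation over the n! permutations.\<close>
 define N where "N = density P (indicator (occupied R n))"
 define X where "X s w = (\<lambda>i\<in>{..<n}. t (int (s i)) w)" for s w
 have fN: "finite_measure N"
  unfolding N_def by (rule finite_measureI) (simp add: emeasure_density emeasure_eq_measure)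
 have eN: "emeasure N (X s -` B \<inter> space N) = prob {w\<in>occupied R n. X s w \<in> B}"
  if "B \<in> sets (PiM {..<n} (\<lambda>_. borel))" for B s
 proof -
  have "X s \<in> measurable P (PiM {..<n} (\<lambda>_. borel))" unfolding X_def by (intro measurable_restrict) auto
  hence ms: "X s -` B \<inter> space P \<in> sets P" using that by (rule measurable_sets)
  hence "emeasure N (X s -` B \<inter> space N) = emeasure P (occupied R n \<inter> (X s -` B \<inter> space P))"
   unfolding N_def by (subst emeasure_density) (auto simp flip: indicator_inter_arith)
  also have "occupied R n \<inter> (X s -` B \<inter> space P) = {w\<in>occupied R n. X s w \<in> B}"
   by (auto simp: occupied_def)
  finally show ?thesis by (simp add: emeasure_eq_measure)
 qed
 let ?D = "distr (count_space (perms n) \<Otimes>\<^sub>M N) (PiM {..<n} (\<lambda>_. borel)) (\<lambda>(s, w). X s w)"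
 have eD: "emeasure ?D B = ennreal (\<Sum>s\<in>perms n. prob {w\<in>occupied R n. X s w \<in> B})"
  if "B \<in> sets (PiM {..<n} (\<lambda>_. borel))" for B
 proof -
  have "emeasure ?D B = (\<Sum>s\<in>perms n. emeasure N (X s -` B \<inter> space N))"
   using that fN by (intro emeasure_distr_count_space_pair) (auto simp: finite_permutations N_def X_def intro!: measurable_restrict)
  thus ?thesis unfolding eN[OF that] by simp
 qed
 have "scale_measure (ennreal (exp R / R ^ n)) ?D = PiM {..<n} (\<lambda>_. ?U)"
 proof (rule PU.PiM_eqI)
  show "sets (scale_measure (ennreal (exp R / R ^ n)) ?D) = sets (PiM {..<n} (\<lambda>_. ?U))"
   by (simp cong: sets_PiM_cong)
  fix A assume "\<And>i. i \<in> {..<n} ==> A i \<in> sets ?U"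
  hence A: "\<And>i. i < n ==> A i \<in> sets borel" by auto
  have "prob {w\<in>occupied R n. X s w \<in> Pi\<^sub>E {..<n} A} = prob {w\<in>occupied R n. \<forall>i<n. t (int (s i)) w \<in> A i \<inter> {0..<R}}"
   if "s \<in> perms n" for s
  proof -
   have "t (int (s i)) w \<in> {0..<R}" if "w \<in> occupied R n" "i < n" for w i
    using that \<open>s \<in> perms n\<close> permutes_in_image[of s "{..<n}" i] unfolding occupied_def by auto
   thus ?thesis unfolding X_def by (intro arg_cong[where f=prob]) (auto simp: PiE_iff)
  qed
  hence "(\<Sum>s\<in>perms n. prob {w\<in>occupied R n. X s w \<in> Pi\<^sub>E {..<n} A}) = exp (- R) * (\<Prod>i<n. measure lborel (A i \<inter> {0..<R}))"
   using prob_boxes[of n "\<lambda>i. A i \<inter> {0..<R}" R] A R by simp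
  moreover have "Pi\<^sub>E {..<n} A \<in> sets (PiM {..<n} (\<lambda>_. borel))" using A by (intro sets_PiM_I_finite) auto
  ultimately have "emeasure (scale_measure (ennreal (exp R / R ^ n)) ?D) (Pi\<^sub>E {..<n} A) =
   ennreal (exp R / R ^ n * (exp (- R) * (\<Prod>i<n. measure lborel (A i \<inter> {0..<R}))))"
   using R by (simp add: eD ennreal_mult[symmetric] prod_nonneg mult_ac)
  also have "exp R / R ^ n * (exp (- R) * (\<Prod>i<n. measure lborel (A i \<inter> {0..<R}))) = (\<Prod>i<n. measure ?U (A i))"
  proof -
   have "measure ?U (A i) = measure lborel (A i \<inter> {0..<R}) / R" if "i < n" for i
    using R A[OF that] by (subst measure_uniform_measure) (auto simp: Int_commute)
   hence "(\<Prod>i<n. measure ?U (A i)) = (\<Prod>i<n. measure lborel (A i \<inter> {0..<R})) / R ^ n"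
    by (simp add: prod_dividef)
   thus ?thesis by (simp add: exp_minus)
  qed
  also have "ennreal (\<Prod>i<n. measure ?U (A i)) = (\<Prod>i\<in>{..<n}. emeasure ?U (A i))"
   by (simp add: U.emeasure_eq_measure prod_ennreal)
  finally show "emeasure (scale_measure (ennreal (exp R / R ^ n)) ?D) (Pi\<^sub>E {..<n} A) = (\<Prod>i\<in>{..<n}. emeasure ?U (A i))" .
 qed simp
 hence "emeasure (PiM {..<n} (\<lambda>_. ?U)) B = ennreal (exp R / R ^ n) * emeasure ?D B"
  by (metis emeasure_scale_measure)
 hence "ennreal (measure (PiM {..<n} (\<lambda>_. ?U)) B) = ennreal (exp R / R ^ n * (\<Sum>s\<in>perms n. prob {w\<in>occupied R n. X s w \<in> B}))"
  unfolding eD[OF B] PU'.emeasure_eq_measure using R by (subst ennreal_mult) (auto intro: sum_nonneg)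
 hence "measure (PiM {..<n} (\<lambda>_. ?U)) B = exp R / R ^ n * (\<Sum>s\<in>perms n. prob {w\<in>occupied R n. X s w \<in> B})"
  using R by (subst (asm) ennreal_inj) (auto intro!: mult_nonneg_nonneg divide_nonneg_pos sum_nonneg)
 thus ?thesis unfolding X_def using R by (simp add: exp_minus field_simps)
qed

text \<open>For a symmetric event all n! orders of the sources contribute equally, so the sum over
  permutations becomes a statement about the sources in their natural order.\<close>

lemma marked_points_law:
 assumes R: "0 < R" and F: "F \<in> sets (PiM {..<n} (\<lambda>_. borel))"
  and sym: "\<And>p z. p permutes {..<n} ==> z \<in> extensional {..<n} ==> (\<lambda>i\<in>{..<n}. z (p i)) \<in> F \<longleftrightarrow> z \<in> F"
 shows "prob {u\<in>occupied R n. (\<lambda>i\<in>{..<n}. (t (int i) u, \<eta> (int i) u, U (int i) u)) \<in> F} =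
  exp (- R) * R ^ n / fact n * measure (PiM {..<n} (\<lambda>_. sample_space R \<nu>)) F"
proof -
 let ?U = "uniform_measure lborel {0..<R}"
 have Up: "prob_space ?U" using R by (intro prob_space_uniform_measure) auto
 interpret U: prob_space ?U by fact
 interpret nu: prob_space \<nu> by (rule prob_space_marks)
 interpret PU': prob_space "PiM {..<n} (\<lambda>_. ?U)" by (rule prob_space_PiM) (rule Up)
 interpret PN': prob_space "PiM {..<n} (\<lambda>_. \<nu>)" by (rule prob_space_PiM) (rule prob_space_marks)
 interpret PP: pair_prob_space "PiM {..<n} (\<lambda>_. ?U)" "PiM {..<n} (\<lambda>_. \<nu>)" ..
 define N where "N = density P (indicator (occupied R n))"
 define X where "X p u = (\<lambda>i\<in>{..<n}. t (int (p i)) u)" for p u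
 define Y where "Y p u = (\<lambda>i\<in>{..<n}. (\<eta> (int (p i)) u, U (int (p i)) u))" for p u
 let ?S1 = "PiM {..<n} (\<lambda>_. borel :: real measure)" and ?S2 = "PiM {..<n} (\<lambda>_. borel :: (real \<times> real) measure)"
 have mX: "X p \<in> measurable P ?S1" for p unfolding X_def by (intro measurable_restrict) auto
 have mY: "Y p \<in> measurable P ?S2" for p unfolding Y_def by (intro measurable_restrict marks_measurable)
 have mXY: "(\<lambda>u. (X p u, Y p u)) \<in> measurable P (?S1 \<Otimes>\<^sub>M ?S2)" for p using mX mY by measurable
 have fN: "finite_measure N"
  unfolding N_def by (rule finite_measureI) (simp add: emeasure_density emeasure_eq_measure)
 have eN: "emeasure N ((\<lambda>u. (X p u, Y p u)) -` B \<inter> space N) = prob {u\<in>occupied R n. (X p u, Y p u) \<in> B}"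
  if "B \<in> sets (?S1 \<Otimes>\<^sub>M ?S2)" for B p
 proof -
  have ms: "(\<lambda>u. (X p u, Y p u)) -` B \<inter> space P \<in> sets P" using mXY that by (rule measurable_sets)
  hence "emeasure N ((\<lambda>u. (X p u, Y p u)) -` B \<inter> space N) = emeasure P (occupied R n \<inter> ((\<lambda>u. (X p u, Y p u)) -` B \<inter> space P))"
   unfolding N_def by (subst emeasure_density) (auto simp flip: indicator_inter_arith)
  also have "occupied R n \<inter> ((\<lambda>u. (X p u, Y p u)) -` B \<inter> space P) = {u\<in>occupied R n. (X p u, Y p u) \<in> B}"
   by (auto simp: occupied_def)
  finally show ?thesis by (simp add: emeasure_eq_measure)
 qed
 let ?D = "distr (count_space (perms n) \<Otimes>\<^sub>M N) (?S1 \<Otimes>\<^sub>M ?S2) (\<lambda>(p, u). (X p u, Y p u))"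
 have eD: "emeasure ?D B = ennreal (\<Sum>p\<in>perms n. prob {u\<in>occupied R n. (X p u, Y p u) \<in> B})"
  if "B \<in> sets (?S1 \<Otimes>\<^sub>M ?S2)" for B
 proof -
  have "emeasure ?D B = (\<Sum>p\<in>perms n. emeasure N ((\<lambda>u. (X p u, Y p u)) -` B \<inter> space N))"
   using that fN mXY by (intro emeasure_distr_count_space_pair) (auto simp: finite_permutations N_def)
  thus ?thesis unfolding eN[OF that] by simp
 qed
 have inj: "inj_on (\<lambda>i. int (p i)) {..<n}" if "p \<in> perms n" for p
  using that by (auto simp: inj_on_def dest: permutes_inj injD)
 have setsS: "sets (PiM {..<n} (\<lambda>_. ?U)) = sets ?S1" "sets (PiM {..<n} (\<lambda>_. \<nu>)) = sets ?S2"
  by (auto intro!: sets_PiM_cong)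
 \<comment> \<open>The marks keep their joint law under every injective relabelling and are
   independent of the points, so all permutations contribute the same factor for the marks.\<close>
 have law: "PiM {..<n} (\<lambda>_. ?U) \<Otimes>\<^sub>M PiM {..<n} (\<lambda>_. \<nu>) = scale_measure (ennreal (exp R / R ^ n)) ?D"
 proof (rule pair_measure_eqI)
  show "sigma_finite_measure (PiM {..<n} (\<lambda>_. ?U))" "sigma_finite_measure (PiM {..<n} (\<lambda>_. \<nu>))" ..
  show "sets (PiM {..<n} (\<lambda>_. ?U) \<Otimes>\<^sub>M PiM {..<n} (\<lambda>_. \<nu>)) = sets (scale_measure (ennreal (exp R / R ^ n)) ?D)"
   by (simp add: sets_pair_measure_cong[OF setsS])
  fix A C assume "A \<in> sets (PiM {..<n} (\<lambda>_. ?U))" "C \<in> sets (PiM {..<n} (\<lambda>_. \<nu>))"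
  hence A: "A \<in> sets ?S1" and C: "C \<in> sets ?S2" unfolding setsS by auto
  have "prob {u\<in>occupied R n. (X p u, Y p u) \<in> A \<times> C} = prob {u\<in>occupied R n. X p u \<in> A} * measure (PiM {..<n} (\<lambda>_. \<nu>)) C"
   if "p \<in> perms n" for p
  proof -
   have "measure (PiM {..<n} (\<lambda>_. \<nu>)) C = measure (distr P ?S2 (Y p)) C"
    unfolding Y_def using marks_PiM_law[OF inj[OF that]] by simp
   also have "... = prob {u\<in>space P. Y p u \<in> C}"
    using mY C by (subst measure_distr) (auto simp: vimage_def Int_def conj_commute)
   finally show ?thesis
    using points_marks_indep[OF A C, of R n "\<lambda>i. int (p i)"] unfolding X_def Y_def by simp
  qed
  hence "(\<Sum>p\<in>perms n. prob {u\<in>occupied R n. (X p u, Y p u) \<in> A \<times> C}) =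
   (\<Sum>p\<in>perms n. prob {u\<in>occupied R n. X p u \<in> A}) * measure (PiM {..<n} (\<lambda>_. \<nu>)) C"
   by (simp add: sum_distrib_right)
  also have "... = exp (- R) * R ^ n * measure (PiM {..<n} (\<lambda>_. ?U)) A * measure (PiM {..<n} (\<lambda>_. \<nu>)) C"
   using points_PiM_law[OF R A] unfolding X_def by simp
  finally have "emeasure (scale_measure (ennreal (exp R / R ^ n)) ?D) (A \<times> C) =
   ennreal (exp R / R ^ n) * ennreal (exp (- R) * R ^ n * measure (PiM {..<n} (\<lambda>_. ?U)) A * measure (PiM {..<n} (\<lambda>_. \<nu>)) C)"
   using A C by (simp add: eD)
  also have "... = ennreal (measure (PiM {..<n} (\<lambda>_. ?U)) A * measure (PiM {..<n} (\<lambda>_. \<nu>)) C)"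
   using R by (subst ennreal_mult[symmetric]) (auto simp: exp_minus)
  finally show "emeasure (PiM {..<n} (\<lambda>_. ?U)) A * emeasure (PiM {..<n} (\<lambda>_. \<nu>)) C = emeasure (scale_measure (ennreal (exp R / R ^ n)) ?D) (A \<times> C)"
   by (simp add: PU'.emeasure_eq_measure PN'.emeasure_eq_measure ennreal_mult)
 qed
 let ?z = "\<lambda>(x, y). \<lambda>i\<in>{..<n}. (x i, y i) :: real \<times> real \<times> real"
 have setsz: "sets (PiM {..<n} (\<lambda>_. ?U \<Otimes>\<^sub>M \<nu>)) = sets (PiM {..<n} (\<lambda>_. borel :: (real \<times> real \<times> real) measure))"
 proof (intro sets_PiM_cong refl)
  have "sets (?U \<Otimes>\<^sub>M \<nu>) = sets ((borel :: real measure) \<Otimes>\<^sub>M (borel :: (real \<times> real) measure))"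
   by (rule sets_pair_measure_cong) simp_all
  thus "sets (?U \<Otimes>\<^sub>M \<nu>) = sets (borel :: (real \<times> real \<times> real) measure)" by (simp only: borel_prod)
 qed
 have F': "F \<in> sets (PiM {..<n} (\<lambda>_. ?U \<Otimes>\<^sub>M \<nu>))" using F unfolding setsz .
 have mz: "?z \<in> measurable (PiM {..<n} (\<lambda>_. ?U) \<Otimes>\<^sub>M PiM {..<n} (\<lambda>_. \<nu>)) (PiM {..<n} (\<lambda>_. ?U \<Otimes>\<^sub>M \<nu>))"
  by (simp add: split_beta')
 let ?F = "?z -` F \<inter> space (PiM {..<n} (\<lambda>_. ?U) \<Otimes>\<^sub>M PiM {..<n} (\<lambda>_. \<nu>))"
 have F2: "?F \<in> sets (?S1 \<Otimes>\<^sub>M ?S2)"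
  using measurable_sets[OF mz F'] by (simp add: sets_pair_measure_cong[OF setsS])
 have "measure (PiM {..<n} (\<lambda>_. ?U \<Otimes>\<^sub>M \<nu>)) F = measure (PiM {..<n} (\<lambda>_. ?U) \<Otimes>\<^sub>M PiM {..<n} (\<lambda>_. \<nu>)) ?F"
  by (subst PiM_pair_eq_distr_zip[OF _ Up prob_space_marks, symmetric], simp, subst measure_distr[OF mz F'], simp)
 also have "... = measure (scale_measure (ennreal (exp R / R ^ n)) ?D) ?F" unfolding law ..
 also have "... = exp R / R ^ n * (\<Sum>p\<in>perms n. prob {u\<in>occupied R n. (X p u, Y p u) \<in> ?F})"
 proof (rule measure_eq_emeasure_eq_ennreal)
  show "0 <= exp R / R ^ n * (\<Sum>p\<in>perms n. prob {u\<in>occupied R n. (X p u, Y p u) \<in> ?F})"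
   using R by (intro mult_nonneg_nonneg sum_nonneg) auto
  show "emeasure (scale_measure (ennreal (exp R / R ^ n)) ?D) ?F =
   ennreal (exp R / R ^ n * (\<Sum>p\<in>perms n. prob {u\<in>occupied R n. (X p u, Y p u) \<in> ?F}))"
   unfolding emeasure_scale_measure eD[OF F2] using R
   by (subst ennreal_mult) (auto intro!: sum_nonneg)
 qed
 also have "(\<Sum>p\<in>perms n. prob {u\<in>occupied R n. (X p u, Y p u) \<in> ?F}) =
  (\<Sum>p\<in>perms n. prob {u\<in>occupied R n. (\<lambda>i\<in>{..<n}. (t (int i) u, \<eta> (int i) u, U (int i) u)) \<in> F})"
 proof (intro sum.cong refl arg_cong[where f=prob] Collect_cong conj_cong)
  fix p u assume s: "p \<in> perms n"
  let ?w = "\<lambda>i\<in>{..<n}. (t (int i) u, \<eta> (int i) u, U (int i) u)"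
  have "(X p u, Y p u) \<in> ?F \<longleftrightarrow> ?z (X p u, Y p u) \<in> F"
   by (auto simp: X_def Y_def space_pair_measure space_PiM sets_eq_imp_space_eq[OF sets_marks])
  also have "?z (X p u, Y p u) = (\<lambda>i\<in>{..<n}. ?w (p i))"
   using s permutes_in_image[of p "{..<n}"] by (auto simp: X_def Y_def fun_eq_iff)
  also have "... \<in> F \<longleftrightarrow> ?w \<in> F"
   by (rule sym) (use s in \<open>simp_all only: mem_Collect_eq restrict_extensional\<close>)
  finally show "(X p u, Y p u) \<in> ?F \<longleftrightarrow> ?w \<in> F" .
 qed
 also have "... = fact n * prob {u\<in>occupied R n. (\<lambda>i\<in>{..<n}. (t (int i) u, \<eta> (int i) u, U (int i) u)) \<in> F}"
  by (simp add: card_permutations)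
 finally show ?thesis unfolding sample_space_def using R by (simp add: exp_minus field_simps)
qed

end

section \<open>Averaging over the number of points\<close>

lemma poisson_weight_sums:
 fixes R :: real
 shows "(\<lambda>n. exp (- R) * R ^ n / fact n) sums 1"
  and "(\<lambda>n. exp (- R) * R ^ n / fact n * (real n - R)^2) sums R"
proof -
 have 0: "(\<lambda>n. R ^ n / fact n) sums exp R"
  using exp_converges[of R] by (simp add: divide_inverse mult.commute)
 have 1: "(\<lambda>n. real n * (R ^ n / fact n)) sums (R * exp R)"
 proof -
  have "(\<lambda>n. real (Suc n) * (R ^ Suc n / fact (Suc n))) = (\<lambda>n. R * (R ^ n / fact n))"
   by (rule ext) (simp add: field_simps del: of_nat_Suc)
  hence "(\<lambda>n. real (Suc n) * (R ^ Suc n / fact (Suc n))) sums (R * exp R)"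
   using sums_mult[OF 0, of R] by simp
  thus ?thesis by (subst (asm) sums_Suc_iff) simp
 qed
 have 2: "(\<lambda>n. real n * real n * (R ^ n / fact n)) sums (R * (R * exp R) + R * exp R)"
 proof -
  have "(\<lambda>n. real (Suc n) * real (Suc n) * (R ^ Suc n / fact (Suc n))) = (\<lambda>n. R * (real n * (R ^ n / fact n)) + R * (R ^ n / fact n))"
  proof
   fix n
   have "real (Suc n) * (R ^ Suc n / fact (Suc n)) = R * (R ^ n / fact n)"
    by (simp add: field_simps del: of_nat_Suc)
   hence "real (Suc n) * real (Suc n) * (R ^ Suc n / fact (Suc n)) = real (Suc n) * (R * (R ^ n / fact n))"
    by (simp only: mult.assoc)
   also have "... = R * (real n * (R ^ n / fact n)) + R * (R ^ n / fact n)" by (simp add: algebra_simps add_divide_distrib)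
   finally show "real (Suc n) * real (Suc n) * (R ^ Suc n / fact (Suc n)) = R * (real n * (R ^ n / fact n)) + R * (R ^ n / fact n)" .
  qed
  hence "(\<lambda>n. real (Suc n) * real (Suc n) * (R ^ Suc n / fact (Suc n))) sums (R * (R * exp R) + R * exp R)"
   using sums_add[OF sums_mult[OF 1, of R] sums_mult[OF 0, of R]] by simp
  thus ?thesis by (subst (asm) sums_Suc_iff) simp
 qed
 show "(\<lambda>n. exp (- R) * R ^ n / fact n) sums 1"
  using sums_mult[OF 0, of "exp (- R)"] by (simp add: exp_minus)
 have "(\<lambda>n. real n * real n * (R ^ n / fact n) - 2 * R * (real n * (R ^ n / fact n)) + R^2 * (R ^ n / fact n)) sums
  (R * (R * exp R) + R * exp R - 2 * R * (R * exp R) + R^2 * exp R)"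
  by (intro sums_add sums_diff sums_mult 0 1 2)
 from sums_mult[OF this, of "exp (- R)"]
 have "(\<lambda>n. exp (- R) * (real n * real n * (R ^ n / fact n) - 2 * R * (real n * (R ^ n / fact n)) + R^2 * (R ^ n / fact n))) sums R"
  by (simp add: power2_eq_square algebra_simps exp_minus)
 also have "(\<lambda>n. exp (- R) * (real n * real n * (R ^ n / fact n) - 2 * R * (real n * (R ^ n / fact n)) + R^2 * (R ^ n / fact n))) =
  (\<lambda>n. exp (- R) * R ^ n / fact n * (real n - R)^2)"
  by (rule ext) (simp add: power2_eq_square algebra_simps add_divide_distrib diff_divide_distrib)
 finally show "(\<lambda>n. exp (- R) * R ^ n / fact n * (real n - R)^2) sums R" .
qed

text \<open>Chebyshev's inequality, carried out on the series of Poisson weights.\<close>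

lemma poisson_concentration:
 fixes R h :: real
 assumes "0 < R" "0 < h"
 shows "1 - (\<Sum>n | \<bar>real n - R\<bar> <= h * R. exp (- R) * R ^ n / fact n) <= 1 / (h^2 * R)"
  and "finite {n. \<bar>real n - R\<bar> <= h * R}"
proof -
 define p where "p n = exp (- R) * R ^ n / fact n" for n
 let ?G = "{n. \<bar>real n - R\<bar> <= h * R}"
 have p0: "0 <= p n" for n unfolding p_def using assms by simp
 have "?G \<subseteq> {..nat \<lceil>R + h * R\<rceil>}"
 proof
  fix n assume "n \<in> ?G"
  hence "real n <= R + h * R" by auto
  thus "n \<in> {..nat \<lceil>R + h * R\<rceil>}" by (simp add: le_nat_iff) linarith
 qed
 thus fin: "finite ?G" by (rule finite_subset) simp
 have s1: "p sums 1" and s2: "(\<lambda>n. p n * (real n - R)^2) sums R"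
  using poisson_weight_sums[of R] unfolding p_def by auto
 have s3: "(\<lambda>n. if n \<in> ?G then p n else 0) sums (\<Sum>n\<in>?G. p n)"
  using sums_If_finite_set[OF fin, of p] by simp
 have s4: "(\<lambda>n. p n - (if n \<in> ?G then p n else 0)) sums (1 - (\<Sum>n\<in>?G. p n))"
  by (rule sums_diff[OF s1 s3])
 have s5: "(\<lambda>n. p n * (real n - R)^2 * (1 / (h * R)^2)) sums (R * (1 / (h * R)^2))"
  by (rule sums_mult2[OF s2])
 have "1 - (\<Sum>n\<in>?G. p n) <= R * (1 / (h * R)^2)"
 proof (rule sums_le[OF _ s4 s5])
  fix n show "p n - (if n \<in> ?G then p n else 0) <= p n * (real n - R)^2 * (1 / (h * R)^2)"
  proof (cases "n \<in> ?G")
   case False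
   hence "h * R <= \<bar>real n - R\<bar>" by auto
   hence "(h * R)^2 <= (real n - R)^2" using assms by (metis abs_le_square_iff abs_of_pos mult_pos_pos)
   hence "1 <= (real n - R)^2 * (1 / (h * R)^2)" using assms by (simp add: field_simps)
   hence "p n * 1 <= p n * ((real n - R)^2 * (1 / (h * R)^2))" using p0 by (intro mult_left_mono) auto
   thus ?thesis using False by (simp add: mult.assoc)
  qed (use p0 in \<open>simp add: mult_nonneg_nonneg\<close>)
 qed
 also have "R * (1 / (h * R)^2) = 1 / (h^2 * R)" using assms by (simp add: power2_eq_square field_simps)
 finally show "1 - (\<Sum>n\<in>?G. exp (- R) * R ^ n / fact n) <= 1 / (h^2 * R)" unfolding p_def .
qed

context marked_points begin

text \<open>Passes from P to n independent sources with n close to R; the second summand is the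
  Chebyshev bound for all other n. Since only an almost sure inclusion of \<open>Bad\<close> in
  symmetric events is asked for, the coefficients themselves need no measurability
  discussion.\<close>

lemma prob_le_sample_prob:
 assumes R: "0 < R" and h: "0 < h" and Bad: "Bad \<in> sets P" and \<kappa>: "0 <= \<kappa>"
  and F: "\<And>n. F n \<in> sets (PiM {..<n} (\<lambda>_. borel))"
  and sym: "\<And>n s z. s permutes {..<n} ==> z \<in> extensional {..<n} ==> (\<lambda>i\<in>{..<n}. z (s i)) \<in> F n \<longleftrightarrow> z \<in> F n"
  and bad: "\<And>n. AE w in P. w \<in> Bad --> w \<in> occupied R n --> (\<lambda>i\<in>{..<n}. (t (int i) w, \<eta> (int i) w, U (int i) w)) \<in> F n"
  and small: "\<And>n. \<bar>real n - R\<bar> <= h * R ==> measure (PiM {..<n} (\<lambda>_. sample_space R \<nu>)) (F n) <= \<kappa>"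
 shows "prob Bad <= \<kappa> + 1 / (h^2 * R)"
proof -
 let ?G = "{n. \<bar>real n - R\<bar> <= h * R}"
 let ?Z = "\<lambda>n w. \<lambda>i\<in>{..<n}. (t (int i) w, \<eta> (int i) w, U (int i) w)"
 have fin: "finite ?G" by (rule poisson_concentration(2)[OF R h])
 have disj: "disjoint_family_on (occupied R) ?G"
 proof (unfold disjoint_family_on_def, intro ballI impI)
  fix m n :: nat assume "m \<noteq> n"
  have *: "occupied R m \<inter> occupied R n = {}" if "m < n" for m n
   using that unfolding occupied_def by force
  thus "occupied R m \<inter> occupied R n = {}" using *[of m n] *[of n m] \<open>m \<noteq> n\<close> by (metis Int_commute linorder_neqE_nat)
 qed
 have pocc: "prob (\<Union>n\<in>?G. occupied R n) = (\<Sum>n\<in>?G. exp (- R) * R ^ n / fact n)"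
  using prob_occupied R by (subst finite_measure_finite_Union[OF fin _ disj]) auto
 have mZ: "?Z n \<in> measurable P (PiM {..<n} (\<lambda>_. borel))" for n
 proof (rule measurable_restrict)
  fix i
  have "(\<lambda>w. (t (int i) w, (\<eta> (int i) w, U (int i) w))) \<in> measurable P (borel \<Otimes>\<^sub>M borel)"
   by (intro measurable_Pair points_measurable marks_measurable)
  thus "(\<lambda>w. (t (int i) w, \<eta> (int i) w, U (int i) w)) \<in> borel_measurable P" by (simp add: borel_prod)
 qed
 have one: "prob (Bad \<inter> occupied R n) <= exp (- R) * R ^ n / fact n * \<kappa>" if n: "n \<in> ?G" for n
 proof -
  have "?Z n -` F n \<inter> space P \<in> sets P" by (rule measurable_sets[OF mZ F])
  hence ms: "occupied R n \<inter> (?Z n -` F n \<inter> space P) \<in> sets P" by auto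
  have eq: "occupied R n \<inter> (?Z n -` F n \<inter> space P) = {w\<in>occupied R n. ?Z n w \<in> F n}"
   by (auto simp: occupied_def)
  have "prob (Bad \<inter> occupied R n) <= prob {w\<in>occupied R n. ?Z n w \<in> F n}"
   using bad[of n] ms unfolding eq by (intro finite_measure_mono_AE) auto
  also have "... = exp (- R) * R ^ n / fact n * measure (PiM {..<n} (\<lambda>_. sample_space R \<nu>)) (F n)"
   by (rule marked_points_law[OF R F sym])
  also have "... <= exp (- R) * R ^ n / fact n * \<kappa>"
   using small[of n] n R by (intro mult_left_mono) auto
  finally show ?thesis .
 qed
 have "prob Bad <= prob ((\<Union>n\<in>?G. Bad \<inter> occupied R n) \<union> (space P - (\<Union>n\<in>?G. occupied R n)))"
  using Bad fin sets.sets_into_space[OF Bad] by (intro finite_measure_mono) auto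
 also have "... <= prob (\<Union>n\<in>?G. Bad \<inter> occupied R n) + prob (space P - (\<Union>n\<in>?G. occupied R n))"
  using Bad fin by (intro measure_Un_le) auto
 also have "prob (\<Union>n\<in>?G. Bad \<inter> occupied R n) <= (\<Sum>n\<in>?G. prob (Bad \<inter> occupied R n))"
  using Bad fin by (intro finite_measure_subadditive_finite) auto
 also have "... <= (\<Sum>n\<in>?G. exp (- R) * R ^ n / fact n * \<kappa>)" by (intro sum_mono one)
 also have "... = prob (\<Union>n\<in>?G. occupied R n) * \<kappa>" unfolding pocc by (simp add: sum_distrib_right)
 also have "... <= 1 * \<kappa>" by (intro mult_right_mono \<kappa>) simp
 also have "prob (space P - (\<Union>n\<in>?G. occupied R n)) = 1 - (\<Sum>n\<in>?G. exp (- R) * R ^ n / fact n)"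
  using fin by (subst prob_compl) (auto simp: pocc)
 also have "... <= 1 / (h^2 * R)" by (rule poisson_concentration(1)[OF R h])
 finally show ?thesis by simp
qed

end

section \<open>First and second moments of the coefficients\<close>

text \<open>A window of length l contains at most l + 1 integers.\<close>

lemma sum_window_le:
 fixes f :: "nat => real"
 assumes "\<And>k. \<bar>f k\<bar> <= c" and supp: "\<And>k. f k \<noteq> 0 ==> a <= real k \<and> real k <= a + l" and "0 <= l"
 shows "(\<Sum>k<n. \<bar>f k\<bar>) <= (l + 1) * c"
proof -
 let ?S = "{k\<in>{..<n}. f k \<noteq> 0}"
 have c0: "0 <= c" using assms(1)[of 0] by linarith
 have card: "real (card ?S) <= l + 1"
 proof (cases "?S = {}")
  case False
  define m where "m = Min ?S"
  define p where "p = Max ?S"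
  have fS: "finite ?S" by simp
  have mp: "m \<in> ?S" "p \<in> ?S" unfolding m_def p_def by (rule Min_in[OF fS False], rule Max_in[OF fS False])
  have "?S \<subseteq> {m..p}" unfolding m_def p_def by (auto intro!: Min_le Max_ge)
  hence "card ?S <= card {m..p}" by (intro card_mono) auto
  also have "... = Suc p - m" by simp
  finally have c1: "card ?S <= Suc p - m" .
  have "m <= p" using mp(1) unfolding p_def by (intro Max_ge) auto
  hence "real (Suc p - m) = real p - real m + 1" by (simp add: of_nat_diff)
  moreover have "a <= real m" "real p <= a + l" using supp[of m] supp[of p] mp by auto
  ultimately show ?thesis using c1 by linarith
 next
  case True
  show ?thesis unfolding True using assms(3) by simp
 qed
 have "(\<Sum>k<n. \<bar>f k\<bar>) = (\<Sum>k\<in>?S. \<bar>f k\<bar>)" by (intro sum.mono_neutral_right) auto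
 also have "... <= (\<Sum>k\<in>?S. c)" by (intro sum_mono assms(1))
 also have "... = real (card ?S) * c" by simp
 also have "... <= (l + 1) * c" by (intro mult_right_mono card c0)
 finally show ?thesis .
qed

text \<open>Common interface of the two observation schemes: \<Psi> is the rescaled primitive
  itself, or a step function within C1 / sqrt (2^j) of it. The support is widened by 1 to the left,
  and to A in place of M on the right, to make room for the samples that interpolation
  involves.\<close>

locale wavelet_kernel = wavelet_energy \<nu> \<alpha> M K \<psi> for \<nu> \<alpha> M K \<psi> +
 fixes \<Psi> :: "nat => nat => real => real" and A C1 :: real
 assumes kernel_measurable [measurable]: "\<And>j k. \<Psi> j k \<in> borel_measurable borel"
  and A: "M <= A" and C1: "0 <= C1"
  and kernel_support: "\<And>j k s. \<Psi> j k s \<noteq> 0 ==> 2 ^ j * real k - 1 <= s \<and> s <= 2 ^ j * (real k + A)"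
  and kernel_approx: "\<And>j k s. \<bar>\<Psi> j k s - sqrt (2 ^ j) * prim (s / 2 ^ j - real k)\<bar> <= C1 / sqrt (2 ^ j)"
begin

text \<open>The contribution of the source z = (time, duration, size) to the coefficient (j,
  k).\<close>

definition atom :: "nat => nat => real \<times> real \<times> real => real" where
 "atom j k z = snd (snd z) * (\<Psi> j k (fst z + fst (snd z)) - \<Psi> j k (fst z))"

text \<open>The first summand is the constant of \<open>sum_prim_diff_le\<close>, the second that of
  \<open>sum_resid_le\<close>, taken at both ends of a pulse.\<close>

definition env_const :: real where
 "env_const = 4 * K * M * (M + 1) + 2 * (A + 2) * C1"

text \<open>Envelope for the sum over k of the absolute atoms: min(1, duration / 2^j) comes from the
  primitive, 1 / 2^j from the discretization error C1 / sqrt (2^j) once the factor sqrt (2^j) is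
  taken out.\<close>

definition env :: "nat => real \<times> real \<times> real => real" where
 "env j z = env_const * \<bar>snd (snd z)\<bar> * (sqrt (2 ^ j) * (min 1 (\<bar>fst (snd z)\<bar> / 2 ^ j) + 1 / 2 ^ j))"

definition resid :: "nat => nat => real => real" where
 "resid j k s = \<Psi> j k s - sqrt (2 ^ j) * prim (s / 2 ^ j - real k)"

lemma A_ge_1: "1 <= A" using A M by simp

lemma env_const_nonneg: "0 <= env_const"
 unfolding env_const_def using K_nonneg M A_ge_1 C1 by (intro add_nonneg_nonneg mult_nonneg_nonneg) auto

lemma resid_measurable [measurable]: "resid j k \<in> borel_measurable borel"
 unfolding resid_def by measurable

lemma resid_bound: "\<bar>resid j k s\<bar> <= C1 / sqrt (2 ^ j)"
 unfolding resid_def by (rule kernel_approx)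

lemma resid_support: "resid j k s \<noteq> 0 ==> 2 ^ j * real k - 1 <= s \<and> s <= 2 ^ j * (real k + A)"
proof -
 assume nz: "resid j k s \<noteq> 0"
 show ?thesis
 proof (cases "\<Psi> j k s = 0")
  case True
  hence "prim (s / 2 ^ j - real k) \<noteq> 0" using nz unfolding resid_def by auto
  hence "0 < s / 2 ^ j - real k" "s / 2 ^ j - real k < M" using prim_eq_0 not_le by blast+
  hence "2 ^ j * real k < s" "s < 2 ^ j * (real k + M)" by (simp_all add: field_simps)
  moreover have "2 ^ j * (real k + M) <= 2 ^ j * (real k + A)" using A by simp
  ultimately show ?thesis by linarith
 qed (rule kernel_support)
qed

lemma prim_diff_bound: "\<bar>prim (a + h) - prim a\<bar> <= 2 * K * M * min 1 \<bar>h\<bar>"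
proof (cases "1 <= \<bar>h\<bar>")
 case True
 thus ?thesis using prim_bound[of "a + h"] prim_bound[of a] by (simp add: min_def)
next
 case False
 have "\<bar>prim (a + h) - prim a\<bar> <= K * \<bar>h\<bar>" using prim_Lipschitz[of "a + h" a] by simp
 also have "... <= (2 * K * M) * \<bar>h\<bar>" using K_nonneg M mult_left_mono[of 1 "2 * M" K] by (intro mult_right_mono) auto
 finally show ?thesis using False by (simp add: min_def)
qed

text \<open>Each difference is at most a multiple of min(1, |h|), and it vanishes unless k lies in
  one of two windows of length M, one for each argument of \<open>prim\<close>.\<close>

lemma sum_prim_diff_le:
 "(\<Sum>k<n. \<bar>prim (a + h - real k) - prim (a - real k)\<bar>) <= 4 * K * M * (M + 1) * min 1 \<bar>h\<bar>"
proof -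
 define d where "d k = prim (a + h - real k) - prim (a - real k)" for k :: nat
 have db: "\<bar>d k\<bar> <= 2 * K * M * min 1 \<bar>h\<bar>" for k
  using prim_diff_bound[of "a - real k" h] unfolding d_def by (simp add: algebra_simps)
 have c0: "0 <= 2 * K * M * min 1 \<bar>h\<bar>" using K_nonneg M by simp
 define f where "f k = d k * of_bool (a - M <= real k \<and> real k <= a)" for k :: nat
 define g where "g k = d k * of_bool (a + h - M <= real k \<and> real k <= a + h)" for k :: nat
 have "\<bar>d k\<bar> <= \<bar>f k\<bar> + \<bar>g k\<bar>" for k
 proof (cases "(a - M <= real k \<and> real k <= a) \<or> (a + h - M <= real k \<and> real k <= a + h)")
  case False
  hence "d k = 0" unfolding d_def using prim_eq_0[of "a + h - real k"] prim_eq_0[of "a - real k"] by auto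
  thus ?thesis by simp
 qed (auto simp: f_def g_def)
 hence "(\<Sum>k<n. \<bar>d k\<bar>) <= (\<Sum>k<n. \<bar>f k\<bar>) + (\<Sum>k<n. \<bar>g k\<bar>)"
  unfolding sum.distrib[symmetric] by (intro sum_mono)
 also have "(\<Sum>k<n. \<bar>f k\<bar>) <= (M + 1) * (2 * K * M * min 1 \<bar>h\<bar>)"
 proof (rule sum_window_le[of _ _ "a - M"])
  show "\<bar>f k\<bar> <= 2 * K * M * min 1 \<bar>h\<bar>" for k unfolding f_def using db[of k] c0 by (auto simp: of_bool_def)
 qed (use M in \<open>auto simp: f_def split: if_splits\<close>)
 also have "(\<Sum>k<n. \<bar>g k\<bar>) <= (M + 1) * (2 * K * M * min 1 \<bar>h\<bar>)"
 proof (rule sum_window_le[of _ _ "a + h - M"])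
  show "\<bar>g k\<bar> <= 2 * K * M * min 1 \<bar>h\<bar>" for k unfolding g_def using db[of k] c0 by (auto simp: of_bool_def)
 qed (use M in \<open>auto simp: g_def split: if_splits\<close>)
 finally show ?thesis unfolding d_def by (simp add: algebra_simps)
qed

lemma sum_resid_le: "(\<Sum>k<n. \<bar>resid j k s\<bar>) <= (A + 2) * (C1 / sqrt (2 ^ j))"
proof -
 have x1: "1 / 2 ^ j <= (1::real)" by simp
 have "(\<Sum>k<n. \<bar>resid j k s\<bar>) <= ((A + 1) + 1) * (C1 / sqrt (2 ^ j))"
 proof (rule sum_window_le[of _ _ "s / 2 ^ j - A"])
  fix k assume "resid j k s \<noteq> 0"
  from resid_support[OF this] have "2 ^ j * real k <= s + 1" "s <= 2 ^ j * (real k + A)" by auto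
  hence "real k <= (s + 1) / 2 ^ j" "s / 2 ^ j <= real k + A" by (simp_all add: field_simps)
  thus "s / 2 ^ j - A <= real k \<and> real k <= s / 2 ^ j - A + (A + 1)"
   using x1 add_divide_distrib[of s 1 "2 ^ j"] by linarith
 qed (use resid_bound A_ge_1 in auto)
 thus ?thesis by (simp add: add.commute)
qed

lemma sum_atom_le_env: "(\<Sum>k<n. \<bar>atom j k z\<bar>) <= env j z"
proof -
 define x :: real where "x = 2 ^ j"
 have x: "0 < x" "1 <= x" unfolding x_def by auto
 define s where "s = fst z"
 define v where "v = fst (snd z)"
 define u where "u = snd (snd z)"
 define r where "r = sqrt x"
 have r: "0 < r" "r * r = x" using x unfolding r_def by auto
 have "\<bar>\<Psi> j k (s + v) - \<Psi> j k s\<bar> <= r * \<bar>prim (s / x + v / x - real k) - prim (s / x - real k)\<bar> + \<bar>resid j k (s + v)\<bar> + \<bar>resid j k s\<bar>" for k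
 proof -
  have "\<Psi> j k (s + v) - \<Psi> j k s = r * (prim (s / x + v / x - real k) - prim (s / x - real k)) + (resid j k (s + v) - resid j k s)"
   unfolding resid_def r_def x_def by (simp add: algebra_simps add_divide_distrib)
  also have "\<bar>...\<bar> <= \<bar>r * (prim (s / x + v / x - real k) - prim (s / x - real k))\<bar> + (\<bar>resid j k (s + v)\<bar> + \<bar>resid j k s\<bar>)" by linarith
  also have "\<bar>r * (prim (s / x + v / x - real k) - prim (s / x - real k))\<bar> = r * \<bar>prim (s / x + v / x - real k) - prim (s / x - real k)\<bar>"
   using r by (simp add: abs_mult)
  finally show ?thesis by simp
 qed
 hence "(\<Sum>k<n. \<bar>\<Psi> j k (s + v) - \<Psi> j k s\<bar>) <=
  (\<Sum>k<n. r * \<bar>prim (s / x + v / x - real k) - prim (s / x - real k)\<bar> + \<bar>resid j k (s + v)\<bar> + \<bar>resid j k s\<bar>)"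
  by (intro sum_mono)
 also have "... = r * (\<Sum>k<n. \<bar>prim (s / x + v / x - real k) - prim (s / x - real k)\<bar>) + (\<Sum>k<n. \<bar>resid j k (s + v)\<bar>) + (\<Sum>k<n. \<bar>resid j k s\<bar>)"
  by (simp add: sum.distrib sum_distrib_left)
 also have "... <= r * (4 * K * M * (M + 1) * min 1 \<bar>v / x\<bar>) + (A + 2) * (C1 / sqrt (2 ^ j)) + (A + 2) * (C1 / sqrt (2 ^ j))"
  by (intro add_mono mult_left_mono sum_prim_diff_le sum_resid_le) (use r in auto)
 also have "... = r * (4 * K * M * (M + 1) * min 1 \<bar>v / x\<bar> + 2 * (A + 2) * C1 * (1 / x))"
 proof -
  have "C1 / r = r * (C1 * (1 / x))" using r x by (simp add: field_simps flip: r(2))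
  hence "C1 / sqrt (2 ^ j) = r * (C1 * (1 / x))" unfolding x_def[symmetric] r_def[symmetric] .
  thus ?thesis by (simp only:) (simp add: algebra_simps add_divide_distrib)
 qed
 also have "... <= r * (env_const * min 1 \<bar>v / x\<bar> + env_const * (1 / x))"
  by (intro mult_left_mono add_mono mult_right_mono)
    (use r x K_nonneg M A_ge_1 C1 in \<open>auto simp: env_const_def\<close>)
 finally have "\<bar>u\<bar> * (\<Sum>k<n. \<bar>\<Psi> j k (s + v) - \<Psi> j k s\<bar>) <= \<bar>u\<bar> * (r * (env_const * min 1 \<bar>v / x\<bar> + env_const * (1 / x)))"
  by (rule mult_left_mono) simp
 moreover have "(\<Sum>k<n. \<bar>atom j k z\<bar>) = \<bar>u\<bar> * (\<Sum>k<n. \<bar>\<Psi> j k (s + v) - \<Psi> j k s\<bar>)"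
  unfolding atom_def s_def v_def u_def by (simp add: abs_mult sum_distrib_left)
 ultimately show ?thesis
  unfolding env_def u_def[symmetric] v_def[symmetric] x_def[symmetric] r_def[symmetric]
  using x by (simp add: algebra_simps abs_divide)
qed

lemma atom_measurable [measurable]: "atom j k \<in> borel_measurable (borel \<Otimes>\<^sub>M (borel \<Otimes>\<^sub>M borel))"
 unfolding atom_def by measurable

lemma env_measurable [measurable]: "env j \<in> borel_measurable (borel \<Otimes>\<^sub>M (borel \<Otimes>\<^sub>M borel))"
 unfolding env_def by measurable

end

section \<open>Integrals under the law of one source\<close>

context mark_law begin

lemma uniform_density:
 assumes "0 < R"
 shows "uniform_measure lborel {0..<R::real} = density lborel (\<lambda>t. ennreal (indicator {0..<R} t / R))"
 unfolding uniform_measure_def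
 by (rule density_cong) (use assms in \<open>auto simp: indicator_def divide_ennreal[symmetric] ennreal_divide_self\<close>)

lemma sample_space_prob: "0 < R ==> prob_space (sample_space R \<nu>)"
proof -
 assume R: "0 < R"
 interpret U: prob_space "uniform_measure lborel {0..<R}" using R by (intro prob_space_uniform_measure) auto
 interpret pair_prob_space "uniform_measure lborel {0..<R}" \<nu> ..
 show ?thesis unfolding sample_space_def by (rule prob_space_axioms)
qed

lemma sets_sample_space [measurable_cong]: "sets (sample_space R \<nu>) = sets (borel \<Otimes>\<^sub>M (borel \<Otimes>\<^sub>M borel))"
 unfolding sample_space_def by (rule sets_pair_measure_cong) (simp_all add: sets_nu_pair)

lemma sample_space_snd:
 fixes f :: "real \<times> real => real"
 assumes "0 < R" and [measurable]: "f \<in> borel_measurable \<nu>" and int: "integrable \<nu> f"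
 shows "integrable (sample_space R \<nu>) (\<lambda>z. f (snd z))" "(LINT z|sample_space R \<nu>. f (snd z)) = (LINT z|\<nu>. f z)"
proof -
 let ?U = "uniform_measure lborel {0..<R}"
 interpret U: prob_space ?U using assms(1) by (intro prob_space_uniform_measure) auto
 have d: "distr (sample_space R \<nu>) \<nu> snd = \<nu>"
  unfolding sample_space_def
 proof (rule measure_eqI)
  fix B assume "B \<in> sets (distr (?U \<Otimes>\<^sub>M \<nu>) \<nu> snd)"
  hence B: "B \<in> sets \<nu>" by simp
  have "snd -` B \<inter> space (?U \<Otimes>\<^sub>M \<nu>) = space ?U \<times> B"
   using sets.sets_into_space[OF B] by (auto simp: space_pair_measure)
  hence "emeasure (distr (?U \<Otimes>\<^sub>M \<nu>) \<nu> snd) B = emeasure (?U \<Otimes>\<^sub>M \<nu>) (space ?U \<times> B)"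
   using B by (subst emeasure_distr) auto
  also have "... = emeasure ?U (space ?U) * emeasure \<nu> B" using B by (intro emeasure_pair_measure_Times) auto
  also have "... = emeasure \<nu> B" by (simp only: U.emeasure_space_1 mult_1)
  finally show "emeasure (distr (?U \<Otimes>\<^sub>M \<nu>) \<nu> snd) B = emeasure \<nu> B" .
 qed simp
 have m: "snd \<in> measurable (sample_space R \<nu>) \<nu>" unfolding sample_space_def by measurable
 show "integrable (sample_space R \<nu>) (\<lambda>z. f (snd z))"
  using integrable_distr_eq[OF m, of f] int d by simp
 show "(LINT z|sample_space R \<nu>. f (snd z)) = (LINT z|\<nu>. f z)"
  using integral_distr[OF m, of f] d by simp
qed

lemma sample_space_integral:
 fixes f :: "real \<times> real \<times> real => real"
 assumes R: "0 < R" and int: "integrable (sample_space R \<nu>) f"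
 shows "R * (LINT z|sample_space R \<nu>. f z) = (LINT y|\<nu>. (LINT t|lborel. indicator {0..<R} t * f (t, y)))"
  and "integrable \<nu> (\<lambda>y. (LINT t|lborel. indicator {0..<R} t * f (t, y)))"
proof -
 let ?U = "uniform_measure lborel {0..<R}"
 interpret U: prob_space ?U using R by (intro prob_space_uniform_measure) auto
 interpret UN: pair_sigma_finite ?U \<nu> ..
 have [measurable]: "f \<in> borel_measurable (borel \<Otimes>\<^sub>M (borel \<Otimes>\<^sub>M borel))"
  using borel_measurable_integrable[OF int] by measurable
 have i: "integrable (?U \<Otimes>\<^sub>M \<nu>) (\<lambda>(t, y). f (t, y))" using int unfolding sample_space_def by simp
 have inner: "(LINT t|?U. f (t, y)) = (LINT t|lborel. indicator {0..<R} t * f (t, y)) / R" for y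
 proof -
  have [measurable]: "(\<lambda>t. f (t, y)) \<in> borel_measurable borel"
   by (rule measurable_compose[OF measurable_Pair2' \<open>f \<in> borel_measurable (borel \<Otimes>\<^sub>M (borel \<Otimes>\<^sub>M borel))\<close>])
     (simp add: space_pair_measure)
  have "(LINT t|?U. f (t, y)) = (LINT t|lborel. (indicator {0..<R} t / R) *\<^sub>R f (t, y))"
   unfolding uniform_density[OF R] using R by (intro integral_density) auto
  thus ?thesis by simp
 qed
 have "(LINT z|sample_space R \<nu>. f z) = (LINT y|\<nu>. (LINT t|?U. f (t, y)))"
  unfolding sample_space_def using UN.integral_snd[OF i] by simp
 thus "R * (LINT z|sample_space R \<nu>. f z) = (LINT y|\<nu>. (LINT t|lborel. indicator {0..<R} t * f (t, y)))"
  unfolding inner using R by simp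
 show "integrable \<nu> (\<lambda>y. (LINT t|lborel. indicator {0..<R} t * f (t, y)))"
 proof -
  have "integrable \<nu> (\<lambda>y. (LINT t|lborel. indicator {0..<R} t * f (t, y)) / R)"
   using UN.integrable_snd[OF i] unfolding inner .
  hence "integrable \<nu> (\<lambda>y. R * ((LINT t|lborel. indicator {0..<R} t * f (t, y)) / R))"
   by (rule integrable_mult_right)
  thus ?thesis using R by simp
 qed
qed

end

context wavelet_kernel begin

lemma env_integrable:
 assumes R: "0 < R"
 shows "integrable (sample_space R \<nu>) (\<lambda>z. env j z ^ 4)" "integrable (sample_space R \<nu>) (\<lambda>z. (env j z)^2)"
proof -
 define x :: real where "x = 2 ^ j"
 define b where "b = env_const * (sqrt x * 2)"
 have x: "1 <= x" unfolding x_def by simp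
 have "env j z ^ 4 <= b ^ 4 * \<bar>snd (snd z)\<bar> ^ 4" "(env j z)^2 <= b^2 * \<bar>snd (snd z)\<bar>^2" "0 <= env j z" for z
 proof -
  show e0: "0 <= env j z" unfolding env_def using env_const_nonneg by simp
  have "1 / x <= 1" "min 1 (\<bar>fst (snd z)\<bar> / x) <= 1" using x by simp_all
  hence "min 1 (\<bar>fst (snd z)\<bar> / x) + 1 / x <= 2" by linarith
  hence "env j z <= env_const * \<bar>snd (snd z)\<bar> * (sqrt x * 2)"
   unfolding env_def x_def[symmetric] using env_const_nonneg x by (intro mult_left_mono) auto
  hence "env j z <= b * \<bar>snd (snd z)\<bar>" unfolding b_def by (simp add: mult_ac)
  from power_mono[OF this e0, of 4] power_mono[OF this e0, of 2]
  show "env j z ^ 4 <= b ^ 4 * \<bar>snd (snd z)\<bar> ^ 4" "(env j z)^2 <= b^2 * \<bar>snd (snd z)\<bar>^2" by (simp_all add: power_mult_distrib)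
 qed note b = this
 have m: "(\<lambda>z::real\<times>real. \<bar>snd z\<bar> ^ p) \<in> borel_measurable \<nu>" for p by measurable
 have i4: "integrable (sample_space R \<nu>) (\<lambda>z. b ^ 4 * \<bar>snd (snd z)\<bar> ^ 4)"
  by (intro integrable_mult_right sample_space_snd(1)[OF R m]) (rule moment_integrable, simp)
 have i2: "integrable (sample_space R \<nu>) (\<lambda>z. b^2 * \<bar>snd (snd z)\<bar>^2)"
  by (intro integrable_mult_right sample_space_snd(1)[OF R m]) (rule moment_integrable, simp)
 show "integrable (sample_space R \<nu>) (\<lambda>z. env j z ^ 4)"
  by (rule integrable_boundedI[OF i4]) (measurable, use b in \<open>auto intro!: order_trans[OF _ abs_ge_self]\<close>)
 show "integrable (sample_space R \<nu>) (\<lambda>z. (env j z)^2)"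
  by (rule integrable_boundedI[OF i2]) (measurable, use b in \<open>auto intro!: order_trans[OF _ abs_ge_self]\<close>)
qed

text \<open>The pulses contribute the truncated second moment, and the discretization error a term
  of relative order x^(-2), absorbed because \<open>H\<^sub>2\<close> decays no faster than
  x^(-2).\<close>

lemma env2_bound:
 obtains C j0 where "0 < C" "\<And>j R. j0 <= j ==> 0 < R ==> (LINT z|sample_space R \<nu>. (env j z)^2) <= C * 2 ^ j * mark_tail \<nu> 2 (2 ^ j)"
proof -
 obtain C x0 where C: "0 < C" "1 <= x0" and T: "\<And>x. x0 <= x ==> truncated_moment 2 x <= C * mark_tail \<nu> 2 x"
  using truncated_moment2_bound by metis
 \<comment> \<open>The loss 2 - \<alpha> turns the general lower bound into c x^(-2).\<close>
 obtain c where c: "0 < c" and L: "\<And>x. 1 <= x ==> c * x powr (- \<alpha> - (2 - \<alpha>)) <= mark_tail \<nu> 2 x"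
  using regular_tail_lower[OF tails(2), of "2 - \<alpha>"] alpha by auto
 define m2 where "m2 = (LINT z|\<nu>. \<bar>snd z\<bar>^2)"
 have m20: "0 <= m2" unfolding m2_def by simp
 obtain j0 :: nat where j0: "x0 <= 2 ^ j0" using real_arch_pow[of 2 x0] by (auto intro: less_imp_le)
 define D where "D = 2 * env_const^2 * (C + m2 / c) + 1"
 have D: "0 < D" unfolding D_def using C c m20 by (intro add_nonneg_pos mult_nonneg_nonneg) auto
 show ?thesis
 proof (rule that[OF D, of j0])
  fix j R assume j: "j0 <= j" and R: "0 < (R::real)"
  define x :: real where "x = 2 ^ j"
  have x: "1 <= x" "x0 <= x" unfolding x_def using order_trans[OF j0 power_increasing[OF j, of "2::real"]] by auto
  have Hx: "0 <= mark_tail \<nu> 2 x" by (rule mark_tail_nonneg)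
  have "x powr (- 2) = 1 / x^2" using x by (simp add: powr_minus powr_numeral divide_inverse)
  hence Lx: "c * (1 / x^2) <= mark_tail \<nu> 2 x" using L[OF x(1)] by simp
  have pw: "(env j z)^2 <= 2 * env_const^2 * x * (\<bar>snd (snd z)\<bar>^2 * (min 1 (\<bar>fst (snd z)\<bar> / x))^2 + 1 / x^2 * \<bar>snd (snd z)\<bar>^2)" for z
  proof -
   define m where "m = min 1 (\<bar>fst (snd z)\<bar> / x)"
   have "(m + 1 / x)^2 <= 2 * (m^2 + 1 / x^2)"
    using sum_squares_bound[of m "1 / x"] by (simp add: power2_sum power_divide)
   hence "env_const^2 * \<bar>snd (snd z)\<bar>^2 * x * (m + 1 / x)^2 <= env_const^2 * \<bar>snd (snd z)\<bar>^2 * x * (2 * (m^2 + 1 / x^2))"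
    using x by (intro mult_left_mono) auto
   moreover have "(env j z)^2 = env_const^2 * \<bar>snd (snd z)\<bar>^2 * x * (m + 1 / x)^2"
    unfolding env_def x_def[symmetric] m_def[symmetric] using x by (simp add: power_mult_distrib)
   ultimately show ?thesis unfolding m_def[symmetric] by (simp add: algebra_simps)
  qed
  define f :: "real \<times> real => real" where "f y = 2 * env_const^2 * x * (\<bar>snd y\<bar>^2 * (min 1 (\<bar>fst y\<bar> / x))^2 + 1 / x^2 * \<bar>snd y\<bar>^2)" for y
  have fi: "integrable \<nu> f" unfolding f_def using truncated_moment_integrable[of 2 x] moment_integrable[of 2] x by simp
  have fm: "f \<in> borel_measurable \<nu>" using fi by auto
  have "(LINT z|sample_space R \<nu>. (env j z)^2) <= (LINT z|sample_space R \<nu>. f (snd z))"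
   using pw unfolding f_def[symmetric] by (intro integral_mono env_integrable(2) R sample_space_snd(1)[OF R fm fi])
  also have "... = (LINT y|\<nu>. f y)" by (rule sample_space_snd(2)[OF R fm fi])
  also have "... = 2 * env_const^2 * x * (truncated_moment 2 x + 1 / x^2 * m2)"
   unfolding f_def truncated_moment_def m2_def using truncated_moment_integrable[of 2 x] moment_integrable[of 2] x by simp
  also have "... <= 2 * env_const^2 * x * (C * mark_tail \<nu> 2 x + m2 / c * mark_tail \<nu> 2 x)"
  proof (intro mult_left_mono add_mono T x)
   have "1 / x^2 <= mark_tail \<nu> 2 x / c" using Lx c by (simp add: field_simps)
   hence "m2 * (1 / x^2) <= m2 * (mark_tail \<nu> 2 x / c)" by (intro mult_left_mono m20)
   thus "1 / x^2 * m2 <= m2 / c * mark_tail \<nu> 2 x" by (simp add: mult_ac)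
  qed (use x in auto)
  also have "... = (2 * env_const^2 * (C + m2 / c)) * x * mark_tail \<nu> 2 x" by (simp add: algebra_simps)
  also have "... <= D * x * mark_tail \<nu> 2 x" unfolding D_def using x Hx by (intro mult_right_mono) auto
  finally show "(LINT z|sample_space R \<nu>. (env j z)^2) <= D * 2 ^ j * mark_tail \<nu> 2 (2 ^ j)" unfolding x_def .
 qed
qed

lemma env4_bound:
 assumes "0 < e" "e <= \<alpha>"
 obtains C where "0 < C" "\<And>j R. 0 < R ==> (LINT z|sample_space R \<nu>. env j z ^ 4) <= C * (2 ^ j) powr (2 - \<alpha> + e)"
proof -
 obtain C where C: "0 < C" and T: "\<And>x. 0 < x ==> truncated_moment 4 x <= C * x powr (- \<alpha> + e)"
  using truncated_moment4_bound[OF assms] by metis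
 define m4 where "m4 = (LINT z|\<nu>. \<bar>snd z\<bar> ^ 4)"
 have m40: "0 <= m4" unfolding m4_def by simp
 define D where "D = 8 * env_const ^ 4 * (C + m4) + 1"
 have D: "0 < D" unfolding D_def using C m40 by (intro add_nonneg_pos mult_nonneg_nonneg) auto
 show ?thesis
 proof (rule that[OF D])
  fix j and R :: real assume R: "0 < R"
  define x :: real where "x = 2 ^ j"
  have x: "1 <= x" unfolding x_def by auto
  have pw: "env j z ^ 4 <= 8 * env_const ^ 4 * x^2 * (\<bar>snd (snd z)\<bar> ^ 4 * (min 1 (\<bar>fst (snd z)\<bar> / x))^2 + 1 / x ^ 4 * \<bar>snd (snd z)\<bar> ^ 4)" for z
  proof -
   define m where "m = min 1 (\<bar>fst (snd z)\<bar> / x)"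
   have m: "0 <= m" "m <= 1" unfolding m_def using x by auto
   have "(m + 1 / x) ^ 4 <= 8 * (m ^ 4 + (1 / x) ^ 4)" by (rule sum_fourth_power_le)
   \<comment> \<open>\<open>truncated_moment\<close> contains the square, which suffices here since
     m <= 1.\<close>
   also have "m ^ 4 <= m ^ 2" by (rule power_decreasing) (use m in auto)
   finally have "(m + 1 / x) ^ 4 <= 8 * (m^2 + 1 / x ^ 4)" by (simp add: power_divide)
   hence "env_const ^ 4 * \<bar>snd (snd z)\<bar> ^ 4 * x^2 * (m + 1 / x) ^ 4 <= env_const ^ 4 * \<bar>snd (snd z)\<bar> ^ 4 * x^2 * (8 * (m^2 + 1 / x ^ 4))"
    by (intro mult_left_mono) auto
   moreover have "env j z ^ 4 = env_const ^ 4 * \<bar>snd (snd z)\<bar> ^ 4 * x^2 * (m + 1 / x) ^ 4"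
   proof -
    have "sqrt x ^ 4 = (sqrt x ^ 2) ^ 2" by simp
    also have "... = x^2" using x by simp
    finally show ?thesis
     unfolding env_def x_def[symmetric] m_def[symmetric] by (simp only: power_mult_distrib mult.assoc)
   qed
   ultimately show ?thesis unfolding m_def[symmetric] by (simp add: algebra_simps)
  qed
  define f :: "real \<times> real => real" where "f y = 8 * env_const ^ 4 * x^2 * (\<bar>snd y\<bar> ^ 4 * (min 1 (\<bar>fst y\<bar> / x))^2 + 1 / x ^ 4 * \<bar>snd y\<bar> ^ 4)" for y
  have fi: "integrable \<nu> f"
   unfolding f_def using truncated_moment_integrable[of 4 x] moment_integrable[of 4] x
   by (intro integrable_mult_right integrable_addI) auto
  have fm: "f \<in> borel_measurable \<nu>" using fi by auto
  have "(LINT z|sample_space R \<nu>. env j z ^ 4) <= (LINT z|sample_space R \<nu>. f (snd z))"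
   using pw unfolding f_def[symmetric] by (intro integral_mono env_integrable(1) R sample_space_snd(1)[OF R fm fi])
  also have "... = (LINT y|\<nu>. f y)" by (rule sample_space_snd(2)[OF R fm fi])
  also have "... = 8 * env_const ^ 4 * x^2 * (truncated_moment 4 x + 1 / x ^ 4 * m4)"
   unfolding f_def truncated_moment_def m4_def using truncated_moment_integrable[of 4 x] moment_integrable[of 4] x
   by (subst integral_mult_right_zero, subst lint_add) auto
  also have "... <= 8 * env_const ^ 4 * x^2 * (C * x powr (- \<alpha> + e) + x powr (- \<alpha> + e) * m4)"
  proof (intro mult_left_mono add_mono T mult_right_mono m40)
   have "1 / x ^ 4 = x powr (- 4)" using x by (simp add: powr_minus powr_numeral divide_inverse)
   also have "... <= x powr (- \<alpha> + e)" using x alpha assms by (intro powr_mono) auto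
   finally show "1 / x ^ 4 <= x powr (- \<alpha> + e)" .
  qed (use x in auto)
  also have "... = (8 * env_const ^ 4 * (C + m4)) * (x^2 * x powr (- \<alpha> + e))" by (simp add: algebra_simps)
  also have "x^2 * x powr (- \<alpha> + e) = x powr (2 - \<alpha> + e)"
  proof -
   have "x powr (2 - \<alpha> + e) = x powr (2 + (- \<alpha> + e))" by (simp add: algebra_simps)
   thus ?thesis using x by (simp only: powr_add) (simp add: powr_numeral)
  qed
  also have "8 * env_const ^ 4 * (C + m4) * x powr (2 - \<alpha> + e) <= D * x powr (2 - \<alpha> + e)"
   unfolding D_def by (intro mult_right_mono) auto
  finally show "(LINT z|sample_space R \<nu>. env j z ^ 4) <= D * (2 ^ j) powr (2 - \<alpha> + e)" unfolding x_def .
 qed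
qed

end

lemma filterlim_realpow_at_top:
 assumes "1 < (b::real)"
 shows "filterlim (\<lambda>j. b ^ j) at_top sequentially"
proof (rule filterlim_at_top_gt[THEN iffD2, rule_format])
 fix Z :: real
 obtain n where n: "Z < b ^ n" using real_arch_pow[OF assms] by blast
 show "\<forall>\<^sub>F j in sequentially. Z <= b ^ j"
  using eventually_ge_at_top[of n]
 proof eventually_elim
  case (elim j)
  have "b ^ n <= b ^ j" using elim assms by (intro power_increasing) auto
  thus ?case using n by simp
 qed
qed

lemma sum_inverse_squares_le: "(\<Sum>k=1..n. 1 / (real k)^2) <= 2"
proof -
 have "(\<Sum>k=1..n. 1 / (real k)^2) <= 2 - 1 / real n" if "0 < n" for n
  using that
 proof (induction n rule: nat_induct_non_zero)
  case (Suc n)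
  define a where "a = real n"
  have a: "1 <= a" using Suc(1) unfolding a_def by simp
  have "1 / (a + 1)^2 <= 1 / (a * (a + 1))"
   using a by (intro divide_left_mono) (auto simp: power2_eq_square)
  also have "... = 1 / a - 1 / (a + 1)" using a by (simp add: field_simps)
  finally have "1 / (real (Suc n))^2 <= 1 / real n - 1 / real (Suc n)" unfolding a_def by (simp add: add.commute)
  thus ?case using Suc.IH by simp
 qed simp
 from this[of n] show ?thesis by (cases "n = 0") (auto intro: order_trans[of _ "2 - 1 / real n"])
qed

lemma integrable_bound_real:
 fixes f g :: "'a => real"
 assumes "integrable M f" "g \<in> borel_measurable M" "\<And>x. \<bar>g x\<bar> <= f x"
 shows "integrable M g"
 by (rule integrable_boundedI[OF assms(1,2)])
   (use assms(3) in \<open>auto intro!: AE_I2 order_trans[OF _ abs_ge_self]\<close>)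

context wavelet_kernel begin

section \<open>Second moments of the coefficients\<close>

lemma atom_integrable:
 assumes R: "0 < R"
 shows "integrable (sample_space R \<nu>) (atom j k)" "integrable (sample_space R \<nu>) (\<lambda>z. (atom j k z)^2)"
proof -
 interpret Q: prob_space "sample_space R \<nu>" by (rule sample_space_prob[OF R])
 have m: "atom j k \<in> borel_measurable (sample_space R \<nu>)"
  by (subst measurable_cong_sets[OF sets_sample_space refl]) (rule atom_measurable)
 have le: "\<bar>atom j k z\<bar> <= env j z" for z
 proof -
  have "\<bar>atom j k z\<bar> <= (\<Sum>k<Suc k. \<bar>atom j k z\<bar>)" by (rule member_le_sum) auto
  thus ?thesis using sum_atom_le_env[of j z "Suc k"] by linarith
 qed
 show i2: "integrable (sample_space R \<nu>) (\<lambda>z. (atom j k z)^2)"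
 proof (rule integrable_boundedI[OF env_integrable(2)[OF R, of j]])
  show "AE z in sample_space R \<nu>. norm ((atom j k z)^2) <= norm ((env j z)^2)"
   using power_mono[OF le, where n = 2] by auto
 qed (rule borel_measurable_power[OF m])
 show "integrable (sample_space R \<nu>) (atom j k)"
  by (rule Q.expectation_abs_le_sqrt(1)[OF m i2])
qed

definition main_part :: "nat => nat => real => real => real" where
 "main_part j k v t = sqrt (2 ^ j) * (prim ((t + v) / 2 ^ j - real k) - prim (t / 2 ^ j - real k))"

definition resid_part :: "nat => nat => real => real => real" where
 "resid_part j k v t = resid j k (t + v) - resid j k t"

lemma kernel_split: "\<Psi> j k (t + v) - \<Psi> j k t = main_part j k v t + resid_part j k v t"
 unfolding main_part_def resid_part_def resid_def by (simp add: algebra_simps)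

lemma main_part_measurable [measurable]: "main_part j k v \<in> borel_measurable borel"
 unfolding main_part_def by measurable

lemma resid_part_measurable [measurable]: "resid_part j k v \<in> borel_measurable borel"
 unfolding resid_part_def by measurable

lemma main_part_square:
 shows "integrable lborel (\<lambda>t. (main_part j k v t)^2)"
  and "(LINT t|lborel. (main_part j k v t)^2) = (2 ^ j)^2 * energy (v / 2 ^ j)"
proof -
 define x :: real where "x = 2 ^ j"
 have x: "0 < x" unfolding x_def by simp
 define f where "f s = (prim (s + v / x) - prim s)^2" for s
 have fi: "integrable lborel f" unfolding f_def by (rule energy_integrable)
 have e: "(\<lambda>t. (main_part j k v t)^2) = (\<lambda>t. x * f (- real k + (1 / x) * t))"
 proof
  fix t
  have a: "(t + v) / x - real k = - real k + (1 / x) * t + v / x" "t / x - real k = - real k + (1 / x) * t"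
   by (simp_all add: add_divide_distrib)
  show "(main_part j k v t)^2 = x * f (- real k + (1 / x) * t)"
   unfolding main_part_def f_def x_def[symmetric] a using x by (simp add: power_mult_distrib)
 qed
 show "integrable lborel (\<lambda>t. (main_part j k v t)^2)"
  unfolding e using x by (intro integrable_mult_right lborel_integrable_real_affine[OF fi]) auto
 have "energy (v / x) = (1 / x) * (LINT t|lborel. f (- real k + (1 / x) * t))"
  using lborel_integral_real_affine[of "1 / x" f "- real k"] x unfolding energy_def f_def by simp
 thus "(LINT t|lborel. (main_part j k v t)^2) = (2 ^ j)^2 * energy (v / 2 ^ j)"
  unfolding e x_def[symmetric] using x by (simp add: power2_eq_square)
qed

text \<open>Squared height of order 2^(-j) on a window of length of order 2^j: the energy of the
  discretization error is bounded uniformly in j and k, against 4^j times the pulse energy for the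
  main part.\<close>

lemma resid_square:
 shows "integrable lborel (\<lambda>t. (resid j k t)^2)" "(LINT t|lborel. (resid j k t)^2) <= C1^2 * (A + 1)"
proof -
 define x :: real where "x = 2 ^ j"
 have x: "1 <= x" unfolding x_def by simp
 let ?I = "{x * real k - 1..x * (real k + A)}"
 have len: "x * real k - 1 <= x * (real k + A)" using x A_ge_1 mult_nonneg_nonneg[of x A] by (simp add: algebra_simps)
 have b: "(resid j k t)^2 <= C1^2 / x * indicator ?I t" for t
 proof (cases "resid j k t = 0")
  case True
  thus ?thesis using x by simp
 next
  case False
  have "(resid j k t)^2 <= (C1 / sqrt x)^2"
   using power_mono[OF resid_bound[of j k t], of 2] unfolding x_def by simp
  also have "... = C1^2 / x" using x by (simp add: power_divide)
  finally show ?thesis using resid_support[OF False] unfolding x_def by simp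
 qed
 have ii: "integrable lborel (\<lambda>t. C1^2 / x * indicator ?I t)"
  using len by (intro integrable_mult_right integrable_real_indicator) auto
 show i: "integrable lborel (\<lambda>t. (resid j k t)^2)"
  by (rule integrable_bound_real[OF ii]) (measurable, use b in simp)
 have "(LINT t|lborel. (resid j k t)^2) <= (LINT t|lborel. C1^2 / x * indicator ?I t)" by (rule integral_mono[OF i ii b])
 also have "... = C1^2 / x * (x * A + 1)" using len by (simp add: algebra_simps)
 also have "... <= C1^2 / x * (x * (A + 1))" using x by (intro mult_left_mono) (auto simp: algebra_simps)
 also have "... = C1^2 * (A + 1)" using x by simp
 finally show "(LINT t|lborel. (resid j k t)^2) <= C1^2 * (A + 1)" .
qed

lemma resid_part_square:
 shows "integrable lborel (\<lambda>t. (resid_part j k v t)^2)" "(LINT t|lborel. (resid_part j k v t)^2) <= 4 * C1^2 * (A + 1)"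
proof -
 have b: "(resid_part j k v t)^2 <= 2 * (resid j k (t + v))^2 + 2 * (resid j k t)^2" for t
 proof -
  have "0 <= (resid j k (t + v) + resid j k t)^2" by simp
  thus ?thesis unfolding resid_part_def by (simp add: power2_eq_square algebra_simps)
 qed
 have ii: "integrable lborel (\<lambda>t. 2 * (resid j k (t + v))^2 + 2 * (resid j k t)^2)"
  using shift_integrable(1)[OF resid_square(1), of j k v] resid_square(1)[of j k] by simp
 show i: "integrable lborel (\<lambda>t. (resid_part j k v t)^2)"
  by (rule integrable_bound_real[OF ii]) (measurable, use b in simp)
 have "(LINT t|lborel. (resid_part j k v t)^2) <= (LINT t|lborel. 2 * (resid j k (t + v))^2 + 2 * (resid j k t)^2)" by (rule integral_mono[OF i ii b])
 also have "... = 4 * (LINT t|lborel. (resid j k t)^2)"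
  using shift_integrable[OF resid_square(1), of j k v] resid_square(1)[of j k] by simp
 also have "... <= 4 * (C1^2 * (A + 1))" using resid_square(2) by simp
 finally show "(LINT t|lborel. (resid_part j k v t)^2) <= 4 * C1^2 * (A + 1)" by simp
qed

text \<open>Young's inequality with a free weight h, so that the main term is disturbed only by an
  arbitrarily small fraction of itself.\<close>

lemma square_perturbation:
 fixes a d h :: real
 assumes "0 < h"
 shows "\<bar>(a + d)^2 - a^2\<bar> <= h * a^2 + (1 + 1 / h) * d^2"
proof -
 have "0 <= (h * \<bar>a\<bar> - \<bar>d\<bar>)^2" by simp
 also have "... = h * (h * a^2) - 2 * h * (\<bar>a\<bar> * \<bar>d\<bar>) + d^2"
  by (simp add: power2_eq_square algebra_simps)
 finally have "(2 * \<bar>a * d\<bar>) * h <= (h * a^2 + d^2 / h) * h"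
  using assms by (simp add: abs_mult algebra_simps)
 hence "2 * \<bar>a * d\<bar> <= h * a^2 + d^2 / h" using assms by (rule mult_right_le_imp_le)
 moreover have "\<bar>(a + d)^2 - a^2\<bar> <= 2 * \<bar>a * d\<bar> + d^2"
 proof -
  have "(a + d)^2 - a^2 = 2 * (a * d) + d^2" by (simp add: power2_sum)
  thus ?thesis using abs_triangle_ineq[of "2 * (a * d)" "d^2"] by (simp add: abs_mult)
 qed
 ultimately show ?thesis by (simp add: distrib_right)
qed

text \<open>The part of the second moment of a coefficient that is due to pulses of one duration v,
  before weighting by their size.\<close>

definition slice :: "real => nat => nat => real => real" where
 "slice R j k v = (LINT t|lborel. indicator {0..<R} t * (\<Psi> j k (t + v) - \<Psi> j k t)^2)"

lemma indicator_mult_integrable: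
 fixes f :: "real => real"
 assumes "integrable lborel f"
 shows "integrable lborel (\<lambda>t. indicator {a..<b} t * f t)"
 using integrable_mult_indicator[OF _ assms, of "{a..<b}"] by simp

lemma slice_integrand_integrable: "integrable lborel (\<lambda>t. (\<Psi> j k (t + v) - \<Psi> j k t)^2)"
proof -
 have b: "(\<Psi> j k (t + v) - \<Psi> j k t)^2 <= 2 * (main_part j k v t)^2 + 2 * (resid_part j k v t)^2" for t
 proof -
  have "0 <= (main_part j k v t - resid_part j k v t)^2" by simp
  thus ?thesis unfolding kernel_split by (simp add: power2_eq_square algebra_simps)
 qed
 show ?thesis
  by (rule integrable_bound_real[where f="\<lambda>t. 2 * (main_part j k v t)^2 + 2 * (resid_part j k v t)^2"])
    (use main_part_square(1) resid_part_square(1) b in simp_all)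
qed

lemma slice_upper: "slice R j k v <= 2 * (2 ^ j)^2 * energy (v / 2 ^ j) + 8 * C1^2 * (A + 1)"
proof -
 have "slice R j k v <= (LINT t|lborel. 2 * (main_part j k v t)^2 + 2 * (resid_part j k v t)^2)"
  unfolding slice_def
 proof (rule integral_mono)
  show "integrable lborel (\<lambda>t. indicator {0..<R} t * (\<Psi> j k (t + v) - \<Psi> j k t)^2)"
   by (rule indicator_mult_integrable[OF slice_integrand_integrable])
  show "integrable lborel (\<lambda>t. 2 * (main_part j k v t)^2 + 2 * (resid_part j k v t)^2)"
   using main_part_square(1) resid_part_square(1) by simp
  fix t
  have "0 <= (main_part j k v t - resid_part j k v t)^2" by simp
  hence "(\<Psi> j k (t + v) - \<Psi> j k t)^2 <= 2 * (main_part j k v t)^2 + 2 * (resid_part j k v t)^2"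
   unfolding kernel_split by (simp add: power2_eq_square algebra_simps)
  thus "indicator {0..<R} t * (\<Psi> j k (t + v) - \<Psi> j k t)^2 <= 2 * (main_part j k v t)^2 + 2 * (resid_part j k v t)^2"
   by (auto simp: indicator_def)
 qed
 also have "... = 2 * ((2 ^ j)^2 * energy (v / 2 ^ j)) + 2 * (LINT t|lborel. (resid_part j k v t)^2)"
  using main_part_square[of j k v] resid_part_square(1)[of j k v] by simp
 also have "... <= 2 * ((2 ^ j)^2 * energy (v / 2 ^ j)) + 2 * (4 * C1^2 * (A + 1))"
  using resid_part_square(2)[of j k v] by linarith
 finally show ?thesis by simp
qed

text \<open>The last term accounts for the sources that would have started before time 0.\<close>

lemma slice_approx:
 assumes v: "0 < v" and R: "2 ^ j * (real k + A) <= R" and h: "0 < h"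
 shows "\<bar>slice R j k v - (2 ^ j)^2 * energy (v / 2 ^ j)\<bar> <=
  h * ((2 ^ j)^2 * energy (v / 2 ^ j)) + (1 + 1 / h) * (4 * C1^2 * (A + 1))
  + K^2 * M ^ 3 * (2 ^ j)^2 * indicator {2 ^ j * real k<..} v"
proof -
 define x :: real where "x = 2 ^ j"
 have x: "1 <= x" unfolding x_def by simp
 let ?a = "main_part j k v" and ?d = "resid_part j k v"
 define G where "G = (LINT t|lborel. indicator {0..<R} t * (?a t)^2)"
 have ai: "integrable lborel (\<lambda>t. (?a t)^2)" by (rule main_part_square(1))
 have di: "integrable lborel (\<lambda>t. (?d t)^2)" by (rule resid_part_square(1))
 have "\<bar>slice R j k v - G\<bar> = \<bar>(LINT t|lborel. indicator {0..<R} t * ((?a t + ?d t)^2 - (?a t)^2))\<bar>"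
  unfolding slice_def G_def
  by (subst lint_diff[symmetric])
    (auto simp: kernel_split right_diff_distrib intro!: indicator_mult_integrable ai slice_integrand_integrable[unfolded kernel_split])
 also have "... <= (LINT t|lborel. \<bar>indicator {0..<R} t * ((?a t + ?d t)^2 - (?a t)^2)\<bar>)" by (rule integral_abs_bound)
 also have "... <= (LINT t|lborel. h * (?a t)^2 + (1 + 1 / h) * (?d t)^2)"
 proof (rule integral_mono)
  show "integrable lborel (\<lambda>t. \<bar>indicator {0..<R} t * ((?a t + ?d t)^2 - (?a t)^2)\<bar>)"
   by (intro integrable_abs indicator_mult_integrable integrable_diffI ai slice_integrand_integrable[unfolded kernel_split])
  show "integrable lborel (\<lambda>t. h * (?a t)^2 + (1 + 1 / h) * (?d t)^2)" using ai di by simp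
  fix t
  have "\<bar>(?a t + ?d t)^2 - (?a t)^2\<bar> <= h * (?a t)^2 + (1 + 1 / h) * (?d t)^2" by (rule square_perturbation[OF h])
  moreover from this have "0 <= h * (?a t)^2 + (1 + 1 / h) * (?d t)^2" by linarith
  ultimately show "\<bar>indicator {0..<R} t * ((?a t + ?d t)^2 - (?a t)^2)\<bar> <= h * (?a t)^2 + (1 + 1 / h) * (?d t)^2"
   by (auto simp: indicator_def)
 qed
 also have "... = h * (x^2 * energy (v / x)) + (1 + 1 / h) * (LINT t|lborel. (?d t)^2)"
  using main_part_square[of j k v] di unfolding x_def by simp
 also have "... <= h * (x^2 * energy (v / x)) + (1 + 1 / h) * (4 * C1^2 * (A + 1))"
  using resid_part_square(2)[of j k v] h by (intro add_left_mono mult_left_mono) auto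
 finally have 1: "\<bar>slice R j k v - G\<bar> <= h * (x^2 * energy (v / x)) + (1 + 1 / h) * (4 * C1^2 * (A + 1))" .
 let ?I = "{x * real k - v..<x * (real k + M) - v}"
 have pw: "(?a t)^2 - indicator {0..<R} t * (?a t)^2 <= x * (K * M)^2 * (indicator ?I t * indicator {x * real k<..} v)" for t
 proof (cases "t \<in> {0..<R} \<or> ?a t = 0")
  case True
  thus ?thesis using x by (auto simp: indicator_def)
 next
  case False
  have t0: "t < 0"
  proof (rule ccontr)
   assume "\<not> t < 0"
   hence "R <= t" using False by auto
   moreover have "x * M <= x * A" using A x by (intro mult_left_mono) auto
   ultimately have "x * (real k + M) <= t" using R unfolding x_def[symmetric] by (simp add: algebra_simps)
   hence "M <= t / x - real k" using x by (simp add: field_simps)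
   moreover have "t / x <= (t + v) / x" using x v by (intro divide_right_mono) auto
   ultimately have "?a t = 0" unfolding main_part_def x_def[symmetric] using prim_eq_0[of "t / x - real k"] prim_eq_0[of "(t + v) / x - real k"] by simp
   thus False using False by simp
  qed
  have "t / x <= 0" using t0 x by (simp add: divide_nonpos_pos)
  hence p0: "prim (t / x - real k) = 0" by (intro prim_eq_0) simp
  hence a: "?a t = sqrt x * prim ((t + v) / x - real k)" unfolding main_part_def x_def by simp
  hence "prim ((t + v) / x - real k) \<noteq> 0" using False by auto
  hence "0 < (t + v) / x - real k" "(t + v) / x - real k < M" using prim_eq_0 not_le by blast+
  hence tv: "x * real k < t + v" "t + v < x * (real k + M)" using x by (simp_all add: field_simps)
  have "(?a t)^2 = x * (prim ((t + v) / x - real k))^2" unfolding a using x by (simp add: power_mult_distrib)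
  also have "... <= x * (K * M)^2" using power_mono[OF prim_bound[of "(t + v) / x - real k"], of 2] x by (intro mult_left_mono) auto
  finally show ?thesis using tv t0 False by (auto simp: indicator_def)
 qed
 have "x^2 * energy (v / x) - G = (LINT t|lborel. (?a t)^2 - indicator {0..<R} t * (?a t)^2)"
  unfolding G_def using main_part_square[of j k v] indicator_mult_integrable[OF ai] unfolding x_def by simp
 also have "... <= (LINT t|lborel. x * (K * M)^2 * (indicator ?I t * indicator {x * real k<..} v))"
  using x M pw by (intro integral_mono integrable_diffI indicator_mult_integrable ai integrable_mult_right integrable_mult_left integrable_real_indicator) auto
 also have "... = x * (K * M)^2 * (x * M * indicator {x * real k<..} v)" using x M by (simp add: algebra_simps)
 also have "... = K^2 * M ^ 3 * x^2 * indicator {x * real k<..} v" by (simp add: power2_eq_square power3_eq_cube)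
 finally have 2: "x^2 * energy (v / x) - G <= K^2 * M ^ 3 * x^2 * indicator {x * real k<..} v" .
 have "G <= (LINT t|lborel. (?a t)^2)"
  unfolding G_def by (rule integral_mono[OF indicator_mult_integrable[OF ai] ai]) (auto simp: indicator_def)
 hence 3: "G <= x^2 * energy (v / x)" using main_part_square(2)[of j k v] unfolding x_def by simp
 show ?thesis using 1 2 3 unfolding x_def[symmetric] by linarith
qed

text \<open>By Campbell's formula, the variance of a coefficient when the number of sources in [0,
  R) is Poisson.\<close>

definition kappa :: "real => nat => nat => real" where
 "kappa R j k = R * (LINT z|sample_space R \<nu>. (atom j k z)^2)"

lemma kappa_eq:
 assumes "0 < R"
 shows "kappa R j k = (LINT y|\<nu>. \<bar>snd y\<bar>^2 * slice R j k (fst y))" "integrable \<nu> (\<lambda>y. \<bar>snd y\<bar>^2 * slice R j k (fst y))"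
proof -
 have e: "(LINT t|lborel. indicator {0..<R} t * (atom j k (t, y))^2) = \<bar>snd y\<bar>^2 * slice R j k (fst y)" for y
 proof -
  have "(\<lambda>t. indicator {0..<R} t * (atom j k (t, y))^2) = (\<lambda>t. \<bar>snd y\<bar>^2 * (indicator {0..<R} t * (\<Psi> j k (t + fst y) - \<Psi> j k t)^2))"
   unfolding atom_def by (simp add: power_mult_distrib mult_ac)
  thus ?thesis unfolding slice_def by simp
 qed
 show "kappa R j k = (LINT y|\<nu>. \<bar>snd y\<bar>^2 * slice R j k (fst y))" "integrable \<nu> (\<lambda>y. \<bar>snd y\<bar>^2 * slice R j k (fst y))"
  using sample_space_integral[OF assms atom_integrable(2)[OF assms, of j k]] unfolding e kappa_def by auto
qed

definition scale_energy :: "real => real" where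
 "scale_energy x = (LINT z|\<nu>. \<bar>snd z\<bar>^2 * energy (fst z / x))"

definition m2 :: real where "m2 = (LINT z|\<nu>. \<bar>snd z\<bar>^2)"

lemma m2_nonneg: "0 <= m2" unfolding m2_def by simp

lemma kappa_upper:
 assumes R: "0 < R"
 shows "kappa R j k <= 2 * (2 ^ j)^2 * scale_energy (2 ^ j) + 8 * C1^2 * (A + 1) * m2"
proof -
 have ei: "integrable \<nu> (\<lambda>z. \<bar>snd z\<bar>^2 * energy (fst z / 2 ^ j))" by (rule energy_moment(1)) simp
 have ui: "integrable \<nu> (\<lambda>z. \<bar>snd z\<bar>^2)" by (rule moment_integrable) simp
 have "kappa R j k <= (LINT y|\<nu>. 2 * (2 ^ j)^2 * (\<bar>snd y\<bar>^2 * energy (fst y / 2 ^ j)) + 8 * C1^2 * (A + 1) * \<bar>snd y\<bar>^2)"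
  unfolding kappa_eq(1)[OF R]
 proof (rule integral_mono[OF kappa_eq(2)[OF R]])
  show "integrable \<nu> (\<lambda>y. 2 * (2 ^ j)^2 * (\<bar>snd y\<bar>^2 * energy (fst y / 2 ^ j)) + 8 * C1^2 * (A + 1) * \<bar>snd y\<bar>^2)"
   by (intro integrable_addI integrable_mult_right ei ui)
  fix y :: "real \<times> real"
  show "\<bar>snd y\<bar>^2 * slice R j k (fst y) <= 2 * (2 ^ j)^2 * (\<bar>snd y\<bar>^2 * energy (fst y / 2 ^ j)) + 8 * C1^2 * (A + 1) * \<bar>snd y\<bar>^2"
   using mult_left_mono[OF slice_upper[of R j k "fst y"], of "\<bar>snd y\<bar>^2"] by (simp add: algebra_simps)
 qed
 also have "... = 2 * (2 ^ j)^2 * scale_energy (2 ^ j) + 8 * C1^2 * (A + 1) * m2"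
  unfolding scale_energy_def m2_def
  by (subst lint_add) (intro integrable_mult_right ei ui, intro integrable_mult_right ei ui, simp)
 finally show ?thesis .
qed

lemma kappa_approx:
 assumes R: "0 < R" "2 ^ j * (real k + A) <= R" and h: "0 < h"
 shows "\<bar>kappa R j k - (2 ^ j)^2 * scale_energy (2 ^ j)\<bar> <=
  h * ((2 ^ j)^2 * scale_energy (2 ^ j)) + (1 + 1 / h) * (4 * C1^2 * (A + 1)) * m2
  + K^2 * M ^ 3 * (2 ^ j)^2 * mark_tail \<nu> 2 (2 ^ j * real k)"
proof -
 define x :: real where "x = 2 ^ j"
 define c where "c = (1 + 1 / h) * (4 * C1^2 * (A + 1))"
 define d where "d = K^2 * M ^ 3 * x^2"
 have ei: "integrable \<nu> (\<lambda>z. \<bar>snd z\<bar>^2 * energy (fst z / x))" unfolding x_def by (rule energy_moment(1)) simp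
 have ui: "integrable \<nu> (\<lambda>z. \<bar>snd z\<bar>^2)" by (rule moment_integrable) simp
 have hi: "integrable \<nu> (\<lambda>z. \<bar>snd z\<bar>^2 * indicator {x * real k<..} (fst z))" by (rule mark_tail_integrable) simp
 have ki: "integrable \<nu> (\<lambda>y. \<bar>snd y\<bar>^2 * slice R j k (fst y))" by (rule kappa_eq(2)[OF R(1)])
 let ?B = "\<lambda>y :: real \<times> real. h * x^2 * (\<bar>snd y\<bar>^2 * energy (fst y / x)) + c * \<bar>snd y\<bar>^2 + d * (\<bar>snd y\<bar>^2 * indicator {x * real k<..} (fst y))"
 have Bi: "integrable \<nu> ?B" by (intro integrable_addI integrable_mult_right ei ui hi)
 let ?D = "\<lambda>y :: real \<times> real. \<bar>snd y\<bar>^2 * slice R j k (fst y) - x^2 * (\<bar>snd y\<bar>^2 * energy (fst y / x))"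
 have Di: "integrable \<nu> ?D" by (intro integrable_diffI integrable_mult_right ei ki)
 have "kappa R j k - x^2 * scale_energy x = (LINT y|\<nu>. ?D y)"
  unfolding kappa_eq(1)[OF R(1)] scale_energy_def
  by (subst lint_diff) (intro ki integrable_mult_right ei, intro integrable_mult_right ei, simp)
 hence "\<bar>kappa R j k - x^2 * scale_energy x\<bar> <= (LINT y|\<nu>. \<bar>?D y\<bar>)" by (simp only: integral_abs_bound)
 also have "... <= (LINT y|\<nu>. ?B y)"
 proof (rule integral_mono_AE[OF integrable_abs[OF Di] Bi])
  show "AE y in \<nu>. \<bar>?D y\<bar> <= ?B y"
   using duration_pos
  proof eventually_elim
   case (elim y)
   have "\<bar>?D y\<bar> = \<bar>snd y\<bar>^2 * \<bar>slice R j k (fst y) - x^2 * energy (fst y / x)\<bar>"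
   proof -
    have "?D y = \<bar>snd y\<bar>^2 * (slice R j k (fst y) - x^2 * energy (fst y / x))" by (simp add: algebra_simps)
    thus ?thesis by (simp only: abs_mult) simp
   qed
   also have "... <= \<bar>snd y\<bar>^2 * (h * (x^2 * energy (fst y / x)) + c + d * indicator {x * real k<..} (fst y))"
    using slice_approx[OF elim R(2) h] unfolding x_def c_def d_def by (intro mult_left_mono) auto
   also have "... = ?B y" by (simp add: algebra_simps)
   finally show ?case .
  qed
 qed
 also have "... = h * x^2 * scale_energy x + c * m2 + d * mark_tail \<nu> 2 (x * real k)"
  unfolding scale_energy_def m2_def mark_tail_def
  by (subst lint_add, intro integrable_addI integrable_mult_right ei ui, intro integrable_mult_right hi,
    subst lint_add, intro integrable_mult_right ei, intro integrable_mult_right ui, simp)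
 finally show ?thesis unfolding x_def c_def d_def by (simp add: mult_ac)
qed

definition q :: "nat => real" where
 "q j = (2 ^ j)^2 * mark_tail \<nu> 2 (2 ^ j)"

lemma tail2_pos: "0 <= x ==> 0 < mark_tail \<nu> 2 x"
 using tails(2) unfolding regular_tail_def by auto

lemma q_pos: "0 < q j"
 unfolding q_def using tail2_pos[of "2 ^ j"] by simp

lemma q_lower:
 assumes "0 < d"
 obtains c where "0 < c" "\<And>j. c * (2 ^ j) powr (2 - \<alpha> - d) <= q j"
proof -
 obtain c where c: "0 < c" and L: "\<And>x. 1 <= x ==> c * x powr (- \<alpha> - d) <= mark_tail \<nu> 2 x"
  using regular_tail_lower[OF tails(2) assms alpha(1)] by metis
 show ?thesis
 proof (rule that[OF c])
  fix j
  define x :: real where "x = 2 ^ j"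
  have x: "1 <= x" unfolding x_def by simp
  have e: "x powr (2 - \<alpha> - d) = x^2 * x powr (- \<alpha> - d)"
  proof -
   have "x powr (2 - \<alpha> - d) = x powr (2 + (- \<alpha> - d))" by (simp add: algebra_simps)
   thus ?thesis using x by (simp only: powr_add) (simp add: powr_numeral)
  qed
  have "x^2 * (c * x powr (- \<alpha> - d)) <= x^2 * mark_tail \<nu> 2 x" by (intro mult_left_mono L x) auto
  thus "c * (2 ^ j) powr (2 - \<alpha> - d) <= q j" unfolding q_def x_def[symmetric] e by (simp add: mult_ac)
 qed
qed

lemma q_tendsto: "filterlim q at_top sequentially"
proof -
 define e where "e = (2 - \<alpha>) / 2"
 have e: "0 < e" "0 < 2 - \<alpha> - e" using alpha unfolding e_def by (simp_all add: field_simps)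
 obtain c where c: "0 < c" and L: "\<And>j. c * (2 ^ j) powr (2 - \<alpha> - e) <= q j" using q_lower[OF e(1)] by metis
 have "((2::real) ^ j) powr (2 - \<alpha> - e) = (2 powr (2 - \<alpha> - e)) ^ j" for j
  by (simp add: powr_powr mult.commute flip: powr_realpow)
 hence "filterlim (\<lambda>j. ((2::real) ^ j) powr (2 - \<alpha> - e)) at_top sequentially"
  using e(2) by (simp add: filterlim_realpow_at_top)
 hence "filterlim (\<lambda>j. c * (2 ^ j) powr (2 - \<alpha> - e)) at_top sequentially"
  by (rule filterlim_tendsto_pos_mult_at_top[OF tendsto_const c])
 thus ?thesis by (rule filterlim_at_top_mono) (use L in auto)
qed

text \<open>For large k the missing sources before time 0 hardly matter, and \<open>kappa\<close> is
  close to C0 q(j) by \<open>energy_moment_asymptotics\<close>. For the first few k there is only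
  the upper bound, and averaging over n coefficients makes them negligible.\<close>

lemma second_moment_asymptotics:
 obtains C0 C j1 where "0 < C0" "0 < C"
  "\<And>R j k. j1 <= j ==> 0 < R ==> kappa R j k <= C * q j"
  "\<And>e. 0 < e ==> \<exists>j0 n0. \<forall>j\<ge>j0. \<forall>n\<ge>n0. \<forall>R>0. 2 ^ j * (real n + A) <= R --> \<bar>(\<Sum>k<n. kappa R j k) - C0 * (real n * q j)\<bar> <= e * (real n * q j)"
proof -
 define H where "H = mark_tail \<nu> 2"
 have Hpos: "0 < H x" if "0 <= x" for x unfolding H_def by (rule tail2_pos[OF that])
 obtain C0 where C0: "0 < C0" and lim: "((\<lambda>x. scale_energy x / H x) \<longlongrightarrow> C0) at_top"
  by (rule energy_moment_asymptotics[folded scale_energy_def H_def])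
 have pow: "filterlim (\<lambda>j. (2::real) ^ j) at_top sequentially" by (rule filterlim_realpow_at_top) simp
 have lim2: "(\<lambda>j. scale_energy (2 ^ j) / H (2 ^ j)) \<longlonglongrightarrow> C0" by (rule filterlim_compose[OF lim pow])
 have qinv: "(\<lambda>j. inverse (q j)) \<longlonglongrightarrow> 0" by (rule filterlim_compose[OF tendsto_inverse_0_at_top q_tendsto]) (rule filterlim_ident)
 have qH: "q j = (2 ^ j)^2 * H (2 ^ j)" for j unfolding q_def H_def ..
 define B where "B = 8 * C1^2 * (A + 1) * m2"
 have B0: "0 <= B" unfolding B_def using A_ge_1 m2_nonneg by simp
 have "\<forall>\<^sub>F j in sequentially. scale_energy (2 ^ j) / H (2 ^ j) < C0 + 1" by (rule order_tendstoD[OF lim2]) simp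
 moreover have "\<forall>\<^sub>F j in sequentially. inverse (q j) < 1" by (rule order_tendstoD[OF qinv]) simp
 ultimately have "\<forall>\<^sub>F j in sequentially. scale_energy (2 ^ j) / H (2 ^ j) < C0 + 1 \<and> inverse (q j) < 1" by eventually_elim simp
 then obtain j1 where j1: "\<And>j. j1 <= j ==> scale_energy (2 ^ j) / H (2 ^ j) < C0 + 1 \<and> inverse (q j) < 1"
  unfolding eventually_sequentially by blast
 define C where "C = 2 * (C0 + 1) + B"
 have C: "0 < C" unfolding C_def using C0 B0 by simp
 have seq: "scale_energy (2 ^ j) <= (C0 + 1) * H (2 ^ j)" if "j1 <= j" for j
  using j1[OF that] Hpos[of "2 ^ j"] by (simp add: field_simps)
 have upper: "kappa R j k <= C * q j" if j: "j1 <= j" and R: "0 < R" for R j k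
 proof -
  have "kappa R j k <= 2 * (2 ^ j)^2 * scale_energy (2 ^ j) + B" unfolding B_def by (rule kappa_upper[OF R])
  also have "... <= 2 * (2 ^ j)^2 * ((C0 + 1) * H (2 ^ j)) + B * q j"
  proof (intro add_mono mult_left_mono seq j)
   have "1 <= q j" using j1[OF j] q_pos[of j] by (simp add: field_simps)
   thus "B <= B * q j" using B0 mult_left_mono[of 1 "q j" B] by simp
  qed simp
  also have "... = C * q j" unfolding C_def qH by (simp add: algebra_simps)
  finally show ?thesis .
 qed
 have kappa0: "0 <= kappa R j k" if "0 < R" for R j k unfolding kappa_def using that by simp
 have lim3: "\<exists>j0 n0. \<forall>j\<ge>j0. \<forall>n\<ge>n0. \<forall>R>0. 2 ^ j * (real n + A) <= R --> \<bar>(\<Sum>k<n. kappa R j k) - C0 * (real n * q j)\<bar> <= e * (real n * q j)" if e: "0 < e" for e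
 proof -
  \<comment> \<open>Four errors of size e1 q(j) per coefficient add up to e / 2 times q(j); the
    other half of e is left for the first \<open>K1\<close> coefficients.\<close>
  define e1 where "e1 = e / 8"
  have e1: "0 < e1" unfolding e1_def using e by simp
  define h where "h = e1 / (C0 + 1)"
  have h: "0 < h" unfolding h_def using e1 C0 by simp
  define c where "c = (1 + 1 / h) * (4 * C1^2 * (A + 1)) * m2"
  have c0: "0 <= c" unfolding c_def using h A_ge_1 m2_nonneg by simp
  define d where "d = K^2 * M ^ 3"
  have d0: "0 <= d" unfolding d_def using M by simp
  \<comment> \<open>Prepares the choice of \<open>K1\<close>: for k >= \<open>K1\<close> the
    correction for missing sources, d times \<open>H\<^sub>2\<close> at 2^j k, is to be a small
    fraction of \<open>H\<^sub>2\<close> at 2^j.\<close>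
  have "((\<lambda>k. d * real k powr - \<alpha>) \<longlongrightarrow> d * 0) sequentially"
   by (intro tendsto_mult tendsto_const tendsto_neg_powr filterlim_real_sequentially) (use alpha in auto)
  hence "\<forall>\<^sub>F k in sequentially. d * real k powr - \<alpha> < e1" by (rule order_tendstoD) (use e1 in simp)
  hence "\<forall>\<^sub>F k in sequentially. d * real k powr - \<alpha> < e1 \<and> 0 < k"
   using eventually_gt_at_top[of 0] by (rule eventually_conj)
  then obtain K1 where K1: "d * real K1 powr - \<alpha> < e1" "0 < K1"
   unfolding eventually_sequentially by blast
  have "((\<lambda>x. H (real K1 * x) / H x) \<longlongrightarrow> real K1 powr - \<alpha>) at_top"
   using tails(2) K1 unfolding regular_tail_def H_def by simp
  hence "(\<lambda>j. d * (H (real K1 * 2 ^ j) / H (2 ^ j))) \<longlonglongrightarrow> d * real K1 powr - \<alpha>"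
   by (intro tendsto_mult tendsto_const filterlim_compose[OF _ pow])
  hence ev1: "\<forall>\<^sub>F j in sequentially. d * (H (real K1 * 2 ^ j) / H (2 ^ j)) < e1" by (rule order_tendstoD) (rule K1)
  have ev2: "\<forall>\<^sub>F j in sequentially. \<bar>scale_energy (2 ^ j) / H (2 ^ j) - C0\<bar> < e1"
   using tendstoD[OF lim2 e1] by (simp add: dist_real_def)
  have "(\<lambda>j. c * inverse (q j)) \<longlonglongrightarrow> c * 0" by (intro tendsto_mult tendsto_const qinv)
  hence ev3: "\<forall>\<^sub>F j in sequentially. c * inverse (q j) < e1" by (rule order_tendstoD) (use e1 in simp)
  have "\<forall>\<^sub>F j in sequentially. j1 <= j \<and> d * (H (real K1 * 2 ^ j) / H (2 ^ j)) < e1 \<and> \<bar>scale_energy (2 ^ j) / H (2 ^ j) - C0\<bar> < e1 \<and> c * inverse (q j) < e1"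
   using eventually_ge_at_top[of j1] ev1 ev2 ev3 by eventually_elim simp
  then obtain j0 where j0: "\<And>j. j0 <= j ==> j1 <= j \<and> d * (H (real K1 * 2 ^ j) / H (2 ^ j)) < e1 \<and> \<bar>scale_energy (2 ^ j) / H (2 ^ j) - C0\<bar> < e1 \<and> c * inverse (q j) < e1"
   unfolding eventually_sequentially by blast
  obtain n0 :: nat where n0: "real K1 * (C + C0) * 2 / e < real n0" using reals_Archimedean2 by blast
  show ?thesis
  proof (rule exI[of _ j0], rule exI[of _ n0], intro allI impI)
   fix j n R assume j: "j0 <= j" and n: "n0 <= n" and R: "0 < R" "2 ^ j * (real n + A) <= R"
   have Hj: "0 < H (2 ^ j)" by (rule Hpos) simp
   have qj: "0 < q j" by (rule q_pos)
   have large: "\<bar>kappa R j k - C0 * q j\<bar> <= e / 2 * q j" if k: "K1 <= k" "k < n" for k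
   proof -
    have "2 ^ j * (real k + A) <= 2 ^ j * (real n + A)" using k by (intro mult_left_mono) auto
    hence "2 ^ j * (real k + A) <= R" using R by linarith
    from kappa_approx[OF R(1) this h]
    have 1: "\<bar>kappa R j k - (2 ^ j)^2 * scale_energy (2 ^ j)\<bar> <= h * ((2 ^ j)^2 * scale_energy (2 ^ j)) + c + d * (2 ^ j)^2 * H (2 ^ j * real k)"
     unfolding c_def d_def H_def .
    have "h * ((2 ^ j)^2 * scale_energy (2 ^ j)) <= h * ((2 ^ j)^2 * ((C0 + 1) * H (2 ^ j)))"
     using j0[OF j] h seq[of j] by (intro mult_left_mono) auto
    also have "... = e1 * q j" unfolding h_def qH using C0 by simp
    finally have 2: "h * ((2 ^ j)^2 * scale_energy (2 ^ j)) <= e1 * q j" .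
    have 3: "c <= e1 * q j" using j0[OF j] qj by (simp add: field_simps)
    have "H (2 ^ j * real k) <= H (real K1 * 2 ^ j)"
     unfolding H_def using k by (intro mark_tail_antimono) (auto simp: mult.commute)
    hence "d * (2 ^ j)^2 * H (2 ^ j * real k) <= d * (2 ^ j)^2 * H (real K1 * 2 ^ j)" using d0 by (intro mult_left_mono) auto
    also have "... = (2 ^ j)^2 * (d * H (real K1 * 2 ^ j))" by simp
    also have "... <= (2 ^ j)^2 * (e1 * H (2 ^ j))"
     using j0[OF j] Hj by (intro mult_left_mono) (auto simp: field_simps)
    also have "... = e1 * q j" unfolding qH by simp
    finally have 4: "d * (2 ^ j)^2 * H (2 ^ j * real k) <= e1 * q j" .
    have "\<bar>scale_energy (2 ^ j) - C0 * H (2 ^ j)\<bar> <= e1 * H (2 ^ j)"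
    proof -
     have "scale_energy (2 ^ j) - C0 * H (2 ^ j) = (scale_energy (2 ^ j) / H (2 ^ j) - C0) * H (2 ^ j)" using Hj by (simp add: field_simps)
     hence "\<bar>scale_energy (2 ^ j) - C0 * H (2 ^ j)\<bar> = \<bar>scale_energy (2 ^ j) / H (2 ^ j) - C0\<bar> * H (2 ^ j)" using Hj by (simp add: abs_mult)
     also have "... <= e1 * H (2 ^ j)" using j0[OF j] Hj by (intro mult_right_mono) auto
     finally show ?thesis .
    qed
    hence "(2 ^ j)^2 * \<bar>scale_energy (2 ^ j) - C0 * H (2 ^ j)\<bar> <= (2 ^ j)^2 * (e1 * H (2 ^ j))" by (rule mult_left_mono) simp
    moreover have "(2 ^ j)^2 * \<bar>scale_energy (2 ^ j) - C0 * H (2 ^ j)\<bar> = \<bar>(2 ^ j)^2 * scale_energy (2 ^ j) - C0 * q j\<bar>"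
    proof -
     have "(2 ^ j)^2 * scale_energy (2 ^ j) - C0 * q j = (2 ^ j)^2 * (scale_energy (2 ^ j) - C0 * H (2 ^ j))"
      unfolding qH by (simp add: algebra_simps)
     thus ?thesis by (simp only: abs_mult) simp
    qed
    ultimately have 5: "\<bar>(2 ^ j)^2 * scale_energy (2 ^ j) - C0 * q j\<bar> <= e1 * q j" unfolding qH by (simp add: mult_ac)
    have "\<bar>kappa R j k - C0 * q j\<bar> <= 4 * (e1 * q j)" using 1 2 3 4 5 by linarith
    thus ?thesis unfolding e1_def by simp
   qed
   have small: "\<bar>kappa R j k - C0 * q j\<bar> <= (C + C0) * q j" for k
   proof -
    have "kappa R j k <= C * q j" using j0[OF j] by (intro upper R(1)) auto
    moreover have "0 <= C0 * q j" "0 <= C * q j" using C0 C qj by auto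
    ultimately have "\<bar>kappa R j k - C0 * q j\<bar> <= C * q j + C0 * q j" using kappa0[OF R(1), of j k] by linarith
    thus ?thesis by (simp add: algebra_simps)
   qed
   have "(\<Sum>k<n. kappa R j k) - C0 * (real n * q j) = (\<Sum>k<n. kappa R j k - C0 * q j)"
    by (simp add: sum_subtractf)
   hence "\<bar>(\<Sum>k<n. kappa R j k) - C0 * (real n * q j)\<bar> <= (\<Sum>k<n. \<bar>kappa R j k - C0 * q j\<bar>)" by (simp only: sum_abs)
   also have "... <= (\<Sum>k<n. e / 2 * q j + (if k < K1 then (C + C0) * q j else 0))"
   proof (rule sum_mono)
    fix k assume "k \<in> {..<n}"
    moreover have "0 <= e / 2 * q j" using e qj by simp
    ultimately show "\<bar>kappa R j k - C0 * q j\<bar> <= e / 2 * q j + (if k < K1 then (C + C0) * q j else 0)"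
     using large[of k] small[of k] by (auto simp: not_less)
   qed
   also have "... = real n * (e / 2 * q j) + (\<Sum>k<n. if k < K1 then (C + C0) * q j else 0)" by (simp add: sum.distrib)
   also have "(\<Sum>k<n. if k < K1 then (C + C0) * q j else 0) <= real K1 * ((C + C0) * q j)"
   proof -
    have "(\<Sum>k<n. if k < K1 then (C + C0) * q j else 0) = (\<Sum>k\<in>{..<n} \<inter> {..<K1}. (C + C0) * q j)"
     by (subst sum.inter_restrict) (auto intro!: sum.cong)
    also have "... = real (card ({..<n} \<inter> {..<K1})) * ((C + C0) * q j)" by simp
    also have "... <= real K1 * ((C + C0) * q j)"
    proof (intro mult_right_mono)
     have "card ({..<n} \<inter> {..<K1}) <= card {..<K1}" by (intro card_mono) auto
     thus "real (card ({..<n} \<inter> {..<K1})) <= real K1" by simp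
    qed (use C C0 qj in auto)
    finally show ?thesis .
   qed
   also have "real K1 * ((C + C0) * q j) <= real n * (e / 2 * q j)"
   proof -
    have "real K1 * (C + C0) * 2 / e <= real n" using n0 n by linarith
    hence "real K1 * (C + C0) <= real n * (e / 2)" using e by (simp add: field_simps)
    thus ?thesis using mult_right_mono[of "real K1 * (C + C0)" "real n * (e / 2)" "q j"] qj by (simp add: mult_ac)
   qed
   finally show "\<bar>(\<Sum>k<n. kappa R j k) - C0 * (real n * q j)\<bar> <= e * (real n * q j)" by (simp add: algebra_simps)
  qed
 qed
 show ?thesis
 proof (rule that[OF C0 C])
  show "kappa R j k <= C * q j" if "j1 <= j" "0 < R" for R j k by (rule upper[OF that])
  show "\<exists>j0 n0. \<forall>j\<ge>j0. \<forall>n\<ge>n0. \<forall>R>0. 2 ^ j * (real n + A) <= R --> \<bar>(\<Sum>k<n. kappa R j k) - C0 * (real n * q j)\<bar> <= e * (real n * q j)" if "0 < e" for e by (rule lim3[OF that])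
 qed
qed

section \<open>First moments of the coefficients\<close>

definition drift :: "real => real" where
 "drift s = (LINT y|\<nu>. snd y * indicator {s<..} (fst y))"

lemma drift_integrable: "integrable \<nu> (\<lambda>y. snd y * indicator {s<..} (fst y))"
 by (rule integrable_bound_real[OF moment_integrable[of 1]]) (simp, measurable, auto simp: indicator_def)

lemma drift_bound: "\<bar>drift s\<bar> <= mark_tail \<nu> 1 s"
proof -
 have "\<bar>drift s\<bar> <= (LINT y|\<nu>. \<bar>snd y * indicator {s<..} (fst y)\<bar>)" unfolding drift_def by (rule integral_abs_bound)
 also have "... = mark_tail \<nu> 1 s" unfolding mark_tail_def by (intro lint_cong refl) (auto simp: indicator_def)
 finally show ?thesis .
qed

lemma drift_increment:
 assumes "a <= b"
 shows "\<bar>drift b - drift a\<bar> <= mark_tail \<nu> 1 a - mark_tail \<nu> 1 b"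
proof -
 have "drift b - drift a = (LINT y|\<nu>. snd y * indicator {b<..} (fst y) - snd y * indicator {a<..} (fst y))"
  unfolding drift_def by (intro lint_diff[symmetric] drift_integrable)
 also have "\<bar>...\<bar> <= (LINT y|\<nu>. \<bar>snd y * indicator {b<..} (fst y) - snd y * indicator {a<..} (fst y)\<bar>)" by (rule integral_abs_bound)
 also have "... = (LINT y|\<nu>. \<bar>snd y\<bar> ^ 1 * indicator {a<..} (fst y) - \<bar>snd y\<bar> ^ 1 * indicator {b<..} (fst y))"
  using assms by (intro lint_cong refl) (auto simp: indicator_def)
 also have "... = mark_tail \<nu> 1 a - mark_tail \<nu> 1 b"
  unfolding mark_tail_def by (intro lint_diff mark_tail_integrable) auto
 finally show ?thesis .
qed

text \<open>By Campbell's formula, the mean of a coefficient for a Poisson number of sources. It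
  need not vanish, because no source starts before time 0 and the process is not stationary.\<close>

definition bias :: "real => nat => nat => real" where
 "bias R j k = R * (LINT z|sample_space R \<nu>. atom j k z)"

lemma kernel_bound: "\<bar>\<Psi> j k s\<bar> <= sqrt (2 ^ j) * (K * M + C1)"
proof -
 have "\<bar>\<Psi> j k s\<bar> <= \<bar>sqrt (2 ^ j) * prim (s / 2 ^ j - real k)\<bar> + C1 / sqrt (2 ^ j)"
  using kernel_approx[of j k s] by linarith
 also have "\<bar>sqrt (2 ^ j) * prim (s / 2 ^ j - real k)\<bar> <= sqrt (2 ^ j) * (K * M)"
  using prim_bound by (simp add: abs_mult)
 also have "C1 / sqrt (2 ^ j) <= sqrt (2 ^ j) * C1"
 proof -
  have "(1::real) <= 2 ^ j" by simp
  hence "C1 * 1 <= C1 * 2 ^ j" using C1 by (intro mult_left_mono) auto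
  thus ?thesis by (simp add: field_simps)
 qed
 finally show ?thesis by (simp add: algebra_simps)
qed

lemma kernel_integrable: "integrable lborel (\<Psi> j k)"
proof (rule bounded_interval_integrable[OF kernel_measurable kernel_bound])
 show "\<Psi> j k s = 0" if "s \<notin> {2 ^ j * real k - 1..2 ^ j * (real k + A)}" for s
  using kernel_support[of j k s] that by auto
qed

text \<open>Integrating \<Psi> (t + v) - \<Psi> (t) over t in [0, R) leaves minus the integral of
  \<Psi> over [0, v), as \<Psi> vanishes beyond R. Fubini over the durations v then produces
  \<open>drift\<close>, the density of the mean of the process.\<close>

lemma bias_eq:
 assumes R: "0 < R" "2 ^ j * (real k + A) < R"
 shows "bias R j k = - (LINT s|lborel. \<Psi> j k s * (indicator {0..} s * drift s))"
  and "integrable lborel (\<lambda>s. \<Psi> j k s * (indicator {0..} s * drift s))"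
proof -
 let ?p = "\<Psi> j k"
 have pint: "integrable lborel (\<lambda>s. indicator B s * ?p s)" if "B \<in> sets borel" for B
  using integrable_mult_indicator[OF _ kernel_integrable, of B] that by simp
 have pR: "?p s = 0" if "R <= s" for s using kernel_support[of j k s] that R by force
 have inner: "(LINT t|lborel. indicator {0..<R} t * atom j k (t, y)) = snd y * - (LINT s|lborel. indicator {0..<fst y} s * ?p s)"
  if y: "0 < fst y" for y
 proof -
  define v where "v = fst y"
  have v: "0 < v" using y unfolding v_def .
  have sh: "(LINT t|lborel. indicator {0..<R} t * ?p (t + v)) = (LINT s|lborel. indicator {v..<R + v} s * ?p s)"
   "integrable lborel (\<lambda>t. indicator {0..<R} t * ?p (t + v))"
  proof -
   have e: "(\<lambda>t. indicator {0..<R} t * ?p (t + v)) = (\<lambda>t. indicator {v..<R + v} (t + v) * ?p (t + v))"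
    by (auto simp: fun_eq_iff indicator_def)
   show "(LINT t|lborel. indicator {0..<R} t * ?p (t + v)) = (LINT s|lborel. indicator {v..<R + v} s * ?p s)"
    "integrable lborel (\<lambda>t. indicator {0..<R} t * ?p (t + v))"
    unfolding e using shift_integrable[OF pint[of "{v..<R + v}"], of v] by auto
  qed
  have "(LINT t|lborel. indicator {0..<R} t * atom j k (t, y)) =
   (LINT t|lborel. snd y * (indicator {0..<R} t * ?p (t + v) - indicator {0..<R} t * ?p t))"
   unfolding atom_def v_def by (simp add: algebra_simps)
  also have "... = snd y * ((LINT s|lborel. indicator {v..<R + v} s * ?p s) - (LINT s|lborel. indicator {0..<R} s * ?p s))"
   using sh pint[of "{0..<R}"] by simp
  also have "(LINT s|lborel. indicator {v..<R + v} s * ?p s) - (LINT s|lborel. indicator {0..<R} s * ?p s) =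
   (LINT s|lborel. indicator {v..<R + v} s * ?p s - indicator {0..<R} s * ?p s)"
   using pint by simp
  also have "... = (LINT s|lborel. - (indicator {0..<v} s * ?p s))"
   using v pR by (intro lint_cong refl) (auto simp: indicator_def not_less)
  finally show ?thesis unfolding v_def by simp
 qed
 have b1: "bias R j k = (LINT y|\<nu>. snd y * - (LINT s|lborel. indicator {0..<fst y} s * ?p s))"
 proof -
  have "bias R j k = (LINT y|\<nu>. (LINT t|lborel. indicator {0..<R} t * atom j k (t, y)))"
   unfolding bias_def by (rule sample_space_integral(1)[OF R(1) atom_integrable(1)[OF R(1)]])
  also have "... = (LINT y|\<nu>. snd y * - (LINT s|lborel. indicator {0..<fst y} s * ?p s))"
  proof (rule integral_cong_AE)
   show "AE y in \<nu>. (LINT t|lborel. indicator {0..<R} t * atom j k (t, y)) = snd y * - (LINT s|lborel. indicator {0..<fst y} s * ?p s)"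
    using duration_pos by eventually_elim (rule inner)
   show "(\<lambda>y. (LINT t|lborel. indicator {0..<R} t * atom j k (t, y))) \<in> borel_measurable \<nu>"
    using sample_space_integral(2)[OF R(1) atom_integrable(1)[OF R(1), of j k]] by auto
   have [measurable]: "(\<lambda>v. (LINT s|lborel. indicator {0..<v} s * ?p s)) \<in> borel_measurable borel"
   proof (rule lborel.borel_measurable_lebesgue_integral)
    have "(\<lambda>q :: real \<times> real. indicator {q. 0 <= snd q \<and> snd q < fst q} q * ?p (snd q)) \<in> borel_measurable (borel \<Otimes>\<^sub>M lborel)" by measurable
    thus "(\<lambda>(v, s). indicator {0..<v} s * ?p s) \<in> borel_measurable (borel \<Otimes>\<^sub>M lborel)"
     by (simp add: split_beta' indicator_def)
   qed
   show "(\<lambda>y. snd y * - (LINT s|lborel. indicator {0..<fst y} s * ?p s)) \<in> borel_measurable \<nu>" by measurable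
  qed
  finally show ?thesis .
 qed
 interpret L: pair_sigma_finite \<nu> lborel ..
 let ?f = "\<lambda>y s. snd y * (indicator {0..<fst y} s * ?p s) :: real"
 have mf: "(\<lambda>(y, s). ?f y s) \<in> borel_measurable (\<nu> \<Otimes>\<^sub>M lborel)"
 proof -
  have "(\<lambda>q. snd (fst q) * (indicator {q :: (real \<times> real) \<times> real. 0 <= snd q \<and> snd q < fst (fst q)} q * ?p (snd q))) \<in> borel_measurable (\<nu> \<Otimes>\<^sub>M lborel)"
   by measurable
  thus ?thesis by (simp add: split_beta' indicator_def)
 qed
 have If: "integrable (\<nu> \<Otimes>\<^sub>M lborel) (\<lambda>(y, s). ?f y s)"
 proof (rule L.Fubini_integrable[OF mf])
  show "AE y in \<nu>. integrable lborel (\<lambda>s. case (y, s) of (y, s) => ?f y s)" using pint by auto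
  show "integrable \<nu> (\<lambda>y. (LINT s|lborel. norm (case (y, s) of (y, s) => ?f y s)))"
  proof (rule integrable_bound_real[where f="\<lambda>y. \<bar>snd y\<bar> ^ 1 * (LINT s|lborel. \<bar>?p s\<bar>)"])
   show "integrable \<nu> (\<lambda>y. \<bar>snd y\<bar> ^ 1 * (LINT s|lborel. \<bar>?p s\<bar>))"
    by (intro integrable_mult_left moment_integrable) simp
   show "(\<lambda>y. (LINT s|lborel. norm (case (y, s) of (y, s) => ?f y s))) \<in> borel_measurable \<nu>"
    using mf by (intro lborel.borel_measurable_lebesgue_integral) (auto simp: split_beta')
   fix y :: "real \<times> real"
   have "(LINT s|lborel. \<bar>indicator {0..<fst y} s * ?p s\<bar>) <= (LINT s|lborel. \<bar>?p s\<bar>)"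
    by (intro integral_mono integrable_abs pint kernel_integrable) (auto simp: indicator_def)
   thus "\<bar>(LINT s|lborel. norm (case (y, s) of (y, s) => ?f y s))\<bar> <= \<bar>snd y\<bar> ^ 1 * (LINT s|lborel. \<bar>?p s\<bar>)"
    by (simp add: abs_mult mult_left_mono)
  qed
 qed
 have i2: "(LINT y|\<nu>. ?f y s) = ?p s * (indicator {0..} s * drift s)" for s
 proof -
  have "(\<lambda>y. ?f y s) = (\<lambda>y. (?p s * indicator {0..} s) * (snd y * indicator {s<..} (fst y)))"
   by (auto simp: fun_eq_iff indicator_def)
  thus ?thesis unfolding drift_def by simp
 qed
 have "bias R j k = - (LINT y|\<nu>. (LINT s|lborel. ?f y s))" unfolding b1 by simp
 also have "(LINT y|\<nu>. (LINT s|lborel. ?f y s)) = (LINT s|lborel. (LINT y|\<nu>. ?f y s))" by (rule L.Fubini_integral[OF If, symmetric])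
 finally show "bias R j k = - (LINT s|lborel. ?p s * (indicator {0..} s * drift s))" unfolding i2 .
 show "integrable lborel (\<lambda>s. ?p s * (indicator {0..} s * drift s))"
  using L.integrable_snd[OF If] unfolding i2 .
qed

lemma drift_measurable [measurable]: "drift \<in> borel_measurable borel"
proof -
 have "(\<lambda>q. snd (snd q) * indicator {q :: real \<times> real \<times> real. fst q < fst (snd q)} q) \<in> borel_measurable (borel \<Otimes>\<^sub>M \<nu>)" by measurable
 hence "(\<lambda>(s, y). snd y * indicator {s<..} (fst y)) \<in> borel_measurable (borel \<Otimes>\<^sub>M \<nu>)" by (simp add: split_beta' indicator_def)
 thus ?thesis unfolding drift_def by (rule borel_measurable_lebesgue_integral)
qed

text \<open>Stated for a general h in place of \<open>drift\<close>, because for kernels of integral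
  zero a constant may first be subtracted from \<open>drift\<close>.\<close>

lemma bias_window_bound:
 assumes R: "0 < R" "2 ^ j * (real k + A) < R" and c: "0 <= c"
  and b: "\<And>s. 0 <= s ==> 2 ^ j * real k - 1 <= s ==> s <= 2 ^ j * (real k + A) ==> \<bar>h s\<bar> <= c"
  and h: "bias R j k = - (LINT s|lborel. \<Psi> j k s * (indicator {0..} s * h s))"
 shows "\<bar>bias R j k\<bar> <= sqrt (2 ^ j) * (K * M + C1) * c * (2 ^ j * (A + 1))"
proof -
 define x :: real where "x = 2 ^ j"
 have x: "1 <= x" unfolding x_def by simp
 let ?I = "{x * real k - 1..x * (real k + A)}"
 define d where "d = sqrt x * (K * M + C1) * c"
 have d: "0 <= d" unfolding d_def using x K_nonneg M C1 c by simp
 have len: "x * real k - 1 <= x * (real k + A)" using x A_ge_1 mult_nonneg_nonneg[of x A] by (simp add: algebra_simps)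
 have "\<bar>bias R j k\<bar> <= (LINT s|lborel. \<bar>\<Psi> j k s * (indicator {0..} s * h s)\<bar>)" unfolding h by (simp only: abs_minus_cancel integral_abs_bound)
 also have "... <= (LINT s|lborel. d * indicator ?I s)"
 proof (rule integral_mono')
  show "integrable lborel (\<lambda>s. d * indicator ?I s)" using len by (intro integrable_mult_right integrable_real_indicator) auto
  fix s
  show "\<bar>\<Psi> j k s * (indicator {0..} s * h s)\<bar> <= d * indicator ?I s"
  proof (cases "\<Psi> j k s = 0 \<or> s < 0")
   case True
   thus ?thesis using d by (auto simp: indicator_def)
  next
   case False
   hence I: "s \<in> ?I" "0 <= s" using kernel_support[of j k s] unfolding x_def by auto
   hence "\<bar>h s\<bar> <= c" using b unfolding x_def by auto
   hence "\<bar>\<Psi> j k s\<bar> * \<bar>h s\<bar> <= (sqrt x * (K * M + C1)) * c"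
    using kernel_bound[of j k s] K_nonneg M C1 unfolding x_def by (intro mult_mono) auto
   thus ?thesis using I unfolding d_def by (simp add: abs_mult)
  qed
  show "0 <= d * indicator ?I s" using d by simp
 qed
 also have "... = d * (x * A + 1)" using len by (simp add: algebra_simps)
 also have "... <= d * (x * (A + 1))" using x d by (intro mult_left_mono) (auto simp: algebra_simps)
 finally show ?thesis unfolding d_def x_def .
qed

text \<open>The window of the first coefficient reaches down to 0, where \<open>drift\<close> has no
  decay to offer. There the kernel is small instead: \<open>prim\<close> vanishes at 0 and is
  Lipschitz, which supplies a factor s and leaves s^(1 - b), integrable for b < 2.\<close>

lemma bias0_bound:
 assumes b: "0 < b" "b < 2" and C: "0 < C" and H: "\<And>s. 0 < s ==> mark_tail \<nu> 1 s <= C * s powr - b"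
 obtains D where "0 < D" "\<And>R j. 0 < R ==> 2 ^ j * A < R ==> (bias R j 0)^2 <= D * (2 ^ j) powr (3 - 2 * b)"
proof -
 define m1 where "m1 = (LINT z|\<nu>. \<bar>snd z\<bar> ^ 1)"
 have m10: "0 <= m1" unfolding m1_def by simp
 define E where "E = (K + C1) * (m1 + C * A powr (2 - b) / (2 - b)) + 1"
 have E: "0 < E" unfolding E_def using K_nonneg C1 m10 C b by (intro add_nonneg_pos mult_nonneg_nonneg add_nonneg_nonneg divide_nonneg_pos) auto
 show ?thesis
 proof (rule that[of "E^2"])
  show "0 < E^2" using E by simp
  fix R :: real and j assume R: "0 < R" "2 ^ j * A < R"
  define x :: real where "x = 2 ^ j"
  have x: "1 <= x" unfolding x_def by simp
  define r where "r = sqrt x"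
  have r: "0 < r" "r * r = x" unfolding r_def using x by auto
  let ?G = "\<lambda>s. (K + C1) / r * (m1 * indicator {0..1} s + C * (s powr (1 - b) * indicator {0..x * A} s))"
  have Gi: "integrable lborel ?G"
   using powr_integrable_from_0(1)[of "1 - b" "x * A"] b x A_ge_1
   by (intro integrable_mult_right integrable_addI integrable_real_indicator) auto
  have "\<bar>bias R j 0\<bar> <= (LINT s|lborel. \<bar>\<Psi> j 0 s * (indicator {0..} s * drift s)\<bar>)"
   using bias_eq(1)[of R j 0] R by (simp only: abs_minus_cancel integral_abs_bound of_nat_0 add_0)
  also have "... <= (LINT s|lborel. ?G s)"
  proof (rule integral_mono_AE'[OF Gi])
   have "AE s in lborel. s \<noteq> (0::real)" by (rule AE_lborel_singleton)
   thus "AE s in lborel. \<bar>\<Psi> j 0 s * (indicator {0..} s * drift s)\<bar> <= ?G s"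
   proof eventually_elim
    case (elim s)
    have G0: "0 <= ?G s" using K_nonneg C1 r m10 C by (intro mult_nonneg_nonneg add_nonneg_nonneg divide_nonneg_pos) auto
    show ?case
    proof (cases "\<Psi> j 0 s = 0 \<or> s < 0")
     case True
     thus ?thesis using G0 by (auto simp: indicator_def)
    next
     case False
     hence s: "0 < s" "s <= x * A" using kernel_support[of j 0 s] elim unfolding x_def by auto
     have "\<bar>\<Psi> j 0 s\<bar> <= \<bar>r * prim (s / x)\<bar> + C1 / r" using kernel_approx[of j 0 s] unfolding r_def x_def by simp
     also have "\<bar>r * prim (s / x)\<bar> <= r * (K * (s / x))"
     proof -
      have "\<bar>prim (s / x)\<bar> <= K * (s / x)" using prim_Lipschitz[of "s / x" 0] prim_eq_0[of 0] s x by simp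
      hence "r * \<bar>prim (s / x)\<bar> <= r * (K * (s / x))" using r by (intro mult_left_mono) auto
      thus ?thesis using r by (simp only: abs_mult abs_of_pos)
     qed
     also have "r * (K * (s / x)) = K * s / r" using r x by (simp add: field_simps flip: r(2))
     also have "K * s / r + C1 / r = (K * s + C1) / r" by (simp add: add_divide_distrib)
     finally have p: "\<bar>\<Psi> j 0 s\<bar> <= (K * s + C1) / r" by simp
     have dr: "\<bar>drift s\<bar> <= mark_tail \<nu> 1 s" by (rule drift_bound)
     have "\<bar>\<Psi> j 0 s\<bar> * \<bar>drift s\<bar> <= ?G s"
     proof (cases "s <= 1")
      case s1: True
      have "\<bar>\<Psi> j 0 s\<bar> * \<bar>drift s\<bar> <= (K + C1) / r * m1"
      proof (intro mult_mono)
       have "(K * s + C1) / r <= (K + C1) / r" using s1 K_nonneg r mult_left_mono[of s 1 K] by (intro divide_right_mono) auto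
       thus "\<bar>\<Psi> j 0 s\<bar> <= (K + C1) / r" using p by linarith
       show "\<bar>drift s\<bar> <= m1" using dr mark_tail_le_moment[of 1 s] unfolding m1_def by simp
      qed (use K_nonneg C1 r in auto)
      also have "... <= (K + C1) / r * (m1 * indicator {0..1} s + C * (s powr (1 - b) * indicator {0..x * A} s))"
       using s1 s K_nonneg C1 r C by (intro mult_left_mono) (auto simp: indicator_def)
      finally show ?thesis .
     next
      case s1: False
      have "\<bar>\<Psi> j 0 s\<bar> * \<bar>drift s\<bar> <= (K + C1) * s / r * (C * s powr - b)"
      proof (intro mult_mono)
       have "K * s + C1 <= (K + C1) * s" using s1 C1 mult_left_mono[of 1 s C1] by (simp add: algebra_simps)
       hence "(K * s + C1) / r <= (K + C1) * s / r" using r by (intro divide_right_mono) auto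
       thus "\<bar>\<Psi> j 0 s\<bar> <= (K + C1) * s / r" using p by linarith
       show "\<bar>drift s\<bar> <= C * s powr - b" using dr H[OF s(1)] by linarith
      qed (use K_nonneg C1 r s in auto)
      also have "... = (K + C1) / r * (C * s powr (1 - b))"
       using s by (simp add: powr_diff powr_minus field_simps)
      also have "... <= (K + C1) / r * (m1 * indicator {0..1} s + C * (s powr (1 - b) * indicator {0..x * A} s))"
       using s K_nonneg C1 r m10 by (intro mult_left_mono) (auto simp: indicator_def)
      finally show ?thesis .
     qed
     thus ?thesis using s by (simp add: abs_mult)
    qed
   qed
   show "AE s in lborel. 0 <= ?G s"
    using K_nonneg C1 r m10 C by (intro AE_I2 mult_nonneg_nonneg add_nonneg_nonneg divide_nonneg_pos) auto
  qed
  also have "(LINT s|lborel. ?G s) = (K + C1) / r * (m1 + C * ((x * A) powr (2 - b) / (2 - b)))"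
   using powr_integrable_from_0[of "1 - b" "x * A"] b x A_ge_1 by simp
  also have "... <= 1 / r * (E * x powr (2 - b))"
  proof -
   have x1: "1 <= x powr (2 - b)" using x b by (simp add: ge_one_powr_ge_zero)
   have "m1 + C * ((x * A) powr (2 - b) / (2 - b)) = m1 + C * A powr (2 - b) / (2 - b) * x powr (2 - b)"
    using x A_ge_1 by (simp add: powr_mult)
   also have "m1 <= m1 * x powr (2 - b)" using mult_left_mono[OF x1 m10] by simp
   finally have "m1 + C * ((x * A) powr (2 - b) / (2 - b)) <= (m1 + C * A powr (2 - b) / (2 - b)) * x powr (2 - b)"
    by (simp add: distrib_right)
   hence "(K + C1) * (m1 + C * ((x * A) powr (2 - b) / (2 - b))) <= (K + C1) * ((m1 + C * A powr (2 - b) / (2 - b)) * x powr (2 - b))"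
    using K_nonneg C1 by (intro mult_left_mono) auto
   also have "... <= E * x powr (2 - b)" unfolding E_def using x1 by (simp add: algebra_simps)
   finally have "(K + C1) * (m1 + C * ((x * A) powr (2 - b) / (2 - b))) / r <= E * x powr (2 - b) / r"
    using r by (intro divide_right_mono) auto
   thus ?thesis by (simp only: times_divide_eq_left mult_1)
  qed
  finally have "\<bar>bias R j 0\<bar> <= 1 / r * (E * x powr (2 - b))" .
  hence "\<bar>bias R j 0\<bar>^2 <= (1 / r * (E * x powr (2 - b)))^2" by (intro power_mono) auto
  also have "... = E^2 * ((x powr (2 - b))^2 / x)" using r by (simp add: power_mult_distrib power_divide power2_eq_square)
  also have "(x powr (2 - b))^2 / x = x powr (3 - 2 * b)"
  proof -
   have "(x powr (2 - b))^2 = x powr ((3 - 2 * b) + 1)" by (simp add: power2_eq_square flip: powr_add)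
   also have "... = x powr (3 - 2 * b) * x" by (subst powr_add) (use x in simp)
   finally show ?thesis using x by simp
  qed
  finally show "(bias R j 0)^2 <= E^2 * (2 ^ j) powr (3 - 2 * b)" unfolding x_def by simp
 qed
qed

text \<open>Either the means are summable, or the increments of \<open>H\<^sub>1\<close> telescope because the kernels have mean zero.\<close>

lemma bias_bound:
 assumes d: "0 < d" "d < \<alpha>" and alt: "1 <= \<alpha> - d \<or> (\<forall>j k. (LINT s|lborel. \<Psi> j k s) = 0)"
 obtains D where "0 < D" "\<And>R j n. 1 <= j ==> 0 < R ==> 2 ^ j * (real n + A) <= R ==>
   (\<Sum>k<n. (bias R j k)^2) <= D * (2 ^ j) powr (3 - 2 * \<alpha> + 2 * d)"
proof -
 define g where "g = \<alpha> - d"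
 have g: "0 < g" "g < 2" unfolding g_def using d alpha by auto
 obtain C where C: "0 < C" and H: "\<And>s. 0 < s ==> mark_tail \<nu> 1 s <= C * s powr - g"
  using regular_tail_upper[OF tails(1) d(1) _ alpha(1)] d unfolding g_def by (metis less_imp_le minus_diff_eq uminus_add_conv_diff)
 obtain D0 where D0: "0 < D0" and B0: "\<And>R j. 0 < R ==> 2 ^ j * A < R ==> (bias R j 0)^2 <= D0 * (2 ^ j) powr (3 - 2 * g)"
  using bias0_bound[OF g C H] by metis
 define c1 where "c1 = (K * M + C1) * (A + 1)"
 have c1: "0 <= c1" unfolding c1_def using K_nonneg M C1 A_ge_1 by simp
 \<comment> \<open>Chosen so that the support window of index k ends before x (k + N) - 1; the
   variation of \<open>drift\<close> over that window is then bounded by a difference of tails with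
   lag N.\<close>
 define N where "N = nat \<lceil>A\<rceil> + 1"
 have N: "A + 1 <= real N" "1 <= N" unfolding N_def by (auto simp: add.commute) linarith
 define D1 where "D1 = c1^2 * (C * 4)^2 * (2 + real N)"
 have D10: "0 <= D1" unfolding D1_def by simp
 have main: "(\<Sum>k=1..<n. (bias R j k)^2) <= D1 * (2 ^ j) powr (3 - 2 * g)"
  if j: "1 <= j" and R: "0 < R" "2 ^ j * (real n + A) <= R" for R j n
 proof -
  define x :: real where "x = 2 ^ j"
  have x2: "2 <= x" unfolding x_def using power_increasing[OF j, of "2::real"] by simp
  define r where "r = sqrt x"
  have r: "0 < r" "r^2 = x" unfolding r_def using x2 by auto
  have Rk: "2 ^ j * (real k + A) < R" if "k < n" for k
  proof -
   have "2 ^ j * (real k + A) < 2 ^ j * (real n + A)" using that by simp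
   thus ?thesis using R by linarith
  qed
  \<comment> \<open>Replaces the left end x k - 1 of the support by x k / 2; this uses x >= 2, that
    is j >= 1.\<close>
  have xk: "x / 2 * real k <= x * real k - 1" if "1 <= k" for k
  proof -
   have "2 * 1 <= x * real k" using x2 that by (intro mult_mono) auto
   thus ?thesis by simp
  qed
  have h2: "(x / 2) powr - g <= 4 * x powr - g"
  proof -
   have "(x / 2) powr - g = 2 powr g * x powr - g"
    using x2 by (subst powr_divide) (auto simp: powr_minus field_simps)
   also have "... <= 2 powr 2 * x powr - g" using g by (intro mult_right_mono powr_mono) auto
   finally show ?thesis by (simp add: powr_numeral)
  qed
  have pw: "(r * x * x powr - g)^2 = x powr (3 - 2 * g)"
  proof -
   have "(r * x * x powr - g)^2 = x * (x * x) * (x powr - g * x powr - g)" using r by (simp add: power_mult_distrib power2_eq_square)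
   also have "... = x powr 3 * x powr (- g + - g)" using x2 by (subst powr_add) (simp add: powr_numeral power3_eq_cube)
   also have "... = x powr (3 - 2 * g)" by (simp flip: powr_add)
   finally show ?thesis .
  qed
  show ?thesis
  proof (cases "1 <= g")
   case True
   have "(bias R j k)^2 <= (c1 * (C * 4))^2 * x powr (3 - 2 * g) * (1 / (real k)^2)" if k: "1 <= k" "k < n" for k
   proof -
    have kp: "0 < x / 2 * real k" using x2 k by simp
    have "\<bar>bias R j k\<bar> <= sqrt (2 ^ j) * (K * M + C1) * (C * (4 * x powr - g * (1 / real k))) * (2 ^ j * (A + 1))"
    proof (rule bias_window_bound[OF R(1) Rk[OF k(2)] _ _ bias_eq(1)[OF R(1) Rk[OF k(2)]]])
     show "0 <= C * (4 * x powr - g * (1 / real k))" using C by simp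
     fix s assume "0 <= s" "2 ^ j * real k - 1 <= s"
     hence s: "x / 2 * real k <= s" using xk[OF k(1)] unfolding x_def by linarith
     have "\<bar>drift s\<bar> <= mark_tail \<nu> 1 s" by (rule drift_bound)
     also have "... <= mark_tail \<nu> 1 (x / 2 * real k)" using s by (intro mark_tail_antimono) auto
     also have "... <= C * (x / 2 * real k) powr - g" by (rule H[OF kp])
     also have "(x / 2 * real k) powr - g = (x / 2) powr - g * real k powr - g" using x2 by (intro powr_mult)
     also have "C * ((x / 2) powr - g * real k powr - g) <= C * (4 * x powr - g * (1 / real k))"
     proof (intro mult_left_mono mult_mono h2)
      have "real k powr - g <= real k powr - 1" using True k by (intro powr_mono) auto
      thus "real k powr - g <= 1 / real k" using k by (simp add: powr_minus_divide)
     qed (use C in auto)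
     finally show "\<bar>drift s\<bar> <= C * (4 * x powr - g * (1 / real k))" .
    qed
    also have "... = c1 * (C * 4) * (r * x * x powr - g) * (1 / real k)"
     unfolding c1_def r_def x_def by simp
    finally have "\<bar>bias R j k\<bar>^2 <= (c1 * (C * 4) * (r * x * x powr - g) * (1 / real k))^2" by (intro power_mono) auto
    also have "... = (c1 * (C * 4))^2 * (r * x * x powr - g)^2 * (1 / real k)^2" by (simp only: power_mult_distrib)
    finally show ?thesis unfolding pw by (simp add: power_divide)
   qed
   hence "(\<Sum>k=1..<n. (bias R j k)^2) <= (\<Sum>k=1..<n. (c1 * (C * 4))^2 * x powr (3 - 2 * g) * (1 / (real k)^2))"
    by (intro sum_mono) auto
   also have "... = (c1 * (C * 4))^2 * x powr (3 - 2 * g) * (\<Sum>k=1..<n. 1 / (real k)^2)" by (simp add: sum_distrib_left)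
   also have "(\<Sum>k=1..<n. 1 / (real k)^2) <= (\<Sum>k=1..n. 1 / (real k)^2)" by (intro sum_mono2) auto
   also have "... <= 2" by (rule sum_inverse_squares_le)
   also have "(c1 * (C * 4))^2 * x powr (3 - 2 * g) * 2 <= D1 * x powr (3 - 2 * g)"
    unfolding D1_def by (simp add: power_mult_distrib algebra_simps)
   finally show ?thesis unfolding x_def by (simp add: mult_left_mono)
  next
   case False
   hence zero: "\<And>j k. (LINT s|lborel. \<Psi> j k s) = 0" using alt unfolding g_def by auto
   define T where "T k = mark_tail \<nu> 1 (x * real k - 1)" for k :: nat
   have Tm: "T b <= T a" if "a <= b" for a b
    unfolding T_def using that x2 by (intro mark_tail_antimono) auto
   have T0: "0 <= T k" for k unfolding T_def by (rule mark_tail_nonneg)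
   have T1: "T 1 <= C * (4 * x powr - g)"
   proof -
    have "T 1 <= mark_tail \<nu> 1 (x / 2)" unfolding T_def using x2 by (intro mark_tail_antimono) auto
    also have "... <= C * (x / 2) powr - g" using x2 by (intro H) auto
    also have "... <= C * (4 * x powr - g)" using h2 C by (intro mult_left_mono) auto
    finally show ?thesis .
   qed
   have "(bias R j k)^2 <= (c1 * (r * x))^2 * (T 1 * (T k - T (k + N)))" if k: "1 <= k" "k < n" for k
   proof -
    define a where "a = x * real k - 1"
    have a0: "0 <= a" unfolding a_def using xk[OF k(1)] x2 mult_nonneg_nonneg[of "x / 2" "real k"] by linarith
    have "bias R j k = - (LINT s|lborel. \<Psi> j k s * (indicator {0..} s * (drift s - drift a)))"
    proof -
     have "(\<lambda>s. \<Psi> j k s * (indicator {0..} s * (drift s - drift a))) = (\<lambda>s. \<Psi> j k s * (indicator {0..} s * drift s) - drift a * \<Psi> j k s)"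
     proof
      fix s
      show "\<Psi> j k s * (indicator {0..} s * (drift s - drift a)) = \<Psi> j k s * (indicator {0..} s * drift s) - drift a * \<Psi> j k s"
      proof (cases "\<Psi> j k s = 0")
       case False
       hence "0 <= s" using kernel_support[OF False] a0 unfolding a_def x_def by linarith
       thus ?thesis by (simp add: algebra_simps)
      qed simp
     qed
     thus ?thesis
      using bias_eq[OF R(1) Rk[OF k(2)]] kernel_integrable[of j k] zero by simp
    qed
    hence "\<bar>bias R j k\<bar> <= sqrt (2 ^ j) * (K * M + C1) * (T k - T (k + N)) * (2 ^ j * (A + 1))"
    proof (rule bias_window_bound[OF R(1) Rk[OF k(2)], rotated 2])
     show "0 <= T k - T (k + N)" using Tm[of k "k + N"] by simp
     fix s assume s: "0 <= s" "2 ^ j * real k - 1 <= s" "s <= 2 ^ j * (real k + A)"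
     have "\<bar>drift s - drift a\<bar> <= mark_tail \<nu> 1 a - mark_tail \<nu> 1 s" using s unfolding a_def x_def by (intro drift_increment) auto
     moreover have "mark_tail \<nu> 1 a = T k" unfolding a_def T_def ..
     moreover have "T (k + N) <= mark_tail \<nu> 1 s"
      unfolding T_def
     proof (rule mark_tail_antimono)
      have "x * (real k + A) + x * 1 <= x * real (k + N)"
       unfolding distrib_left[symmetric] using N x2 by (intro mult_left_mono) auto
      thus "s <= x * real (k + N) - 1" using s x2 unfolding x_def by linarith
     qed simp
     ultimately show "\<bar>drift s - drift a\<bar> <= T k - T (k + N)" by linarith
    qed
    also have "... = c1 * (r * x) * (T k - T (k + N))" unfolding c1_def r_def x_def by simp
    finally have "\<bar>bias R j k\<bar>^2 <= (c1 * (r * x) * (T k - T (k + N)))^2" by (intro power_mono) auto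
    also have "... = (c1 * (r * x))^2 * (T k - T (k + N))^2" by (simp only: power_mult_distrib)
    \<comment> \<open>One of the two factors T k - T (k + N) is bounded by T 1, the other is kept
      for the telescoping sum.\<close>
    also have "... <= (c1 * (r * x))^2 * (T 1 * (T k - T (k + N)))"
    proof (intro mult_left_mono)
     have "T k - T (k + N) <= T 1" using Tm[OF k(1)] T0[of "k + N"] by linarith
     thus "(T k - T (k + N))^2 <= T 1 * (T k - T (k + N))"
      unfolding power2_eq_square using Tm[of k "k + N"] by (intro mult_right_mono) auto
    qed simp
    finally show ?thesis by simp
   qed
   hence "(\<Sum>k=1..<n. (bias R j k)^2) <= (\<Sum>k=1..<n. (c1 * (r * x))^2 * (T 1 * (T k - T (k + N))))" by (intro sum_mono) auto
   also have "... = (c1 * (r * x))^2 * (T 1 * (\<Sum>k=1..<n. T k - T (k + N)))" by (simp add: sum_distrib_left)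
   also have "(\<Sum>k=1..<n. T k - T (k + N)) <= real N * T 1"
   proof -
    \<comment> \<open>Telescoping with lag N: the first N tails remain, minus the N tails from n
      on.\<close>
    have "(\<Sum>k=1..<n. T k - T (k + N)) <= (\<Sum>k=1..<1 + N. T k) - (\<Sum>k=n..<n + N. T k)" if "1 <= n" for n
     using that
    proof (induction n rule: dec_induct)
     case base
     show ?case by simp
    next
     case (step n)
     have "(\<Sum>k=n..<n + N. T k) = T n + (\<Sum>k=Suc n..<n + N. T k)" using N by (subst sum.atLeast_Suc_lessThan) auto
     moreover have "(\<Sum>k=Suc n..<Suc n + N. T k) = (\<Sum>k=Suc n..<n + N. T k) + T (n + N)"
      using N by simp
     ultimately show ?case using step by (simp del: sum.op_ivl_Suc add: sum.atLeastLessThan_Suc)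
    qed
    moreover have "0 <= (\<Sum>k=n..<n + N. T k)" by (intro sum_nonneg T0)
    moreover have "(\<Sum>k=1..<1 + N. T k) <= (\<Sum>k=1..<1 + N. T 1)" by (intro sum_mono Tm) auto
    moreover have "(\<Sum>k=1..<n. T k - T (k + N)) = 0" if "\<not> 1 <= n" using that by simp
    ultimately show ?thesis using T0[of 1] by (cases "1 <= n") fastforce+
   qed
   also have "(c1 * (r * x))^2 * (T 1 * (real N * T 1)) = (c1 * (r * x))^2 * real N * (T 1)^2" by (simp add: power2_eq_square)
   also have "... <= (c1 * (r * x))^2 * real N * (C * (4 * x powr - g))^2"
    using T1 T0[of 1] by (intro mult_left_mono power_mono) auto
   also have "... = c1^2 * (C * 4)^2 * real N * (r * x * x powr - g)^2" by (simp add: power_mult_distrib)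
   also have "... <= D1 * x powr (3 - 2 * g)" unfolding pw D1_def by (intro mult_right_mono mult_left_mono) auto
   finally show ?thesis unfolding x_def using T0[of 1] by (simp add: mult_left_mono)
  qed
 qed
 show ?thesis
 proof (rule that[of "D0 + D1"])
  show "0 < D0 + D1" using D0 D10 by simp
  fix R :: real and j n assume j: "1 <= j" and R: "0 < R" "2 ^ j * (real n + A) <= R"
  have e: "3 - 2 * \<alpha> + 2 * d = 3 - 2 * g" unfolding g_def by simp
  show "(\<Sum>k<n. (bias R j k)^2) <= (D0 + D1) * (2 ^ j) powr (3 - 2 * \<alpha> + 2 * d)"
  proof (cases "n = 0")
   case False
   have "2 ^ j * A < 2 ^ j * (real n + A)" using False by simp
   hence "(bias R j 0)^2 <= D0 * (2 ^ j) powr (3 - 2 * g)" by (intro B0 R(1)) (use R(2) in linarith)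
   moreover have "(\<Sum>k<n. (bias R j k)^2) = (bias R j 0)^2 + (\<Sum>k=1..<n. (bias R j k)^2)"
    using False by (simp add: lessThan_atLeast0 sum.atLeast_Suc_lessThan)
   ultimately show ?thesis using main[OF j R] unfolding e by (simp add: distrib_right)
  qed (use D0 D10 in simp)
 qed
qed

end

section \<open>Minimizers of the contrast\<close>

text \<open>Quasiconvexity propagates the increase at p + h and p - h to all points outside the
  interval, so a minimizer over the compact interval is a global one. Comparing three values yields
  both existence and location of minimizers.\<close>

lemma quasiconvex_argmin:
 fixes f :: "real => real"
 assumes cont: "continuous_on {p - h..p + h} f"
  and quasi: "\<And>x y z. x <= y ==> y <= z ==> f y <= max (f x) (f z)"
  and h: "0 < h" and S: "{p - h..p + h} \<subseteq> S"
  and up: "f p < f (p + h)" and dn: "f p < f (p - h)"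
 shows "\<exists>a. is_arg_min f (\<lambda>a. a \<in> S) a" "\<And>a. is_arg_min f (\<lambda>a. a \<in> S) a ==> \<bar>a - p\<bar> <= h"
proof -
 have out: "f p < f x" if "h < \<bar>x - p\<bar>" for x
 proof (cases "p <= x")
  case True
  hence "f (p + h) <= max (f p) (f x)" using that h by (intro quasi) auto
  thus ?thesis using up by (auto simp: max_def split: if_splits)
 next
  case False
  hence "f (p - h) <= max (f x) (f p)" using that h by (intro quasi) auto
  thus ?thesis using dn by (auto simp: max_def split: if_splits)
 qed
 obtain a where a: "a \<in> {p - h..p + h}" "\<And>x. x \<in> {p - h..p + h} ==> f a <= f x"
  using continuous_attains_inf[OF _ _ cont] h by auto
 have "f a <= f x" for x
 proof (cases "h < \<bar>x - p\<bar>")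
  case True
  have "f a <= f p" using h by (intro a) auto
  thus ?thesis using out[OF True] by simp
 next
  case False
  thus ?thesis by (intro a(2)) (auto simp: abs_le_iff)
 qed
 thus "\<exists>a. is_arg_min f (\<lambda>a. a \<in> S) a"
  using a(1) S by (intro exI[of _ a]) (auto simp: is_arg_min_def not_less)
 show "\<bar>b - p\<bar> <= h" if "is_arg_min f (\<lambda>a. a \<in> S) b" for b
 proof (rule ccontr)
  assume "\<not> ?thesis"
  hence "f p < f b" by (intro out) simp
  moreover have "p \<in> S" using S h by auto
  ultimately show False using that by (auto simp: is_arg_min_def)
 qed
qed

text \<open>A nonnegative combination of exponentials of affine functions is convex, and a convex
  combination of two values is at most their maximum.\<close>

lemma exp_sum_quasiconvex:
 fixes c l d :: "'i => real"
 assumes c: "\<And>i. i \<in> I ==> 0 <= c i" and xy: "x <= y" and yz: "y <= (z::real)"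
 shows "(\<Sum>i\<in>I. c i * exp (l i * y + d i)) <= max (\<Sum>i\<in>I. c i * exp (l i * x + d i)) (\<Sum>i\<in>I. c i * exp (l i * z + d i))"
  (is "?F y <= max (?F x) (?F z)")
proof (cases "x = z")
 case False
 define u where "u = (y - x) / (z - x)"
 have u: "0 <= u" "u <= 1" unfolding u_def using xy yz False by (auto simp: field_simps)
 have y: "y = (1 - u) * x + u * z" 
 proof -
  have "u * (z - x) = y - x" unfolding u_def using False by simp
  thus ?thesis by (simp add: algebra_simps)
 qed
 have "exp (l i * y + d i) <= (1 - u) * exp (l i * x + d i) + u * exp (l i * z + d i)" for i
 proof -
  have "l i * y + d i = (1 - u) *\<^sub>R (l i * x + d i) + u *\<^sub>R (l i * z + d i)" unfolding y by (simp add: algebra_simps)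
  thus ?thesis using convex_onD[OF exp_convex u, of "l i * x + d i" "l i * z + d i"] by simp
 qed
 hence "?F y <= (\<Sum>i\<in>I. c i * ((1 - u) * exp (l i * x + d i) + u * exp (l i * z + d i)))"
  using c by (intro sum_mono mult_left_mono) auto
 also have "... = (\<Sum>i\<in>I. (1 - u) * (c i * exp (l i * x + d i)) + u * (c i * exp (l i * z + d i)))"
  by (intro sum.cong refl) (simp add: distrib_left mult.left_commute)
 also have "... = (1 - u) * ?F x + u * ?F z" by (simp only: sum.distrib sum_distrib_left)
 also have "... <= (1 - u) * max (?F x) (?F z) + u * max (?F x) (?F z)" using u by (intro add_mono mult_left_mono) auto
 also have "... = max (?F x) (?F z)" by (simp add: algebra_simps)
 finally show ?thesis .
qed (use xy yz in auto)

text \<open>The mean of i under the weights 2^(-i), which are the proportions in which the levels J0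
  + i occur among the indices; it is the excess of \<open>mean_scale\<close> over J0.\<close>

definition geometric_mean_level :: "nat => real" where
 "geometric_mean_level m = (\<Sum>i=1..m. real i / 2 ^ i) / (\<Sum>i=1..m. 1 / 2 ^ i)"

lemma sum_half_powers: "(\<Sum>i=1..m. 1 / 2 ^ i) = 1 - 1 / (2::real) ^ m"
 by (induction m) (auto simp: field_simps)

lemma sum_level_half_powers: "(\<Sum>i=1..m. real i / 2 ^ i) = 2 - (real m + 2) / 2 ^ m"
 by (induction m) (auto simp: field_simps)

lemma geometric_mean_level_tendsto: "geometric_mean_level \<longlonglongrightarrow> 2"
proof -
 have p: "(\<lambda>m. (1 / 2 :: real) ^ m) \<longlonglongrightarrow> 0" by (rule LIMSEQ_realpow_zero) auto
 have n: "(\<lambda>m. real m * (1 / 2) ^ m) \<longlonglongrightarrow> 0" by (rule powser_times_n_limit_0) simp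
 have "(\<lambda>m. (2 - (real m * (1 / 2) ^ m + 2 * (1 / 2) ^ m)) / (1 - (1 / 2) ^ m)) \<longlonglongrightarrow> (2 - (0 + 2 * 0)) / (1 - 0)"
  by (intro tendsto_intros p n) auto
 moreover have "(2 - (real m * (1 / 2) ^ m + 2 * (1 / 2) ^ m)) / (1 - (1 / 2) ^ m) = geometric_mean_level m" for m
  unfolding geometric_mean_level_def sum_half_powers sum_level_half_powers by (simp add: power_divide add_divide_distrib)
 ultimately show ?thesis by simp
qed

section \<open>The contrast, level by level\<close>

lemma whittle_indices_eq:
 "whittle_indices J J0 J1 = Sigma {J0<..J1} (\<lambda>j. int ` {..<2 ^ (J - j)})"
proof -
 have "{k::int. 0 <= k \<and> k <= 2 ^ n - 1} = int ` {..<2 ^ n}" for n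
 proof -
  have "k \<in> int ` {..<2 ^ n}" if "0 <= k" "k <= 2 ^ n - 1" for k :: int
   using that by (intro image_eqI[of _ _ "nat k"]) (auto simp: nat_less_iff)
  moreover have "int k <= 2 ^ n - 1" if "k < 2 ^ n" for k :: nat
  proof -
   have "int k < int (2 ^ n)" using that by (simp only: of_nat_less_iff)
   thus ?thesis by simp
  qed
  ultimately show ?thesis by auto
 qed
 thus ?thesis unfolding whittle_indices_def by fastforce
qed

lemma sum_whittle_indices:
 "(\<Sum>(j, k)\<in>whittle_indices J J0 J1. f j k) = (\<Sum>j\<in>{J0<..J1}. \<Sum>k<2 ^ (J - j). f j (int k))"
 unfolding whittle_indices_eq
 by (subst sum.Sigma[symmetric]) (auto simp: sum.reindex)

lemma sum_levels_shift:
 fixes f :: "nat => 'b :: comm_monoid_add"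
 assumes "J0 <= J1"
 shows "(\<Sum>j\<in>{J0<..J1}. f j) = (\<Sum>i=1..J1 - J0. f (J0 + i))"
proof -
 have "{J0<..J1} = (+) J0 ` {1..J1 - J0}"
 proof (rule set_eqI, rule iffI)
  fix j assume "j \<in> {J0<..J1}"
  thus "j \<in> (+) J0 ` {1..J1 - J0}" by (intro image_eqI[of _ _ "j - J0"]) auto
 qed (use assms in auto)
 hence "(\<Sum>j\<in>{J0<..J1}. f j) = sum f ((+) J0 ` {1..J1 - J0})" by (simp only:)
 also have "... = (\<Sum>i=1..J1 - J0. f (J0 + i))" by (subst sum.reindex) auto
 finally show ?thesis .
qed

lemma mean_scale_whittle_indices:
 assumes "J0 < J1" "J1 <= J"
 shows "mean_scale (whittle_indices J J0 J1) = real J0 + geometric_mean_level (J1 - J0)"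
proof -
 define m where "m = J1 - J0"
 have m: "1 <= m" unfolding m_def using assms by simp
 have pw: "(2::real) ^ (J - (J0 + i)) = 2 ^ (J - J0) / 2 ^ i" if "i \<in> {1..m}" for i
 proof -
  have "J - J0 = (J - (J0 + i)) + i" using that assms unfolding m_def by (simp, arith)
  hence "(2::real) ^ (J - J0) = 2 ^ (J - (J0 + i)) * 2 ^ i" by (metis power_add)
  thus ?thesis by simp
 qed
 define G where "G = (\<Sum>i=1..m. 1 / (2::real) ^ i)"
 have G: "0 < G" unfolding G_def using m by (intro sum_pos) auto
 have lev: "(\<Sum>(j, k)\<in>whittle_indices J J0 J1. g j) = (\<Sum>i=1..m. g (J0 + i) * (2 ^ (J - J0) / 2 ^ i))" for g :: "nat => real"
 proof -
  have "(\<Sum>(j, k)\<in>whittle_indices J J0 J1. g j) = (\<Sum>i=1..m. 2 ^ (J - (J0 + i)) * g (J0 + i))"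
   unfolding sum_whittle_indices using assms by (subst sum_levels_shift) (auto simp: m_def)
  also have "... = (\<Sum>i=1..m. g (J0 + i) * (2 ^ (J - J0) / 2 ^ i))"
   by (intro sum.cong refl) (simp add: pw)
  finally show ?thesis .
 qed
 have "real (card (whittle_indices J J0 J1)) = (\<Sum>(j, k)\<in>whittle_indices J J0 J1. 1)" by (simp add: case_prod_beta)
 also have "... = 2 ^ (J - J0) * G" unfolding lev[of "\<lambda>_. 1"] G_def by (simp add: sum_distrib_left)
 finally have c: "real (card (whittle_indices J J0 J1)) = 2 ^ (J - J0) * G" .
 have "(\<Sum>(j, k)\<in>whittle_indices J J0 J1. real j) = 2 ^ (J - J0) * (real J0 * G + (\<Sum>i=1..m. real i / 2 ^ i))"
  unfolding lev[of real] G_def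
  by (simp add: sum_distrib_left sum.distrib[symmetric] field_simps)
 hence "mean_scale (whittle_indices J J0 J1) = (real J0 * G + (\<Sum>i=1..m. real i / 2 ^ i)) / G"
  unfolding mean_scale_def c by simp
 thus ?thesis using G unfolding geometric_mean_level_def m_def[symmetric] G_def[symmetric] by (simp add: add_divide_distrib)
qed

definition level_energy :: "nat => (nat => int => real) => nat => real" where
 "level_energy J d j = (\<Sum>k<2 ^ (J - j). (d j (int k))^2)"

lemma level_energy_nonneg: "0 <= level_energy J d j"
 unfolding level_energy_def by (intro sum_nonneg) auto

text \<open>Exponentiation removes the logarithm: each level contributes an exponential of an affine
  function of a, and all factors that depend neither on the level nor on a are collected in E.
  Centring i by \<open>geometric_mean_level\<close> is the trace of the linear term of the
  contrast.\<close>

lemma exp_whittle_contrast: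
 fixes J0 J1 J :: nat and d :: "nat => int => real"
 defines "m \<equiv> J1 - J0"
 assumes J: "J0 < J1" "J1 <= J" and N: "0 < N"
  and b: "\<And>i. b i = level_energy J d (J0 + i) * 2 powr (- (2 - \<alpha>) * real i) / N"
  and pos: "0 < (\<Sum>i=1..m. b i)"
 obtains E where "0 < E"
  "\<And>a. exp (whittle_contrast (whittle_indices J J0 J1) d a)
   = E * (\<Sum>i=1..m. b i * exp (((real i - geometric_mean_level m) * ln 2) * a + - ((real i - geometric_mean_level m) * ln 2) * \<alpha>))"
proof -
 define g where "g = geometric_mean_level m"
 define E where "E = N * exp (ln 2 * g * (2 - \<alpha>))"
 have E: "0 < E" unfolding E_def using N by simp
 have b0: "0 <= b i" for i unfolding b using level_energy_nonneg N by simp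
 have "exp (whittle_contrast (whittle_indices J J0 J1) d a)
   = E * (\<Sum>i=1..m. b i * exp (((real i - g) * ln 2) * a + - ((real i - g) * ln 2) * \<alpha>))" for a
 proof -
  define S where "S = (\<Sum>(j, k)\<in>whittle_indices J J0 J1. (d j k)^2 / 2 powr ((2 - a) * real j))"
  have "S = (\<Sum>i=1..m. level_energy J d (J0 + i) / 2 powr ((2 - a) * real (J0 + i)))"
   unfolding S_def sum_whittle_indices level_energy_def m_def using J
   by (subst sum_levels_shift) (auto simp: sum_divide_distrib)
  also have "... = (\<Sum>i=1..m. N * b i * 2 powr ((a - \<alpha>) * real i - (2 - a) * real J0))"
  proof (rule sum.cong[OF refl])
   fix i
   have "level_energy J d (J0 + i) = N * b i * 2 powr ((2 - \<alpha>) * real i)"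
   proof -
    have p: "2 powr (- (2 - \<alpha>) * real i) * 2 powr ((2 - \<alpha>) * real i) = 1"
     by (simp only: powr_add[symmetric]) (simp add: algebra_simps)
    have "N * b i * 2 powr ((2 - \<alpha>) * real i) = level_energy J d (J0 + i) * (2 powr (- (2 - \<alpha>) * real i) * 2 powr ((2 - \<alpha>) * real i))"
     unfolding b using N by simp
    thus ?thesis unfolding p by simp
   qed
   hence "level_energy J d (J0 + i) / 2 powr ((2 - a) * real (J0 + i)) = N * b i * (2 powr ((2 - \<alpha>) * real i) / 2 powr ((2 - a) * real (J0 + i)))"
    by simp
   also have "2 powr ((2 - \<alpha>) * real i) / 2 powr ((2 - a) * real (J0 + i)) = 2 powr ((a - \<alpha>) * real i - (2 - a) * real J0)"
    unfolding powr_diff[symmetric] by (simp add: algebra_simps)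
   finally show "level_energy J d (J0 + i) / 2 powr ((2 - a) * real (J0 + i)) = N * b i * 2 powr ((a - \<alpha>) * real i - (2 - a) * real J0)" .
  qed
  finally have S: "S = (\<Sum>i=1..m. N * b i * 2 powr ((a - \<alpha>) * real i - (2 - a) * real J0))" .
  \<comment> \<open>Needed for exp (ln S) = S.\<close>
  have "0 < S"
  proof -
   have "\<exists>i\<in>{1..m}. b i \<noteq> 0" 
   proof (rule ccontr)
    assume "\<not> ?thesis"
    hence "(\<Sum>i=1..m. b i) = 0" by (intro sum.neutral) blast
    thus False using pos by simp
   qed
   then obtain i where "i \<in> {1..m}" "b i \<noteq> 0" by blast
   hence "i \<in> {1..m}" "0 < b i" using b0[of i] by auto
   thus ?thesis unfolding S using N b0 by (intro sum_pos2[of _ i]) auto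
  qed
  hence "exp (whittle_contrast (whittle_indices J J0 J1) d a) = S * exp ((real J0 + g) * ln 2 * (2 - a))"
   unfolding whittle_contrast_def S_def[symmetric] mean_scale_whittle_indices[OF J] g_def m_def by (simp add: exp_add)
  also have "... = (\<Sum>i=1..m. E * (b i * exp (((real i - g) * ln 2) * a + - ((real i - g) * ln 2) * \<alpha>)))"
   unfolding S sum_distrib_right
  proof (rule sum.cong[OF refl])
   fix i
   show "N * b i * 2 powr ((a - \<alpha>) * real i - (2 - a) * real J0) * exp ((real J0 + g) * ln 2 * (2 - a))
    = E * (b i * exp (((real i - g) * ln 2) * a + - ((real i - g) * ln 2) * \<alpha>))"
    unfolding E_def powr_def by (simp add: mult.assoc flip: exp_add) (simp add: algebra_simps)
  qed
  finally show ?thesis by (simp add: sum_distrib_left)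
 qed
 thus ?thesis using that[OF E] unfolding g_def by blast
qed

text \<open>With normalized energies close to 2^(-i), the value at \<alpha> is at most 1 + 2 r, the
  levels beyond K included. At \<alpha> + h and \<alpha> - h a lower bound suffices, so finitely
  many levels are enough; their sum tends to 1 / (1 - (1 - 2^x)^2) for x = h and x = -h, which
  exceeds 1.\<close>

lemma whittle_argmin_near:
 assumes a: "0 < \<alpha>" "\<alpha> < 2" and h0: "0 < h0"
 obtains K0 m0 r where "0 < r" "r < 1"
  "\<And>K J J0 J1 d N. K0 <= K ==> 0 < N ==> J0 < J1 ==> J1 <= J ==> m0 <= J1 - J0 ==> K <= J1 - J0 ==>
   (\<And>i. 1 <= i ==> i <= K ==> \<bar>level_energy J d (J0 + i) * 2 powr (- (2 - \<alpha>) * real i) / N * 2 ^ i - 1\<bar> <= r) ==>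
   (\<Sum>i=Suc K..J1 - J0. level_energy J d (J0 + i) * 2 powr (- (2 - \<alpha>) * real i) / N) <= r ==>
   (\<exists>x. is_arg_min (whittle_contrast (whittle_indices J J0 J1) d) (\<lambda>x. x \<in> {0<..<2}) x) \<and>
   (\<forall>x. is_arg_min (whittle_contrast (whittle_indices J J0 J1) d) (\<lambda>x. x \<in> {0<..<2}) x --> \<bar>x - \<alpha>\<bar> <= h0)"
proof -
 \<comment> \<open>Small enough for \<alpha> + h and \<alpha> - h to stay inside (0, 2), and below 1
   so that the geometric series with ratio 2^(h - 1) converges.\<close>
 define h where "h = Min {h0, \<alpha> / 2, (2 - \<alpha>) / 2, 1 / 2}"
 have h: "0 < h" "h <= h0" "h < 1" "h < \<alpha>" "h < 2 - \<alpha>"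
 proof -
  have "h <= x" if "x \<in> {h0, \<alpha> / 2, (2 - \<alpha>) / 2, 1 / 2}" for x unfolding h_def using that by (intro Min_le) auto
  from this[of "\<alpha> / 2"] this[of "(2 - \<alpha>) / 2"] this[of "1 / 2"] this[of h0]
  have "h <= \<alpha> / 2" "h <= (2 - \<alpha>) / 2" "h <= 1 / 2" "h <= h0" by auto
  moreover show "0 < h" unfolding h_def using a h0 by auto
  ultimately show "h <= h0" "h < 1" "h < \<alpha>" "h < 2 - \<alpha>" using a by auto
 qed
 define E where "E K x = (\<Sum>i=1..K. (2 powr (x - 1)) ^ i)" for K and x :: real
 have lim: "(\<lambda>K. E K x * 2 powr (- 2 * x)) \<longlonglongrightarrow> 1 / (1 - (1 - 2 powr x)^2)" and lim1: "1 < 1 / (1 - (1 - 2 powr x)^2)"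
  if x: "x < 1" "x \<noteq> 0" for x :: real
 proof -
  define y where "y = 2 powr x"
  have y: "0 < y" "y < 2" "y \<noteq> 1"
  proof -
   show "0 < y" unfolding y_def by simp
   have "y < 2 powr 1" unfolding y_def using x by (intro powr_less_mono) auto
   thus "y < 2" by simp
   show "y \<noteq> 1" unfolding y_def using x by simp
  qed
  have y2: "2 powr (x - 1) = y / 2" "2 powr (- 2 * x) = 1 / y^2" unfolding y_def
   by (simp add: powr_diff) (simp add: powr_minus_divide powr_powr[symmetric] mult.commute[of 2] powr_numeral)
  have "(\<lambda>i. (y / 2) ^ i) sums (1 / (1 - y / 2))" using y by (intro geometric_sums) auto
  hence "(\<lambda>i. (y / 2) ^ Suc i) sums (1 / (1 - y / 2) - 1)" by (subst sums_Suc_iff) simp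
  hence "(\<lambda>K. \<Sum>i<K. (y / 2) ^ Suc i) \<longlonglongrightarrow> 1 / (1 - y / 2) - 1" unfolding sums_def .
  moreover have "(\<Sum>i<K. (y / 2) ^ Suc i) = E K x" for K
   unfolding E_def y2 by (simp add: sum.atLeast1_atMost_eq)
  ultimately have "(\<lambda>K. E K x) \<longlonglongrightarrow> 1 / (1 - y / 2) - 1" by simp
  hence "(\<lambda>K. E K x * 2 powr (- 2 * x)) \<longlonglongrightarrow> (1 / (1 - y / 2) - 1) * (1 / y^2)" unfolding y2 by (intro tendsto_intros)
  also have "(1 / (1 - y / 2) - 1) * (1 / y^2) = 1 / (1 - (1 - y)^2)"
  proof -
   have "1 / (1 - y / 2) - 1 = y / (2 - y)" using y by (simp add: field_simps)
   moreover have "1 - (1 - y)^2 = y * (2 - y)" by (simp add: power2_eq_square algebra_simps)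
   ultimately show ?thesis using y by (simp add: power2_eq_square)
  qed
  finally show "(\<lambda>K. E K x * 2 powr (- 2 * x)) \<longlonglongrightarrow> 1 / (1 - (1 - 2 powr x)^2)" unfolding y_def .
  have "1 - (1 - y)^2 = y * (2 - y)" by (simp add: power2_eq_square algebra_simps)
  hence "0 < 1 - (1 - y)^2" using y by simp
  moreover have "0 < (1 - y)^2" using y by simp
  ultimately show "1 < 1 / (1 - (1 - 2 powr x)^2)" unfolding y_def[symmetric] by (simp add: field_simps)
 qed
 have "\<forall>\<^sub>F K in sequentially. 1 < E K h * 2 powr (- 2 * h)"
  by (rule order_tendstoD(1)[OF lim lim1]) (use h in auto)
 moreover have "\<forall>\<^sub>F K in sequentially. 1 < E K (- h) * 2 powr (- 2 * (- h))"
  by (rule order_tendstoD(1)[OF lim lim1]) (use h in auto)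
 ultimately have "\<forall>\<^sub>F K in sequentially. 1 < E K h * 2 powr (- 2 * h) \<and> 1 < E K (- h) * 2 powr (- 2 * (- h))"
  by (rule eventually_conj)
 then obtain K0 where K0: "1 < E K0 h * 2 powr (- 2 * h)" "1 < E K0 (- h) * 2 powr (- 2 * (- h))"
  unfolding eventually_sequentially by blast
 \<comment> \<open>A level strictly between 1 and both comparison values, so that it survives
   replacing the limit 2 by \<open>geometric_mean_level m\<close> for large m.\<close>
 obtain c where c: "1 < c" "c < E K0 h * 2 powr (- 2 * h)" "c < E K0 (- h) * 2 powr (- 2 * (- h))"
  using dense[of 1 "min (E K0 h * 2 powr (- 2 * h)) (E K0 (- h) * 2 powr (- 2 * (- h)))"] K0 by auto
 have limm: "(\<lambda>m. E K0 x * 2 powr (- geometric_mean_level m * x)) \<longlonglongrightarrow> E K0 x * 2 powr (- 2 * x)" for x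
  by (intro tendsto_intros geometric_mean_level_tendsto) auto
 have "\<forall>\<^sub>F m in sequentially. c < E K0 h * 2 powr (- geometric_mean_level m * h)
   \<and> c < E K0 (- h) * 2 powr (- geometric_mean_level m * (- h))"
  by (intro eventually_conj order_tendstoD(1)[OF limm] c)
 then obtain m0 where m0: "\<And>m. m0 <= m ==> c < E K0 h * 2 powr (- geometric_mean_level m * h)
   \<and> c < E K0 (- h) * 2 powr (- geometric_mean_level m * (- h))"
  unfolding eventually_sequentially by blast
 \<comment> \<open>The solution of (1 - r) c = 1 + 2 r, where the lower bound beside \<alpha> meets
   the upper bound at \<alpha>.\<close>
 define r where "r = (c - 1) / (c + 2)"
 have r: "0 < r" "r < 1" "(1 - r) * c = 1 + 2 * r" unfolding r_def using c by (auto simp: field_simps)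
 show ?thesis
 proof (rule that[OF r(1,2)])
  fix K J J0 J1 :: nat and d :: "nat => int => real" and N :: real
  assume K: "K0 <= K" and N: "0 < N" and J: "J0 < J1" "J1 <= J" and m: "m0 <= J1 - J0" "K <= J1 - J0"
   and near: "\<And>i. 1 <= i ==> i <= K ==> \<bar>level_energy J d (J0 + i) * 2 powr (- (2 - \<alpha>) * real i) / N * 2 ^ i - 1\<bar> <= r"
   and tail: "(\<Sum>i=Suc K..J1 - J0. level_energy J d (J0 + i) * 2 powr (- (2 - \<alpha>) * real i) / N) <= r"
  define b where "b i = level_energy J d (J0 + i) * 2 powr (- (2 - \<alpha>) * real i) / N" for i
  define m where "m = J1 - J0"
  define g where "g = geometric_mean_level m"
  define W where "W = whittle_contrast (whittle_indices J J0 J1) d"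
  define F where "F x = (\<Sum>i=1..m. b i * exp (((real i - g) * ln 2) * x + - ((real i - g) * ln 2) * \<alpha>))" for x
  have b0: "0 <= b i" for i unfolding b_def using level_energy_nonneg N by simp
  have near': "(1 - r) / 2 ^ i <= b i" "b i <= (1 + r) / 2 ^ i" if "1 <= i" "i <= K" for i
   using near[OF that] unfolding b_def[symmetric] by (auto simp: field_simps abs_le_iff)
  have F\<alpha>: "F \<alpha> <= 1 + 2 * r"
  proof -
   have "F \<alpha> = (\<Sum>i\<in>{1..K} \<union> {Suc K..m}. b i)" unfolding F_def using m(2) by (intro sum.cong) (auto simp: m_def)
   also have "... = (\<Sum>i=1..K. b i) + (\<Sum>i=Suc K..m. b i)" by (intro sum.union_disjoint) auto
   also have "... <= (\<Sum>i=1..K. (1 + r) * (1 / 2 ^ i)) + r"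
    using tail near'(2) unfolding b_def[symmetric] m_def[symmetric] by (intro add_mono sum_mono) auto
   also have "(\<Sum>i=1..K. (1 + r) * (1 / 2 ^ i)) = (1 + r) * (1 - 1 / 2 ^ K)"
    unfolding sum_distrib_left[symmetric] sum_half_powers ..
   also have "... <= (1 + r) * 1" using r by (intro mult_left_mono) auto
   finally show ?thesis by simp
  qed
  have F1: "(1 - r) * (E K0 x * 2 powr (- g * x)) <= F (\<alpha> + x)" for x
  proof -
   have "(1 - r) * (E K0 x * 2 powr (- g * x)) = (\<Sum>i=1..K0. (1 - r) / 2 ^ i * exp ((real i - g) * ln 2 * x))"
    unfolding E_def sum_distrib_right sum_distrib_left
   proof (rule sum.cong[OF refl])
    fix i
    have "(2 powr (x - 1)) ^ i = 2 powr (x * real i) / 2 ^ i"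
     by (simp add: powr_powr powr_diff power_divide mult.commute flip: powr_realpow)
    thus "(1 - r) * ((2 powr (x - 1)) ^ i * 2 powr (- g * x)) = (1 - r) / 2 ^ i * exp ((real i - g) * ln 2 * x)"
     by (simp add: powr_def algebra_simps flip: exp_add)
   qed
   also have "... <= (\<Sum>i=1..K0. b i * exp ((real i - g) * ln 2 * x))"
    using near'(1) K by (intro sum_mono mult_right_mono) auto
   also have "... <= (\<Sum>i=1..m. b i * exp ((real i - g) * ln 2 * x))"
    using K m(2) b0 by (intro sum_mono2) (auto simp: m_def)
   also have "... = F (\<alpha> + x)" unfolding F_def by (intro sum.cong refl) (simp add: algebra_simps)
   finally show ?thesis .
  qed
  have mm: "m0 <= m" unfolding m_def by (rule m(1))
  have lt: "F \<alpha> < F (\<alpha> + h)" "F \<alpha> < F (\<alpha> - h)"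
  proof -
   have "(1 - r) * c < (1 - r) * (E K0 h * 2 powr (- g * h))" using m0[OF mm] r unfolding g_def by (intro mult_strict_left_mono) auto
   thus "F \<alpha> < F (\<alpha> + h)" using F1[of h] F\<alpha> r(3) by linarith
   have "(1 - r) * c < (1 - r) * (E K0 (- h) * 2 powr (- g * (- h)))" using m0[OF mm] r unfolding g_def by (intro mult_strict_left_mono) auto
   thus "F \<alpha> < F (\<alpha> - h)" using F1[of "- h"] F\<alpha> r(3) by simp
  qed
  have K1: "1 <= K0" using K0(1) unfolding E_def by (cases K0) auto
  have pos: "0 < (\<Sum>i=1..J1 - J0. b i)"
  proof -
   have "0 < (1 - r) / 2 ^ 1" using r by simp
   also have "... <= b 1" using K1 K by (intro near'(1)) auto
   finally show ?thesis using J b0 by (intro sum_pos2[of _ 1]) auto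
  qed
  obtain E' where E': "0 < E'" "\<And>x. exp (W x) = E' * F x"
   unfolding W_def F_def g_def m_def by (rule exp_whittle_contrast[OF J N b_def pos]) blast
  have iff: "is_arg_min W (\<lambda>x. x \<in> {0<..<2}) = is_arg_min F (\<lambda>x. x \<in> {0<..<2})"
  proof -
   have "W x < W y \<longleftrightarrow> F x < F y" for x y
    using E'(2)[of x] E'(2)[of y] E'(1) exp_less_cancel_iff[of "W x" "W y"] by simp
   thus ?thesis by (auto simp: is_arg_min_def fun_eq_iff)
  qed
  have "continuous_on {\<alpha> - h..\<alpha> + h} F" unfolding F_def by (intro continuous_intros)
  moreover have "F y <= max (F x) (F z)" if "x <= y" "y <= z" for x y z
   unfolding F_def by (rule exp_sum_quasiconvex[OF b0 that])
  moreover have "{\<alpha> - h..\<alpha> + h} \<subseteq> {0<..<2}" using h by auto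
  ultimately have "\<exists>x. is_arg_min F (\<lambda>x. x \<in> {0<..<2}) x" "\<And>x. is_arg_min F (\<lambda>x. x \<in> {0<..<2}) x ==> \<bar>x - \<alpha>\<bar> <= h"
   using quasiconvex_argmin[of \<alpha> h F "{0<..<2}"] h lt by blast+
  thus "(\<exists>x. is_arg_min (whittle_contrast (whittle_indices J J0 J1) d) (\<lambda>x. x \<in> {0<..<2}) x) \<and>
   (\<forall>x. is_arg_min (whittle_contrast (whittle_indices J J0 J1) d) (\<lambda>x. x \<in> {0<..<2}) x --> \<bar>x - \<alpha>\<bar> <= h0)"
   unfolding W_def[symmetric] iff using h(2) by (blast intro: order_trans)
 qed
qed

section \<open>Wavelet coefficients as sums over the sources\<close>

lemma borel_measurable_lebesgueI: "f \<in> borel_measurable borel ==> f \<in> borel_measurable lebesgue"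
 by (rule measurable_completion) simp

lemma lebesgue_integrable_bounded_support:
 fixes f :: "real => real"
 assumes "f \<in> borel_measurable lebesgue" "\<And>s. \<bar>f s\<bar> <= c" "\<And>s. s \<notin> {a..b} ==> f s = 0"
 shows "integrable lebesgue f"
 by (rule integrableI_bounded_set[where A = "{a..b}" and B = c]) (use assms in \<open>auto simp: emeasure_lborel_Icc_eq\<close>)

locale sampled_wavelet =
 fixes M K L :: real and \<psi> \<phi> :: "real => real"
 assumes M: "1 <= M" and psi_measurable: "\<psi> \<in> borel_measurable lebesgue"
  and psi_bound: "\<And>s. \<bar>\<psi> s\<bar> <= K" and psi_support: "\<And>s. s \<notin> {0..M} ==> \<psi> s = 0"
  and psi_zero: "(LINT s|lebesgue. \<psi> s) = 0"
  and phi_measurable: "\<phi> \<in> borel_measurable lebesgue"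
  and phi_bound: "\<And>s. \<bar>\<phi> s\<bar> <= L" and phi_support: "\<And>s. s \<notin> {- M + 1..1} ==> \<phi> s = 0"
  and phi_sum: "\<And>s. ((\<lambda>m::int. \<phi> (s - of_int m)) has_sum 1) UNIV"
begin

lemma K_nonneg: "0 <= K" using psi_bound[of 0] by linarith
lemma L_nonneg: "0 <= L" using phi_bound[of 0] by linarith

lemma wavelet_eq: "wavelet \<psi> j (int k) s = \<psi> (- real k + (1 / 2 ^ j) * s) / sqrt (2 ^ j)"
proof -
 have "2 powr (- real j / 2) = 1 / (2 powr real j) powr (1 / 2)" by (simp add: powr_powr flip: powr_minus_divide)
 also have "(2 powr real j) powr (1 / 2) = sqrt (2 ^ j)" by (simp add: powr_half_sqrt powr_realpow)
 finally have "2 powr (- real j / 2) = 1 / sqrt (2 ^ j)" .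
 moreover have "2 powr (- real j) = 1 / 2 ^ j" by (simp add: powr_minus_divide powr_realpow)
 ultimately show ?thesis unfolding wavelet_def by simp
qed

lemma wavelet_measurable: "wavelet \<psi> j (int k) \<in> borel_measurable lebesgue"
 unfolding wavelet_eq[abs_def]
 using borel_measurable_affine[OF psi_measurable, of "1 / 2 ^ j" "- real k"] by (intro borel_measurable_divide) auto

lemma wavelet_bound: "\<bar>wavelet \<psi> j (int k) s\<bar> <= K / sqrt (2 ^ j)"
 unfolding wavelet_eq abs_divide using psi_bound by (intro frac_le) (auto intro: K_nonneg)

lemma wavelet_support: "wavelet \<psi> j (int k) s \<noteq> 0 ==> s \<in> {2 ^ j * real k..2 ^ j * (real k + M)}"
proof -
 assume "wavelet \<psi> j (int k) s \<noteq> 0"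
 hence "- real k + (1 / 2 ^ j) * s \<in> {0..M}" unfolding wavelet_eq using psi_support by force
 thus ?thesis by (auto simp: field_simps)
qed

lemma wavelet_mult_integrable:
 assumes "g \<in> borel_measurable lebesgue" "\<And>s. s \<in> {2 ^ j * real k..2 ^ j * (real k + M)} ==> \<bar>g s\<bar> <= c"
 shows "integrable lebesgue (\<lambda>s. wavelet \<psi> j (int k) s * g s)"
proof (rule lebesgue_integrable_bounded_support[where c = "K / sqrt (2 ^ j) * \<bar>c\<bar>"])
 show "(\<lambda>s. wavelet \<psi> j (int k) s * g s) \<in> borel_measurable lebesgue"
  by (intro borel_measurable_times wavelet_measurable assms)
 show "wavelet \<psi> j (int k) s * g s = 0" if "s \<notin> {2 ^ j * real k..2 ^ j * (real k + M)}" for s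
  using wavelet_support[of j k s] that by auto
 show "\<bar>wavelet \<psi> j (int k) s * g s\<bar> <= K / sqrt (2 ^ j) * \<bar>c\<bar>" for s
 proof (cases "s \<in> {2 ^ j * real k..2 ^ j * (real k + M)}")
  case True
  have "\<bar>g s\<bar> <= \<bar>c\<bar>" using assms(2)[OF True] by simp
  thus ?thesis unfolding abs_mult using wavelet_bound[of j k s] by (intro mult_mono) (auto intro: K_nonneg)
 next
  case False
  hence "wavelet \<psi> j (int k) s = 0" using wavelet_support[of j k s] by auto
  thus ?thesis using K_nonneg by simp
 qed
qed

lemma wavelet_integral: "(LINT s|lebesgue. wavelet \<psi> j (int k) s * f (- real k + (1 / 2 ^ j) * s)) = sqrt (2 ^ j) * (LINT s|lebesgue. \<psi> s * f s)"
proof -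
 have "(LINT s|lebesgue. \<psi> s * f s) = \<bar>1 / 2 ^ j\<bar> *\<^sub>R (LINT s|lebesgue. \<psi> (- real k + (1 / 2 ^ j) * s) * f (- real k + (1 / 2 ^ j) * s))"
  by (rule lebesgue_integral_real_affine) simp
 hence "(LINT s|lebesgue. \<psi> (- real k + (1 / 2 ^ j) * s) * f (- real k + (1 / 2 ^ j) * s)) = 2 ^ j * (LINT s|lebesgue. \<psi> s * f s)" by simp
 moreover have "(LINT s|lebesgue. wavelet \<psi> j (int k) s * f (- real k + (1 / 2 ^ j) * s)) =
   (LINT s|lebesgue. \<psi> (- real k + (1 / 2 ^ j) * s) * f (- real k + (1 / 2 ^ j) * s)) / sqrt (2 ^ j)"
  unfolding wavelet_eq by (subst integral_divide_zero[symmetric]) simp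
 ultimately have "(LINT s|lebesgue. wavelet \<psi> j (int k) s * f (- real k + (1 / 2 ^ j) * s)) = 2 ^ j / sqrt (2 ^ j) * (LINT s|lebesgue. \<psi> s * f s)"
  by simp
 thus ?thesis by (simp add: real_div_sqrt)
qed

lemma wavelet_zero: "(LINT s|lebesgue. wavelet \<psi> j (int k) s) = 0"
 using wavelet_integral[of j k "\<lambda>_. 1"] psi_zero by simp

lemma wavelet_first_moment:
 assumes "(LINT s|lebesgue. s * \<psi> s) = 0"
 shows "(LINT s|lebesgue. wavelet \<psi> j (int k) s * s) = 0"
proof -
 have "(LINT s|lebesgue. wavelet \<psi> j (int k) s * s)
   = (LINT s|lebesgue. 2 ^ j * (wavelet \<psi> j (int k) s * (- real k + (1 / 2 ^ j) * s)) + 2 ^ j * real k * wavelet \<psi> j (int k) s)"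
  by (intro lint_cong refl) (simp add: field_simps)
 also have "... = (LINT s|lebesgue. 2 ^ j * (wavelet \<psi> j (int k) s * (- real k + (1 / 2 ^ j) * s)))
   + (LINT s|lebesgue. 2 ^ j * real k * wavelet \<psi> j (int k) s)"
 proof (intro lint_add integrable_mult_right wavelet_mult_integrable[where c = M])
  show "\<bar>- real k + (1 / 2 ^ j) * s\<bar> <= M" if "s \<in> {2 ^ j * real k..2 ^ j * (real k + M)}" for s
   using that M by (auto simp: abs_le_iff field_simps)
  show "(\<lambda>s. - real k + (1 / 2 ^ j) * s) \<in> borel_measurable lebesgue" by (rule borel_measurable_lebesgueI) measurable
  show "integrable lebesgue (wavelet \<psi> j (int k))"
   using wavelet_mult_integrable[of "\<lambda>_. 1" j k 1] by simp
 qed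
 also have "... = 0" using wavelet_integral[of j k "\<lambda>s. s"] assms wavelet_zero by (simp add: mult.commute)
 finally show ?thesis .
qed

text \<open>The weight of the observation X(m) in the discrete-time coefficient.\<close>

definition sampled_weight :: "nat => nat => int => real" where
 "sampled_weight j k m = (LINT s|lebesgue. wavelet \<psi> j (int k) s * \<phi> (s - of_int m))"

text \<open>All m for which \<phi> (s - m) can be nonzero for some s in the support of the wavelet;
  the ends reflect the support [-M + 1, 1] of \<phi>.\<close>

definition sample_range :: "nat => nat => int set" where
 "sample_range j k = {\<lceil>2 ^ j * real k - 1\<rceil>..\<lfloor>2 ^ j * (real k + M) + M - 1\<rfloor>}"

lemma sample_range_iff: "m \<in> sample_range j k \<longleftrightarrow> 2 ^ j * real k - 1 <= of_int m \<and> of_int m <= 2 ^ j * (real k + M) + M - 1"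
 unfolding sample_range_def by (simp only: atLeastAtMost_iff ceiling_le_iff le_floor_iff)

lemma finite_sample_range [simp]: "finite (sample_range j k)"
 unfolding sample_range_def by simp

lemma sample_range_le: "m \<in> sample_range j k ==> of_int m <= 2 ^ j * (real k + 2 * M) - 1"
proof -
 assume "m \<in> sample_range j k"
 moreover have "M <= 2 ^ j * M" using M by simp
 ultimately show ?thesis by (simp add: sample_range_iff distrib_left)
qed

lemma phi_shift_measurable: "(\<lambda>s. \<phi> (s - of_int m)) \<in> borel_measurable lebesgue"
 using borel_measurable_affine[OF phi_measurable, of 1 "- of_int m"] by simp

lemma phi_sum_sample_range:
 assumes s: "s \<in> {2 ^ j * real k..2 ^ j * (real k + M)}" and h: "((\<lambda>m::int. f m * \<phi> (s - of_int m)) has_sum c) UNIV"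
 shows "(\<Sum>m\<in>sample_range j k. f m * \<phi> (s - of_int m)) = c"
proof -
 have z: "\<phi> (s - of_int m) = 0" if "m \<notin> sample_range j k" for m
  using that s by (intro phi_support) (auto simp: sample_range_iff)
 have "((\<lambda>m. f m * \<phi> (s - of_int m)) has_sum c) (sample_range j k)"
  by (subst has_sum_cong_neutral[where T = UNIV and g = "\<lambda>m. f m * \<phi> (s - of_int m)"]) (use z h in auto)
 thus ?thesis by (subst (asm) has_sum_finite_iff) auto
qed

lemma wavelet_phi_integrable: "integrable lebesgue (\<lambda>s. wavelet \<psi> j (int k) s * \<phi> (s - of_int m))"
 by (rule wavelet_mult_integrable[where c = L]) (simp_all add: phi_bound phi_shift_measurable)

lemma sum_sampled_weight:
 assumes "finite I"
 shows "(\<Sum>m\<in>I. c m * sampled_weight j k m) = (LINT s|lebesgue. wavelet \<psi> j (int k) s * (\<Sum>m\<in>I. c m * \<phi> (s - of_int m)))"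
proof -
 have "(LINT s|lebesgue. wavelet \<psi> j (int k) s * (\<Sum>m\<in>I. c m * \<phi> (s - of_int m)))
   = (LINT s|lebesgue. (\<Sum>m\<in>I. c m * (wavelet \<psi> j (int k) s * \<phi> (s - of_int m))))"
  by (intro lint_cong refl) (simp add: sum_distrib_left mult_ac)
 also have "... = (\<Sum>m\<in>I. (LINT s|lebesgue. c m * (wavelet \<psi> j (int k) s * \<phi> (s - of_int m))))"
  by (intro lint_sum integrable_mult_right wavelet_phi_integrable)
 finally show ?thesis unfolding sampled_weight_def by simp
qed

text \<open>The wavelet coefficient of the indicator of the ray below x, exact or from samples, so
  that a pulse on [x, y) contributes a difference of two values. The rays exclude x because pulses
  contain their starting time but not their end.\<close>

fun coeff_kernel :: "observation => nat => nat => real => real" where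
 "coeff_kernel Continuous_Time j k x = (LINT s|lebesgue. wavelet \<psi> j (int k) s * indicator {..<x} s)"
| "coeff_kernel Discrete_Time j k x = (\<Sum>m\<in>sample_range j k. indicator {..<x} (of_int m) * sampled_weight j k m)"

lemma wavelet_indicator_integrable:
 assumes "A \<in> sets borel"
 shows "integrable lebesgue (\<lambda>s. wavelet \<psi> j (int k) s * indicator A s)"
 by (rule wavelet_mult_integrable[where c = 1]) (use assms in \<open>auto intro!: borel_measurable_lebesgueI borel_measurable_indicator simp: indicator_def\<close>)

lemma coeff_kernel_diff:
 assumes "x <= y"
 shows "coeff_kernel Continuous_Time j k y - coeff_kernel Continuous_Time j k x = (LINT s|lebesgue. wavelet \<psi> j (int k) s * indicator {x..<y} s)"
  and "coeff_kernel Discrete_Time j k y - coeff_kernel Discrete_Time j k x = (\<Sum>m\<in>sample_range j k. indicator {x..<y} (of_int m) * sampled_weight j k m)"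
proof -
 have i: "indicator {x..<y} s = indicator {..<y} s - (indicator {..<x} s :: real)" for s
  using assms by (auto simp: indicator_def)
 show "coeff_kernel Continuous_Time j k y - coeff_kernel Continuous_Time j k x = (LINT s|lebesgue. wavelet \<psi> j (int k) s * indicator {x..<y} s)"
  unfolding i right_diff_distrib coeff_kernel.simps
  by (rule lint_diff[symmetric]) (rule wavelet_indicator_integrable, simp)+
 show "coeff_kernel Discrete_Time j k y - coeff_kernel Discrete_Time j k x = (\<Sum>m\<in>sample_range j k. indicator {x..<y} (of_int m) * sampled_weight j k m)"
  unfolding i left_diff_distrib coeff_kernel.simps sum_subtractf ..
qed

definition discrepancy_const :: real where "discrepancy_const = K * (((M + 1) * L + 1) * (M + 1))"

lemma discrepancy_const_nonneg: "0 <= discrepancy_const"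
 unfolding discrepancy_const_def using K_nonneg L_nonneg M by simp

text \<open>As the translates of \<phi> sum to 1, interpolation reproduces the step at x except on
  [x - M, x + 1]. There at most M + 1 samples are active, each with weight at most L, and the
  wavelet is at most K / sqrt (2^j); the product with the length M + 1 is
  \<open>discrepancy_const\<close>.\<close>

lemma discrete_kernel_approx:
 "\<bar>coeff_kernel Discrete_Time j k x - coeff_kernel Continuous_Time j k x\<bar> <= discrepancy_const / sqrt (2 ^ j)"
proof -
 define g where "g s = (\<Sum>m\<in>sample_range j k. indicator {..<x} (of_int m) * \<phi> (s - of_int m)) - indicator {..<x} s" for s
 have gm: "g \<in> borel_measurable lebesgue" unfolding g_def
  by (intro borel_measurable_diff borel_measurable_sum borel_measurable_times phi_shift_measurable borel_measurable_const borel_measurable_lebesgueI[OF borel_measurable_indicator]) auto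
 have gb: "\<bar>g s\<bar> <= ((M + 1) * L + 1) * indicator {x - M..x + 1} s" if s: "s \<in> {2 ^ j * real k..2 ^ j * (real k + M)}" for s
 proof (cases "s \<in> {x - M..x + 1}")
  case True
  define I where "I = {\<lceil>s - 1\<rceil>..\<lfloor>s + M - 1\<rfloor>}"
  have "\<bar>\<Sum>m\<in>sample_range j k. indicator {..<x} (of_int m) * \<phi> (s - of_int m)\<bar>
    <= (\<Sum>m\<in>sample_range j k. \<bar>indicator {..<x} (of_int m) * \<phi> (s - of_int m)\<bar>)" by (rule sum_abs)
  also have "... <= (\<Sum>m\<in>sample_range j k. if m \<in> I then L else 0)"
  proof (rule sum_mono)
   fix m
   have "\<phi> (s - of_int m) = 0" if "m \<notin> I"
   proof -
    have "\<not> (s - 1 <= of_int m \<and> of_int m <= s + M - 1)"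
     using that unfolding I_def by (simp only: atLeastAtMost_iff ceiling_le_iff le_floor_iff not_False_eq_True)
    thus ?thesis by (intro phi_support) auto
   qed
   thus "\<bar>indicator {..<x} (of_int m) * \<phi> (s - of_int m)\<bar> <= (if m \<in> I then L else 0)"
    using phi_bound[of "s - of_int m"] L_nonneg by (auto simp: indicator_def)
  qed
  also have "... = (\<Sum>m\<in>sample_range j k \<inter> I. L)" by (rule sum.inter_restrict[symmetric]) simp
  also have "... <= (\<Sum>m\<in>I. L)" using L_nonneg by (intro sum_mono2) (auto simp: I_def)
  also have "... = real (card I) * L" by simp
  also have "... <= (M + 1) * L"
  proof (rule mult_right_mono[OF _ L_nonneg])
   have c: "card I = nat (\<lfloor>s + M - 1\<rfloor> - \<lceil>s - 1\<rceil> + 1)" unfolding I_def by (rule card_atLeastAtMost_int)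
   have "real_of_int (\<lfloor>s + M - 1\<rfloor> - \<lceil>s - 1\<rceil> + 1) <= M + 1" by linarith
   moreover have "real (nat z) <= M + 1" if "real_of_int z <= M + 1" for z using that M by (cases "0 <= z") auto
   ultimately show "real (card I) <= M + 1" unfolding c by blast
  qed
  finally show ?thesis unfolding g_def using True by (auto simp: indicator_def abs_le_iff)
 next
  case False
  hence "s < x - M \<or> x + 1 < s" by auto
  hence "(\<Sum>m\<in>sample_range j k. indicator {..<x} (of_int m) * \<phi> (s - of_int m)) = indicator {..<x} s"
  proof
   assume l: "s < x - M"
   have "(\<Sum>m\<in>sample_range j k. indicator {..<x} (of_int m) * \<phi> (s - of_int m)) = (\<Sum>m\<in>sample_range j k. 1 * \<phi> (s - of_int m))"
   proof (rule sum.cong[OF refl])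
    fix m
    show "indicator {..<x} (of_int m) * \<phi> (s - of_int m) = 1 * \<phi> (s - of_int m)"
    proof (cases "of_int m < x")
     case False
     hence "\<phi> (s - of_int m) = 0" using l by (intro phi_support) auto
     thus ?thesis by simp
    qed simp
   qed
   also have "... = 1" using phi_sum[of s] by (intro phi_sum_sample_range[OF s]) simp
   finally show ?thesis using l M by simp
  next
   assume r: "x + 1 < s"
   have "(\<Sum>m\<in>sample_range j k. indicator {..<x} (of_int m) * \<phi> (s - of_int m)) = 0"
   proof (rule sum.neutral, rule ballI)
    fix m
    show "indicator {..<x} (of_int m) * \<phi> (s - of_int m) = 0"
    proof (cases "of_int m < x")
     case True
     hence "\<phi> (s - of_int m) = 0" using r by (intro phi_support) auto
     thus ?thesis by simp
    qed simp
   qed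
   thus ?thesis using r by simp
  qed
  thus ?thesis unfolding g_def using False by simp
 qed
 have "\<bar>g s\<bar> <= (M + 1) * L + 1" if "s \<in> {2 ^ j * real k..2 ^ j * (real k + M)}" for s
  using gb[OF that] M L_nonneg by (auto simp: indicator_def split: if_splits intro: order_trans)
 hence gi: "integrable lebesgue (\<lambda>s. wavelet \<psi> j (int k) s * g s)" by (rule wavelet_mult_integrable[OF gm])
 have d1: "coeff_kernel Discrete_Time j k x = (LINT s|lebesgue. wavelet \<psi> j (int k) s * (\<Sum>m\<in>sample_range j k. indicator {..<x} (of_int m) * \<phi> (s - of_int m)))"
  unfolding coeff_kernel.simps by (rule sum_sampled_weight) simp
 have int1: "integrable lebesgue (\<lambda>s. wavelet \<psi> j (int k) s * (\<Sum>m\<in>sample_range j k. indicator {..<x} (of_int m) * \<phi> (s - of_int m)))"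
  using integrable_addI[OF gi wavelet_indicator_integrable[of "{..<x}" j k]] unfolding g_def by (simp add: algebra_simps)
 have "coeff_kernel Discrete_Time j k x - coeff_kernel Continuous_Time j k x = (LINT s|lebesgue. wavelet \<psi> j (int k) s * g s)"
  unfolding d1 coeff_kernel.simps(1) g_def right_diff_distrib
  by (rule lint_diff[symmetric, OF int1 wavelet_indicator_integrable]) simp
 also have "\<bar>...\<bar> <= (LINT s|lebesgue. \<bar>wavelet \<psi> j (int k) s * g s\<bar>)" by (rule integral_abs_bound)
 also have "... <= (LINT s|lebesgue. K / sqrt (2 ^ j) * ((M + 1) * L + 1) * indicator {x - M..x + 1} s)"
 proof (rule integral_mono[OF integrable_abs[OF gi]])
  show "integrable lebesgue (\<lambda>s. K / sqrt (2 ^ j) * ((M + 1) * L + 1) * indicator {x - M..x + 1} s)"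
   by (intro integrable_mult_right integrable_real_indicator) (auto simp: emeasure_lborel_Icc_eq)
  show "\<bar>wavelet \<psi> j (int k) s * g s\<bar> <= K / sqrt (2 ^ j) * ((M + 1) * L + 1) * indicator {x - M..x + 1} s" for s
  proof (cases "s \<in> {2 ^ j * real k..2 ^ j * (real k + M)}")
   case True
   show ?thesis unfolding abs_mult mult.assoc using wavelet_bound[of j k s] gb[OF True] K_nonneg by (intro mult_mono) auto
  next
   case False
   hence "wavelet \<psi> j (int k) s = 0" using wavelet_support[of j k s] by auto
   thus ?thesis using K_nonneg L_nonneg M by simp
  qed
 qed
 also have "... = K / sqrt (2 ^ j) * ((M + 1) * L + 1) * (M + 1)" using M by simp
 finally show ?thesis unfolding discrepancy_const_def by (simp add: mult_ac)
qed

text \<open>To the right of all relevant samples the kernel is the sum of all weights, which by the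
  partition of unity is the integral of the wavelet, that is 0.\<close>

lemma discrete_kernel_support:
 assumes "coeff_kernel Discrete_Time j k x \<noteq> 0"
 shows "2 ^ j * real k - 1 < x" "x <= 2 ^ j * (real k + 2 * M) - 1"
proof -
 from assms obtain m where "m \<in> sample_range j k" "of_int m < x"
  by (force simp: indicator_def elim: sum.not_neutral_contains_not_neutral)
 thus "2 ^ j * real k - 1 < x" by (auto simp: sample_range_iff)
 show "x <= 2 ^ j * (real k + 2 * M) - 1"
 proof (rule ccontr)
  assume "\<not> ?thesis"
  hence "indicator {..<x} (of_int m :: real) = (1 :: real)" if "m \<in> sample_range j k" for m using sample_range_le[OF that] by simp
  hence "coeff_kernel Discrete_Time j k x = (\<Sum>m\<in>sample_range j k. 1 * sampled_weight j k m)" by simp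
  also have "... = (LINT s|lebesgue. wavelet \<psi> j (int k) s * (\<Sum>m\<in>sample_range j k. 1 * \<phi> (s - of_int m)))"
   by (rule sum_sampled_weight) simp
  also have "... = (LINT s|lebesgue. wavelet \<psi> j (int k) s)"
  proof (rule lint_cong[OF refl])
   fix s
   show "wavelet \<psi> j (int k) s * (\<Sum>m\<in>sample_range j k. 1 * \<phi> (s - of_int m)) = wavelet \<psi> j (int k) s"
    using wavelet_support[of j k s] phi_sum_sample_range[of s j k "\<lambda>_. 1" 1] phi_sum[of s]
    by (cases "wavelet \<psi> j (int k) s = 0") auto
  qed
  finally show False using assms wavelet_zero by simp
 qed
qed

text \<open>Integrating the step function up to a point B beyond its support gives the weights
  multiplied by B - m. Reproduction of constants and of linear functions by \<phi> turns the sum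
  into the integral of the wavelet against an affine function, and its first two moments
  vanish.\<close>

lemma discrete_kernel_integral:
 assumes m1: "(LINT s|lebesgue. s * \<psi> s) = 0"
  and lin: "\<And>s. ((\<lambda>m::int. of_int m * \<phi> (s - of_int m)) has_sum (a + b * s)) UNIV"
 shows "(LINT x|lborel. coeff_kernel Discrete_Time j k x) = 0"
proof -
 define B where "B = 2 ^ j * (real k + 2 * M)"
 have le: "of_int m <= B" if "m \<in> sample_range j k" for m using sample_range_le[OF that] unfolding B_def by simp
 have eq: "coeff_kernel Discrete_Time j k x = (\<Sum>m\<in>sample_range j k. indicator {of_int m<..B} x * sampled_weight j k m)" for x
 proof (cases "x <= B")
  case True
  thus ?thesis unfolding coeff_kernel.simps by (intro sum.cong refl) (simp add: indicator_def)
 next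
  case False
  hence "coeff_kernel Discrete_Time j k x = 0" using discrete_kernel_support(2)[of j k x] unfolding B_def by fastforce
  thus ?thesis using False by simp
 qed
 have "(LINT x|lborel. coeff_kernel Discrete_Time j k x) = (\<Sum>m\<in>sample_range j k. (LINT x|lborel. indicator {of_int m<..B} x * sampled_weight j k m))"
  unfolding eq
 proof (rule lint_sum, intro integrable_mult_left integrable_real_indicator)
  fix m assume "m \<in> sample_range j k"
  thus "emeasure lborel {real_of_int m<..B} < \<infinity>" using le by simp
 qed simp
 also have "... = (\<Sum>m\<in>sample_range j k. (B - of_int m) * sampled_weight j k m)" using le by (intro sum.cong refl) simp
 also have "... = (LINT s|lebesgue. wavelet \<psi> j (int k) s * (\<Sum>m\<in>sample_range j k. (B - of_int m) * \<phi> (s - of_int m)))"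
  by (rule sum_sampled_weight) simp
 also have "... = (LINT s|lebesgue. (B - a) * wavelet \<psi> j (int k) s - b * (wavelet \<psi> j (int k) s * s))"
 proof (rule lint_cong[OF refl])
  fix s
  show "wavelet \<psi> j (int k) s * (\<Sum>m\<in>sample_range j k. (B - of_int m) * \<phi> (s - of_int m)) = (B - a) * wavelet \<psi> j (int k) s - b * (wavelet \<psi> j (int k) s * s)"
  proof (cases "wavelet \<psi> j (int k) s = 0")
   case False
   hence s: "s \<in> {2 ^ j * real k..2 ^ j * (real k + M)}" by (rule wavelet_support)
   have 1: "(\<Sum>m\<in>sample_range j k. \<phi> (s - of_int m)) = 1" using phi_sum_sample_range[OF s, of "\<lambda>_. 1" 1] phi_sum[of s] by simp
   have 2: "(\<Sum>m\<in>sample_range j k. of_int m * \<phi> (s - of_int m)) = a + b * s" by (rule phi_sum_sample_range[OF s lin])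
   have 3: "(\<Sum>m\<in>sample_range j k. (B - of_int m) * \<phi> (s - of_int m)) = B * (\<Sum>m\<in>sample_range j k. \<phi> (s - of_int m)) - (\<Sum>m\<in>sample_range j k. of_int m * \<phi> (s - of_int m))"
    by (simp add: left_diff_distrib sum_subtractf sum_distrib_left)
   show ?thesis unfolding 3 1 2 by (simp add: algebra_simps)
  qed simp
 qed
 also have "... = 0"
 proof -
  have "integrable lebesgue (\<lambda>s. wavelet \<psi> j (int k) s * s)"
  proof (rule wavelet_mult_integrable[where c = "2 ^ j * (real k + M)"])
   show "\<bar>s\<bar> <= 2 ^ j * (real k + M)" if "s \<in> {2 ^ j * real k..2 ^ j * (real k + M)}" for s
   proof -
    have "0 <= 2 ^ j * real k" by simp
    hence "0 <= s" "s <= 2 ^ j * (real k + M)" using that unfolding atLeastAtMost_iff by linarith+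
    thus ?thesis by simp
   qed
  qed (rule borel_measurable_lebesgueI, simp)
  moreover have "integrable lebesgue (wavelet \<psi> j (int k))" using wavelet_mult_integrable[of "\<lambda>_. 1" j k 1] by simp
  ultimately show ?thesis
   by (subst lint_diff) (auto simp: wavelet_zero wavelet_first_moment[OF m1])
 qed
 finally show ?thesis .
qed

lemma coeff_kernel_measurable_discrete: "coeff_kernel Discrete_Time j k \<in> borel_measurable borel"
proof -
 have "coeff_kernel Discrete_Time j k = (\<lambda>x. \<Sum>m\<in>sample_range j k. indicator {of_int m<..} x * sampled_weight j k m)"
  by (intro ext) (auto intro!: sum.cong simp: indicator_def)
 also have "... \<in> borel_measurable borel" by (intro borel_measurable_sum borel_measurable_times borel_measurable_indicator) auto
 finally show ?thesis .
qed

text \<open>A coefficient only involves the values of the path before time \<open>2\<^sup>j (k + 2 M)\<close>.\<close>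

lemma wavelet_coeff_eq_kernel:
 fixes tt ee uu :: "nat => real"
 assumes x: "\<And>s. s < 2 ^ j * (real k + 2 * M) ==> x s = (\<Sum>l<n. uu l * indicator {tt l..<tt l + ee l} s)"
  and ee: "\<And>l. l < n ==> 0 < ee l"
 shows "wavelet_coeff obs \<psi> \<phi> x j (int k) = (\<Sum>l<n. uu l * (coeff_kernel obs j k (tt l + ee l) - coeff_kernel obs j k (tt l)))"
proof (cases obs)
 case Continuous_Time
 have "wavelet_coeff obs \<psi> \<phi> x j (int k) = (LINT s|lebesgue. (\<Sum>l<n. uu l * (wavelet \<psi> j (int k) s * indicator {tt l..<tt l + ee l} s)))"
  unfolding Continuous_Time wavelet_coeff.simps set_lebesgue_integral_def
 proof (rule lint_cong[OF refl])
  fix s :: real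
  show "indicator {0..} s *\<^sub>R (wavelet \<psi> j (int k) s * x s) = (\<Sum>l<n. uu l * (wavelet \<psi> j (int k) s * indicator {tt l..<tt l + ee l} s))"
  proof (cases "wavelet \<psi> j (int k) s = 0")
   case False
   hence "s \<in> {2 ^ j * real k..2 ^ j * (real k + M)}" by (rule wavelet_support)
   moreover have "0 <= 2 ^ j * real k" "2 ^ j * (real k + M) < 2 ^ j * (real k + 2 * M)" using M by auto
   ultimately have s: "0 <= s" "s < 2 ^ j * (real k + 2 * M)" unfolding atLeastAtMost_iff by linarith+
   show ?thesis unfolding x[OF s(2)] using s(1) by (simp only: indicator_eq_1_iff[THEN iffD2, of s "{0..}"] atLeast_iff scaleR_one sum_distrib_left mult_ac)
  qed simp
 qed
 also have "... = (\<Sum>l<n. (LINT s|lebesgue. uu l * (wavelet \<psi> j (int k) s * indicator {tt l..<tt l + ee l} s)))"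
  by (intro lint_sum integrable_mult_right wavelet_indicator_integrable) simp
 also have "... = (\<Sum>l<n. uu l * (coeff_kernel obs j k (tt l + ee l) - coeff_kernel obs j k (tt l)))"
  using ee unfolding Continuous_Time by (intro sum.cong refl) (subst coeff_kernel_diff(1), auto intro: less_imp_le)
 finally show ?thesis .
next
 case Discrete_Time
 have "wavelet_coeff obs \<psi> \<phi> x j (int k) = (LINT s|lebesgue. wavelet \<psi> j (int k) s * (\<Sum>m\<in>sample_range j k. x (of_int m) * \<phi> (s - of_int m)))"
  unfolding Discrete_Time wavelet_coeff.simps
 proof (rule lint_cong[OF refl])
  fix s :: real
  show "wavelet \<psi> j (int k) s * interpolate \<phi> x s = wavelet \<psi> j (int k) s * (\<Sum>m\<in>sample_range j k. x (of_int m) * \<phi> (s - of_int m))"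
  proof (cases "wavelet \<psi> j (int k) s = 0")
   case False
   hence s: "s \<in> {2 ^ j * real k..2 ^ j * (real k + M)}" by (rule wavelet_support)
   have "\<phi> (s - of_int m) = 0" if "m \<notin> sample_range j k" for m
    using that s by (intro phi_support) (auto simp: sample_range_iff)
   hence "((\<lambda>m. x (of_int m) * \<phi> (s - of_int m)) has_sum (\<Sum>m\<in>sample_range j k. x (of_int m) * \<phi> (s - of_int m))) UNIV"
    by (intro has_sum_finite_neutralI[where B = "sample_range j k"]) auto
   thus ?thesis unfolding interpolate_def by (simp add: infsumI)
  qed simp
 qed
 also have "... = (\<Sum>m\<in>sample_range j k. x (of_int m) * sampled_weight j k m)"
  by (rule sum_sampled_weight[symmetric]) simp
 also have "... = (\<Sum>m\<in>sample_range j k. \<Sum>l<n. uu l * (indicator {tt l..<tt l + ee l} (of_int m) * sampled_weight j k m))"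
 proof (rule sum.cong[OF refl])
  fix m assume "m \<in> sample_range j k"
  hence "of_int m < 2 ^ j * (real k + 2 * M)" using sample_range_le[of m j k] by linarith
  thus "x (of_int m) * sampled_weight j k m = (\<Sum>l<n. uu l * (indicator {tt l..<tt l + ee l} (of_int m) * sampled_weight j k m))"
   by (subst x) (simp_all only: sum_distrib_right mult.assoc)
 qed
 also have "... = (\<Sum>l<n. uu l * (\<Sum>m\<in>sample_range j k. indicator {tt l..<tt l + ee l} (of_int m) * sampled_weight j k m))"
  by (subst sum.swap) (simp only: sum_distrib_left)
 also have "... = (\<Sum>l<n. uu l * (coeff_kernel obs j k (tt l + ee l) - coeff_kernel obs j k (tt l)))"
  using ee unfolding Discrete_Time by (intro sum.cong refl) (subst coeff_kernel_diff(2), auto intro: less_imp_le)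
 finally show ?thesis .
qed

end

text \<open>Integration by parts turns the integral of \<open>prim\<close> into minus the first
  moment of \<psi>.\<close>

lemma (in wavelet_primitive) prim_integral_zero:
 assumes "(LINT s|lborel. s * \<psi> s) = 0"
 shows "(LINT s|lborel. prim s) = 0"
proof -
 have iM: "integrable lborel (\<lambda>s. indicator {0..M} s :: real)"
  using M by (intro integrable_real_indicator) auto
 have "(LINT s|lborel. prim s) = (LINT s|lborel. indicator {0..M} s * prim s)"
 proof (rule lint_cong[OF refl])
  fix s
  show "prim s = indicator {0..M} s * prim s" using prim_eq_0[of s] by (cases "s <= 0 \<or> M <= s") auto
 qed
 also have "... = (LINT r|lborel. \<psi> r * (LINT s|lborel. indicator {0..M} s * indicator {r<..} s))"
  by (rule integral_mult_prim[OF _ iM]) measurable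
 also have "... = (LINT r|lborel. M * \<psi> r - r * \<psi> r)"
 proof (rule lint_cong[OF refl])
  fix r
  show "\<psi> r * (LINT s|lborel. indicator {0..M} s * indicator {r<..} s) = M * \<psi> r - r * \<psi> r"
  proof (cases "\<psi> r = 0")
   case False
   hence r: "0 <= r" "r <= M" using psi_support[of r] by auto
   have e: "(LINT s|lborel. indicator {0..M} s * indicator {r<..} s :: real) = (LINT s|lborel. indicator {r<..M} s)"
    using r by (intro lint_cong refl) (auto simp: indicator_def)
   show ?thesis unfolding e using r by (simp add: algebra_simps)
  qed simp
 qed
 also have "... = (LINT r|lborel. M * \<psi> r) - (LINT r|lborel. r * \<psi> r)"
 proof (intro lint_diff integrable_mult_right psi_integrable)
  show "integrable lborel (\<lambda>r. r * \<psi> r)"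
  proof (rule bounded_interval_integrable[where c = "M * K" and a = 0 and b = M])
   show "\<bar>s * \<psi> s\<bar> <= M * K" for s
    using psi_bound[of s] psi_support[of s] M K_nonneg by (cases "s \<in> {0..M}") (auto simp: abs_mult intro!: mult_mono)
  qed (auto simp: psi_support)
 qed
 also have "... = 0" using assms psi_zero by simp
 finally show ?thesis .
qed

section \<open>Reduction of both observation schemes to one model\<close>

lemma regular_tail_mark_tail:
 assumes "prob_space \<nu>" "sets \<nu> = sets borel" "integrable \<nu> (\<lambda>z. \<bar>snd z\<bar> ^ p)"
  and L: "slowly_varying L" "\<And>s. 0 < s ==> 0 < L s" "\<And>s. 0 < s ==> mark_tail \<nu> p s = L s * s powr (- \<alpha>)"
 shows "regular_tail \<alpha> (mark_tail \<nu> p)"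
 unfolding regular_tail_def
proof (intro conjI allI impI)
 have [measurable_cong]: "sets \<nu> = sets (borel \<Otimes>\<^sub>M borel)" using assms(2) by (simp only: borel_prod)
 have int: "integrable \<nu> (\<lambda>z. \<bar>snd z\<bar> ^ p * indicator {t<..} (fst z))" for t
  by (rule integrable_boundedI[OF assms(3)]) (measurable, auto simp: indicator_def)
 show mono: "mark_tail \<nu> p y <= mark_tail \<nu> p x" if "0 <= x" "x <= y" for x y
  unfolding mark_tail_def using that by (intro integral_mono int) (auto simp: indicator_def)
 have pos: "0 < mark_tail \<nu> p x" if "0 < x" for x using L(2,3)[OF that] that by simp
 \<comment> \<open>The representation by L is given for positive arguments; monotonicity carries
   positivity to 0.\<close>
 show "0 < mark_tail \<nu> p x" if "0 <= x" for x
  using pos[of "x + 1"] mono[of x "x + 1"] that by simp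
 fix c :: real assume c: "0 < c"
 have "((\<lambda>x. L (c * x) / L x * c powr - \<alpha>) \<longlongrightarrow> 1 * c powr - \<alpha>) at_top"
  using L(1) c unfolding slowly_varying_def by (intro tendsto_mult tendsto_const) auto
 moreover have "\<forall>\<^sub>F x in at_top. L (c * x) / L x * c powr - \<alpha> = mark_tail \<nu> p (c * x) / mark_tail \<nu> p x"
  using eventually_gt_at_top[of 0]
 proof eventually_elim
  case (elim x)
  have "(c * x) powr - \<alpha> = c powr - \<alpha> * x powr - \<alpha>" using c elim by (simp add: powr_mult)
  moreover have "x powr - \<alpha> \<noteq> 0" using elim by simp
  ultimately show ?case using c elim by (simp add: L(3))
 qed
 ultimately show "((\<lambda>x. mark_tail \<nu> p (c * x) / mark_tail \<nu> p x) \<longlongrightarrow> c powr - \<alpha>) at_top"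
  by (subst tendsto_cong[OF eventually_mono]) (auto elim: eventually_mono simp: eq_commute)
qed

lemma (in marked_points) AE_durations_pos: "AE w in P. \<forall>l. 0 < \<eta> l w"
proof (subst AE_all_countable, rule allI)
 fix l
 have "AE z in \<nu>. 0 < fst z" using iid unfolding iid_marked_poisson_def by auto
 hence "AE z in distr P borel (\<lambda>w. (\<eta> l w, U l w)). 0 < fst z" unfolding mark_law .
 thus "AE w in P. 0 < \<eta> l w"
  by (subst (asm) AE_distr_iff[OF marks_measurable]) (auto simp flip: borel_prod)
qed

lemma (in marked_points) AE_infinite_source:
 "AE w in P. \<forall>R n s. w \<in> occupied R n --> s < R -->
   infinite_source t \<eta> U w s = (\<Sum>l<n. U (int l) w * indicator {t (int l) w..<t (int l) w + \<eta> (int l) w} s)"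
 using AE_points_ordered
proof eventually_elim
 case (elim w)
 show ?case
 proof (intro allI impI)
  fix R s :: real and n assume o: "w \<in> occupied R n" and s: "s < R"
  show "infinite_source t \<eta> U w s = (\<Sum>l<n. U (int l) w * indicator {t (int l) w..<t (int l) w + \<eta> (int l) w} s)"
   unfolding infinite_source_def
  proof (rule suminf_finite)
   fix l assume "l \<notin> {..<n}"
   hence "t (int n) w <= t (int l) w" using elim by (cases "l = n") (auto intro!: less_imp_le)
   hence "s < t (int l) w" using o s unfolding occupied_def by auto
   thus "U (int l) w * indicator {t (int l) w..<t (int l) w + \<eta> (int l) w} s = 0" by simp
  qed simp
 qed
qed

lemma (in sampled_wavelet) AE_wavelet_coeff:
 assumes "marked_points P \<nu> t \<eta> U"
 shows "AE w in P. \<forall>R n j k. w \<in> marked_points.occupied P t R n --> 2 ^ j * (real k + 2 * M) <= R -->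
   wavelet_coeff obs \<psi> \<phi> (infinite_source t \<eta> U w) j (int k) =
    (\<Sum>l<n. U (int l) w * (coeff_kernel obs j k (t (int l) w + \<eta> (int l) w) - coeff_kernel obs j k (t (int l) w)))"
proof -
 interpret marked_points P \<nu> t \<eta> U by fact
 show ?thesis
  using AE_infinite_source AE_durations_pos
 proof eventually_elim
  case (elim w)
  show ?case
  proof (intro allI impI)
   fix R :: real and n j k assume o: "w \<in> occupied R n" and R: "2 ^ j * (real k + 2 * M) <= R"
   show "wavelet_coeff obs \<psi> \<phi> (infinite_source t \<eta> U w) j (int k) =
    (\<Sum>l<n. U (int l) w * (coeff_kernel obs j k (t (int l) w + \<eta> (int l) w) - coeff_kernel obs j k (t (int l) w)))"
   proof (rule wavelet_coeff_eq_kernel)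
    show "infinite_source t \<eta> U w s = (\<Sum>l<n. U (int l) w * indicator {t (int l) w..<t (int l) w + \<eta> (int l) w} s)"
     if "s < 2 ^ j * (real k + 2 * M)" for s
    proof -
     have "s < R" using that R by linarith
     thus ?thesis using elim(1) o by blast
    qed
   qed (use elim(2) in auto)
  qed
 qed
qed

text \<open>All that the statistical argument uses about the coefficients: an almost sure
  representation by sources, valid simultaneously for all windows [0, R) that contain the support of
  the kernel.\<close>

locale whittle_model = marked_points P \<nu> t \<eta> U + mk: wavelet_kernel \<nu> \<alpha> M K \<psi> \<Psi> A C1
 for P :: "'a measure" and \<nu> t \<eta> U \<alpha> M K \<psi> \<Psi> A C1 +
 fixes coeff :: "'a => nat => int => real"
 assumes AE_coeff: "AE \<omega> in P. \<forall>R n j k. \<omega> \<in> occupied R n --> 2 ^ j * (real k + A) <= R -->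
  coeff \<omega> j (int k) = (\<Sum>l<n. mk.atom j k (t (int l) \<omega>, \<eta> (int l) \<omega>, U (int l) \<omega>))"

text \<open>The assumptions (d) and (e) act through the last conclusion, the vanishing integral of
  the kernels, and through nothing else.\<close>

lemma whittle_model_exists:
 assumes mp: "marked_points P \<nu> t \<eta> U" and mom: "4 <= pstar" "integrable \<nu> (\<lambda>z. \<bar>snd z\<bar> ^ pstar)"
  and \<alpha>: "0 < \<alpha>" "\<alpha> < 2"
  and sv: "\<And>p. p <= pstar ==> slowly_varying (L p)" "\<And>p s. p <= pstar ==> 0 < s ==> 0 < L p s"
   "\<And>p s. p <= pstar ==> 0 < s ==> mark_tail \<nu> p s = L p s * s powr (- \<alpha>)"
  and M: "1 <= M" and psi: "admissible_wavelet M \<psi>" and phi: "admissible_interpolator M \<phi>"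
 obtains K \<psi>' \<Psi> C1 where
  "whittle_model P \<nu> t \<eta> U \<alpha> M K \<psi>' \<Psi> (2 * M) C1 (\<lambda>w. wavelet_coeff obs \<psi> \<phi> (infinite_source t \<eta> U w))"
  "(LINT s|lebesgue. s * \<psi> s) = 0 \<and> (\<exists>a b. \<forall>s. ((\<lambda>k::int. of_int k * \<phi> (s - of_int k)) has_sum (a + b * s)) UNIV)
    --> (\<forall>j k. (LINT s|lborel. \<Psi> j k s) = 0)"
proof -
 interpret mp: marked_points P \<nu> t \<eta> U by fact
 interpret nu: prob_space \<nu> by (rule mp.prob_space_marks)
 have sets_nu: "sets \<nu> = sets borel" by simp
 have [measurable_cong]: "sets \<nu> = sets (borel \<Otimes>\<^sub>M borel)" using sets_nu by (simp only: borel_prod)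
 have momp: "integrable \<nu> (\<lambda>z. \<bar>snd z\<bar> ^ p)" if "p <= pstar" for p
 proof (rule integrable_boundedI[where f = "\<lambda>z. 1 + \<bar>snd z\<bar> ^ pstar"])
  show "AE z in \<nu>. norm (\<bar>snd z\<bar> ^ p) <= norm (1 + \<bar>snd z\<bar> ^ pstar)"
  proof (rule AE_I2)
   fix z :: "real \<times> real"
   have "\<bar>snd z\<bar> ^ p <= 1 + \<bar>snd z\<bar> ^ pstar"
   proof (cases "\<bar>snd z\<bar> <= 1")
    case True
    thus ?thesis using power_le_one[of "\<bar>snd z\<bar>" p] by (simp add: add_increasing2)
   next
    case False
    hence "\<bar>snd z\<bar> ^ p <= \<bar>snd z\<bar> ^ pstar" using that by (intro power_increasing) auto
    thus ?thesis by simp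
   qed
   thus "norm (\<bar>snd z\<bar> ^ p) <= norm (1 + \<bar>snd z\<bar> ^ pstar)" by simp
  qed
 qed (use mom(2) in \<open>auto simp: nu.emeasure_space_1\<close>)
 have tail: "regular_tail \<alpha> (mark_tail \<nu> p)" if "p <= pstar" for p
  by (rule regular_tail_mark_tail[OF nu.prob_space_axioms sets_nu momp sv]) (use that in auto)
 have "AE z in \<nu>. 0 < fst z" using mp.iid unfolding iid_marked_poisson_def by auto
 hence ml: "mark_law \<nu> \<alpha>"
  using sets_nu momp[OF mom(1)] \<alpha> tail mom(1) nu.prob_space_axioms
  by (auto simp: mark_law_def mark_law_axioms_def)
 from psi have pm: "\<psi> \<in> borel_measurable lebesgue" and pb: "bounded (range \<psi>)"
  and pn: "\<not> (AE s in lebesgue. \<psi> s = 0)" and ps: "\<And>s. s \<notin> {0..M} ==> \<psi> s = 0"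
  and pz: "(LINT s:{0..M}|lebesgue. \<psi> s) = 0" unfolding admissible_wavelet_def by auto
 obtain K where K: "\<And>s. \<bar>\<psi> s\<bar> <= K" using pb unfolding bounded_iff by auto
 have K0: "0 <= K" using K[of 0] by linarith
 from phi obtain L' where L': "\<And>s. \<bar>\<phi> s\<bar> <= L'" unfolding admissible_interpolator_def bounded_iff by auto
 have pz': "(LINT s|lebesgue. \<psi> s) = 0"
 proof -
  have "(LINT s|lebesgue. \<psi> s) = (LINT s:{0..M}|lebesgue. \<psi> s)"
   unfolding set_lebesgue_integral_def
  proof (rule lint_cong[OF refl])
   fix s
   show "\<psi> s = indicator {0..M} s *\<^sub>R \<psi> s" using ps[of s] by (cases "s \<in> {0..M}") auto
  qed
  thus ?thesis using pz by simp
 qed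
 interpret sw: sampled_wavelet M K L' \<psi> \<phi>
  using M pm K ps pz' phi L' unfolding admissible_interpolator_def by unfold_locales auto
 obtain \<psi>0 where p0: "\<psi>0 \<in> borel_measurable lborel" "AE s in lborel. \<psi> s = \<psi>0 s"
  using completion_ex_borel_measurable_real[OF pm] by auto
 \<comment> \<open>Clipping to [-K, K] and cutting to [0, M] makes the bound and the support
   condition hold everywhere, while the result still agrees with \<psi> almost everywhere.\<close>
 define \<psi>' where "\<psi>' s = (if s \<in> {0..M} then max (- K) (min K (\<psi>0 s)) else 0)" for s
 have [measurable]: "\<psi>0 \<in> borel_measurable borel" using p0(1) by simp
 have p'm [measurable]: "\<psi>' \<in> borel_measurable borel" unfolding \<psi>'_def by measurable
 have ae: "AE s in lborel. \<psi>' s = \<psi> s"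
  using p0(2)
 proof eventually_elim
  case (elim s)
  show ?case using K[of s] ps[of s] elim unfolding \<psi>'_def by (auto simp: abs_le_iff min_def max_def)
 qed
 have int_eq: "(LINT s|lborel. \<psi>' s * g s) = (LINT s|lebesgue. \<psi> s * g s)" if [measurable]: "g \<in> borel_measurable borel" for g
 proof -
  have "(LINT s|lborel. \<psi>' s * g s) = (LINT s|lebesgue. \<psi>' s * g s)" by (subst integral_completion) auto
  also have "... = (LINT s|lebesgue. \<psi> s * g s)"
  proof (rule integral_cong_AE)
   show "(\<lambda>s. \<psi>' s * g s) \<in> borel_measurable lebesgue" by (rule borel_measurable_lebesgueI) measurable
   show "(\<lambda>s. \<psi> s * g s) \<in> borel_measurable lebesgue" by (intro borel_measurable_times pm borel_measurable_lebesgueI that)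
   show "AE s in lebesgue. \<psi>' s * g s = \<psi> s * g s" by (rule AE_completion) (use ae in eventually_elim, simp)
  qed
  finally show ?thesis .
 qed
 interpret wp: wavelet_primitive M K \<psi>'
 proof
  show "\<bar>\<psi>' s\<bar> <= K" for s unfolding \<psi>'_def using K0 by auto
  show "\<psi>' s = 0" if "s \<notin> {0..M}" for s unfolding \<psi>'_def using that by auto
  show "(LINT s|lborel. \<psi>' s) = 0" using int_eq[of "\<lambda>_. 1"] pz' by simp
  show "\<not> (AE s in lborel. \<psi>' s = 0)"
  proof
   assume "AE s in lborel. \<psi>' s = 0"
   hence "AE s in lborel. \<psi> s = 0" using ae by eventually_elim simp
   thus False using pn AE_completion by blast
  qed
 qed (use M in simp_all)
 \<comment> \<open>By substitution the continuous-time kernel is exactly the rescaled primitive, so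
   its approximation error is 0.\<close>
 have cont: "sw.coeff_kernel Continuous_Time j k x = sqrt (2 ^ j) * wp.prim (x / 2 ^ j - real k)" for j k x
 proof -
  have "(LINT s|lebesgue. wavelet \<psi> j (int k) s * indicator {..<x} s)
    = (LINT s|lebesgue. wavelet \<psi> j (int k) s * indicator {..<x / 2 ^ j - real k} (- real k + (1 / 2 ^ j) * s))"
   by (intro lint_cong refl) (auto simp: indicator_def field_simps)
  also have "... = sqrt (2 ^ j) * (LINT s|lebesgue. \<psi> s * indicator {..<x / 2 ^ j - real k} s)" by (rule sw.wavelet_integral)
  also have "(LINT s|lebesgue. \<psi> s * indicator {..<x / 2 ^ j - real k} s) = wp.prim (x / 2 ^ j - real k)"
   unfolding wp.prim_def by (rule int_eq[symmetric]) simp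
  finally show ?thesis by simp
 qed
 have weng: "wavelet_energy \<nu> \<alpha> M K \<psi>'"
  using ml wp.wavelet_primitive_axioms by (simp add: wavelet_energy_def)
 have wk: "wavelet_kernel \<nu> \<alpha> M K \<psi>' (sw.coeff_kernel obs) (2 * M) sw.discrepancy_const"
 proof (intro wavelet_kernel.intro weng wavelet_kernel_axioms.intro)
  show "sw.coeff_kernel obs j k \<in> borel_measurable borel" for j k
  proof (cases obs)
   case Continuous_Time
   have "sw.coeff_kernel Continuous_Time j k = (\<lambda>x. sqrt (2 ^ j) * wp.prim (x / 2 ^ j - real k))" by (rule ext) (rule cont)
   thus ?thesis unfolding Continuous_Time by simp
  qed (simp add: sw.coeff_kernel_measurable_discrete del: sw.coeff_kernel.simps)
  show "M <= 2 * M" using M by simp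
  show "0 <= sw.discrepancy_const" by (rule sw.discrepancy_const_nonneg)
  show "2 ^ j * real k - 1 <= s \<and> s <= 2 ^ j * (real k + 2 * M)" if nz: "sw.coeff_kernel obs j k s \<noteq> 0" for j k s
  proof (cases obs)
   case Continuous_Time
   have "wp.prim (s / 2 ^ j - real k) \<noteq> 0" using nz unfolding Continuous_Time cont by simp
   hence "\<not> (s / 2 ^ j - real k <= 0 \<or> M <= s / 2 ^ j - real k)" using wp.prim_eq_0 by blast
   hence "2 ^ j * real k < s" "s < 2 ^ j * (real k + M)" by (auto simp: not_le field_simps)
   moreover have "2 ^ j * (real k + M) <= 2 ^ j * (real k + 2 * M)" using M by simp
   ultimately show ?thesis by linarith
  next
   case Discrete_Time
   show ?thesis using sw.discrete_kernel_support[of j k s] nz unfolding Discrete_Time by linarith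
  qed
  show "\<bar>sw.coeff_kernel obs j k s - sqrt (2 ^ j) * wp.prim (s / 2 ^ j - real k)\<bar> <= sw.discrepancy_const / sqrt (2 ^ j)" for j k s
  proof (cases obs)
   case Continuous_Time
   show ?thesis unfolding Continuous_Time cont using sw.discrepancy_const_nonneg by simp
  next
   case Discrete_Time
   show ?thesis unfolding Discrete_Time cont[symmetric] by (rule sw.discrete_kernel_approx)
  qed
 qed
 show ?thesis
 proof (rule that)
  show "whittle_model P \<nu> t \<eta> U \<alpha> M K \<psi>' (sw.coeff_kernel obs) (2 * M) sw.discrepancy_const (\<lambda>w. wavelet_coeff obs \<psi> \<phi> (infinite_source t \<eta> U w))"
  proof (intro whittle_model.intro mp wk whittle_model_axioms.intro)
   show "AE w in P. \<forall>R n j k. w \<in> mp.occupied R n --> 2 ^ j * (real k + 2 * M) <= R -->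
    wavelet_coeff obs \<psi> \<phi> (infinite_source t \<eta> U w) j (int k) =
    (\<Sum>l<n. wavelet_kernel.atom (sw.coeff_kernel obs) j k (t (int l) w, \<eta> (int l) w, U (int l) w))"
    using sw.AE_wavelet_coeff[OF mp, of obs] unfolding wavelet_kernel.atom_def[OF wk] by simp
  qed
  show "(LINT s|lebesgue. s * \<psi> s) = 0 \<and> (\<exists>a b. \<forall>s. ((\<lambda>k::int. of_int k * \<phi> (s - of_int k)) has_sum (a + b * s)) UNIV)
    --> (\<forall>j k. (LINT s|lborel. sw.coeff_kernel obs j k s) = 0)"
  proof (intro impI allI, elim conjE exE)
   fix j k a b
   assume m1: "(LINT s|lebesgue. s * \<psi> s) = 0"
    and "\<forall>s. ((\<lambda>k::int. of_int k * \<phi> (s - of_int k)) has_sum (a + b * s)) UNIV"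
   hence lin: "((\<lambda>k::int. of_int k * \<phi> (s - of_int k)) has_sum (a + b * s)) UNIV" for s by blast
   show "(LINT s|lborel. sw.coeff_kernel obs j k s) = 0"
   proof (cases obs)
    case Continuous_Time
    have "(LINT s|lborel. s * \<psi>' s) = 0" using int_eq[of "\<lambda>s. s"] m1 by (simp add: mult.commute)
    hence "(LINT s|lborel. wp.prim s) = 0" by (rule wp.prim_integral_zero)
    hence "(LINT s|lborel. wp.prim (- real k + (1 / 2 ^ j) * s)) = 0"
     by (subst (asm) lborel_integral_real_affine[where c = "1 / 2 ^ j" and t = "- real k"]) auto
    thus ?thesis unfolding Continuous_Time cont by simp
   next
    case Discrete_Time
    show ?thesis unfolding Discrete_Time by (rule sw.discrete_kernel_integral[OF m1 lin])
   qed
  qed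
 qed
qed

section \<open>Concentration of the scale energies and consistency\<close>

lemma PiM_components_indep:
 assumes Q: "prob_space Q" and n: "0 < n"
 shows "prob_space.indep_vars (PiM {..<n::nat} (\<lambda>_. Q)) (\<lambda>_. Q) (\<lambda>i z. z i) {..<n}"
proof -
 interpret P: prob_space "PiM {..<n} (\<lambda>_. Q)" by (intro prob_space_PiM Q)
 have "distr (PiM {..<n} (\<lambda>_. Q)) (PiM {..<n} (\<lambda>_. Q)) (\<lambda>z. \<lambda>i\<in>{..<n}. z i) = distr (PiM {..<n} (\<lambda>_. Q)) (PiM {..<n} (\<lambda>_. Q)) (\<lambda>z. z)"
  by (intro distr_cong refl) (simp add: space_PiM)
 also have "... = PiM {..<n} (\<lambda>i. distr (PiM {..<n} (\<lambda>_. Q)) Q (\<lambda>z. z i))"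
  unfolding distr_id2[OF refl] by (intro PiM_cong refl distr_PiM_component[symmetric] Q)
 finally show ?thesis
  using n by (subst P.indep_vars_iff_distr_eq_PiM') auto
qed

context wavelet_kernel begin

definition sample_energy :: "nat => nat => (nat => real \<times> real \<times> real) => nat => real" where
 "sample_energy J n z j = (\<Sum>k<2 ^ (J - j). (\<Sum>i<n. atom j k (z i))^2)"

lemma sample_energy_nonneg: "0 <= sample_energy J n z j"
 unfolding sample_energy_def by (intro sum_nonneg) auto

text \<open>\<open>energy_concentration\<close> for the coordinate variables; division by R converts
  \<open>kappa\<close> and \<open>bias\<close> into moments of a single source.\<close>

lemma sample_energy_concentration:
 fixes J j n :: nat and R \<kappa> :: real
 assumes R: "0 < R" and n: "0 < n" and \<kappa>: "\<And>k. kappa R j k <= R * \<kappa>" "0 <= \<kappa>"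
 defines "PM \<equiv> PiM {..<n} (\<lambda>_. sample_space R \<nu>)"
  and "s \<equiv> real n / R * (\<Sum>k<2 ^ (J - j). kappa R j k)"
  and "D \<equiv> (real n / R)^2 * (\<Sum>k<2 ^ (J - j). (bias R j k)^2)"
 shows "integrable PM (\<lambda>z. sample_energy J n z j)"
  and "(LINT z|PM. \<bar>sample_energy J n z j - s\<bar>) <=
   sqrt (16 * real n * (LINT z|sample_space R \<nu>. env j z ^ 4) + 4 * (real n)^2 * \<kappa> * (LINT z|sample_space R \<nu>. (env j z)^2))
    + 2 * D + 2 * sqrt (D * s)"
  and "(LINT z|PM. sample_energy J n z j) <= s + D"
proof -
 let ?Q = "sample_space R \<nu>"
 have Q: "prob_space ?Q" by (rule sample_space_prob[OF R])
 interpret P: prob_space PM unfolding PM_def by (intro prob_space_PiM Q)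
 have mQ: "borel_measurable ?Q = borel_measurable (borel \<Otimes>\<^sub>M (borel \<Otimes>\<^sub>M borel))"
  by (rule measurable_cong_sets[OF sets_sample_space refl])
 have law: "distr PM ?Q (\<lambda>z. z i) = ?Q" if "i < n" for i
  unfolding PM_def using that by (intro distr_PiM_component Q) auto
 have k: "(LINT z|?Q. (atom j k z)^2) <= \<kappa>" for k using \<kappa>(1)[of k] R unfolding kappa_def by simp
 have s: "real n * (\<Sum>k<2 ^ (J - j). (LINT z|?Q. (atom j k z)^2)) = s"
  unfolding s_def kappa_def using R by (simp add: sum_distrib_left)
 have D: "(\<Sum>k<2 ^ (J - j). (real n * (LINT z|?Q. atom j k z))^2) = D"
  unfolding D_def bias_def using R by (simp add: sum_distrib_left power_mult_distrib power_divide)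
 note C = P.energy_concentration[of ?Q "\<lambda>i z. z i" n ?Q "{..<2 ^ (J - j)}" "\<lambda>k. atom j k" "env j" \<kappa>,
   OF PiM_components_indep[OF Q n, folded PM_def] law Q refl finite_lessThan _ _ sum_atom_le_env env_integrable(1)[OF R] k \<kappa>(2),
   unfolded mQ s D, folded sample_energy_def, OF _ atom_measurable env_measurable]
 show "integrable PM (\<lambda>z. sample_energy J n z j)" by (rule C(1)) auto
 show "(LINT z|PM. \<bar>sample_energy J n z j - s\<bar>) <=
   sqrt (16 * real n * (LINT z|sample_space R \<nu>. env j z ^ 4) + 4 * (real n)^2 * \<kappa> * (LINT z|sample_space R \<nu>. (env j z)^2))
    + 2 * D + 2 * sqrt (D * s)" by (rule C(2)) auto
 show "(LINT z|PM. sample_energy J n z j) <= s + D" by (rule C(3)) auto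
qed

lemma kappa_nonneg: "0 < R ==> 0 <= kappa R j k"
 unfolding kappa_def by simp

text \<open>Relative to the size g of a level energy, the variance splits into x^\<alpha> / X from
  fourth moments and x / X from covariances, and the squared means are of order b. The 3 d in the
  exponents collects losses: fourth moments lose d and the square of the lower bound on q loses 2 d;
  the squared means lose 2 d and the lower bound on q loses d.\<close>

lemma scale_concentration:
 assumes d: "0 < d" "d < \<alpha>" and alt: "1 <= \<alpha> - d \<or> (\<forall>j k. (LINT s|lborel. \<Psi> j k s) = 0)"
 obtains a j1 where "0 < a"
  "\<And>J j n R g b. j1 <= j ==> j <= J ==> R = 2 ^ J * (1 + A) ==> \<bar>real n - R\<bar> <= R / 2 ==>
    g = 2 ^ (J - j) * q j ==> b = (2 ^ j) powr (2 - \<alpha> + 3 * d) / 2 ^ J ==>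
    integrable (PiM {..<n} (\<lambda>_. sample_space R \<nu>)) (\<lambda>z. sample_energy J n z j) \<and>
    (LINT z|PiM {..<n} (\<lambda>_. sample_space R \<nu>). \<bar>sample_energy J n z j - real n / R * (\<Sum>k<2 ^ (J - j). kappa R j k)\<bar>)
     <= a * g * (sqrt ((2 ^ j) powr (\<alpha> + 3 * d) / 2 ^ J + 2 ^ j / 2 ^ J) + b + sqrt b) \<and>
    (LINT z|PiM {..<n} (\<lambda>_. sample_space R \<nu>). sample_energy J n z j) <= a * g * (1 + b)"
proof -
 obtain C0 C j1 where C: "0 < C" and kap: "\<And>R j k. j1 <= j ==> 0 < R ==> kappa R j k <= C * q j"
  by (rule second_moment_asymptotics) blast
 obtain C2 j2 where C2: "0 < C2" and e2: "\<And>j R. j2 <= j ==> 0 < R ==> (LINT z|sample_space R \<nu>. (env j z)^2) <= C2 * 2 ^ j * mark_tail \<nu> 2 (2 ^ j)"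
  by (rule env2_bound) blast
 obtain C4 where C4: "0 < C4" and e4: "\<And>j R. 0 < R ==> (LINT z|sample_space R \<nu>. env j z ^ 4) <= C4 * (2 ^ j) powr (2 - \<alpha> + d)"
  by (rule env4_bound[of d]) (use d in auto)
 obtain Db where Db: "0 < Db" and bb: "\<And>R j n. 1 <= j ==> 0 < R ==> 2 ^ j * (real n + A) <= R ==>
   (\<Sum>k<n. (bias R j k)^2) <= Db * (2 ^ j) powr (3 - 2 * \<alpha> + 2 * d)"
  by (rule bias_bound[OF d alt]) blast
 obtain c where c: "0 < c" and ql: "\<And>j. c * (2 ^ j) powr (2 - \<alpha> - d) <= q j" by (rule q_lower[OF d(1)]) blast
 \<comment> \<open>G collects the constants of the variance bound and G2 those of the squared means;
   a is then chosen to dominate every coefficient that occurs below.\<close>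
 define G where "G = 32 * (1 + A) * C4 / c^2 + 16 * (1 + A) * C * C2"
 define G2 where "G2 = 4 * Db / c"
 have G: "0 < G" "0 < G2" unfolding G_def G2_def using C C2 C4 c Db A_ge_1 by (auto intro!: add_pos_pos mult_pos_pos)
 define a where "a = sqrt G + 2 * G2 + 2 * sqrt (2 * C * G2) + 2 * C"
 have a: "0 < a" "sqrt G <= a" "2 * G2 <= a" "2 * sqrt (2 * C * G2) <= a" "2 * C <= a" "G2 <= a"
  unfolding a_def using G C by (auto intro: add_nonneg_pos)
 show ?thesis
 proof (rule that[OF a(1), of "Max {1, j1, j2}"])
  fix J j n :: nat and R g b :: real
  assume j: "Max {1, j1, j2} <= j" and jJ: "j <= J" and R: "R = 2 ^ J * (1 + A)" and n: "\<bar>real n - R\<bar> <= R / 2"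
   and g: "g = 2 ^ (J - j) * q j" and b: "b = (2 ^ j) powr (2 - \<alpha> + 3 * d) / 2 ^ J"
  define PM where "PM = PiM {..<n} (\<lambda>_. sample_space R \<nu>)"
  define X x :: real where "X = 2 ^ J" and "x = 2 ^ j"
  have x: "1 <= x" "0 < X" "x <= X" unfolding X_def x_def using jJ by (auto intro: power_increasing)
  have nj: "(2::real) ^ (J - j) = X / x" unfolding X_def x_def using jJ by (simp add: power_diff)
  have jj: "1 <= j" "j1 <= j" "j2 <= j" using j by auto
  have R0: "0 < R" unfolding R using A_ge_1 by (intro mult_pos_pos) auto
  have "0 < real n" using n R0 by linarith
  moreover have "real n <= 2 * R" using n R0 by linarith
  ultimately have n0: "0 < n" "real n <= 2 * R" by auto
  have q0: "0 < q j" by (rule q_pos)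
  have gx: "g = X / x * q j" and g0: "0 < g" unfolding g nj using x q0 by auto
  have bx: "b = x powr (2 - \<alpha> + 3 * d) / X" unfolding b x_def X_def ..
  have b0: "0 < b" unfolding bx using x by simp
  define s where "s = real n / R * (\<Sum>k<2 ^ (J - j). kappa R j k)"
  define D where "D = (real n / R)^2 * (\<Sum>k<2 ^ (J - j). (bias R j k)^2)"
  define V where "V = 16 * real n * (LINT z|sample_space R \<nu>. env j z ^ 4) + 4 * (real n)^2 * (C * q j / R) * (LINT z|sample_space R \<nu>. (env j z)^2)"
  define v where "v = x powr (\<alpha> + 3 * d) / X + x / X"
  have k: "kappa R j k <= R * (C * q j / R)" for k using kap[OF jj(2) R0, of k] R0 by simp
  have k0: "0 <= C * q j / R" using C q0 R0 by simp
  note conc = sample_energy_concentration[OF R0 n0(1) k k0, of J, folded PM_def s_def D_def V_def]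
  have nR: "real n / R <= 2" "0 <= real n / R" using n0 R0 by (auto simp: field_simps)
  \<comment> \<open>The value R = 2^J (1 + A) is chosen so that the support windows of all
    coefficients up to level J fit into [0, R].\<close>
  have fit: "2 ^ j * (real (2 ^ (J - j)) + A) <= R"
  proof -
   have "2 ^ j * (real (2 ^ (J - j)) + A) = X + x * A" using x nj unfolding x_def by (simp add: field_simps)
   also have "... <= R" unfolding R X_def[symmetric] using x A_ge_1 mult_right_mono[of x X A] by (simp add: distrib_left)
   finally show ?thesis .
  qed
  have sb: "s <= 2 * C * g" "0 <= s"
  proof -
   have "(\<Sum>k<2 ^ (J - j). kappa R j k) <= (\<Sum>k<(2::nat) ^ (J - j). C * q j)" by (intro sum_mono kap jj R0)
   also have "... = C * g" unfolding g by simp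
   finally have "s <= 2 * (C * g)" unfolding s_def using nR kappa_nonneg[OF R0] by (intro mult_mono) (auto intro!: sum_nonneg)
   thus "s <= 2 * C * g" by simp
   show "0 <= s" unfolding s_def by (intro mult_nonneg_nonneg nR sum_nonneg kappa_nonneg R0)
  qed
  have Dbd: "D <= G2 * g * b" "0 <= D"
  proof -
   have "(real n / R)^2 <= 2^2" using nR by (intro power_mono)
   hence "D <= 2^2 * (Db * x powr (3 - 2 * \<alpha> + 2 * d))"
    unfolding D_def x_def using Db by (intro mult_mono bb[OF jj(1) R0 fit]) (auto intro!: sum_nonneg)
   also have "... = G2 * ((c * x powr (2 - \<alpha> - d)) / x * x powr (2 - \<alpha> + 3 * d))"
   proof -
    have "x powr (3 - 2 * \<alpha> + 2 * d) = x powr (2 - \<alpha> - d) / x powr 1 * x powr (2 - \<alpha> + 3 * d)"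
     unfolding powr_diff[symmetric] powr_add[symmetric] by (rule arg_cong[where f = "\<lambda>e. x powr e"]) simp
    thus ?thesis unfolding G2_def using c x by simp
   qed
   also have "... <= G2 * (q j / x * x powr (2 - \<alpha> + 3 * d))"
    using G x ql[of j] unfolding x_def[symmetric] by (intro mult_left_mono mult_right_mono divide_right_mono) auto
   also have "... = G2 * g * b" unfolding gx bx using x by simp
   finally show "D <= G2 * g * b" .
   show "0 <= D" unfolding D_def by (auto intro!: mult_nonneg_nonneg sum_nonneg)
  qed
  have Vb: "V <= g^2 * (G * v)"
  proof -
   have "16 * real n * (LINT z|sample_space R \<nu>. env j z ^ 4) <= 16 * (2 * R) * (C4 * x powr (2 - \<alpha> + d))"
    unfolding x_def using n0 R0 C4 by (intro mult_mono e4) auto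
   also have "... = 32 * (1 + A) * C4 / c^2 * (X * (c * x powr (2 - \<alpha> - d))^2 / x^2 * x powr (\<alpha> + 3 * d))"
   proof -
    have "x powr (2 - \<alpha> + d) = x powr ((2 - \<alpha> - d) + (2 - \<alpha> - d) - 2 + (\<alpha> + 3 * d))" by (simp add: algebra_simps)
    also have "... = x powr (2 - \<alpha> - d) * x powr (2 - \<alpha> - d) / x powr 2 * x powr (\<alpha> + 3 * d)"
     by (simp only: powr_add powr_diff)
    also have "... = (x powr (2 - \<alpha> - d))^2 / x^2 * x powr (\<alpha> + 3 * d)" using x by (simp add: power2_eq_square powr_numeral)
    finally have e: "x powr (2 - \<alpha> + d) = (x powr (2 - \<alpha> - d))^2 / x^2 * x powr (\<alpha> + 3 * d)" .
    show ?thesis unfolding e R X_def[symmetric] using c by (simp add: power_mult_distrib)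
   qed
   also have "... <= 32 * (1 + A) * C4 / c^2 * (X * (q j)^2 / x^2 * x powr (\<alpha> + 3 * d))"
    using x c C4 A_ge_1 ql[of j] unfolding x_def[symmetric]
    by (intro mult_left_mono mult_right_mono divide_right_mono power_mono) auto
   also have "... = g^2 * (32 * (1 + A) * C4 / c^2 * (x powr (\<alpha> + 3 * d) / X))"
    unfolding gx using x by (simp add: power2_eq_square mult_ac)
   finally have 1: "16 * real n * (LINT z|sample_space R \<nu>. env j z ^ 4) <= g^2 * (32 * (1 + A) * C4 / c^2 * (x powr (\<alpha> + 3 * d) / X))" .
   have "(LINT z|sample_space R \<nu>. (env j z)^2) <= C2 * (q j / x)"
    using e2[OF jj(3) R0] x unfolding q_def x_def[symmetric] by (simp add: power2_eq_square)
   moreover have "(real n)^2 <= (2 * R)^2" using n0 by (intro power_mono) auto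
   ultimately have "4 * (real n)^2 * (C * q j / R) * (LINT z|sample_space R \<nu>. (env j z)^2) <= 4 * (2 * R)^2 * (C * q j / R) * (C2 * (q j / x))"
    using k0 C2 q0 x R0 C by (intro mult_mono) auto
   also have "... = g^2 * (16 * (1 + A) * C * C2 * (x / X))"
    using R0 x unfolding gx by (simp add: power2_eq_square) (simp add: R X_def[symmetric])
   finally have 2: "4 * (real n)^2 * (C * q j / R) * (LINT z|sample_space R \<nu>. (env j z)^2) <= g^2 * (16 * (1 + A) * C * C2 * (x / X))" .
   have "V <= g^2 * (32 * (1 + A) * C4 / c^2 * (x powr (\<alpha> + 3 * d) / X) + 16 * (1 + A) * C * C2 * (x / X))"
    using add_mono[OF 1 2] unfolding V_def by (simp only: distrib_left[of "g^2"])
   also have "... <= g^2 * (G * v)"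
   proof (rule mult_left_mono)
    have p: "0 <= 32 * (1 + A) * C4 / c^2" "0 <= 16 * (1 + A) * C * C2" using A_ge_1 C C2 C4 by auto
    show "32 * (1 + A) * C4 / c^2 * (x powr (\<alpha> + 3 * d) / X) + 16 * (1 + A) * C * C2 * (x / X) <= G * v"
     unfolding v_def distrib_left using p x by (intro add_mono mult_right_mono) (auto simp: G_def)
   qed simp
   finally show ?thesis .
  qed
  have v0: "0 <= v" unfolding v_def using x by simp
  have "sqrt V <= g * (sqrt G * sqrt v)"
   using real_sqrt_le_mono[OF Vb] g0 by (simp add: real_sqrt_mult)
  moreover have "sqrt (D * s) <= g * (sqrt (2 * C * G2) * sqrt b)"
  proof -
   have "D * s <= (G2 * g * b) * (2 * C * g)" using Dbd sb G g0 b0 by (intro mult_mono) auto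
   also have "... = g^2 * (2 * C * G2 * b)" by (simp add: power2_eq_square)
   finally show ?thesis using real_sqrt_le_mono g0 by (fastforce simp: real_sqrt_mult)
  qed
  ultimately have "sqrt V + 2 * D + 2 * sqrt (D * s) <= g * (sqrt G * sqrt v) + 2 * (G2 * g * b) + 2 * (g * (sqrt (2 * C * G2) * sqrt b))"
   using Dbd by linarith
  also have "... = g * (sqrt G * sqrt v + 2 * G2 * b + 2 * sqrt (2 * C * G2) * sqrt b)" by (simp add: algebra_simps)
  also have "... <= g * (a * sqrt v + a * b + a * sqrt b)"
   using a b0 v0 g0 by (intro mult_left_mono add_mono mult_right_mono) auto
  also have "... = a * g * (sqrt v + b + sqrt b)" by (simp add: algebra_simps)
  finally have E1: "(LINT z|PM. \<bar>sample_energy J n z j - s\<bar>) <= a * g * (sqrt v + b + sqrt b)" using conc(2) by linarith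
  have "s + D <= a * g + a * g * b"
  proof (rule add_mono)
   show "s <= a * g" using sb(1) mult_right_mono[OF a(5), of g] g0 by linarith
   have "G2 * (g * b) <= a * (g * b)" using a g0 b0 by (intro mult_right_mono) auto
   thus "D <= a * g * b" using Dbd by (simp add: mult.assoc)
  qed
  hence "(LINT z|PM. sample_energy J n z j) <= a * g * (1 + b)" using conc(3) by (simp add: distrib_left)
  thus "integrable (PiM {..<n} (\<lambda>_. sample_space R \<nu>)) (\<lambda>z. sample_energy J n z j) \<and>
    (LINT z|PiM {..<n} (\<lambda>_. sample_space R \<nu>). \<bar>sample_energy J n z j - real n / R * (\<Sum>k<2 ^ (J - j). kappa R j k)\<bar>)
     <= a * g * (sqrt ((2 ^ j) powr (\<alpha> + 3 * d) / 2 ^ J + 2 ^ j / 2 ^ J) + b + sqrt b) \<and>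
    (LINT z|PiM {..<n} (\<lambda>_. sample_space R \<nu>). sample_energy J n z j) <= a * g * (1 + b)"
   using conc(1) E1 unfolding PM_def s_def v_def x_def X_def by blast
 qed
qed

end

text \<open>A single Markov inequality: either violation forces the sum of the deviations from the
  centres \<beta>, plus Y / 2, to be at least r / 2, since the centres are within r / 2 of
  1.\<close>

lemma (in prob_space) prob_far_or_large_le:
 fixes X :: "'i => 'a => real"
 assumes I: "finite I" "\<And>i. i \<in> I ==> integrable M (X i)" "\<And>i. i \<in> I ==> \<bar>\<beta> i - 1\<bar> <= r / 2"
  and X: "(\<Sum>i\<in>I. expectation (\<lambda>x. \<bar>X i x - \<beta> i\<bar>)) <= r * d / 4"
  and Y: "integrable M Y" "\<And>x. 0 <= Y x" "expectation Y <= r * d / 2" and r: "0 < r"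
 shows "prob {x\<in>space M. \<not> ((\<forall>i\<in>I. \<bar>X i x - 1\<bar> <= r) \<and> Y x <= r)} <= d"
proof -
 define Z where "Z x = (\<Sum>i\<in>I. \<bar>X i x - \<beta> i\<bar>) + Y x / 2" for x
 have iX: "integrable M (\<lambda>x. \<bar>X i x - \<beta> i\<bar>)" if "i \<in> I" for i using I(2)[OF that] by simp
 hence iS: "integrable M (\<lambda>x. \<Sum>i\<in>I. \<bar>X i x - \<beta> i\<bar>)" by (rule integrable_sumI)
 hence iZ: "integrable M Z" unfolding Z_def using Y(1) by simp
 have Z0: "0 <= Z x" for x unfolding Z_def using Y(2)[of x] by (simp add: sum_nonneg)
 have "expectation Z = (\<Sum>i\<in>I. expectation (\<lambda>x. \<bar>X i x - \<beta> i\<bar>)) + expectation Y / 2"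
  unfolding Z_def using iS Y(1) iX by (simp add: lint_sum)
 hence EZ: "expectation Z <= r * d / 2" using X Y(3) by simp
 have "prob {x\<in>space M. \<not> ((\<forall>i\<in>I. \<bar>X i x - 1\<bar> <= r) \<and> Y x <= r)} <= prob {x\<in>space M. r / 2 <= Z x}"
 proof (rule finite_measure_mono)
  show "{x\<in>space M. r / 2 <= Z x} \<in> sets M" using iZ by measurable
  show "{x\<in>space M. \<not> ((\<forall>i\<in>I. \<bar>X i x - 1\<bar> <= r) \<and> Y x <= r)} \<subseteq> {x\<in>space M. r / 2 <= Z x}"
  proof safe
   fix x i assume i: "i \<in> I" "\<not> \<bar>X i x - 1\<bar> <= r"
   have "\<bar>X i x - \<beta> i\<bar> <= (\<Sum>i\<in>I. \<bar>X i x - \<beta> i\<bar>)" by (rule member_le_sum) (use i I in auto)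
   thus "r / 2 <= Z x" unfolding Z_def using i(2) I(3)[OF i(1)] Y(2)[of x] by linarith
  next
   fix x assume "\<not> Y x <= r"
   moreover have "0 <= (\<Sum>i\<in>I. \<bar>X i x - \<beta> i\<bar>)" by (rule sum_nonneg) simp
   ultimately show "r / 2 <= Z x" unfolding Z_def by linarith
  qed
 qed
 also have "... <= expectation Z / (r / 2)"
  by (rule integral_Markov_inequality_measure[OF iZ sets.top]) (use Z0 r in auto)
 also have "... <= d" using EZ r by (simp add: field_simps)
 finally show ?thesis .
qed

section \<open>Regularity of the normalized level energies\<close>

lemma two_powr_mult_nat: "2 powr (e * real i) = (2 ^ i) powr e"
 by (simp add: powr_powr mult.commute flip: powr_realpow)

lemma near_one_mult:
 fixes x y :: real
 assumes "\<bar>x - 1\<bar> <= d" "\<bar>y - 1\<bar> <= e" "d <= 1"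
 shows "\<bar>x * y - 1\<bar> <= d + 2 * e"
proof -
 have "\<bar>x\<bar> * \<bar>y - 1\<bar> <= 2 * e" using assms by (intro mult_mono) auto
 moreover have "x * y - 1 = (x - 1) + x * (y - 1)" by (simp add: algebra_simps)
 ultimately show ?thesis using assms(1) by (simp add: abs_mult[symmetric])
qed

context wavelet_kernel begin

text \<open>With N = C0 2^(J - j0) q(j0) the limit is 2^(-i): the number of coefficients halves from
  level to level, and the power divides out the growth of q.\<close>

definition rel_level :: "real => nat => (nat => real) => nat => real" where
 "rel_level N j0 e i = e (j0 + i) * 2 powr (- (2 - \<alpha>) * real i) / N"

text \<open>The closeness hypotheses of \<open>whittle_argmin_near\<close>, as a property of the
  energies alone.\<close>

definition regular_levels :: "real => nat => nat => real => nat => (nat => real) => bool" where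
 "regular_levels \<rho> L m N j0 e \<longleftrightarrow>
   (\<forall>i\<in>{1..L}. \<bar>rel_level N j0 e i * 2 ^ i - 1\<bar> <= \<rho>) \<and> (\<Sum>i=Suc L..m. rel_level N j0 e i) <= \<rho>"

text \<open>Uniform in i, unlike \<open>q_ratio\<close>; for small e the factor 2^(e i) is
  outweighed by the decay 2^(-i) of the number of coefficients.\<close>

lemma q_growth:
 assumes "0 < e"
 obtains C j1 where "0 < C" "\<And>j i. j1 <= j ==> q (j + i) * 2 powr (- (2 - \<alpha>) * real i) <= C * 2 powr (e * real i) * q j"
proof -
 obtain C x0 where C: "1 <= C" and P: "\<And>x y. x0 <= y ==> y <= x ==> mark_tail \<nu> 2 x <= C * (x / y) powr (- \<alpha> + e) * mark_tail \<nu> 2 y"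
  by (rule regular_tail_Potter[OF tails(2) assms alpha(1)]) blast
 obtain j1 where j1: "x0 < 2 ^ j1" using real_arch_pow[of 2 x0] by auto
 show ?thesis
 proof (rule that[of C j1])
  fix j i assume j: "j1 <= j"
  have "(2::real) ^ j1 <= 2 ^ j" using j by (intro power_increasing) auto
  hence "x0 <= 2 ^ j" using j1 by linarith
  hence H: "mark_tail \<nu> 2 (2 ^ (j + i)) <= C * (2 ^ (j + i) / 2 ^ j) powr (- \<alpha> + e) * mark_tail \<nu> 2 (2 ^ j)"
   by (rule P) (auto intro: power_increasing)
  define z where "z = (2::real) ^ i"
  have z: "0 < z" unfolding z_def by simp
  have i: "(2::real) ^ (j + i) / 2 ^ j = z" unfolding z_def by (simp add: power_add)
  have "q (j + i) * z powr (- (2 - \<alpha>)) <= (2 ^ (j + i))^2 * (C * z powr (- \<alpha> + e) * mark_tail \<nu> 2 (2 ^ j)) * z powr (- (2 - \<alpha>))"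
   unfolding q_def using H unfolding i by (intro mult_right_mono mult_left_mono) auto
  also have "... = C * q j * (z powr 2 * z powr (- \<alpha> + e) * z powr (- (2 - \<alpha>)))"
   unfolding q_def power_add z_def[symmetric] power_mult_distrib using z by (simp add: mult_ac)
  also have "z powr 2 * z powr (- \<alpha> + e) * z powr (- (2 - \<alpha>)) = z powr e"
   unfolding powr_add[symmetric] by simp
  finally show "q (j + i) * 2 powr (- (2 - \<alpha>) * real i) <= C * 2 powr (e * real i) * q j"
   unfolding two_powr_mult_nat z_def by (simp add: mult_ac)
 qed (use C in simp)
qed

lemma q_ratio: "(\<lambda>j. q (j + i) * 2 powr (- (2 - \<alpha>) * real i) / q j) \<longlonglongrightarrow> 1"
proof -
 have "((\<lambda>x. mark_tail \<nu> 2 (2 ^ i * x) / mark_tail \<nu> 2 x) \<longlongrightarrow> (2 ^ i) powr - \<alpha>) at_top"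
  using tails(2) unfolding regular_tail_def by simp
 hence "(\<lambda>j. mark_tail \<nu> 2 (2 ^ i * 2 ^ j) / mark_tail \<nu> 2 (2 ^ j)) \<longlonglongrightarrow> (2 ^ i) powr - \<alpha>"
  by (rule filterlim_compose) (rule filterlim_realpow_at_top, simp)
 hence "(\<lambda>j. mark_tail \<nu> 2 (2 ^ i * 2 ^ j) / mark_tail \<nu> 2 (2 ^ j) * ((2 ^ i)^2 * 2 powr (- (2 - \<alpha>) * real i)))
   \<longlonglongrightarrow> (2 ^ i) powr - \<alpha> * ((2 ^ i)^2 * 2 powr (- (2 - \<alpha>) * real i))" by (intro tendsto_mult tendsto_const)
 moreover have "(2 ^ i) powr - \<alpha> * ((2 ^ i)^2 * 2 powr (- (2 - \<alpha>) * real i)) = 1"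
 proof -
  have "(2 ^ i) powr - \<alpha> * ((2 ^ i)^2 * 2 powr (- (2 - \<alpha>) * real i)) = (2 ^ i) powr - \<alpha> * ((2 ^ i) powr 2 * (2 ^ i) powr (- (2 - \<alpha>)))"
   unfolding two_powr_mult_nat by simp
  also have "... = 1" unfolding powr_add[symmetric] by simp
  finally show ?thesis .
 qed
 moreover have "mark_tail \<nu> 2 (2 ^ i * 2 ^ j) / mark_tail \<nu> 2 (2 ^ j) * ((2 ^ i)^2 * 2 powr (- (2 - \<alpha>) * real i))
   = q (j + i) * 2 powr (- (2 - \<alpha>) * real i) / q j" for j
  unfolding q_def by (simp add: power_add power_mult_distrib mult_ac)
 ultimately show ?thesis by simp
qed

text \<open>The first L levels are treated one by one, their relative errors tending to 0 for fixed
  i. Beyond L only expectations are summed: each is at most B y^i + B u, where the first part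
  belongs to a convergent series and the second sums to at most J u times B, with u exponentially
  small in J.\<close>

lemma sample_levels_regular:
 fixes F :: "'b filter" and J J0 J1 :: "'b => nat"
 assumes g: "0 < g" "g < \<alpha>" "g <= 1 / 2" and alt: "1 <= \<alpha> - g \<or> (\<forall>j k. (LINT s|lborel. \<Psi> j k s) = 0)"
  and ord: "\<forall>\<^sub>F T in F. J0 T < J1 T \<and> J1 T <= J T" and lim: "filterlim J0 at_top F" "filterlim (\<lambda>T. J1 T - J0 T) at_top F"
  and c: "0 < c" and var: "\<forall>\<^sub>F T in F. (\<alpha> + 3 * g) * real (J0 T) - real (J T) <= - c * real (J T)"
  and drift: "\<forall>\<^sub>F T in F. \<forall>i\<le>J1 T - J0 T. (1 - \<alpha> + 4 * g) * real i + (2 - \<alpha> + 4 * g) * real (J0 T) - real (J T) <= - c * real (J T)"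
  and \<rho>: "0 < \<rho>" "\<rho> < 1" and \<delta>: "0 < \<delta>"
 obtains C0 L h where "0 < C0" "L0 <= L" "0 < h"
  "\<forall>\<^sub>F T in F. \<forall>n R N. R = 2 ^ J T * (1 + A) --> N = C0 * 2 ^ (J T - J0 T) * q (J0 T) --> \<bar>real n - R\<bar> <= h * R -->
    measure (PiM {..<n} (\<lambda>_. sample_space R \<nu>))
     {z\<in>space (PiM {..<n} (\<lambda>_. sample_space R \<nu>)). \<not> regular_levels \<rho> L (J1 T - J0 T) N (J0 T) (sample_energy (J T) n z)} <= \<delta>"
proof -
 obtain C0 where C0: "0 < C0" and kap: "\<And>e. 0 < e ==> \<exists>j0 n0. \<forall>j\<ge>j0. \<forall>n\<ge>n0. \<forall>R>0. 2 ^ j * (real n + A) <= R -->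
   \<bar>(\<Sum>k<n. kappa R j k) - C0 * (real n * q j)\<bar> <= e * (real n * q j)"
  by (rule second_moment_asymptotics) blast
 obtain a j1 where a: "0 < a" and conc: "\<And>J j n R \<sigma> b. j1 <= j ==> j <= J ==> R = 2 ^ J * (1 + A) ==> \<bar>real n - R\<bar> <= R / 2 ==>
    \<sigma> = 2 ^ (J - j) * q j ==> b = (2 ^ j) powr (2 - \<alpha> + 3 * g) / 2 ^ J ==>
    integrable (PiM {..<n} (\<lambda>_. sample_space R \<nu>)) (\<lambda>z. sample_energy J n z j) \<and>
    (LINT z|PiM {..<n} (\<lambda>_. sample_space R \<nu>). \<bar>sample_energy J n z j - real n / R * (\<Sum>k<2 ^ (J - j). kappa R j k)\<bar>)
     <= a * \<sigma> * (sqrt ((2 ^ j) powr (\<alpha> + 3 * g) / 2 ^ J + 2 ^ j / 2 ^ J) + b + sqrt b) \<and>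
    (LINT z|PiM {..<n} (\<lambda>_. sample_space R \<nu>). sample_energy J n z j) <= a * \<sigma> * (1 + b)"
  by (rule scale_concentration[OF g(1,2) alt]) blast
 obtain Cr j2 where Cr: "0 < Cr" and grow: "\<And>j i. j2 <= j ==> q (j + i) * 2 powr (- (2 - \<alpha>) * real i) <= Cr * 2 powr (g * real i) * q j"
  by (rule q_growth[OF g(1)]) blast
 \<comment> \<open>As g <= 1/2, the growth 2^(g i) from \<open>q_growth\<close> against the weight
   2^(-i) leaves at most y^i.\<close>
 define y :: real where "y = 2 powr (- 1 / 2)"
 define B where "B = a * Cr / C0"
 have B: "0 < B" unfolding B_def using a Cr C0 by simp
 have y: "0 < y" "y < 1" unfolding y_def using powr_less_mono[of "- 1 / 2" 0 2] by auto
 have "summable (\<lambda>i. y ^ i)" using y by (intro summable_geometric) simp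
 hence "\<exists>N. \<forall>m\<ge>N. \<forall>n. norm (sum (\<lambda>i. y ^ i) {m..<n}) < \<rho> * \<delta> / (4 * B)"
  unfolding summable_Cauchy using \<rho> \<delta> B by (auto intro!: divide_pos_pos)
 then obtain L' where L': "\<And>m n. L' <= m ==> norm (sum (\<lambda>i. y ^ i) {m..<n}) < \<rho> * \<delta> / (4 * B)" by blast
 define L where "L = max L0 L'"
 \<comment> \<open>The centre of a normalized level energy is a product of three factors within e1
   of 1; \<open>near_one_mult\<close> puts it within 7 e1 of 1, which is below \<rho> / 2.\<close>
 define e1 where "e1 = \<rho> / 16"
 have e1: "0 < e1" "e1 <= 1" unfolding e1_def using \<rho> by auto
 obtain j3 n3 where "\<forall>j\<ge>j3. \<forall>n\<ge>n3. \<forall>R>0. 2 ^ j * (real n + A) <= R -->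
   \<bar>(\<Sum>k<n. kappa R j k) - C0 * (real n * q j)\<bar> <= (e1 * C0) * (real n * q j)"
  using kap[of "e1 * C0"] e1 C0 by auto
 hence kap3: "j3 <= j ==> n3 <= n ==> 0 < R ==> 2 ^ j * (real n + A) <= R ==>
   \<bar>(\<Sum>k<n. kappa R j k) - C0 * (real n * q j)\<bar> <= (e1 * C0) * (real n * q j)" for j n R
  by blast
 \<comment> \<open>u measures the margin in the conditions on J0 and J1, and v dominates 2^J0 / 2^J
   because J1 <= J. Together they make \<open>w i\<close> a bound for the error in
   \<open>scale_concentration\<close> at level J0 + i.\<close>
 define u where "u T = 2 powr (- c * real (J T))" for T
 define v :: "'b => real" where "v T = (1 / 2) ^ (J1 T - J0 T)" for T
 define w where "w i T = sqrt (2 powr ((\<alpha> + 3 * g) * real i) * u T + 2 ^ i * v T) + 2 ^ i * u T + sqrt (2 ^ i * u T)" for i T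
 have Jlim: "filterlim J at_top F"
 proof (rule filterlim_at_top_mono[OF lim(1)])
  show "\<forall>\<^sub>F T in F. J0 T <= J T" using ord by eventually_elim simp
 qed
 have upow: "u T = (2 powr (- c)) ^ J T" for T unfolding u_def by (simp add: powr_powr flip: powr_realpow)
 have cc: "0 < 2 powr (- c)" "2 powr (- c) < 1" using powr_less_mono[of "- c" 0 2] c by auto
 have ulim: "(u \<longlongrightarrow> 0) F"
  unfolding upow using cc by (intro filterlim_compose[OF LIMSEQ_realpow_zero Jlim]) auto
 have vlim: "(v \<longlongrightarrow> 0) F"
  unfolding v_def by (intro filterlim_compose[OF LIMSEQ_realpow_zero lim(2)]) auto
 have "((\<lambda>T. real (J T) * (2 powr (- c)) ^ J T) \<longlongrightarrow> 0) F"
  using cc by (intro filterlim_compose[OF powser_times_n_limit_0 Jlim]) auto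
 hence "((\<lambda>T. real (J T) * u T) \<longlongrightarrow> 0) F" unfolding upow .
 hence ev_tail: "\<forall>\<^sub>F T in F. real (J T) * u T < \<rho> * \<delta> / (4 * B)"
  by (rule order_tendstoD) (use \<rho> \<delta> B in auto)
 have wlim: "(w i \<longlongrightarrow> sqrt (2 powr ((\<alpha> + 3 * g) * real i) * 0 + 2 ^ i * 0) + 2 ^ i * 0 + sqrt (2 ^ i * 0)) F" for i
  unfolding w_def by (intro tendsto_intros ulim vlim)
 have ev_w: "\<forall>\<^sub>F T in F. \<forall>i\<in>{1..L}. w i T < \<rho> * \<delta> / 4 * C0 / (2 * a) / (real L + 1)"
 proof (intro eventually_ball_finite ballI order_tendstoD(2)[OF wlim])
  show "sqrt (2 powr ((\<alpha> + 3 * g) * real i) * 0 + 2 ^ i * 0) + 2 ^ i * 0 + sqrt (2 ^ i * 0) < \<rho> * \<delta> / 4 * C0 / (2 * a) / (real L + 1)" for i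
   using \<rho> \<delta> C0 a by simp
 qed simp
 have ev_r: "\<forall>\<^sub>F T in F. \<forall>i\<in>{1..L}. \<bar>q (J0 T + i) * 2 powr (- (2 - \<alpha>) * real i) / q (J0 T) - 1\<bar> < e1"
 proof (intro eventually_ball_finite ballI)
  show "\<forall>\<^sub>F T in F. \<bar>q (J0 T + i) * 2 powr (- (2 - \<alpha>) * real i) / q (J0 T) - 1\<bar> < e1" for i
   using tendstoD[OF filterlim_compose[OF q_ratio lim(1)] e1(1), of i] by (simp add: dist_real_def)
 qed simp
 have "\<forall>\<^sub>F T in F. Max {1, j1, j2, j3} <= J0 T" using lim(1) unfolding filterlim_at_top by blast
 moreover have "\<forall>\<^sub>F T in F. L + n3 <= J1 T - J0 T" using lim(2) unfolding filterlim_at_top by blast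
 ultimately have main: "\<forall>\<^sub>F T in F. \<forall>n R N. R = 2 ^ J T * (1 + A) --> N = C0 * 2 ^ (J T - J0 T) * q (J0 T) --> \<bar>real n - R\<bar> <= e1 * R -->
    measure (PiM {..<n} (\<lambda>_. sample_space R \<nu>))
     {z\<in>space (PiM {..<n} (\<lambda>_. sample_space R \<nu>)). \<not> regular_levels \<rho> L (J1 T - J0 T) N (J0 T) (sample_energy (J T) n z)} <= \<delta>"
  using ev_r ev_w ev_tail ord var drift
 proof eventually_elim
  case (elim T)
  show ?case
  proof (intro allI impI)
   fix n :: nat and R N :: real
   assume R: "R = 2 ^ J T * (1 + A)" and N: "N = C0 * 2 ^ (J T - J0 T) * q (J0 T)" and n: "\<bar>real n - R\<bar> <= e1 * R"
   define PM where "PM = PiM {..<n} (\<lambda>_. sample_space R \<nu>)"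
   define m where "m = J1 T - J0 T"
   define S where "S z j = sample_energy (J T) n z j" for z j
   define r where "r i = q (J0 T + i) * 2 powr (- (2 - \<alpha>) * real i) / q (J0 T)" for i
   define \<sigma> where "\<sigma> i = 2 ^ (J T - (J0 T + i)) * q (J0 T + i)" for i
   define b where "b i = (2 ^ (J0 T + i)) powr (2 - \<alpha> + 3 * g) / 2 ^ J T" for i
   define s where "s i = real n / R * (\<Sum>k<2 ^ (J T - (J0 T + i)). kappa R (J0 T + i) k)" for i
   have R0: "0 < R" unfolding R using A_ge_1 by (intro mult_pos_pos) auto
   have nR: "\<bar>real n / R - 1\<bar> <= e1"
   proof -
    have "real n / R - 1 = (real n - R) / R" using R0 by (simp add: diff_divide_distrib)
    thus ?thesis using n R0 by (simp add: abs_divide divide_le_eq)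
   qed
   have n2: "\<bar>real n - R\<bar> <= R / 2"
   proof -
    have "e1 * R <= 1 / 2 * R" using R0 \<rho> unfolding e1_def by (intro mult_right_mono) auto
    thus ?thesis using n by linarith
   qed
   have jle: "J0 T + i <= J T" if "i <= m" for i using elim that unfolding m_def by auto
   have q0: "0 < q j" for j by (rule q_pos)
   have N0: "0 < N" unfolding N using C0 q0 by simp
   have \<sigma>0: "0 < \<sigma> i" for i unfolding \<sigma>_def using q0 by simp
   have u0: "0 < u T" "0 < v T" unfolding u_def v_def by auto
   have scale: "2 powr (- (2 - \<alpha>) * real i) / N * \<sigma> i * 2 ^ i = r i / C0" if "i <= m" for i
   proof -
    have "J T - J0 T = (J T - (J0 T + i)) + i" using jle[OF that] by simp
    hence "(2::real) ^ (J T - J0 T) = 2 ^ (J T - (J0 T + i)) * 2 ^ i" by (metis power_add)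
    thus ?thesis unfolding N r_def \<sigma>_def by (simp add: mult_ac)
   qed
   note conc' = conc[OF _ jle R n2 \<sigma>_def b_def, folded PM_def S_def s_def]
   have j1': "j1 <= J0 T + i" for i using elim(1) by simp
   interpret PM: prob_space PM unfolding PM_def by (intro prob_space_PiM sample_space_prob R0)
   have rl: "rel_level N (J0 T) (S z) i = S z (J0 T + i) / \<sigma> i * (r i / C0) / 2 ^ i" if "i <= m" for z i
    unfolding rel_level_def scale[OF that, symmetric] using \<sigma>0[of i] by simp
   have r0: "0 < r i" for i unfolding r_def using q0 by simp
   \<comment> \<open>The first bound serves the finitely many levels i <= L. The second carries the
     weight with which b enters the tail sum and is uniform in i; this is what the hypothesis
     \<open>drift\<close> provides.\<close>
   have bu: "b i <= 2 ^ i * u T" and bt: "2 powr (g * real i) / 2 ^ i * b i <= u T" if "i <= m" for i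
   proof -
    have dr: "(1 - \<alpha> + 4 * g) * real i + (2 - \<alpha> + 4 * g) * real (J0 T) - real (J T) <= - c * real (J T)"
     using elim that unfolding m_def by blast
    have b: "b i = 2 powr ((2 - \<alpha> + 3 * g) * (real (J0 T) + real i) - real (J T))"
     unfolding b_def by (simp add: powr_diff powr_powr powr_realpow[symmetric] mult.commute)
    have e: "(2::real) ^ i = 2 powr real i" by (simp add: powr_realpow)
    have nn: "0 <= g * real (J0 T)" "0 <= g * real i" "g * real i <= 1 * real i"
     using g mult_right_mono[of g 1 "real i"] by auto
    have "(2 - \<alpha> + 3 * g) * (real (J0 T) + real i) - real (J T) <= real i + - c * real (J T)"
     using dr nn by (simp add: algebra_simps)
    thus "b i <= 2 ^ i * u T" unfolding b e u_def powr_add[symmetric] by (intro powr_mono) auto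
    have "g * real i - real i + ((2 - \<alpha> + 3 * g) * (real (J0 T) + real i) - real (J T)) <= - c * real (J T)"
     using dr nn by (simp add: algebra_simps)
    thus "2 powr (g * real i) / 2 ^ i * b i <= u T"
     unfolding b e u_def powr_add[symmetric] powr_diff[symmetric] by (intro powr_mono) auto
   qed
   have "PM.prob {z\<in>space PM. \<not> ((\<forall>i\<in>{1..L}. \<bar>rel_level N (J0 T) (S z) i * 2 ^ i - 1\<bar> <= \<rho>) \<and> (\<Sum>i=Suc L..m. rel_level N (J0 T) (S z) i) <= \<rho>)} <= \<delta>"
   proof (rule PM.prob_far_or_large_le[where \<beta> = "\<lambda>i. s i / \<sigma> i * (r i / C0)"])
    have im: "i <= m" if "i \<in> {1..L}" for i using that elim unfolding m_def by auto
    show "integrable PM (\<lambda>z. rel_level N (J0 T) (S z) i * 2 ^ i)" if "i \<in> {1..L}" for i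
     using conc'[OF j1' im[OF that]] unfolding rl[OF im[OF that]] by (intro integrable_mult_left integrable_divide) auto
    show "\<bar>s i / \<sigma> i * (r i / C0) - 1\<bar> <= \<rho> / 2" if i: "i \<in> {1..L}" for i
    proof -
     define k where "k = (\<Sum>k<2 ^ (J T - (J0 T + i)). kappa R (J0 T + i) k) / (C0 * \<sigma> i)"
     have "\<bar>(\<Sum>k<2 ^ (J T - (J0 T + i)). kappa R (J0 T + i) k) - C0 * (real (2 ^ (J T - (J0 T + i))) * q (J0 T + i))\<bar>
       <= (e1 * C0) * (real (2 ^ (J T - (J0 T + i))) * q (J0 T + i))"
     proof (rule kap3[OF _ _ R0])
      show "j3 <= J0 T + i" using elim(1) by simp
      have "n3 <= J T - (J0 T + i)" using elim i unfolding m_def by auto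
      also have "... <= 2 ^ (J T - (J0 T + i))" by (rule less_imp_le[OF less_exp])
      finally show "n3 <= 2 ^ (J T - (J0 T + i))" .
      have p: "(2::real) ^ (J0 T + i) * 2 ^ (J T - (J0 T + i)) = 2 ^ J T" using jle[OF im[OF i]] by (simp flip: power_add)
      have "(2::real) ^ (J0 T + i) * A <= 2 ^ J T * A" using jle[OF im[OF i]] A_ge_1 by (intro mult_right_mono power_increasing) auto
      thus "2 ^ (J0 T + i) * (real (2 ^ (J T - (J0 T + i))) + A) <= R" unfolding R using p by (simp add: distrib_left)
     qed
     hence "\<bar>(\<Sum>k<2 ^ (J T - (J0 T + i)). kappa R (J0 T + i) k) - C0 * \<sigma> i\<bar> <= e1 * (C0 * \<sigma> i)"
      unfolding \<sigma>_def by (simp add: mult.assoc)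
     moreover have "0 < C0 * \<sigma> i" using C0 \<sigma>0[of i] by simp
     moreover from this have "k - 1 = ((\<Sum>k<2 ^ (J T - (J0 T + i)). kappa R (J0 T + i) k) - C0 * \<sigma> i) / (C0 * \<sigma> i)"
      unfolding k_def using C0 \<sigma>0[of i] by (simp add: diff_divide_distrib)
     ultimately have k: "\<bar>k - 1\<bar> <= e1" by (simp only: abs_divide) (simp add: divide_le_eq)
     have ri: "\<bar>r i - 1\<bar> <= e1" unfolding r_def using elim i by (auto intro: less_imp_le)
     have "\<bar>k * (r i * (real n / R)) - 1\<bar> <= e1 + 2 * (e1 + 2 * e1)"
      by (intro near_one_mult k ri nR e1)
     moreover have "k * (r i * (real n / R)) = s i / \<sigma> i * (r i / C0)" unfolding k_def s_def using C0 by (simp add: mult_ac)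
     ultimately show ?thesis unfolding e1_def using \<rho> by simp
    qed
    show "(\<Sum>i\<in>{1..L}. PM.expectation (\<lambda>z. \<bar>rel_level N (J0 T) (S z) i * 2 ^ i - s i / \<sigma> i * (r i / C0)\<bar>)) <= \<rho> * \<delta> / 4"
    proof -
     have "PM.expectation (\<lambda>z. \<bar>rel_level N (J0 T) (S z) i * 2 ^ i - s i / \<sigma> i * (r i / C0)\<bar>) <= \<rho> * \<delta> / 4 / (real L + 1)"
      if i: "i \<in> {1..L}" for i
     proof -
      have dv: "\<bar>rel_level N (J0 T) (S z) i * 2 ^ i - s i / \<sigma> i * (r i / C0)\<bar> = r i / (C0 * \<sigma> i) * \<bar>S z (J0 T + i) - s i\<bar>" for z
      proof -
       have "rel_level N (J0 T) (S z) i * 2 ^ i - s i / \<sigma> i * (r i / C0) = r i / (C0 * \<sigma> i) * (S z (J0 T + i) - s i)"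
        unfolding rl[OF im[OF i]] by (simp add: algebra_simps)
       thus ?thesis using r0[of i] C0 \<sigma>0[of i] by (simp only: abs_mult) simp
      qed
      have r2: "r i <= 2"
      proof -
       have "\<bar>r i - 1\<bar> < e1" unfolding r_def using elim i by blast
       thus ?thesis using e1 by linarith
      qed
      have "(2 ^ (J0 T + i)) powr (\<alpha> + 3 * g) / 2 ^ J T <= 2 powr ((\<alpha> + 3 * g) * real i) * u T"
      proof -
       have "(2 ^ (J0 T + i)) powr (\<alpha> + 3 * g) / 2 ^ J T = 2 powr ((\<alpha> + 3 * g) * (real (J0 T) + real i) - real (J T))"
        by (simp add: powr_diff powr_powr powr_realpow[symmetric] mult.commute)
       also have "... <= 2 powr ((\<alpha> + 3 * g) * real i) * u T"
        unfolding u_def powr_add[symmetric] using elim by (intro powr_mono) (auto simp: algebra_simps)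
       finally show ?thesis .
      qed
      moreover have "(2::real) ^ (J0 T + i) / 2 ^ J T <= 2 ^ i * v T"
      proof -
       have "(2::real) ^ (J0 T + m) <= 2 ^ J T" using jle[of m] by (intro power_increasing) auto
       thus ?thesis unfolding v_def m_def[symmetric] by (simp add: power_add power_divide field_simps)
      qed
      ultimately have "sqrt ((2 ^ (J0 T + i)) powr (\<alpha> + 3 * g) / 2 ^ J T + 2 ^ (J0 T + i) / 2 ^ J T) + b i + sqrt (b i) <= w i T"
       unfolding w_def using bu[OF im[OF i]] by (intro add_mono real_sqrt_le_mono) auto
      also have "... <= \<rho> * \<delta> / 4 * C0 / (2 * a) / (real L + 1)" using elim i by (auto intro: less_imp_le)
      finally have "a * \<sigma> i * (sqrt ((2 ^ (J0 T + i)) powr (\<alpha> + 3 * g) / 2 ^ J T + 2 ^ (J0 T + i) / 2 ^ J T) + b i + sqrt (b i))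
       <= a * \<sigma> i * (\<rho> * \<delta> / 4 * C0 / (2 * a) / (real L + 1))" using a \<sigma>0[of i] by (intro mult_left_mono) auto
      hence E: "PM.expectation (\<lambda>z. \<bar>S z (J0 T + i) - s i\<bar>) <= a * \<sigma> i * (\<rho> * \<delta> / 4 * C0 / (2 * a) / (real L + 1))"
       using conc'[OF j1' im[OF i]] by linarith
      have "PM.expectation (\<lambda>z. r i / (C0 * \<sigma> i) * \<bar>S z (J0 T + i) - s i\<bar>) <= 2 / (C0 * \<sigma> i) * (a * \<sigma> i * (\<rho> * \<delta> / 4 * C0 / (2 * a) / (real L + 1)))"
       using E r2 C0 \<sigma>0[of i] by (simp only: integral_mult_right_zero) (intro mult_mono divide_right_mono, auto)
      also have "... = \<rho> * \<delta> / 4 / (real L + 1)"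
      proof -
       have "2 / (C0 * p) * (a * p * (x * C0 / (2 * a) / d)) = x / d" if "0 < p" for p x d using that C0 a by simp
       thus ?thesis using \<sigma>0 by blast
      qed
      finally show ?thesis unfolding dv .
     qed
     hence "(\<Sum>i\<in>{1..L}. PM.expectation (\<lambda>z. \<bar>rel_level N (J0 T) (S z) i * 2 ^ i - s i / \<sigma> i * (r i / C0)\<bar>))
       <= (\<Sum>i\<in>{1..L}. \<rho> * \<delta> / 4 / (real L + 1))" by (rule sum_mono)
     also have "... = real L / (real L + 1) * (\<rho> * \<delta> / 4)" by simp
     also have "... <= 1 * (\<rho> * \<delta> / 4)" using \<rho> \<delta> by (intro mult_right_mono) auto
     finally show ?thesis by simp
    qed
    have int: "integrable PM (\<lambda>z. rel_level N (J0 T) (S z) i)" if "i \<in> {Suc L..m}" for i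
     using conc'[OF j1', of i] that by (subst rl) (auto intro!: integrable_mult_left integrable_divide)
    show "integrable PM (\<lambda>z. \<Sum>i=Suc L..m. rel_level N (J0 T) (S z) i)"
     by (rule integrable_sumI[OF int])
    show "0 <= (\<Sum>i=Suc L..m. rel_level N (J0 T) (S z) i)" for z
     unfolding rel_level_def S_def using N0 sample_energy_nonneg by (intro sum_nonneg) auto
    have "PM.expectation (\<lambda>z. rel_level N (J0 T) (S z) i) <= B * y ^ i + B * u T" if i: "i \<in> {Suc L..m}" for i
    proof -
     have im': "i <= m" using i by simp
     have b0: "0 <= b i" unfolding b_def by simp
     have "r i * q (J0 T) <= Cr * 2 powr (g * real i) * q (J0 T)" unfolding r_def using grow[of "J0 T" i] elim(1) q0[of "J0 T"] by simp
     hence rb: "r i <= Cr * 2 powr (g * real i)" using q0[of "J0 T"] by simp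
     have "PM.expectation (\<lambda>z. rel_level N (J0 T) (S z) i) = PM.expectation (\<lambda>z. S z (J0 T + i)) * (r i / (C0 * \<sigma> i) / 2 ^ i)"
      unfolding rl[OF im'] by (subst integral_mult_left_zero[symmetric]) (simp add: mult_ac)
     also have "... <= a * \<sigma> i * (1 + b i) * (Cr * 2 powr (g * real i) / (C0 * \<sigma> i) / 2 ^ i)"
      using conc'[OF j1' im'] rb r0[of i] C0 \<sigma>0[of i] a b0
      by (intro mult_mono divide_right_mono) (auto intro!: mult_nonneg_nonneg)
     also have "... = B * (2 powr (g * real i) / 2 ^ i) + B * (2 powr (g * real i) / 2 ^ i * b i)"
      unfolding B_def using \<sigma>0[of i] C0 by (simp add: field_simps)
     also have "... <= B * y ^ i + B * u T"
     proof (intro add_mono mult_left_mono bt[OF im'])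
      have "2 powr (g * real i) / 2 ^ i = 2 powr (g * real i - real i)" by (simp add: powr_diff powr_realpow)
      also have "... <= 2 powr (- 1 / 2 * real i)"
       using mult_right_mono[OF g(3), of "real i"] by (intro powr_mono) auto
      also have "... = y ^ i" unfolding y_def by (subst powr_realpow[symmetric]) (auto simp: powr_powr)
      finally show "2 powr (g * real i) / 2 ^ i <= y ^ i" .
     qed (use B in auto)
     finally show ?thesis .
    qed
    hence "PM.expectation (\<lambda>z. \<Sum>i=Suc L..m. rel_level N (J0 T) (S z) i) <= (\<Sum>i=Suc L..m. B * y ^ i + B * u T)"
     by (subst lint_sum[OF int]) (auto intro: sum_mono)
    also have "... = B * (\<Sum>i=Suc L..<Suc m. y ^ i) + real (card {Suc L..m}) * (B * u T)"
     by (simp add: sum.distrib sum_distrib_left atLeastLessThanSuc_atLeastAtMost)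
    also have "... <= B * (\<rho> * \<delta> / (4 * B)) + B * (\<rho> * \<delta> / (4 * B))"
    proof (rule add_mono)
     have "\<bar>\<Sum>i=Suc L..<Suc m. y ^ i\<bar> < \<rho> * \<delta> / (4 * B)" using L'[of "Suc L" "Suc m"] unfolding L_def by simp
     thus "B * (\<Sum>i=Suc L..<Suc m. y ^ i) <= B * (\<rho> * \<delta> / (4 * B))" using B by (intro mult_left_mono) auto
     have "card {Suc L..m} <= J T" using elim unfolding m_def by auto
     hence "real (card {Suc L..m}) * u T <= real (J T) * u T" using u0 by (intro mult_right_mono) auto
     hence "B * (real (card {Suc L..m}) * u T) <= B * (\<rho> * \<delta> / (4 * B))" using elim B by (intro mult_left_mono) auto
     thus "real (card {Suc L..m}) * (B * u T) <= B * (\<rho> * \<delta> / (4 * B))" by (simp add: mult_ac)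
    qed
    also have "... = \<rho> * \<delta> / 2" using B by simp
    finally show "PM.expectation (\<lambda>z. \<Sum>i=Suc L..m. rel_level N (J0 T) (S z) i) <= \<rho> * \<delta> / 2" .
   qed (use \<rho> in auto)
   thus "measure (PiM {..<n} (\<lambda>_. sample_space R \<nu>))
     {z\<in>space (PiM {..<n} (\<lambda>_. sample_space R \<nu>)). \<not> regular_levels \<rho> L (J1 T - J0 T) N (J0 T) (sample_energy (J T) n z)} <= \<delta>"
    unfolding regular_levels_def PM_def S_def m_def .
  qed
 qed
 have "L0 <= L" unfolding L_def by simp
 thus ?thesis using that[OF C0 _ e1(1) main] by blast
qed

end

text \<open>The strict inequality leaves room to enlarge b slightly and still keep a margin linear
  in J; this margin pays for the powers lost in the Potter bounds.\<close>

lemma Limsup_ratio_less: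
 fixes X J :: "'b => nat"
 assumes b: "0 < b" and lim: "Limsup F (\<lambda>T. ereal (real (X T) / real (J T))) < ereal (1 / b)"
  and J: "\<forall>\<^sub>F T in F. 0 < J T"
 obtains e0 c where "0 < e0" "0 < c"
  "\<And>e. 0 <= e ==> e <= e0 ==> \<forall>\<^sub>F T in F. (b + 4 * e) * real (X T) - real (J T) <= - c * real (J T)"
proof -
 obtain z where z: "Limsup F (\<lambda>T. ereal (real (X T) / real (J T))) < ereal z" "ereal z < ereal (1 / b)"
  using ereal_dense2[OF lim] by blast
 \<comment> \<open>Taking the positive part avoids arguing that the limsup is nonnegative.\<close>
 define k where "k = max z 0"
 have k: "0 <= k" "b * k < 1" unfolding k_def using z(2) b by (auto simp: max_def field_simps)
 define c where "c = (1 - b * k) / 2"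
 define e0 where "e0 = c / (4 * (k + 1))"
 have c: "0 < c" "0 < e0" unfolding e0_def c_def using k by auto
 show ?thesis
 proof (rule that[OF c(2,1)])
  fix e assume e: "0 <= e" "e <= e0"
  have "4 * e * k <= 4 * e0 * (k + 1)" using e k by (intro mult_mono) auto
  also have "... = c"
  proof -
   have g: "4 * (c / (4 * p)) * p = c" if "0 < p" for p using that by simp
   show ?thesis unfolding e0_def by (rule g) (use k in simp)
  qed
  finally have ek: "(b + 4 * e) * k <= 1 - c" unfolding c_def by (simp add: field_simps)
  show "\<forall>\<^sub>F T in F. (b + 4 * e) * real (X T) - real (J T) <= - c * real (J T)"
   using Limsup_lessD[OF z(1)] J
  proof eventually_elim
   case (elim T)
   have "real (X T) <= z * real (J T)" using elim by (simp add: divide_less_eq)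
   also have "... <= k * real (J T)" unfolding k_def by (intro mult_right_mono) auto
   finally have "(b + 4 * e) * real (X T) <= (b + 4 * e) * (k * real (J T))"
    using b e by (intro mult_left_mono) auto
   also have "... = (b + 4 * e) * k * real (J T)" by simp
   also have "... <= (1 - c) * real (J T)" by (intro mult_right_mono ek) simp
   finally show ?case by (simp add: algebra_simps)
  qed
 qed
qed

context wavelet_kernel begin

lemma sample_energy_measurable: "(\<lambda>z. sample_energy J n z j) \<in> borel_measurable (PiM {..<n} (\<lambda>_. borel))"
proof -
 have a: "atom j k \<in> borel_measurable borel" for k using atom_measurable[of j k] by (simp add: borel_prod)
 have "(\<lambda>z. atom j k (z i)) \<in> borel_measurable (PiM {..<n} (\<lambda>_. borel))" if "i \<in> {..<n}" for i k
  by (rule measurable_compose[OF _ a]) (rule measurable_component_singleton[OF that])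
 thus ?thesis unfolding sample_energy_def
  by (intro borel_measurable_sum borel_measurable_power)
qed

lemma regular_levels_sets:
 "{z\<in>space (PiM {..<n} (\<lambda>_. borel)). \<not> regular_levels r L m N j0 (sample_energy J n z)} \<in> sets (PiM {..<n} (\<lambda>_. borel))"
proof -
 note [measurable] = sample_energy_measurable
 show ?thesis unfolding regular_levels_def rel_level_def by measurable
qed

lemma sample_energy_permute:
 assumes "s permutes {..<n}"
 shows "sample_energy J n (\<lambda>i\<in>{..<n}. z (s i)) j = sample_energy J n z j"
proof -
 have "(\<Sum>i<n. atom j k ((\<lambda>i\<in>{..<n}. z (s i)) i)) = (\<Sum>i<n. atom j k (z i))" for k
  using sum.permute[OF assms, of "\<lambda>i. atom j k (z i)"] by (simp add: o_def)
 thus ?thesis unfolding sample_energy_def by simp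
qed

lemma regular_levels_cong:
 assumes "L <= m" "\<And>i. i <= m ==> e (j0 + i) = e' (j0 + i)"
 shows "regular_levels r L m N j0 e = regular_levels r L m N j0 e'"
 using assms unfolding regular_levels_def rel_level_def by simp

end

text \<open>On \<open>occupied R n\<close>, an estimate off by more than h forces the level energies
  of the n sources to be irregular, by \<open>whittle_argmin_near\<close>. That event is invariant
  under permutations and rare by \<open>sample_levels_regular\<close>, so
  \<open>prob_le_sample_prob\<close> applies.\<close>

lemma (in whittle_model) local_whittle_consistent:
 fixes F :: "real filter" and J J0 J1 :: "real => nat"
 assumes e: "0 < e" "e < \<alpha>" "e <= 1 / 2" and alt: "1 <= \<alpha> - e \<or> (\<forall>j k. (LINT s|lborel. \<Psi> j k s) = 0)"
  and ord: "\<forall>\<^sub>F T in F. J0 T < J1 T \<and> J1 T <= J T" and lim: "filterlim J0 at_top F" "filterlim (\<lambda>T. J1 T - J0 T) at_top F"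
  and c: "0 < c" and var: "\<forall>\<^sub>F T in F. (\<alpha> + 3 * e) * real (J0 T) - real (J T) <= - c * real (J T)"
  and drift: "\<forall>\<^sub>F T in F. \<forall>i\<le>J1 T - J0 T. (1 - \<alpha> + 4 * e) * real i + (2 - \<alpha> + 4 * e) * real (J0 T) - real (J T) <= - c * real (J T)"
  and est: "local_whittle_estimator P F (\<lambda>T w. whittle_contrast (whittle_indices (J T) (J0 T) (J1 T)) (coeff w)) \<alpha>hat"
 shows "converges_in_probability P F \<alpha>hat \<alpha>"
 unfolding converges_in_probability_def
proof (intro conjI allI impI)
 show "\<forall>\<^sub>F T in F. \<alpha>hat T \<in> borel_measurable P"
  using est unfolding local_whittle_estimator_def by eventually_elim simp
 fix h :: real assume h: "0 < h"
 define Bad where "Bad T = {w\<in>space P. h < \<bar>\<alpha>hat T w - \<alpha>\<bar>}" for T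
 obtain L0 m0 r where r: "0 < r" "r < 1" and near:
  "\<And>L J J0 J1 d N. L0 <= L ==> 0 < N ==> J0 < J1 ==> J1 <= J ==> m0 <= J1 - J0 ==> L <= J1 - J0 ==>
   (\<And>i. 1 <= i ==> i <= L ==> \<bar>level_energy J d (J0 + i) * 2 powr (- (2 - \<alpha>) * real i) / N * 2 ^ i - 1\<bar> <= r) ==>
   (\<Sum>i=Suc L..J1 - J0. level_energy J d (J0 + i) * 2 powr (- (2 - \<alpha>) * real i) / N) <= r ==>
   (\<exists>x. is_arg_min (whittle_contrast (whittle_indices J J0 J1) d) (\<lambda>x. x \<in> {0<..<2}) x) \<and>
   (\<forall>x. is_arg_min (whittle_contrast (whittle_indices J J0 J1) d) (\<lambda>x. x \<in> {0<..<2}) x --> \<bar>x - \<alpha>\<bar> <= h)"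
  by (rule whittle_argmin_near[OF mk.alpha h]) blast
 have "((\<lambda>T. prob (Bad T)) \<longlongrightarrow> 0) F"
 proof (rule tendstoI)
  fix g :: real assume g: "0 < g"
  obtain C0 L \<theta> where C0: "0 < C0" and L: "L0 <= L" and \<theta>: "0 < \<theta>" and small:
   "\<forall>\<^sub>F T in F. \<forall>n R N. R = 2 ^ J T * (1 + A) --> N = C0 * 2 ^ (J T - J0 T) * mk.q (J0 T) --> \<bar>real n - R\<bar> <= \<theta> * R -->
     measure (PiM {..<n} (\<lambda>_. sample_space R \<nu>))
      {z\<in>space (PiM {..<n} (\<lambda>_. sample_space R \<nu>)). \<not> mk.regular_levels r L (J1 T - J0 T) N (J0 T) (mk.sample_energy (J T) n z)} <= g / 3"
   by (rule mk.sample_levels_regular[OF e alt ord lim c var drift r, of "g / 3" L0]) (use g in auto)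
  have Jlim: "filterlim J at_top F"
  proof (rule filterlim_at_top_mono[OF lim(1)])
   show "\<forall>\<^sub>F T in F. J0 T <= J T" using ord by eventually_elim simp
  qed
  have "((\<lambda>T. (1 / 2) ^ J T) \<longlongrightarrow> (0::real)) F" by (intro filterlim_compose[OF LIMSEQ_realpow_zero Jlim]) auto
  hence "\<forall>\<^sub>F T in F. (1 / 2) ^ J T < \<theta>^2 * g / 3" by (rule order_tendstoD) (use \<theta> g in auto)
  moreover have "\<forall>\<^sub>F T in F. max m0 L <= J1 T - J0 T" using lim(2) unfolding filterlim_at_top by blast
  ultimately have "\<forall>\<^sub>F T in F. prob (Bad T) < g"
   using small ord est[unfolded local_whittle_estimator_def]
  proof eventually_elim
   case (elim T)
   \<comment> \<open>The window to which the point process is restricted: long enough for all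
     coefficients of the index set, and tending to infinity with J, so that the number of points
     concentrates.\<close>
   define R where "R = 2 ^ J T * (1 + A)"
   define N where "N = C0 * 2 ^ (J T - J0 T) * mk.q (J0 T)"
   define m where "m = J1 T - J0 T"
   have N0: "0 < N" unfolding N_def using C0 mk.q_pos by simp
   have R: "2 ^ J T <= R" unfolding R_def using mk.A_ge_1 by simp
   have R0: "0 < R" using R by (rule less_le_trans[rotated]) simp
   have meas: "\<alpha>hat T \<in> borel_measurable P" using elim by blast
   define E where "E n = {z\<in>space (PiM {..<n} (\<lambda>_. borel)). \<not> mk.regular_levels r L m N (J0 T) (mk.sample_energy (J T) n z)}" for n
   have "prob (Bad T) <= g / 3 + 1 / (\<theta>^2 * R)"
   proof (rule prob_le_sample_prob[OF R0 \<theta>])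
    show "Bad T \<in> sets P" unfolding Bad_def using meas by measurable
    show "0 <= g / 3" using g by simp
    show "E n \<in> sets (PiM {..<n} (\<lambda>_. borel))" for n unfolding E_def by (rule mk.regular_levels_sets)
    show "(\<lambda>i\<in>{..<n}. z (p i)) \<in> E n \<longleftrightarrow> z \<in> E n" if "p permutes {..<n}" "z \<in> extensional {..<n}" for n p z
    proof -
     have "mk.sample_energy (J T) n (\<lambda>i\<in>{..<n}. z (p i)) = mk.sample_energy (J T) n z"
      by (rule ext) (rule mk.sample_energy_permute[OF that(1)])
     thus ?thesis unfolding E_def using that(2) by (simp add: space_PiM PiE_iff)
    qed
    show "measure (PiM {..<n} (\<lambda>_. sample_space R \<nu>)) (E n) <= g / 3" if "\<bar>real n - R\<bar> <= \<theta> * R" for n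
    proof -
     have "space (PiM {..<n} (\<lambda>_. sample_space R \<nu>)) = space (PiM {..<n} (\<lambda>_. borel))"
      unfolding space_PiM by (intro PiE_cong) (simp add: sample_space_def space_pair_measure)
     hence "E n = {z\<in>space (PiM {..<n} (\<lambda>_. sample_space R \<nu>)). \<not> mk.regular_levels r L (J1 T - J0 T) N (J0 T) (mk.sample_energy (J T) n z)}"
      unfolding E_def m_def by simp
     thus ?thesis using elim(3) that unfolding R_def N_def by simp
    qed
    show "AE w in P. w \<in> Bad T --> w \<in> occupied R n --> (\<lambda>i\<in>{..<n}. (t (int i) w, \<eta> (int i) w, U (int i) w)) \<in> E n" for n
     using AE_coeff
    proof eventually_elim
     case coeff: (elim w)
     show ?case
     proof (intro impI, rule ccontr)
      let ?z = "\<lambda>i\<in>{..<n}. (t (int i) w, \<eta> (int i) w, U (int i) w)"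
      assume bad: "w \<in> Bad T" and o: "w \<in> occupied R n" and "?z \<notin> E n"
      hence reg: "mk.regular_levels r L m N (J0 T) (mk.sample_energy (J T) n ?z)"
       unfolding E_def by (simp add: space_PiM PiE_iff)
      have lev: "level_energy (J T) (coeff w) j = mk.sample_energy (J T) n ?z j" if j: "j <= J T" for j
      proof -
       have "coeff w j (int k) = (\<Sum>i<n. mk.atom j k (?z i))" if k: "k < 2 ^ (J T - j)" for k
       proof -
        have "2 ^ j * (real k + A) <= 2 ^ j * (2 ^ (J T - j) + A)"
        proof (intro mult_left_mono add_right_mono)
         have "real k <= real (2 ^ (J T - j))" using k by (simp only: of_nat_le_iff)
         thus "real k <= 2 ^ (J T - j)" by simp
        qed simp
        also have "... = 2 ^ J T + 2 ^ j * A" using j by (simp add: distrib_left flip: power_add)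
        also have "... <= 2 ^ J T + 2 ^ J T * A"
         using j mk.A_ge_1 by (intro add_left_mono mult_right_mono power_increasing) auto
        also have "... = R" unfolding R_def by (simp add: distrib_left)
        finally show ?thesis using coeff o by simp
       qed
       thus ?thesis unfolding level_energy_def mk.sample_energy_def by simp
      qed
      have "mk.regular_levels r L m N (J0 T) (level_energy (J T) (coeff w)) = mk.regular_levels r L m N (J0 T) (mk.sample_energy (J T) n ?z)"
       using elim by (intro mk.regular_levels_cong lev) (auto simp: m_def)
      hence "mk.regular_levels r L m N (J0 T) (level_energy (J T) (coeff w))" using reg by simp
      hence "(\<exists>x. is_arg_min (whittle_contrast (whittle_indices (J T) (J0 T) (J1 T)) (coeff w)) (\<lambda>x. x \<in> {0<..<2}) x) \<and>
       (\<forall>x. is_arg_min (whittle_contrast (whittle_indices (J T) (J0 T) (J1 T)) (coeff w)) (\<lambda>x. x \<in> {0<..<2}) x --> \<bar>x - \<alpha>\<bar> <= h)"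
       using elim unfolding mk.regular_levels_def mk.rel_level_def m_def by (intro near[OF L N0]) auto
      moreover have "w \<in> space P" using bad unfolding Bad_def by simp
      ultimately have "\<bar>\<alpha>hat T w - \<alpha>\<bar> <= h" using elim(5) by blast
      thus False using bad unfolding Bad_def by simp
     qed
    qed
   qed
   also have "1 / (\<theta>^2 * R) < g / 2"
   proof -
    have "1 / (\<theta>^2 * R) <= 1 / (\<theta>^2 * 2 ^ J T)" using R \<theta> by (intro divide_left_mono mult_left_mono mult_pos_pos R0) auto
    also have "... = (1 / 2) ^ J T / \<theta>^2" by (simp add: power_divide)
    also have "... < g / 2"
    proof -
     have "0 < (1 / 2 :: real) ^ J T" by simp
     hence "(1 / 2) ^ J T < \<theta>^2 * g / 2" using elim(1) by linarith
     thus ?thesis using \<theta> by (simp add: pos_divide_less_eq mult.commute)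
    qed
    finally show ?thesis .
   qed
   finally show "prob (Bad T) < g" using g by simp
  qed
  thus "\<forall>\<^sub>F T in F. dist (prob (Bad T)) 0 < g" by simp
 qed
 thus "((\<lambda>T. prob {w\<in>space P. h < \<bar>\<alpha>hat T w - \<alpha>\<bar>}) \<longlongrightarrow> 0) F" unfolding Bad_def .
qed

text \<open>Both cases reduce to \<open>local_whittle_consistent\<close> with a small exponent loss
  g. They differ in the alternative that bounds the means (decay of \<open>H\<^sub>1\<close> or
  kernels of integral zero) and in the verification of the inequality \<open>drift\<close>.\<close>

theorem theorem4p1:
  fixes P :: "'a measure" and \<nu> :: "(real \<times> real) measure"
    and t \<eta> U :: "int \<Rightarrow> 'a \<Rightarrow> real"
    and pstar :: nat and \<alpha> M :: real and L :: "nat \<Rightarrow> real \<Rightarrow> real"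
    and \<psi> \<phi> :: "real \<Rightarrow> real"
    and obs :: observation and J0 J1 :: "real \<Rightarrow> nat"
    and \<alpha>hat :: "real \<Rightarrow> 'a \<Rightarrow> real"
  assumes "prob_space P"
    and "iid_marked_poisson P \<nu> t \<eta> U"
    and "4 \<le> pstar"
    and "integrable \<nu> (\<lambda>z. \<bar>snd z\<bar> ^ pstar)"
    and "0 < \<alpha>" "\<alpha> < 2"
    and "\<And>p. p \<le> pstar \<Longrightarrow> slowly_varying (L p)"
    and "\<And>p s. p \<le> pstar \<Longrightarrow> 0 < s \<Longrightarrow> 0 < L p s"
    and "\<And>p s. p \<le> pstar \<Longrightarrow> 0 < s \<Longrightarrow> mark_tail \<nu> p s = L p s * s powr (- \<alpha>)"
    and "1 \<le> M"
    and "admissible_wavelet M \<psi>"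
    and "admissible_interpolator M \<phi>"
    and "local_whittle_estimator P (horizon obs)
           (\<lambda>T \<omega>. whittle_contrast (whittle_indices (max_scale M T) (J0 T) (J1 T))
                    (wavelet_coeff obs \<psi> \<phi> (infinite_source t \<eta> U \<omega>))) \<alpha>hat"
    and "\<forall>\<^sub>F T in horizon obs. 0 < J0 T \<and> J0 T < J1 T \<and> J1 T \<le> max_scale M T"
    and "filterlim J0 at_top (horizon obs)" "filterlim (\<lambda>T. J1 T - J0 T) at_top (horizon obs)"
    and "Limsup (horizon obs) (\<lambda>T. ereal (real (J0 T) / real (max_scale M T))) < ereal (1 / \<alpha>)"
  shows "(Limsup (horizon obs) (\<lambda>T. ereal (real (J1 T) / real (max_scale M T))) < ereal (1 / (2 - \<alpha>)) \<and>
          (LINT s|lebesgue. s * \<psi> s) = 0 \<and>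
          (\<exists>a b. \<forall>s. ((\<lambda>k::int. of_int k * \<phi> (s - of_int k)) has_sum (a + b * s)) UNIV)
            \<longrightarrow> converges_in_probability P (horizon obs) \<alpha>hat \<alpha>)
       \<and> (1 < \<alpha> \<longrightarrow> converges_in_probability P (horizon obs) \<alpha>hat \<alpha>)"
proof -
 let ?F = "horizon obs" and ?J = "max_scale M"
 have mp: "marked_points P \<nu> t \<eta> U" using assms(1,2) by (simp add: marked_points_def marked_points_axioms_def)
 obtain K \<psi>' \<Psi> C1 where
  model: "whittle_model P \<nu> t \<eta> U \<alpha> M K \<psi>' \<Psi> (2 * M) C1 (\<lambda>w. wavelet_coeff obs \<psi> \<phi> (infinite_source t \<eta> U w))"
  and kernel0: "(LINT s|lebesgue. s * \<psi> s) = 0 \<and> (\<exists>a b. \<forall>s. ((\<lambda>k::int. of_int k * \<phi> (s - of_int k)) has_sum (a + b * s)) UNIV)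
    --> (\<forall>j k. (LINT s|lborel. \<Psi> j k s) = 0)"
  by (rule whittle_model_exists[OF mp assms(3-12), where obs = obs]) blast
 interpret whittle_model P \<nu> t \<eta> U \<alpha> M K \<psi>' \<Psi> "2 * M" C1 "\<lambda>w. wavelet_coeff obs \<psi> \<phi> (infinite_source t \<eta> U w)"
  by (rule model)
 have ord: "\<forall>\<^sub>F T in ?F. J0 T < J1 T \<and> J1 T <= ?J T" using assms(14) by eventually_elim simp
 have Jpos: "\<forall>\<^sub>F T in ?F. 0 < ?J T" using assms(14) by eventually_elim simp
 obtain g1 c1 where e1: "0 < g1" "0 < c1"
  and b: "\<And>g. 0 <= g ==> g <= g1 ==> \<forall>\<^sub>F T in ?F. (\<alpha> + 4 * g) * real (J0 T) - real (?J T) <= - c1 * real (?J T)"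
  by (rule Limsup_ratio_less[OF assms(5,17) Jpos]) blast
 have consistent: "converges_in_probability P ?F \<alpha>hat \<alpha>"
  if g: "0 < g" "g < \<alpha>" "g <= 1 / 2" "g <= g1" and c: "0 < c"
   and alt: "1 <= \<alpha> - g \<or> (\<forall>j k. (LINT s|lborel. \<Psi> j k s) = 0)"
   and drift: "\<forall>\<^sub>F T in ?F. \<forall>i\<le>J1 T - J0 T. (1 - \<alpha> + 4 * g) * real i + (2 - \<alpha> + 4 * g) * real (J0 T) - real (?J T) <= - c * real (?J T)"
  for g c
 proof (rule local_whittle_consistent[OF g(1-3) alt ord assms(15,16) _ _ _ assms(13), of "min c c1"])
  have mono: "- d * real (?J T) <= - min c c1 * real (?J T)" if "d \<in> {c, c1}" for d T
   using that by (intro mult_right_mono) auto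
  show "\<forall>\<^sub>F T in ?F. (\<alpha> + 3 * g) * real (J0 T) - real (?J T) <= - min c c1 * real (?J T)"
   using b[OF less_imp_le[OF g(1)] g(4)]
  proof eventually_elim
   case (elim T)
   have "(\<alpha> + 3 * g) * real (J0 T) <= (\<alpha> + 4 * g) * real (J0 T)" using g by (intro mult_right_mono) auto
   thus ?case using elim mono[of c1 T] by simp
  qed
  show "\<forall>\<^sub>F T in ?F. \<forall>i\<le>J1 T - J0 T. (1 - \<alpha> + 4 * g) * real i + (2 - \<alpha> + 4 * g) * real (J0 T) - real (?J T) <= - min c c1 * real (?J T)"
   using drift by eventually_elim (use mono[of c] in \<open>auto intro: order_trans\<close>)
 qed (use c e1 in auto)
 show ?thesis
 proof (intro conjI impI)
  assume "1 < \<alpha>"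
  \<comment> \<open>With 8 g <= \<alpha> - 1 the coefficient 1 - \<alpha> + 4 g is negative, so the
    inequality is worst at i = 0, where J0 <= J already gives it with margin (\<alpha> - 1) / 2;
    also \<alpha> - g >= 1.\<close>
  define g where "g = min g1 ((\<alpha> - 1) / 8)"
  have "0 < g" unfolding g_def using e1 \<open>1 < \<alpha>\<close> by simp
  moreover have "g <= (\<alpha> - 1) / 8" unfolding g_def by (rule min.cobounded2)
  ultimately have g: "0 < g" "g <= g1" "g <= (\<alpha> - 1) / 8" unfolding g_def by auto
  show "converges_in_probability P ?F \<alpha>hat \<alpha>"
  proof (rule consistent[of g "(\<alpha> - 1) / 2"])
   show "\<forall>\<^sub>F T in ?F. \<forall>i\<le>J1 T - J0 T. (1 - \<alpha> + 4 * g) * real i + (2 - \<alpha> + 4 * g) * real (J0 T) - real (?J T)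
     <= - ((\<alpha> - 1) / 2) * real (?J T)"
    using ord
   proof eventually_elim
    case (elim T)
    have "(1 - \<alpha> + 4 * g) * real i <= 0" for i using g \<open>1 < \<alpha>\<close> by (intro mult_nonpos_nonneg) auto
    moreover have "(2 - \<alpha> + 4 * g) * real (J0 T) <= (1 - (\<alpha> - 1) / 2) * real (?J T)"
     using elim g assms(6) by (intro mult_mono) (auto simp: field_simps)
    ultimately have "(1 - \<alpha> + 4 * g) * real i + (2 - \<alpha> + 4 * g) * real (J0 T) <= 0 + (1 - (\<alpha> - 1) / 2) * real (?J T)" for i
     by (rule add_mono)
    thus ?case by (simp add: algebra_simps)
   qed
  qed (use g \<open>1 < \<alpha>\<close> assms(6) in auto)
 next
  assume asm: "Limsup ?F (\<lambda>T. ereal (real (J1 T) / real (?J T))) < ereal (1 / (2 - \<alpha>)) \<and>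
     (LINT s|lebesgue. s * \<psi> s) = 0 \<and>
     (\<exists>a b. \<forall>s. ((\<lambda>k::int. of_int k * \<phi> (s - of_int k)) has_sum (a + b * s)) UNIV)"
  have "0 < 2 - \<alpha>" using assms(6) by simp
  then obtain g2 c2 where e2: "0 < g2" "0 < c2"
   and b2: "\<And>g. 0 <= g ==> g <= g2 ==> \<forall>\<^sub>F T in ?F. (2 - \<alpha> + 4 * g) * real (J1 T) - real (?J T) <= - c2 * real (?J T)"
   by (rule Limsup_ratio_less[OF _ conjunct1[OF asm] Jpos]) blast
  define g where "g = min (min g1 g2) (min (\<alpha> / 2) (1 / 2))"
  have g: "0 < g" "g <= g1" "g <= g2" "g <= \<alpha> / 2" "g <= 1 / 2" unfolding g_def using e1 e2 assms(5) by auto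
  show "converges_in_probability P ?F \<alpha>hat \<alpha>"
  proof (rule consistent[of g c2])
   show "\<forall>\<^sub>F T in ?F. \<forall>i\<le>J1 T - J0 T. (1 - \<alpha> + 4 * g) * real i + (2 - \<alpha> + 4 * g) * real (J0 T) - real (?J T) <= - c2 * real (?J T)"
    using b2[OF less_imp_le[OF g(1)] g(3)] ord
   proof eventually_elim
    case (elim T)
    \<comment> \<open>Raising the coefficient of i to 2 - \<alpha> + 4 g turns the left side into a
      multiple of i + J0, which is at most J1.\<close>
    have "(1 - \<alpha> + 4 * g) * real i + (2 - \<alpha> + 4 * g) * real (J0 T) <= (2 - \<alpha> + 4 * g) * real (J1 T)" if i: "i <= J1 T - J0 T" for i
    proof -
     have s: "real i + real (J0 T) <= real (J1 T)" using i elim by linarith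
     have "(1 - \<alpha> + 4 * g) * real i <= (2 - \<alpha> + 4 * g) * real i" by (intro mult_right_mono) auto
     moreover have "(2 - \<alpha> + 4 * g) * (real i + real (J0 T)) <= (2 - \<alpha> + 4 * g) * real (J1 T)"
      using assms(6) g by (intro mult_left_mono s) auto
     ultimately show ?thesis by (simp add: distrib_left)
    qed
    thus ?case using elim by fastforce
   qed
  qed (use g e2 asm kernel0 assms(5) in auto)
 qed
qed

end
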